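(* Let $n\ge3$, $\Omega\subset\mathbb{R}^n$ a bounded smooth oriented domain with $0\in\partial\Omega$, $a\in C^1(\overline\Omega)$ with $\Delta+a$ coercive in $\Omega$, and $(s_\epsilon)_{\epsilon>0}\subset(0,2)$ with $s_\epsilon\to0$. For each $\epsilon>0$ let $u_\epsilon\in C^2(\overline\Omega\setminus\{0\})\cap C^1(\overline\Omega)$ solve $\Delta u_\epsilon+au_\epsilon=u_\epsilon^{2^*(s_\epsilon)-1}|x|^{-s_\epsilon}$ in $\Omega$, $u_\epsilon>0$ in $\Omega$, $u_\epsilon=0$ on $\partial\Omega$, and satisfy $\frac{\int_\Omega(|\nabla u_\epsilon|^2+au_\epsilon^2)}{(\int_\Omega u_\epsilon^{2^*(s_\epsilon)}|x|^{-s_\epsilon})^{2/2^*(s_\epsilon)}}=\mu_{s_\epsilon,a}(\Omega)+o(1)\le\frac1{K(n,0)}+o(1)$ as $\epsilon\to0$. Assume $u_\epsilon\rightharpoonup0$ weakly in $H^2_{1,0}(\Omega)$. Let $x_\epsilon\in\Omega$, $\mu_\epsilon>0$ with $u_\epsilon(x_\epsilon)=\max_{\overline\Omega}u_\epsilon=\mu_\epsilon^{-\frac{n-2}{2}}$, and $k_\epsilon:=|x_\epsilon|^{s_\epsilon/2}\mu_\epsilon^{\frac{2-s_\epsilon}{2}}$. Then $$\lim_{\epsilon\to0}\mu_\epsilon=\lim_{\epsilon\to0}k_\epsilon=0,\qquad\lim_{\epsilon\to0}\frac{d(x_\epsilon,\partial\Omega)}{\mu_\epsilon}=\lim_{\epsilon\to0}\frac{d(x_\epsilon,\partial\Omega)}{k_\epsilon}=+\infty.$$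 Setting $v_\epsilon(x):=\frac{u_\epsilon(x_\epsilon+k_\epsilon x)}{u_\epsilon(x_\epsilon)}$ for $x\in\frac{\Omega-x_\epsilon}{k_\epsilon}$, there exists $v\in C^\infty(\mathbb{R}^n)$, $v\ne0$, such that for every $\eta\in C_c^\infty(\mathbb{R}^n)$, $\eta v_\epsilon\rightharpoonup\eta v$ weakly in $\mathscr{D}^{1,2}(\mathbb{R}^n)$, and $v_\epsilon\to v$ in $C^1_{loc}(\mathbb{R}^n)$, where $$v(x)=\Big(1+\frac{|x|^2}{n(n-2)}\Big)^{-\frac{n-2}{2}},\qquad\int_{\mathbb{R}^n}|\nabla v|^2dx=\Big(\frac1{K(n,0)}\Big)^{\frac{2^*}{2^*-2}}.$$ Moreover, up to a subsequence, $(\mu_\epsilon/|x_\epsilon|)^{s_\epsilon}\to1$ and $k_\epsilon/\mu_\epsilon\to1$ as $\epsilon\to0$.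
   Context: $\Delta:=-\sum_i\partial_{ii}$. $H^2_{1,0}(\Omega)$ (resp. $\mathscr{D}^{1,2}(\mathbb{R}^n)$) is the completion of $C_c^\infty(\Omega)$ (resp. $C_c^\infty(\mathbb{R}^n)$) for $u\mapsto\|\nabla u\|_{L^2}$. $\Delta+a$ coercive means there is $A_0>0$ with $\int_\Omega(|\nabla\varphi|^2+a\varphi^2)\ge A_0\|\nabla\varphi\|_{L^2}^2$ for all $\varphi\in H^2_{1,0}(\Omega)$. $2^*(s):=\frac{2(n-s)}{n-2}$, $2^*:=2^*(0)$. $\mu_{s,a}(\Omega):=\inf_{u\in H^2_{1,0}(\Omega)\setminus\{0\}}\frac{\int_\Omega(|\nabla u|^2+au^2)}{(\int_\Omega|u|^{2^*(s)}|x|^{-s})^{2/2^*(s)}}$; $1/K(n,0)=\inf_{u\in\mathscr{D}^{1,2}(\mathbb{R}^n)\setminus\{0\}}\|\nabla u\|_2^2/\|u\|_{2^*}^2$. *)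

theory Defs
  imports "HOL-Analysis.Analysis"
begin

definition grad :: "('a::euclidean_space \<Rightarrow> real) \<Rightarrow> 'a \<Rightarrow> 'a" where
  "grad f x = (\<Sum>b\<in>Basis. frechet_derivative f (at x) b *\<^sub>R b)"

definition pd :: "'a::euclidean_space \<Rightarrow> ('a \<Rightarrow> real) \<Rightarrow> 'a \<Rightarrow> real" where
  "pd b f x = frechet_derivative f (at x) b"

text \<open>Laplacian with the paper's sign convention: Delta = - sum_i d_ii.\<close>
definition lap :: "('a::euclidean_space \<Rightarrow> real) \<Rightarrow> 'a \<Rightarrow> real" where
  "lap f x = - (\<Sum>b\<in>Basis. pd b (pd b f) x)"

primrec Ck :: "nat \<Rightarrow> 'a::euclidean_space set \<Rightarrow> ('a \<Rightarrow> real) \<Rightarrow> bool" where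
  "Ck 0 U f = continuous_on U f"
| "Ck (Suc k) U f = (continuous_on U f \<and> (\<forall>x\<in>U. f differentiable (at x))
      \<and> (\<forall>b\<in>Basis. Ck k U (pd b f)))"

definition smooth_on :: "'a::euclidean_space set \<Rightarrow> ('a \<Rightarrow> real) \<Rightarrow> bool" where
  "smooth_on U f = (\<forall>k. Ck k U f)"

primrec CkBar :: "nat \<Rightarrow> 'a::euclidean_space set \<Rightarrow> ('a \<Rightarrow> real) \<Rightarrow> bool" where
  "CkBar 0 S f = continuous_on S f"
| "CkBar (Suc k) S f = (continuous_on S f \<and> (\<forall>x\<in>interior S. f differentiable (at x))
      \<and> (\<forall>b\<in>Basis. \<exists>g. CkBar k S g \<and> (\<forall>x\<in>interior S. g x = pd b f x)))"

definition smooth_bounded_domain :: "'a::euclidean_space set \<Rightarrow> bool" where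
  "smooth_bounded_domain \<Omega> = (open \<Omega> \<and> connected \<Omega> \<and> bounded \<Omega> \<and> \<Omega> \<noteq> {} \<and>
     (\<forall>p\<in>frontier \<Omega>. \<exists>r>0. \<exists>\<phi>. smooth_on (ball p r) \<phi> \<and> grad \<phi> p \<noteq> 0 \<and>
        (\<forall>x\<in>ball p r. x \<in> \<Omega> \<longleftrightarrow> \<phi> x < 0)))"

definition test_fun :: "'a::euclidean_space set \<Rightarrow> ('a \<Rightarrow> real) \<Rightarrow> bool" where
  "test_fun U \<phi> = (smooth_on UNIV \<phi> \<and> (\<exists>K. compact K \<and> K \<subseteq> U \<and> (\<forall>x. x \<notin> K \<longrightarrow> \<phi> x = 0)))"

text \<open>H^2_{1,0}(Omega): completion of C_c^infinity(Omega) for the norm of the gradient in L^2,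
  realised (Omega bounded, Poincare inequality) as pairs (u, g) with u in L^2(Omega), g in L^2(Omega)
  (the gradient of u in the completion) approximated by test functions.\<close>
definition H10 :: "'a::euclidean_space set \<Rightarrow> ('a \<Rightarrow> real) \<Rightarrow> ('a \<Rightarrow> 'a) \<Rightarrow> bool" where
  "H10 \<Omega> u g = (u \<in> borel_measurable (lebesgue_on \<Omega>) \<and> g \<in> borel_measurable (lebesgue_on \<Omega>) \<and>
     integrable (lebesgue_on \<Omega>) (\<lambda>x. (u x)\<^sup>2) \<and> integrable (lebesgue_on \<Omega>) (\<lambda>x. (norm (g x))\<^sup>2) \<and>
     (\<exists>\<phi> :: nat \<Rightarrow> 'a \<Rightarrow> real. (\<forall>k. test_fun \<Omega> (\<phi> k)) \<and>
        (\<lambda>k. integral\<^sup>L (lebesgue_on \<Omega>) (\<lambda>x. (norm (grad (\<phi> k) x - g x))\<^sup>2)) \<longlonglongrightarrow> 0 \<and>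
        (\<lambda>k. integral\<^sup>L (lebesgue_on \<Omega>) (\<lambda>x. (\<phi> k x - u x)\<^sup>2)) \<longlonglongrightarrow> 0))"

definition crit :: "nat \<Rightarrow> real \<Rightarrow> real" where
  "crit n s = 2 * (real n - s) / (real n - 2)"

text \<open>D^{1,2}(R^n): completion of C_c^infinity(R^n) for the gradient L^2 norm, realised
  (Sobolev inequality) as pairs (u, g), u in L^{2^*}, g in L^2, approximated by test functions.\<close>
definition D12 :: "('a::euclidean_space \<Rightarrow> real) \<Rightarrow> ('a \<Rightarrow> 'a) \<Rightarrow> bool" where
  "D12 u g = (u \<in> borel_measurable lebesgue \<and> g \<in> borel_measurable lebesgue \<and>
     integrable lebesgue (\<lambda>x. \<bar>u x\<bar> powr crit DIM('a) 0) \<and> integrable lebesgue (\<lambda>x. (norm (g x))\<^sup>2) \<and>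
     (\<exists>\<phi> :: nat \<Rightarrow> 'a \<Rightarrow> real. (\<forall>k. test_fun UNIV (\<phi> k)) \<and>
        (\<lambda>k. integral\<^sup>L lebesgue (\<lambda>x. (norm (grad (\<phi> k) x - g x))\<^sup>2)) \<longlonglongrightarrow> 0 \<and>
        (\<lambda>k. integral\<^sup>L lebesgue (\<lambda>x. \<bar>\<phi> k x - u x\<bar> powr crit DIM('a) 0)) \<longlonglongrightarrow> 0))"

definition mu_sa :: "real \<Rightarrow> ('a::euclidean_space \<Rightarrow> real) \<Rightarrow> 'a set \<Rightarrow> real" where
  "mu_sa s a \<Omega> = Inf {(integral\<^sup>L (lebesgue_on \<Omega>) (\<lambda>x. (norm (g x))\<^sup>2 + a x * (u x)\<^sup>2)) /
        (integral\<^sup>L (lebesgue_on \<Omega>) (\<lambda>x. \<bar>u x\<bar> powr crit DIM('a) s * norm x powr (- s)))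
          powr (2 / crit DIM('a) s) | u g. H10 \<Omega> u g \<and> \<not> (AE x in lebesgue_on \<Omega>. u x = 0)}"

definition invK0 :: "'a::euclidean_space itself \<Rightarrow> real" where
  "invK0 _ = Inf {(integral\<^sup>L lebesgue (\<lambda>x. (norm (g x))\<^sup>2)) /
        (integral\<^sup>L lebesgue (\<lambda>x. \<bar>u x\<bar> powr crit DIM('a) 0)) powr (2 / crit DIM('a) 0)
        | (u :: 'a \<Rightarrow> real) g. D12 u g \<and> \<not> (AE x in lebesgue. u x = 0)}"

definition coercive :: "('a::euclidean_space \<Rightarrow> real) \<Rightarrow> 'a set \<Rightarrow> bool" where
  "coercive a \<Omega> = (\<exists>A0>0. \<forall>\<phi> g. H10 \<Omega> \<phi> g \<longrightarrow>
      integral\<^sup>L (lebesgue_on \<Omega>) (\<lambda>x. (norm (g x))\<^sup>2 + a x * (\<phi> x)\<^sup>2)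
        \<ge> A0 * integral\<^sup>L (lebesgue_on \<Omega>) (\<lambda>x. (norm (g x))\<^sup>2))"

end

theory Submission
 imports Defs "HOL-Complex_Analysis.Great_Picard" "HOL-Library.Diagonal_Subsequence"
begin

text \<open>If the maxima stayed bounded along a sequence, the solutions divided by their maxima would converge
  to a harmonic function with zero boundary values and maximum 1. Hence the maxima blow up; after rescaling
  around the maximum points, boundary barriers and the Ascoli theorem give a limit \<open>V\<close> with \<open>V 0 = 1\<close>, extended
  by zero off the limit domain. By Fatou and the energy bound, \<open>V\<close> minimizes the Sobolev quotient; a minimizer
  is superharmonic, hence positive, so that the limit domain is the whole space. Finally \<open>w = V powr (- 2 / (n - 2))\<close>
  satisfies \<open>div (w powr (2 - n) * grad (laplacian of w)) = n * w powr (1 - n) * E2\<close>, where \<open>E2\<close> is the squared norm of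
  the trace-free Hessian; testing with cutoffs gives \<open>E2 = 0\<close>, so that \<open>w\<close> is quadratic and \<open>V\<close> is the bubble.\<close>

text \<open>The pole of the weight lies on the boundary, so after rescaling both could stay near the
  maximum point. The rescaled weight is \<open>(norm y0 / norm (y - y0)) powr s\<close>, with the
  rescaled pole \<open>y0\<close> outside the rescaled domain; as \<open>s\<close> tends to 0 it
  tends to 1 locally uniformly where the limit is positive. A half space as limit domain is excluded
  only at the end: the limit, extended by zero, competes in the Sobolev quotient of the whole space,
  the energy bound makes it a minimizer there, and minimizers are superharmonic across the frontier
  of the limit domain too. Rescaling divides both energies by the same factor \<open>Q\<close>, a
  power of \<open>norm (x j) / \<mu> j\<close>. Its lower limit is at least 1 because the pole stays
  away from 0, and an upper limit above 1 would push the energy of \<open>V\<close> below its value;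
  this gives the limits of the two ratios. Since the limit function is always the same, every
  sequence has a subsequence with the asserted limits, which therefore hold along the whole family.
  The elliptic estimates are comparisons with explicit functions, for which second derivatives along
  the coordinate axes suffice.\<close>

notation scaleR (infixr "*R" 75)
notation LIMSEQ ("((_)/ ----> (_))" [60, 60] 60)

section \<open>Gradients and the classes \<open>Ck\<close>\<close>

lemma GDERIV_frechet:
 assumes "GDERIV f x :> (D::'a::euclidean_space)"
 shows "frechet_derivative f (at x) = (%h. h \<bullet> D)"
 using assms frechet_derivative_at[of f _ x] unfolding gderiv_def by metis

lemma GDERIV_pd:
 assumes "GDERIV f x :> (D::'a::euclidean_space)"
 shows "pd b f x = b \<bullet> D"
 by (simp add: pd_def GDERIV_frechet[OF assms])

lemma GDERIV_grad:
 assumes "GDERIV f x :> (D::'a::euclidean_space)"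
 shows "grad f x = D"
 by (simp add: grad_def GDERIV_frechet[OF assms] inner_commute[of _ D] euclidean_representation)

lemma differentiable_GDERIV:
 fixes f :: "'a::euclidean_space => real"
 assumes "f differentiable (at x)"
 shows "GDERIV f x :> grad f x"
proof -
 have d: "(f has_derivative frechet_derivative f (at x)) (at x)"
  using assms frechet_derivative_works by blast
 interpret l: bounded_linear "frechet_derivative f (at x)" using d has_derivative_bounded_linear by blast
 have "frechet_derivative f (at x) h = h \<bullet> grad f x" for h
 proof -
  have "frechet_derivative f (at x) h = frechet_derivative f (at x) (SUM b:Basis. (h \<bullet> b) *R b)"
   by (simp add: euclidean_representation)
  also have "... = (SUM b:Basis. (h \<bullet> b) * frechet_derivative f (at x) b)"
   by (simp add: l.sum l.scaleR)
  also have "... = h \<bullet> grad f x"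
   by (simp add: grad_def inner_sum_right mult.commute)
  finally show ?thesis .
 qed
 thus ?thesis using d unfolding gderiv_def by (metis (no_types, lifting) ext)
qed

lemma GDERIV_differentiable: "GDERIV f x :> (D::'a::euclidean_space) ==> f differentiable (at x)"
 unfolding gderiv_def differentiable_def by blast

lemma inner_grad_pd:
 "b : Basis ==> b \<bullet> grad f x = pd b f x"
 by (simp add: grad_def pd_def inner_sum_right inner_Basis if_distrib cong: if_cong)

lemma grad_eq_sum_pd: "grad f x = (SUM b:Basis. pd b f x *R b)"
 by (simp add: grad_def pd_def)

lemma GDERIV_continuous: "GDERIV f x :> D ==> isCont f x"
 unfolding gderiv_def by (rule has_derivative_continuous)

lemma GDERIV_transform_open:
 assumes "GDERIV f x :> D" "open U" "x : U" "!!y. y : U ==> f y = g y"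
 shows "GDERIV g x :> D"
 using assms unfolding gderiv_def by (metis has_derivative_transform_within_open)

lemma GDERIV_inner: "GDERIV (%y. y \<bullet> c) x :> c"
 unfolding gderiv_def by (auto intro!: derivative_eq_intros)

lemma GDERIV_cmult: "GDERIV f x :> D ==> GDERIV (%y. c * f y) x :> c *R D"
 using GDERIV_mult[OF GDERIV_const[of c]] by auto

lemma GDERIV_norm2: "GDERIV (%y. (norm (y - z))^2) x :> 2 *R (x - z)"
proof -
 have "((%y. (y - z) \<bullet> (y - z)) has_derivative (%h. h \<bullet> (2 *R (x - z)))) (at x)"
  by (auto intro!: derivative_eq_intros simp: inner_commute)
 thus ?thesis by (simp add: gderiv_def power2_norm_eq_inner)
qed

lemma GDERIV_affine:
 assumes "GDERIV f (c + k *R x) :> D"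
 shows "GDERIV (%y. f (c + k *R y)) x :> k *R D"
proof -
 have 1: "((%y. c + k *R y) has_derivative (%h. k *R h)) (at x)"
  by (auto intro!: derivative_eq_intros)
 have "((%y. f (c + k *R y)) has_derivative (%h. (k *R h) \<bullet> D)) (at x)"
  by (rule has_derivative_compose[OF 1]) (use assms in \<open>simp add: gderiv_def\<close>)
 thus ?thesis by (simp add: gderiv_def)
qed

lemma GDERIV_along:
 assumes "GDERIV f (x + t *R b) :> D"
 shows "((%ta. f (x + ta *R b)) has_real_derivative (b \<bullet> D)) (at t)"
proof -
 have 1: "((%ta. x + ta *R b) has_derivative (%h. h *R b)) (at t)"
  by (auto intro!: derivative_eq_intros)
 have "((%ta. f (x + ta *R b)) has_derivative (%h. (h *R b) \<bullet> D)) (at t)"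
  by (rule has_derivative_compose[OF 1]) (use assms in \<open>simp add: gderiv_def\<close>)
 moreover have "(%h. (h *R b) \<bullet> D) = (*) (b \<bullet> D)" by (auto simp: mult.commute)
 ultimately show ?thesis by (simp add: has_field_derivative_def)
qed

lemma Ck_continuous: "Ck k U f ==> continuous_on U f"
 by (cases k) auto

lemma Ck_SucD: "Ck (Suc k) U f ==> Ck k U f"
 by (induction k arbitrary: f) auto

lemma Ck_mono: "Ck k U f ==> j <= k ==> Ck j U f"
proof (induction k)
 case (Suc k)
 thus ?case by (metis Ck_SucD le_Suc_eq)
qed auto

lemma pd_cong_open:
 assumes "open U" "x : U" "!!y. y : U ==> f y = g y" "f differentiable (at x)"
 shows "pd b g x = pd b f x"
proof -
 have "GDERIV g x :> grad f x"
  using GDERIV_transform_open[OF differentiable_GDERIV[OF assms(4)] assms(1,2,3)] by blast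
 thus ?thesis using GDERIV_pd differentiable_GDERIV[OF assms(4)] by metis
qed

lemma differentiable_cong_open:
 fixes f :: "'a::euclidean_space => real"
 assumes "open U" "x : U" "!!y. y : U ==> f y = g y" "f differentiable (at x)"
 shows "g differentiable (at x)"
 using GDERIV_transform_open[OF differentiable_GDERIV[OF assms(4)] assms(1,2,3)] GDERIV_differentiable
 by blast

lemma Ck_cong:
 assumes "open U" "Ck k U f" "!!y. y : U ==> f y = g y"
 shows "Ck k U g"
 using assms(2,3)
proof (induction k arbitrary: f g)
 case 0
 thus ?case by (metis Ck.simps(1) continuous_on_cong)
next
 case (Suc k)
 have "continuous_on U g" using Suc.prems by (metis Ck_continuous continuous_on_cong)
 moreover have "g differentiable (at x)" if "x : U" for x
  using differentiable_cong_open[OF assms(1) that, of f g] Suc.prems that by auto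
 moreover have "Ck k U (pd b g)" if "b : Basis" for b
 proof (rule Suc.IH[of "pd b f"])
  show "Ck k U (pd b f)" using Suc.prems that by auto
  show "pd b f y = pd b g y" if "y : U" for y
   using pd_cong_open[OF assms(1) that, of f g b] Suc.prems that by auto
 qed
 ultimately show ?case by auto
qed

lemma CkBar_imp_Ck:
 assumes "open U" "U <= S" "CkBar k S f"
 shows "Ck k U f"
 using assms(3)
proof (induction k arbitrary: f)
 case 0
 thus ?case using assms continuous_on_subset by auto
next
 case (Suc k)
 have US: "U <= interior S" using assms by (simp add: interior_maximal)
 have "continuous_on U f" using Suc.prems assms continuous_on_subset by auto
 moreover have "ALL x:U. f differentiable (at x)" using Suc.prems US by auto
 moreover have "Ck k U (pd b f)" if b: "b : Basis" for b
 proof -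
  obtain g where "CkBar k S g" "ALL x:interior S. g x = pd b f x"
   using Suc.prems b by auto
  thus ?thesis using Suc.IH[of g] Ck_cong[OF assms(1), of k g "pd b f"] US by blast
 qed
 ultimately show ?case by auto
qed

lemma Ck_GDERIV: "Ck (Suc k) U f ==> x : U ==> GDERIV f x :> grad f x"
 by (simp add: differentiable_GDERIV)

text \<open>Lets an explicit gradient formula stand in for \<open>frechet_derivative\<close>:
  gradients are unique, so \<open>b \<bullet> g x\<close> equals \<open>pd b f x\<close> on the open
  set, and \<open>Ck\<close> depends only on values there.\<close>

lemma Ck_Suc_I:
 fixes f :: "'a::euclidean_space => real"
 assumes U: "open U" and g: "!!x. x : U ==> GDERIV f x :> g x"
  and k: "!!b. b : Basis ==> Ck k U (%x. b \<bullet> g x)"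
 shows "Ck (Suc k) U f"
proof -
 have "continuous_on U f" using g GDERIV_continuous continuous_at_imp_continuous_on by blast
 moreover have "Ck k U (pd b f)" if "b : Basis" for b
  by (rule Ck_cong[OF U k[OF that]]) (metis g GDERIV_pd)
 moreover have "f differentiable (at x)" if "x : U" for x
  using GDERIV_differentiable[OF g[OF that]] .
 ultimately show ?thesis by auto
qed

lemma Ck_const: "open U ==> Ck k U (%x. c)"
proof (induction k arbitrary: c)
 case (Suc k)
 show ?case by (rule Ck_Suc_I[where g="%x. 0"]) (use Suc GDERIV_const in auto)
qed auto

lemma Ck_inner: "open U ==> Ck k U (%x. x \<bullet> c)"
proof (cases k)
 case (Suc j)
 assume "open U"
 thus ?thesis unfolding Suc
  by (intro Ck_Suc_I[where g="%x. c"]) (auto intro: GDERIV_inner Ck_const)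
qed (auto intro!: continuous_intros)

lemma Ck_add:
 assumes U: "open U" shows "Ck k U f ==> Ck k U g ==> Ck k U (%x. f x + g x)"
proof (induction k arbitrary: f g)
 case (Suc k)
 show ?case
 proof (rule Ck_Suc_I[OF U, where g="%x. grad f x + grad g x"])
  show "GDERIV (%x. f x + g x) x :> grad f x + grad g x" if "x : U" for x
   using Suc.prems that by (auto intro!: GDERIV_add differentiable_GDERIV)
  show "Ck k U (%x. b \<bullet> (grad f x + grad g x))" if "b : Basis" for b
   using Suc.IH[of "pd b f" "pd b g"] Suc.prems that
   by (auto simp: inner_add_right inner_grad_pd)
 qed
qed (auto intro!: continuous_intros)

lemma Ck_mult:
 assumes U: "open U" shows "Ck k U f ==> Ck k U g ==> Ck k U (%x. f x * g x)"
proof (induction k arbitrary: f g)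
 case (Suc k)
 show ?case
 proof (rule Ck_Suc_I[OF U, where g="%x. f x *R grad g x + g x *R grad f x"])
  show "GDERIV (%x. f x * g x) x :> f x *R grad g x + g x *R grad f x" if "x : U" for x
   using Suc.prems that by (auto intro!: GDERIV_mult differentiable_GDERIV)
  show "Ck k U (%x. b \<bullet> (f x *R grad g x + g x *R grad f x))" if b: "b : Basis" for b
  proof -
   have "Ck k U (%x. f x * pd b g x + g x * pd b f x)"
    by (rule Ck_add[OF U]; rule Suc.IH; use Suc.prems b Ck_SucD in auto)
   thus ?thesis using b by (simp add: inner_add_right inner_grad_pd)
  qed
 qed
qed (auto intro!: continuous_intros)

lemma Ck_sum:
 assumes U: "open U" and "finite I" "!!i. i : I ==> Ck k U (f i)"
 shows "Ck k U (%x. SUM i:I. f i x)"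
 using assms(2,3) by (induction I rule: finite_induct) (auto intro: Ck_const U Ck_add)

lemma Ck_norm2: "open U ==> Ck k U (%x::'a::euclidean_space. (norm x)^2)"
proof -
 assume U: "open U"
 have "Ck k U (%x::'a. SUM b:Basis. (x \<bullet> b) * (x \<bullet> b))"
  by (intro Ck_sum Ck_mult Ck_inner U) auto
 moreover have "(norm x)^2 = (SUM b:Basis. (x \<bullet> b) * (x \<bullet> b))" for x :: 'a
  by (simp add: power2_norm_eq_inner euclidean_inner[of x x])
 ultimately show ?thesis by simp
qed

text \<open>A family of one-variable functions closed under differentiation, such as the powers
 or the functions \<open>t\<^sup>-\<^sup>m exp(-1/t)\<close>, stays smooth after composition.\<close>
lemma Ck_compose_family:
 fixes h :: "'i => real => real" and w :: "'a::euclidean_space => real"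
 assumes U: "open U" and w: "!!k. Ck k U w"
  and h: "!!i x. x : U ==> (h i has_real_derivative (c i * h (p i) (w x) + d i * h (q i) (w x))) (at (w x))"
 shows "Ck k U (%x. h i (w x))"
proof (induction k arbitrary: i)
 case 0
 have "isCont (%x. h i (w x)) x" if "x : U" for x
  using GDERIV_continuous[OF GDERIV_DERIV_compose[OF Ck_GDERIV[OF w that] h[OF that, of i]]] .
 thus ?case by (simp add: continuous_at_imp_continuous_on)
next
 case (Suc k)
 show ?case
 proof (rule Ck_Suc_I[OF U])
  show "GDERIV (%x. h i (w x)) x :> (c i * h (p i) (w x) + d i * h (q i) (w x)) *R grad w x"
   if "x : U" for x
   using GDERIV_DERIV_compose[OF Ck_GDERIV[OF w that] h[OF that]] .
  fix b :: 'a assume b: "b : Basis"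
  have "Ck k U (%x. (c i * h (p i) (w x) + d i * h (q i) (w x)) * pd b w x)"
   using w[of "Suc k"] b by (intro Ck_mult Ck_add Ck_const Suc U) auto
  thus "Ck k U (%x. b \<bullet> ((c i * h (p i) (w x) + d i * h (q i) (w x)) *R grad w x))"
   using b by (simp add: inner_grad_pd)
 qed
qed

lemma Ck_powr:
 assumes U: "open U" and w: "!!k. Ck k U w" and pos: "!!x. x : U ==> w x > 0"
 shows "Ck k U (%x. w x powr al)"
 by (rule Ck_compose_family[OF U w, where h="%al t. t powr al" and c="%al. al" and p="%al. al - 1"
    and d="%_. 0" and q="%al. al"])
  (use pos in \<open>auto intro!: derivative_eq_intros\<close>)

section \<open>Second directional derivatives and the maximum principle\<close>

text \<open>Differentiability is asked along one line, and a second time at the single point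
  \<open>x\<close>. Sums, affine changes and reflections are then immediate, and it is what a
  comparison at an interior maximum uses.\<close>

definition has_d2 :: "('a::real_normed_vector => real) => 'a => 'a => real => bool" where
 "has_d2 f b x l \<longleftrightarrow> (EX g e. e > 0 & (ALL t. \<bar>t\<bar> < e -->
   ((%ta. f (x + ta *R b)) has_real_derivative g t) (at t)) & (g has_real_derivative l) (at 0))"

text \<open>The sign is opposite to that of \<open>lap\<close>: for C2 functions
  \<open>L = - lap f x\<close>.\<close>

definition has_lap :: "('a::euclidean_space => real) => 'a => real => bool" where
 "has_lap f x L \<longleftrightarrow> (EX l. (ALL b:Basis. has_d2 f b x (l b)) & L = sum l Basis)"

lemma has_d2_add:
 assumes "has_d2 f b x l" "has_d2 g b x m" shows "has_d2 (%y. f y + g y) b x (l + m)"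
proof -
 obtain f' e where f: "e > 0" "!!t. \<bar>t\<bar> < e ==> ((%ta. f (x + ta *R b)) has_real_derivative f' t) (at t)"
  "(f' has_real_derivative l) (at 0)" using assms(1) unfolding has_d2_def by blast
 obtain g' e' where g: "e' > 0" "!!t. \<bar>t\<bar> < e' ==> ((%ta. g (x + ta *R b)) has_real_derivative g' t) (at t)"
  "(g' has_real_derivative m) (at 0)" using assms(2) unfolding has_d2_def by blast
 show ?thesis unfolding has_d2_def
  by (rule exI[of _ "%t. f' t + g' t"], rule exI[of _ "min e e'"])
   (use f g in \<open>auto intro!: DERIV_add\<close>)
qed

lemma has_d2_cmult:
 assumes "has_d2 f b x l" shows "has_d2 (%y. c * f y) b x (c * l)"
proof -
 obtain f' e where f: "e > 0" "!!t. \<bar>t\<bar> < e ==> ((%ta. f (x + ta *R b)) has_real_derivative f' t) (at t)"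
  "(f' has_real_derivative l) (at 0)" using assms(1) unfolding has_d2_def by blast
 show ?thesis unfolding has_d2_def
  by (rule exI[of _ "%t. c * f' t"], rule exI[of _ e])
   (use f in \<open>auto intro!: DERIV_cmult\<close>)
qed

lemma has_d2_affine:
 assumes "has_d2 f b (c + k *R x) l"
 shows "has_d2 (%y. f (c + k *R y)) b x (k^2 * l)"
proof (cases "k = 0")
 case True
 thus ?thesis unfolding has_d2_def
  by (intro exI[of _ "%t. 0"] exI[of _ 1]) auto
next
 case False
 obtain g e where g: "e > 0" "!!t. \<bar>t\<bar> < e ==> ((%ta. f (c + k *R x + ta *R b)) has_real_derivative g t) (at t)"
  "(g has_real_derivative l) (at 0)" using assms unfolding has_d2_def by blast
 have k: "((%ta. k * ta) has_real_derivative k) (at t)" for t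
  by (auto intro!: derivative_eq_intros)
 have 1: "((%ta. f (c + k *R (x + ta *R b))) has_real_derivative g (k * t) * k) (at t)"
  if "\<bar>t\<bar> < e / \<bar>k\<bar>" for t
 proof -
  have "\<bar>k * t\<bar> < e" using that False by (simp add: abs_mult field_simps)
  from DERIV_chain2[OF g(2)[OF this] k] show ?thesis by (simp add: algebra_simps)
 qed
 have "((%t. g (k * t)) has_real_derivative l * k) (at 0)"
  using DERIV_chain2[of g l "(*) k" 0 k] g(3) k by simp
 from DERIV_cmult_right[OF this, of k]
 have 2: "((%t. g (k * t) * k) has_real_derivative (k^2 * l)) (at 0)" by (simp add: power2_eq_square ac_simps)
 show ?thesis unfolding has_d2_def
  by (rule exI[of _ "%t. g (k * t) * k"], rule exI[of _ "e / \<bar>k\<bar>"]) (use 1 2 g(1) False in auto)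
qed

lemma has_d2_linear_map:
 assumes "has_d2 f (T b) (T x) l" "!!t. T (x + t *R b) = T x + t *R T b"
 shows "has_d2 (%y. f (T y)) b x l"
 using assms unfolding has_d2_def by simp

lemma has_d2_uminus_dir:
 assumes "has_d2 f b x l" shows "has_d2 f (- b) x l"
proof -
 obtain g e where g: "e > 0" "!!t. \<bar>t\<bar> < e ==> ((%ta. f (x + ta *R b)) has_real_derivative g t) (at t)"
  "(g has_real_derivative l) (at 0)" using assms unfolding has_d2_def by blast
 have um: "((%t::real. - t) has_real_derivative - 1) (at t)" for t
  by (auto intro!: derivative_eq_intros)
 have 1: "((%ta. f (x + ta *R (- b))) has_real_derivative - g (- t)) (at t)" if "\<bar>t\<bar> < e" for t
  using DERIV_chain2[of "%ta. f (x + ta *R b)" "g (- t)" "%t. - t" t "-1" UNIV] g(2)[of "- t"] that um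
  by simp
 have "((%t. - g (- t)) has_real_derivative l) (at 0)"
  using DERIV_minus[OF DERIV_chain2[of g l "%t. - t" 0 "-1" UNIV]] g(3) um by simp
 thus ?thesis unfolding has_d2_def using 1 g(1) by (metis (no_types, lifting))
qed

lemma has_d2_transform:
 assumes "has_d2 f b x l" "open U" "x : U" "!!y. y : U ==> f y = g y"
 shows "has_d2 g b x l"
proof -
 obtain f' e where f: "e > 0" "!!t. \<bar>t\<bar> < e ==> ((%ta. f (x + ta *R b)) has_real_derivative f' t) (at t)"
  "(f' has_real_derivative l) (at 0)" using assms(1) unfolding has_d2_def by blast
 have c: "continuous_on UNIV (%ta::real. x + ta *R b)" by (intro continuous_intros)
 define V where "V = (%ta::real. x + ta *R b) -` U"
 have V: "open V" "0 : V" unfolding V_def using c assms(2,3) by (auto intro: open_vimage)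
 then obtain d where d: "d > 0" "ball 0 d <= V" by (meson open_contains_ball)
 have "((%ta. g (x + ta *R b)) has_real_derivative f' t) (at t)" if "\<bar>t\<bar> < min e d" for t
 proof (rule has_field_derivative_transform_within_open[OF f(2) V(1)])
  show "\<bar>t\<bar> < e" using that by simp
  show "t : V" using d that by auto
 qed (use assms(4) V_def in auto)
 thus ?thesis unfolding has_d2_def using f d by (metis min_less_iff_conj)
qed

lemma has_d2_GDERIV:
 assumes U: "open U" "x : U" and g: "!!y. y : U ==> GDERIV f y :> g y"
  and h: "GDERIV (%y. b \<bullet> g y) x :> h"
 shows "has_d2 f b x (b \<bullet> h)"
proof -
 have c: "continuous_on UNIV (%ta::real. x + ta *R b)" by (intro continuous_intros)
 define V where "V = (%ta::real. x + ta *R b) -` U"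
 have V: "open V" "0 : V" unfolding V_def using c U by (auto intro: open_vimage)
 then obtain d where d: "d > 0" "ball 0 d <= V" by (meson open_contains_ball)
 have "((%ta. f (x + ta *R b)) has_real_derivative b \<bullet> g (x + t *R b)) (at t)" if "\<bar>t\<bar> < d" for t
  by (rule GDERIV_along, rule g) (use d that in \<open>auto simp: V_def\<close>)
 moreover have "((%t. b \<bullet> g (x + t *R b)) has_real_derivative (b \<bullet> h)) (at 0)"
  by (rule GDERIV_along) (use h in simp)
 ultimately show ?thesis unfolding has_d2_def using d(1)
  by (intro exI[of _ "%t. b \<bullet> g (x + t *R b)"] exI[of _ d]) auto
qed

text \<open>Profiles are written in the squared distance, a polynomial, so that the centre
  \<open>z\<close> is not a singular point of the change of variables.\<close>

lemma has_d2_radial: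
 fixes z :: "'a::euclidean_space"
 assumes b: "b : Basis" and U: "open U" "(norm (x - z))^2 : U"
  and F: "!!r. r : U ==> (F has_real_derivative F1 r) (at r)"
  and F1: "(F1 has_real_derivative F2) (at ((norm (x - z))^2))"
 shows "has_d2 (%y. F ((norm (y - z))^2)) b x (F2 * (2 * (b \<bullet> (x - z)))^2 + 2 * F1 ((norm (x - z))^2))"
proof -
 let ?N = "%y. (norm (y - z))^2"
 define W where "W = ?N -` U"
 have W: "open W" "x : W" unfolding W_def using U by (auto intro!: open_vimage continuous_intros)
 have 1: "GDERIV (%y. F (?N y)) y :> F1 (?N y) *R (2 *R (y - z))" if "y : W" for y
  by (rule GDERIV_DERIV_compose[OF GDERIV_norm2]) (use F that in \<open>auto simp: W_def\<close>)
 have "GDERIV (%y. (y - z) \<bullet> b) x :> b" unfolding gderiv_def by (auto intro!: derivative_eq_intros)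
 from GDERIV_mult[OF GDERIV_cmult[OF GDERIV_DERIV_compose[OF GDERIV_norm2 F1], of 2] this]
 have 2: "GDERIV (%y. b \<bullet> (F1 (?N y) *R (2 *R (y - z)))) x :>
   (2 * F1 (?N x)) *R b + ((x - z) \<bullet> b) *R (2 *R (F2 *R (2 *R (x - z))))"
  by (simp add: inner_commute ac_simps)
 from has_d2_GDERIV[OF W 1 2] show ?thesis
  using b by (simp add: inner_add_right power2_eq_square inner_commute algebra_simps)
qed

lemma has_lap_radial:
 fixes z :: "'a::euclidean_space"
 assumes U: "open U" "(norm (x - z))^2 : U"
  and F: "!!r. r : U ==> (F has_real_derivative F1 r) (at r)"
  and F1: "(F1 has_real_derivative F2) (at ((norm (x - z))^2))"
 shows "has_lap (%y. F ((norm (y - z))^2)) x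
   (4 * F2 * (norm (x - z))^2 + 2 * real DIM('a) * F1 ((norm (x - z))^2))"
proof -
 have "(SUM b:Basis. F2 * (2 * (b \<bullet> (x - z)))^2 + 2 * F1 ((norm (x - z))^2))
   = 4 * F2 * (SUM b:Basis. ((x - z) \<bullet> b) * ((x - z) \<bullet> b)) + 2 * real DIM('a) * F1 ((norm (x - z))^2)"
  by (simp add: sum.distrib sum_distrib_left power2_eq_square inner_commute mult_ac)
 also have "(SUM b:Basis. ((x - z) \<bullet> b) * ((x - z) \<bullet> b)) = (norm (x - z))^2"
  by (simp add: power2_norm_eq_inner euclidean_inner[of "x - z" "x - z"])
 finally show ?thesis unfolding has_lap_def using has_d2_radial[OF _ U F F1]
  by (intro exI[of _ "%b. F2 * (2 * (b \<bullet> (x - z)))^2 + 2 * F1 ((norm (x - z))^2)"]) auto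
qed

lemma has_lap_norm2: "has_lap (%y::'a::euclidean_space. (norm (y - z))^2) x (2 * real DIM('a))"
 using has_lap_radial[of UNIV x z "%r. r" "%r. 1" 0] by (auto intro!: derivative_eq_intros)

lemma has_lap_planar:
 fixes c :: "'a::euclidean_space"
 assumes c: "c : Basis" and F: "!!r. (F has_real_derivative F1 r) (at r)"
  and F1: "(F1 has_real_derivative F2) (at (x \<bullet> c))"
 shows "has_lap (%y. F (y \<bullet> c)) x F2"
proof -
 have 1: "GDERIV (%y. F (y \<bullet> c)) y :> F1 (y \<bullet> c) *R c" for y
  by (rule GDERIV_DERIV_compose[OF GDERIV_inner F])
 have "has_d2 (%y. F (y \<bullet> c)) b x ((b \<bullet> c) * (b \<bullet> c) * F2)" if "b : Basis" for b
 proof -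
  have "GDERIV (%y. b \<bullet> (F1 (y \<bullet> c) *R c)) x :> (b \<bullet> c) *R (F2 *R c)"
   using GDERIV_cmult[OF GDERIV_DERIV_compose[OF GDERIV_inner F1], of "b \<bullet> c"] by (simp add: ac_simps)
  from has_d2_GDERIV[OF open_UNIV UNIV_I 1 this] show ?thesis by (simp add: ac_simps)
 qed
 moreover have "(SUM b:Basis. (b \<bullet> c) * (b \<bullet> c) * F2) = (SUM b:Basis. if b = c then F2 else 0)"
  using c by (intro sum.cong) (auto simp: inner_Basis)
 hence "(SUM b:Basis. (b \<bullet> c) * (b \<bullet> c) * F2) = F2" using c by simp
 ultimately show ?thesis unfolding has_lap_def
  by (intro exI[of _ "%b. (b \<bullet> c) * (b \<bullet> c) * F2"]) auto
qed

lemma has_lap_add: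
 assumes "has_lap f x l" "has_lap g x m" shows "has_lap (%y. f y + g y) x (l + m)"
proof -
 obtain p q where "!!b. b : Basis ==> has_d2 f b x (p b)" "l = sum p Basis"
  "!!b. b : Basis ==> has_d2 g b x (q b)" "m = sum q Basis"
  using assms unfolding has_lap_def by auto
 thus ?thesis unfolding has_lap_def
  by (intro exI[of _ "%b. p b + q b"]) (auto intro: has_d2_add simp: sum.distrib)
qed

lemma has_lap_cmult:
 assumes "has_lap f x l" shows "has_lap (%y. c * f y) x (c * l)"
proof -
 obtain p where "!!b. b : Basis ==> has_d2 f b x (p b)" "l = sum p Basis"
  using assms unfolding has_lap_def by auto
 thus ?thesis unfolding has_lap_def
  by (intro exI[of _ "%b. c * p b"]) (auto intro: has_d2_cmult simp: sum_distrib_left)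
qed

lemma has_lap_diff: "has_lap f x l ==> has_lap g x m ==> has_lap (%y. f y - g y) x (l - m)"
 using has_lap_add[of f x l "%y. (-1) * g y" "(-1) * m"] has_lap_cmult[of g x m "-1"] by simp

lemma has_lap_affine:
 assumes "has_lap f (c + k *R x) l" shows "has_lap (%y. f (c + k *R y)) x (k^2 * l)"
proof -
 obtain p where "!!b. b : Basis ==> has_d2 f b (c + k *R x) (p b)" "l = sum p Basis"
  using assms unfolding has_lap_def by auto
 thus ?thesis unfolding has_lap_def
  by (intro exI[of _ "%b. k^2 * p b"]) (auto intro: has_d2_affine simp: sum_distrib_left)
qed

lemma has_lap_transform:
 "has_lap f x l ==> open U ==> x : U ==> (!!y. y : U ==> f y = g y) ==> has_lap g x l"
 unfolding has_lap_def using has_d2_transform by metis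

lemma Ck2_has_lap:
 assumes "open U" "Ck (Suc (Suc 0)) U f" "x : U"
 shows "has_lap f x (- lap f x)"
proof -
 have "has_d2 f b x (pd b (pd b f) x)" if b: "b : Basis" for b
 proof -
  have "GDERIV (pd b f) x :> grad (pd b f) x" using assms(2,3) b by (auto intro!: differentiable_GDERIV)
  hence "GDERIV (%y. b \<bullet> grad f y) x :> grad (pd b f) x" using b by (simp add: inner_grad_pd)
  from has_d2_GDERIV[OF assms(1,3) Ck_GDERIV[OF assms(2)] this] show ?thesis using b by (simp add: inner_grad_pd)
 qed
 thus ?thesis unfolding has_lap_def lap_def by (auto intro!: exI[of _ "%b. pd b (pd b f) x"])
qed

text \<open>A positive second derivative at a critical point makes the first derivative positive
  just to the right, and the mean value theorem then produces a larger value of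
  \<open>f\<close>.\<close>

lemma has_d2_local_max:
 assumes "has_d2 f b x l" "e > 0" "!!t. \<bar>t\<bar> < e ==> f (x + t *R b) <= f x"
 shows "l <= 0"
proof (rule ccontr)
 assume "~ l <= 0"
 hence l: "l > 0" by simp
 obtain g e' where g: "e' > 0" "!!t. \<bar>t\<bar> < e' ==> ((%ta. f (x + ta *R b)) has_real_derivative g t) (at t)"
  "(g has_real_derivative l) (at 0)" using assms(1) unfolding has_d2_def by blast
 have g0: "g 0 = 0"
  by (rule DERIV_local_max[OF g(2)[of 0] assms(2)]) (use g(1) assms(3) in auto)
 obtain d where d: "d > 0" "!!h. h > 0 ==> h < d ==> g h > 0"
  using DERIV_pos_inc_right[OF g(3) l] g0 by auto
 define t where "t = min (min e e') d / 2"
 have t: "0 < t" "t < e" "t < e'" "t < d" using assms(2) g(1) d(1) by (auto simp: t_def)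
 obtain z where z: "0 < z" "z < t" "f (x + t *R b) - f (x + 0 *R b) = (t - 0) * g z"
  using MVT2[of 0 t "%ta. f (x + ta *R b)" g] g(2) t by auto
 have "g z > 0" using d z t by auto
 hence "(t - 0) * g z > 0" using t by simp
 hence "f (x + t *R b) > f x" using z(3) by simp
 thus False using assms(3)[of t] t by auto
qed

lemma has_lap_local_max:
 assumes "has_lap f x L" "open U" "x : U" "!!y. y : U ==> f y <= f x"
 shows "L <= 0"
proof -
 obtain l where l: "!!b. b : Basis ==> has_d2 f b x (l b)" "L = sum l Basis"
  using assms(1) unfolding has_lap_def by auto
 obtain e where e: "e > 0" "ball x e <= U" using assms(2,3) by (meson open_contains_ball)
 have "l b <= 0" if b: "b : Basis" for b
  by (rule has_d2_local_max[OF l(1)[OF b] e(1)])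
   (use e(2) b assms(4) in \<open>auto simp: dist_norm subset_iff\<close>)
 thus ?thesis unfolding l(2) by (rule sum_nonpos)
qed

lemma max_principle_strict:
 fixes f :: "'a::euclidean_space => real"
 assumes "open D" "bounded D" "continuous_on (closure D) f"
  and lap: "!!x. x : D ==> EX L>0. has_lap f x L"
  and bd: "!!x. x : frontier D ==> f x <= M" and x: "x : D"
 shows "f x <= M"
proof -
 have c: "compact (closure D)" using assms(2) by simp
 obtain y where y: "y : closure D" "!!z. z : closure D ==> f z <= f y"
  using continuous_attains_sup[OF c _ assms(3)] x by (metis closure_subset empty_iff subset_iff)
 have "y ~: D"
 proof
  assume yD: "y : D"
  then obtain L where "L > 0" "has_lap f y L" using lap by auto
  thus False using has_lap_local_max[OF _ assms(1) yD] y(2) closure_subset by (metis not_le subset_iff)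
 qed
 hence "y : frontier D" using y(1) assms(1) by (simp add: frontier_def interior_open)
 thus ?thesis using bd y(2) x closure_subset by (metis order_trans subset_iff)
qed

lemma max_principle:
 fixes f :: "'a::euclidean_space => real"
 assumes D: "open D" "bounded D" "continuous_on (closure D) f"
  and lap: "!!x. x : D ==> EX L>=0. has_lap f x L"
  and bd: "!!x. x : frontier D ==> f x <= M" and x: "x : D"
 shows "f x <= M"
proof (rule field_le_epsilon)
 fix e :: real assume e: "e > 0"
 obtain R where R: "R > 0" "!!y. y : closure D ==> norm y <= R"
  using bounded_closure[OF D(2)] bounded_pos by blast
 \<comment> \<open>The added \<open>c * (norm x)^2\<close> makes the Laplacian strictly positive and
   costs at most \<open>e\<close> on the frontier.\<close>
 define c where "c = e / R^2"
 have c: "c > 0" using e R by (simp add: c_def)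
 have "f x + c * (norm (x - 0))^2 <= M + e"
 proof (rule max_principle_strict[OF D(1,2) _ _ _ x])
  show "continuous_on (closure D) (%y. f y + c * (norm (y - 0))^2)"
   by (intro continuous_intros D)
  show "EX L>0. has_lap (%y. f y + c * (norm (y - 0))^2) y L" if yD: "y : D" for y
  proof -
   obtain L where "L >= 0" "has_lap f y L" using lap[OF yD] by blast
   thus ?thesis using has_lap_add[OF _ has_lap_cmult[OF has_lap_norm2[of 0 y], of c]] c
    by (metis DIM_positive add_nonneg_pos mult_pos_pos of_nat_0_less_iff zero_less_numeral)
  qed
  show "f y + c * (norm (y - 0))^2 <= M + e" if y: "y : frontier D" for y
  proof -
   have "(norm y)^2 <= R^2" using R(2)[of y] y by (auto simp: frontier_def intro: power_mono)
   hence "c * (norm y)^2 <= c * R^2" using c by (simp add: mult_left_mono)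
   also have "... = e" using R(1) by (simp add: c_def)
   finally show ?thesis using bd[OF y] by simp
  qed
 qed
 moreover have "0 <= c * (norm (x - 0))^2" using c by simp
 ultimately show "f x <= M + e" by simp
qed

section \<open>Interior gradient estimate\<close>

definition reflect :: "'a::real_inner => 'a => 'a" where
 "reflect b y = y - (2 * (y \<bullet> b)) *R b"

lemma has_lap_reflect:
 assumes "has_lap f (reflect c x) L" "c : Basis"
 shows "has_lap (%y. f (reflect c y)) x L"
proof -
 obtain l where l: "!!b. b : Basis ==> has_d2 f b (reflect c x) (l b)" "L = sum l Basis"
  using assms(1) unfolding has_lap_def by auto
 have "has_d2 (%y. f (reflect c y)) b x (l b)" if b: "b : Basis" for b
 proof (rule has_d2_linear_map[of f "reflect c"])
  show "has_d2 f (reflect c b) (reflect c x) (l b)"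
  proof (cases "b = c")
   case True
   have "c \<bullet> c = 1" using assms(2) by simp
   hence "reflect c b = - c" unfolding reflect_def True by (simp add: scaleR_2)
   thus ?thesis using has_d2_uminus_dir[OF l(1)[OF b]] True by simp
  next
   case False
   hence "reflect c b = b" unfolding reflect_def using b assms(2) by (simp add: inner_Basis)
   thus ?thesis using l(1)[OF b] by simp
  qed
  show "reflect c (x + t *R b) = reflect c x + t *R reflect c b" for t
   by (simp add: reflect_def algebra_simps)
 qed
 thus ?thesis unfolding has_lap_def using l(2) by auto
qed

lemma norm_reflect: "norm c = 1 ==> norm (reflect c y) = norm y"
proof -
 assume "norm c = 1"
 hence "c \<bullet> c = 1" by (simp add: norm_eq_1)
 hence "reflect c y \<bullet> reflect c y = y \<bullet> y"
  by (simp add: reflect_def inner_diff_left inner_diff_right inner_commute)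
 thus ?thesis by (simp add: norm_eq)
qed

text \<open>The odd part of \<open>f\<close> in direction \<open>b\<close> is compared on a half ball with a quadratic barrier
 vanishing at the centre.\<close>
lemma gradient_estimate0:
 fixes f :: "'a::euclidean_space => real"
 assumes b: "b : Basis" and d: "d > 0"
  and cont: "continuous_on (cball 0 d) f"
  and lap: "!!y. y : ball 0 d ==> EX L. \<bar>L\<bar> <= F & has_lap f y L"
  and A: "!!y. y : cball 0 d ==> \<bar>f y\<bar> <= A"
  and der: "((%t. f (t *R b)) has_real_derivative p) (at 0)"
 shows "p <= real DIM('a) * A / d + F * d / 2"
proof -
 let ?n = "real DIM('a)"
 have nb: "norm b = 1" "b \<bullet> b = 1" using b by auto
 define H where "H = {y::'a. norm y < d & y \<bullet> b > 0}"
 define ph where "ph y = (1/2) * (f y - f (reflect b y))" for y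
 define K where "K = A / d^2"
 \<comment> \<open>In the barrier \<open>\<psi>\<close> the Laplacian \<open>2 n K\<close> of
   \<open>K * (norm y)^2\<close> is cancelled by \<open>- K n t^2\<close>, and the term with
   \<open>F / 2\<close> contributes \<open>- F\<close>, which absorbs the Laplacian of the odd part.
   The linear terms keep \<open>P\<close> nonnegative for \<open>0 <= t <= d\<close>, and their
   slope at 0 is exactly the bound to be proved.\<close>
 define P where "P t = K * (?n * d * t - ?n * t^2) + (F / 2) * (t * d - t^2)" for t
 define \<psi> where "\<psi> y = K * (norm (y - 0))^2 + P (y \<bullet> b)" for y
 have A0: "A >= 0" using A[of 0] d by auto
 have F0: "F >= 0" using lap[of 0] d by (metis abs_ge_zero centre_in_ball order_trans)
 have oH: "open H" unfolding H_def
  by (intro open_Collect_conj open_Collect_less continuous_intros)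
 have bH: "bounded H" unfolding bounded_iff H_def by (auto intro!: exI[of _ d])
 have clH: "closure H <= {y. norm y <= d & y \<bullet> b >= 0}"
  by (rule closure_minimal) (auto simp: H_def intro!: closed_Collect_conj closed_Collect_le continuous_intros)
 have cr: "continuous_on S (reflect b)" for S unfolding reflect_def by (intro continuous_intros)
 have r: "norm (reflect b y) = norm y" for y by (rule norm_reflect[OF nb(1)])
 have cphi: "continuous_on (cball 0 d) ph" unfolding ph_def
  by (intro continuous_intros cont continuous_on_compose2[OF cont cr]) (auto simp: r)
 have main: "ph y - \<psi> y <= 0" if y: "y : H" for y
 proof (rule max_principle[OF oH bH _ _ _ y])
  show "continuous_on (closure H) (%y. ph y - \<psi> y)" unfolding \<psi>_def P_def
   by (intro continuous_intros continuous_on_subset[OF cphi]) (use clH in auto)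
  show "EX L>=0. has_lap (%y. ph y - \<psi> y) x L" if x: "x : H" for x
  proof -
   obtain L where L: "\<bar>L\<bar> <= F" "has_lap f x L" using lap[of x] x by (auto simp: H_def)
   obtain M where M: "\<bar>M\<bar> <= F" "has_lap f (reflect b x) M" using lap[of "reflect b x"] x by (auto simp: H_def r)
   have 1: "has_lap ph x ((1/2) * (L - M))"
    unfolding ph_def[abs_def] by (intro has_lap_cmult has_lap_diff L has_lap_reflect M b)
   have 2: "has_lap (%y. P (y \<bullet> b)) x (K * (- 2 * ?n) + (F/2) * (- 2))"
    by (rule has_lap_planar[OF b, where ?F1.0="%t. K * (?n * d - 2 * ?n * t) + (F / 2) * (d - 2 * t)"])
     (auto simp: P_def intro!: derivative_eq_intros)
   have 3: "has_lap \<psi> x (K * (2 * ?n) + (K * (- 2 * ?n) + (F/2) * (- 2)))"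
    unfolding \<psi>_def[abs_def] by (intro has_lap_add has_lap_cmult has_lap_norm2 2)
   have "0 <= (1/2) * (L - M) - (K * (2 * ?n) + (K * (- 2 * ?n) + (F/2) * (- 2)))"
    using abs_le_D2[OF L(1)] abs_le_D1[OF M(1)] by (simp add: field_simps)
   thus ?thesis using has_lap_diff[OF 1 3] by blast
  qed
  show "ph x - \<psi> x <= 0" if x: "x : frontier H" for x
  proof -
   have xc: "norm x <= d" "x \<bullet> b >= 0" using x clH by (auto simp: frontier_def)
   have xH: "x ~: H" using x oH by (simp add: frontier_def interior_open)
   have tb: "x \<bullet> b <= d" using xc Cauchy_Schwarz_ineq2[of x b] nb by auto
   have Fp: "0 <= (F / 2) * ((x \<bullet> b) * d - (x \<bullet> b)^2)"
    using F0 tb xc by (simp add: power2_eq_square mult_left_mono)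
   have np: "0 <= ?n * d * (x \<bullet> b) - ?n * (x \<bullet> b)^2"
   proof -
    have "(x \<bullet> b) * (x \<bullet> b) <= d * (x \<bullet> b)" using tb xc by (simp add: mult_right_mono)
    hence "?n * ((x \<bullet> b) * (x \<bullet> b)) <= ?n * (d * (x \<bullet> b))" by (simp add: mult_left_mono)
    thus ?thesis by (simp add: power2_eq_square ac_simps)
   qed
   show ?thesis
   \<comment> \<open>On the flat face the odd part vanishes; the rest of the frontier lies on the
     sphere, where the barrier is at least \<open>A\<close>.\<close>
   proof (cases "x \<bullet> b = 0")
    case True
    hence "ph x = 0" unfolding ph_def reflect_def by simp
    moreover have "\<psi> x >= 0" unfolding \<psi>_def P_def True K_def using A0 by simp
    ultimately show ?thesis by simp
   next
    case False
    hence nx: "norm x = d" using xH xc unfolding H_def by auto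
    have "\<bar>ph x\<bar> <= A" using A[of x] A[of "reflect b x"] xc unfolding ph_def by (auto simp: r abs_le_iff)
    moreover have "\<psi> x >= A"
    proof -
     have "K * (norm (x - 0))^2 = A" using nx d by (simp add: K_def)
     moreover have "0 <= K * (?n * d * (x \<bullet> b) - ?n * (x \<bullet> b)^2)"
      using np A0 by (intro mult_nonneg_nonneg) (auto simp: K_def)
     ultimately show ?thesis unfolding \<psi>_def P_def using Fp by linarith
    qed
    ultimately show ?thesis by linarith
   qed
  qed
 qed
 have refl_tb: "reflect b (t *R b) = (-t) *R b" for t
  using nb by (simp add: reflect_def algebra_simps flip: scaleR_left.add)
 have dphi: "((%t. ph (t *R b)) has_real_derivative p) (at 0)"
 proof -
  have um: "((%t::real. - t) has_real_derivative - 1) (at 0)"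
   by (auto intro!: derivative_eq_intros)
  have "((%t. f ((-t) *R b)) has_real_derivative - p) (at 0)"
   using DERIV_chain2[of "%t. f (t *R b)" p "%t. - t" 0 "-1" UNIV] der
    um by simp
  from DERIV_cmult[OF DERIV_diff[OF der this], of "1/2"] show ?thesis
   unfolding ph_def refl_tb by simp
 qed
 have dpsi: "((%t. K * t^2 + P t) has_real_derivative ?n * A / d + F * d / 2) (at 0)"
  unfolding P_def K_def using d by (auto intro!: derivative_eq_intros simp: power2_eq_square field_simps)
 show ?thesis
 proof (rule ccontr)
  assume "~ ?thesis"
  hence pos: "p - (?n * A / d + F * d / 2) > 0" by simp
  let ?h = "%t. ph (t *R b) - (K * t^2 + P t)"
  obtain e where e: "e > 0" "!!h. h > 0 ==> h < e ==> ?h 0 < ?h (0 + h)"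
   using DERIV_pos_inc_right[OF DERIV_diff[OF dphi dpsi] pos] by blast
  define t where "t = min e d / 2"
  have t: "t > 0" "t < e" "t < d" using e(1) d by (auto simp: t_def)
  have "t *R b : H" unfolding H_def using t nb by auto
  from main[OF this] have "?h t <= 0" unfolding \<psi>_def using nb t by simp
  moreover have "?h 0 = 0" unfolding ph_def reflect_def P_def by simp
  ultimately show False using e(2)[of t] t by simp
 qed
qed

lemma gradient_estimate:
 fixes f :: "'a::euclidean_space => real"
 assumes b: "b : Basis" and d: "d > 0"
  and cont: "continuous_on (cball x d) f"
  and lap: "!!y. y : ball x d ==> EX L. \<bar>L\<bar> <= F & has_lap f y L"
  and A: "!!y. y : cball x d ==> \<bar>f y\<bar> <= A"
  and der: "GDERIV f x :> D"
 shows "\<bar>b \<bullet> D\<bar> <= real DIM('a) * A / d + F * d / 2"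
proof -
 have gen: "c * (b \<bullet> D) <= real DIM('a) * A / d + F * d / 2" if c: "\<bar>c\<bar> = 1" for c :: real
 proof -
  define g where "g y = c * f (x + 1 *R y)" for y
  show ?thesis
  proof (rule gradient_estimate0[OF b d, of g])
   show "continuous_on (cball 0 d) g" unfolding g_def
    by (intro continuous_intros continuous_on_compose2[OF cont]) (auto simp: dist_norm)
   show "EX L. \<bar>L\<bar> <= F & has_lap g y L" if "y : ball 0 d" for y
   proof -
    have "x + y : ball x d" using that by (simp add: dist_norm)
    then obtain L where L: "\<bar>L\<bar> <= F" "has_lap f (x + 1 *R y) L" using lap by auto
    have "has_lap g y (c * (1^2 * L))" unfolding g_def[abs_def] by (intro has_lap_cmult has_lap_affine L)
    thus ?thesis using L(1) c by (intro exI[of _ "c * (1^2 * L)"]) (auto simp: abs_mult)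
   qed
   show "\<bar>g y\<bar> <= A" if "y : cball 0 d" for y
    using A[of "x + y"] that c by (auto simp: g_def abs_mult dist_norm)
   have "((%t. f (x + t *R b)) has_real_derivative b \<bullet> D) (at 0)"
    by (rule GDERIV_along) (use der in simp)
   from DERIV_cmult[OF this, of c] show "((%t. g (t *R b)) has_real_derivative c * (b \<bullet> D)) (at 0)"
    by (simp add: g_def)
  qed
 qed
 show ?thesis using gen[of 1] gen[of "-1"] by auto
qed

lemma norm_le_Basis_bound:
 fixes D :: "'a::euclidean_space"
 assumes "!!b. b : Basis ==> \<bar>b \<bullet> D\<bar> <= B"
 shows "norm D <= real DIM('a) * B"
proof -
 have "norm D <= (SUM b:Basis. \<bar>D \<bullet> b\<bar>)" by (rule norm_le_l1)
 also have "... <= (SUM b:(Basis::'a set). B)" using assms by (intro sum_mono) (auto simp: inner_commute)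
 finally show ?thesis by simp
qed

section \<open>Compactly supported \<open>C\<^sup>1\<close> functions and integration by parts\<close>

text \<open>The gradient and a compact set containing the support are carried as data. The class
  stops at C1 because the truncations \<open>trunc\<close> and \<open>cutf\<close> used below are
  not smoother.\<close>

definition C1c :: "('a::euclidean_space => real) => ('a => 'a) => 'a set => bool" where
 "C1c f g K \<longleftrightarrow> compact K & continuous_on UNIV g & (ALL x. GDERIV f x :> g x) & (ALL x. x ~: K --> f x = 0)"

lemma GDERIV_unique: "GDERIV f x :> D ==> GDERIV f x :> E ==> D = (E::'a::euclidean_space)"
 using GDERIV_grad by metis

lemma C1c_grad_zero: assumes "C1c f g K" "x ~: K" shows "g x = 0"
proof -
 have K: "open (- K)" using assms unfolding C1c_def by (simp add: compact_imp_closed open_Compl)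
 have "GDERIV (%y. 0) x :> g x"
  by (rule GDERIV_transform_open[of f x "g x" "- K"]) (use K assms in \<open>auto simp: C1c_def\<close>)
 thus ?thesis using GDERIV_unique[OF _ GDERIV_const] by blast
qed

lemma C1c_cont: "C1c f g K ==> continuous_on S f"
 unfolding C1c_def using GDERIV_continuous continuous_at_imp_continuous_on by blast

lemma C1c_cont_grad: "C1c f g K ==> continuous_on S g"
 unfolding C1c_def using continuous_on_subset by blast

lemma C1c_mult:
 assumes "C1c f g K" "!!x. GDERIV p x :> q x" "continuous_on UNIV q"
 shows "C1c (%x. f x * p x) (%x. f x *R q x + p x *R g x) K"
proof -
 have "continuous_on UNIV p" using assms(2) GDERIV_continuous continuous_at_imp_continuous_on by blast
 thus ?thesis using assms C1c_cont[OF assms(1)] unfolding C1c_def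
  by (auto intro!: continuous_intros GDERIV_mult)
qed

lemma integrable_cont_compact:
 fixes f :: "'a::euclidean_space => 'b::euclidean_space"
 assumes "compact K" "continuous_on K f" "!!x. x ~: K ==> f x = 0"
 shows "integrable lborel f"
proof -
 have "integrable lborel (%x. indicator K x *R f x)" by (rule borel_integrable_compact[OF assms(1,2)])
 moreover have "(%x. indicator K x *R f x) = f" using assms(3) by (auto simp: indicator_def)
 ultimately show ?thesis by simp
qed

lemma cont_borel_measurable: "continuous_on UNIV f ==> f : borel_measurable borel"
 by (rule borel_measurable_continuous_onI)

lemma cont_compact_bounded:
 fixes f :: "'a::euclidean_space => 'b::euclidean_space"
 assumes "compact K" "continuous_on K f" "!!x. x ~: K ==> f x = 0"
 obtains B where "B > 0" "!!x. norm (f x) <= B"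
proof -
 have "bounded (f ` K)" using assms(1,2) compact_continuous_image compact_imp_bounded by blast
 then obtain B where B: "B > 0" "!!x. x : K ==> norm (f x) <= B" unfolding bounded_pos by auto
 hence "norm (f x) <= B" for x using assms(3) by (cases "x : K") auto
 thus thesis using B(1) that by blast
qed

lemma cont_compact_uniform:
 fixes f :: "'a::euclidean_space => 'b::euclidean_space"
 assumes K: "compact K" and f: "continuous_on UNIV f" "!!x. x ~: K ==> f x = 0" and e: "e > 0"
 obtains d where "d > 0" "!!x y. norm (x - y) <= d ==> norm (f x - f y) <= e"
proof -
 obtain R where R: "R > 0" "!!x. x : K ==> norm x <= R" using compact_imp_bounded[OF K] unfolding bounded_pos by auto
 have "uniformly_continuous_on (cball 0 (R + 1)) f"
  by (rule compact_uniformly_continuous[OF continuous_on_subset[OF f(1)]]) auto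
 then obtain d where d: "d > 0" "!!x y. x : cball 0 (R+1) ==> y : cball 0 (R+1) ==> dist y x < d ==> dist (f y) (f x) < e"
  unfolding uniformly_continuous_on_def using e by metis
 have "norm (f x - f y) <= e" if n: "norm (x - y) <= min (d/2) (1/2)" for x y
 proof (cases "x : K | y : K")
  case True
  have "norm x <= norm y + norm (x - y)" "norm y <= norm x + norm (x - y)"
   using norm_triangle_sub[of x y] norm_triangle_sub[of y x] by (auto simp: norm_minus_commute)
  hence "x : cball 0 (R+1)" "y : cball 0 (R+1)" using True R(2)[of x] R(2)[of y] n by auto
  moreover have "dist y x < d" using n d(1) by (auto simp: dist_norm norm_minus_commute)
  ultimately show ?thesis using d(2) by (metis dist_norm less_imp_le norm_minus_commute)
 next
  case False
  thus ?thesis using f(2) e by auto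
 qed
 thus thesis using d(1) by (intro that[of "min (d/2) (1/2)"]) auto
qed

lemma GDERIV_lipschitz:
 fixes f :: "'a::euclidean_space => real"
 assumes "convex S" "!!x. x : S ==> GDERIV f x :> g x" "!!x. x : S ==> norm (g x) <= B" "x : S" "y : S"
 shows "\<bar>f x - f y\<bar> <= B * norm (x - y)"
proof -
 have "norm (f x - f y) <= B * norm (x - y)"
 proof (rule differentiable_bound[OF assms(1), of f "%x h. h \<bullet> g x"])
  show "(f has_derivative (%h. h \<bullet> g x)) (at x within S)" if "x : S" for x
   using assms(2)[OF that] unfolding gderiv_def by (rule has_derivative_at_withinI)
  show "onorm (%h. h \<bullet> g x) <= B" if "x : S" for x
  proof (rule onorm_bound)
   show "0 <= B" using assms(3)[OF that] norm_ge_zero order_trans by blast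
   show "norm (h \<bullet> g x) <= B * norm h" for h
    using Cauchy_Schwarz_ineq2[of h "g x"] assms(3)[OF that] mult_left_mono[of "norm (g x)" B "norm h"]
    by (simp add: mult.commute)
  qed
 qed (use assms in auto)
 thus ?thesis by simp
qed

lemma lborel_integral_affine:
 fixes f :: "'a::euclidean_space => 'b::euclidean_space"
 assumes f: "f : borel_measurable borel" and k: "k ~= 0"
 shows "integral\<^sup>L lborel f = \<bar>k\<bar>^DIM('a) *R (LBINT x. f (c + k *R x))"
proof -
 have m: "(%x. c + k *R x) : borel_measurable borel"
  by (intro cont_borel_measurable continuous_intros)
 have "integral\<^sup>L lborel f = integral\<^sup>L (density (distr lborel borel (%x. c + k *R x)) (%_. \<bar>k\<bar>^DIM('a))) f"
  using lborel_affine[OF k, of c] by simp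
 also have "... = integral\<^sup>L (distr lborel borel (%x. c + k *R x)) (%x. \<bar>k\<bar>^DIM('a) *R f x)"
  by (subst integral_density[symmetric]) (use f in \<open>auto simp: ennreal_power\<close>)
 also have "... = (LBINT x. \<bar>k\<bar>^DIM('a) *R f (c + k *R x))"
  by (rule integral_distr) (use f m in auto)
 finally show ?thesis by simp
qed

lemma lborel_nn_integral_affine:
 fixes f :: "'a::euclidean_space => ennreal"
 assumes f: "f : borel_measurable borel" and k: "k > 0"
 shows "integral\<^sup>N lborel f = ennreal (k^DIM('a)) * (\<integral>\<^sup>+x. f (c + k *R x) \<partial>lborel)"
proof -
 have m: "(%x. c + k *R x) : borel_measurable borel"
  by (intro cont_borel_measurable continuous_intros)
 have fm: "(%x. f (c + k *R x)) : borel_measurable borel"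
  by (rule measurable_compose[OF m f])
 have "integral\<^sup>N lborel f = integral\<^sup>N (density (distr lborel borel (%x. c + k *R x)) (%_. \<bar>k\<bar>^DIM('a))) f"
  using lborel_affine[of k c] k by simp
 also have "... = integral\<^sup>N (distr lborel borel (%x. c + k *R x)) (%x. ennreal (\<bar>k\<bar>^DIM('a)) * f x)"
  by (subst nn_integral_density) (use f in \<open>auto simp: ennreal_power\<close>)
 also have "... = (\<integral>\<^sup>+x. ennreal (\<bar>k\<bar>^DIM('a)) * f (c + k *R x) \<partial>lborel)"
  by (rule nn_integral_distr) (use f m in auto)
 also have "... = ennreal (k^DIM('a)) * (\<integral>\<^sup>+x. f (c + k *R x) \<partial>lborel)"
  using k fm by (subst nn_integral_cmult) auto
 finally show ?thesis .
qed

lemma lborel_integral_translate: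
 fixes f :: "'a::euclidean_space => 'b::euclidean_space"
 assumes "f : borel_measurable borel"
 shows "(LBINT x. f (x + c)) = integral\<^sup>L lborel f"
 using lborel_integral_affine[OF assms, of 1 c] by (simp add: add.commute)

lemma lborel_integral_reflect:
 fixes f :: "'a::euclidean_space => 'b::euclidean_space"
 assumes "f : borel_measurable borel"
 shows "(LBINT x. f (c - x)) = integral\<^sup>L lborel f"
 using lborel_integral_affine[OF assms, of "-1" c] by simp

text \<open>Difference quotients of \<open>f\<close> integrate to zero by translation invariance.\<close>
lemma integral_grad_zero:
 assumes fg: "C1c f g K"
 shows "(LBINT x. h \<bullet> g x) = 0"
proof -
 have K: "compact K" using fg by (simp add: C1c_def)
 \<comment> \<open>Contains the supports of all difference quotients \<open>q n\<close>, since
   \<open>t n <= 1\<close>; the dominating function lives on it.\<close>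
 define K' where "K' = (%(x, s). x - s *R h) ` (K \<times> {0..1::real})"
 have "compact K'" unfolding K'_def
  by (rule compact_continuous_image) (auto intro!: continuous_intros compact_Times K simp: case_prod_beta)
 have K'I: "x : K'" if "x + s *R h : K" "0 <= s" "s <= 1" for x s
  unfolding K'_def using that by (intro image_eqI[of _ _ "(x + s *R h, s)"]) auto
 obtain B where B: "B > 0" "!!x. norm (g x) <= B"
  using cont_compact_bounded[OF K C1c_cont_grad[OF fg] C1c_grad_zero[OF fg]] by blast
 define t where "t n = 1 / real (Suc n)" for n
 have t: "0 < t n" "t n <= 1" for n by (auto simp: t_def)
 have t0: "t ----> 0" unfolding t_def by (rule LIMSEQ_Suc[OF lim_1_over_n])
 define q where "q n x = (f (x + t n *R h) - f x) / t n" for n x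
 have fm: "f : borel_measurable borel" using C1c_cont[OF fg] by (intro cont_borel_measurable)
 have fi: "integrable lborel f"
  by (rule integrable_cont_compact[OF K C1c_cont[OF fg]]) (use fg in \<open>auto simp: C1c_def\<close>)
 have fi2: "integrable lborel (%x. f (x + c))" for c
 proof -
  have "compact ((%x. x - c) ` K)" by (intro compact_continuous_image continuous_intros K)
  moreover have "x : (%x. x - c) ` K" if "x + c : K" for x
   using that by (intro image_eqI[of _ _ "x + c"]) auto
  moreover have "f x = 0" if "x ~: K" for x using fg that by (auto simp: C1c_def)
  ultimately show ?thesis
   by (intro integrable_cont_compact[of "(%x. x - c) ` K"] continuous_on_compose2[OF C1c_cont[OF fg, of UNIV]])
    (auto intro!: continuous_intros)
 qed
 have int0: "integral\<^sup>L lborel (q n) = 0" for n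
  unfolding q_def[abs_def] using fi fi2[of "t n *R h"] lborel_integral_translate[OF fm, of "t n *R h"] by simp
 have qm: "q n : borel_measurable lborel" for n
  unfolding q_def[abs_def] using fi fi2[of "t n *R h"] by (auto dest!: borel_measurable_integrable)
 have lim: "(%n. integral\<^sup>L lborel (q n)) ----> (LBINT x. h \<bullet> g x)"
 proof (rule integral_dominated_convergence[where w="%x. indicator K' x *R (B * norm h)"])
  show "(%x. h \<bullet> g x) : borel_measurable lborel"
   using C1c_cont_grad[OF fg, of UNIV] by (auto intro!: cont_borel_measurable continuous_intros)
  show "integrable lborel (%x. indicator K' x *R (B * norm h))"
   by (rule borel_integrable_compact[OF \<open>compact K'\<close>]) auto
  show "AE x in lborel. (%n. q n x) ----> h \<bullet> g x"
  proof (rule AE_I2)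
   fix x
   have "((%ta. f (x + ta *R h)) has_real_derivative h \<bullet> g x) (at 0)"
    by (rule GDERIV_along) (use fg in \<open>auto simp: C1c_def\<close>)
   hence "((%y. (f (x + (0 + y) *R h) - f (x + 0 *R h)) / y) \<longlongrightarrow> h \<bullet> g x) (at 0)"
    unfolding DERIV_def .
   moreover have "filterlim t (at 0) sequentially"
    unfolding filterlim_at using t0 t(1) by (auto simp: less_imp_neq[symmetric])
   ultimately have "((%n. (f (x + (0 + t n) *R h) - f (x + 0 *R h)) / t n) ----> h \<bullet> g x)"
    by (rule filterlim_compose)
   thus "(%n. q n x) ----> h \<bullet> g x" by (simp add: q_def)
  qed
  show "AE x in lborel. norm (q n x) <= indicator K' x *R (B * norm h)" for n
  proof (rule AE_I2)
   fix x
   have "\<bar>f (x + t n *R h) - f x\<bar> <= B * norm (x + t n *R h - x)"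
    by (rule GDERIV_lipschitz[of UNIV f g]) (use fg B in \<open>auto simp: C1c_def\<close>)
   hence 1: "norm (q n x) <= B * norm h" unfolding q_def using t(1)[of n] by (simp add: field_simps)
   show "norm (q n x) <= indicator K' x *R (B * norm h)"
   proof (cases "x : K'")
    case False
    hence "x + t n *R h ~: K" "x + 0 *R h ~: K" using K'I[of x "t n"] K'I[of x 0] t by (auto simp: less_imp_le)
    hence "q n x = 0" unfolding q_def using fg by (auto simp: C1c_def)
    thus ?thesis using False by simp
   qed (use 1 in simp)
  qed
 qed (use qm in auto)
 thus ?thesis unfolding int0 using LIMSEQ_unique[OF tendsto_const] by metis
qed

section \<open>Products with compactly supported functions, integration by parts, Green's
  identity\<close>

lemma C1c_integrable:
 assumes "C1c f g K" "continuous_on K (p :: 'a::euclidean_space => real)"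
 shows "integrable lborel (%x. f x * p x)"
 by (rule integrable_cont_compact[of K]) (use assms C1c_cont[OF assms(1)] in \<open>auto simp: C1c_def intro!: continuous_intros\<close>)

lemma C1c_integrable_grad:
 assumes "C1c f g K" "continuous_on K (p :: 'a::euclidean_space => 'a)"
 shows "integrable lborel (%x. g x \<bullet> p x)"
 by (rule integrable_cont_compact[of K])
  (use assms C1c_grad_zero[OF assms(1)] C1c_cont_grad[OF assms(1)] in \<open>auto simp: C1c_def intro!: continuous_intros\<close>)

text \<open>The factor \<open>p\<close> is controlled on \<open>U\<close> alone. Off
  \<open>K\<close> the product vanishes identically, and the open sets \<open>U\<close> and
  \<open>- K\<close> cover the space, so the gradient can be pieced together.\<close>

lemma C1c_mult_local:
 assumes f: "C1c f g K" and U: "open U" "K <= U" and p: "!!x. x : U ==> GDERIV p x :> q x" "continuous_on U q"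
 shows "C1c (%x. f x * p x) (%x. if x : K then f x *R q x + p x *R g x else 0) K"
proof -
 have K: "compact K" "closed K" using f by (auto simp: C1c_def compact_imp_closed)
 let ?G = "%x. if x : K then f x *R q x + p x *R g x else 0"
 have cp: "continuous_on U p" using p(1) GDERIV_continuous continuous_at_imp_continuous_on by blast
 have G: "?G x = f x *R q x + p x *R g x" for x
  using f C1c_grad_zero[OF f] by (auto simp: C1c_def)
 have "GDERIV (%x. f x * p x) x :> ?G x" for x
 proof (cases "x : U")
  case True
  thus ?thesis unfolding G by (intro GDERIV_mult p(1)) (use f in \<open>auto simp: C1c_def\<close>)
 next
  case False
  have "GDERIV (%x. f x * p x) x :> 0"
   by (rule GDERIV_transform_open[OF GDERIV_const[of 0], of "- K"]) (use K False U f in \<open>auto simp: C1c_def\<close>)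
  thus ?thesis using False U by auto
 qed
 moreover have "continuous_on UNIV ?G"
 proof -
  have "continuous_on U ?G" unfolding G by (intro continuous_intros C1c_cont[OF f] C1c_cont_grad[OF f] cp p(2))
  moreover have "continuous_on (- K) ?G" by (rule continuous_on_eq[of _ "%x. 0"]) auto
  ultimately have "continuous_on (U Un - K) ?G" using U(1) K(2) by (intro continuous_on_open_Un) auto
  moreover have "U Un - K = UNIV" using U by auto
  ultimately show ?thesis by simp
 qed
 ultimately show ?thesis using f by (auto simp: C1c_def)
qed

text \<open>The product \<open>f * p\<close> is compactly supported and C1, so its directional
  derivative integrates to zero.\<close>

lemma integration_by_parts:
 assumes f: "C1c f g K" and U: "open U" "K <= U" and p: "!!x. x : U ==> GDERIV p x :> q x" "continuous_on U q"
 shows "(LBINT x. f x * (h \<bullet> q x)) = - (LBINT x. p x * (h \<bullet> g x))"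
proof -
 have cp: "continuous_on U p" using p(1) GDERIV_continuous continuous_at_imp_continuous_on by blast
 have K: "compact K" "closed K" using f by (auto simp: C1c_def compact_imp_closed)
 have z: "(if x : K then f x *R q x + p x *R g x else 0) = f x *R q x + p x *R g x" for x
  using f C1c_grad_zero[OF f] by (auto simp: C1c_def)
 have i1: "integrable lborel (%x. f x * (h \<bullet> q x))"
  by (rule C1c_integrable[OF f]) (intro continuous_intros continuous_on_subset[OF p(2) U(2)])
 have i2: "integrable lborel (%x. p x * (h \<bullet> g x))"
  by (rule integrable_cont_compact[OF K(1)])
   (use C1c_grad_zero[OF f] in \<open>auto intro!: continuous_intros C1c_cont_grad[OF f] continuous_on_subset[OF cp U(2)]\<close>)
 have "(LBINT x. h \<bullet> (f x *R q x + p x *R g x)) = 0"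
  using integral_grad_zero[OF C1c_mult_local[OF f U p], of h] unfolding z .
 hence "(LBINT x. f x * (h \<bullet> q x) + p x * (h \<bullet> g x)) = 0" by (simp add: inner_add_right)
 thus ?thesis using i1 i2 by simp
qed

text \<open>Integration by parts in each coordinate, applied to \<open>pd b u\<close>; the minus
  sign goes into the convention for \<open>lap\<close>.\<close>

lemma green_identity:
 assumes f: "C1c f g K" and U: "open U" "K <= U" and u: "Ck (Suc (Suc 0)) U u"
 shows "(LBINT x. g x \<bullet> grad u x) = (LBINT x. f x * lap u x)"
proof -
 have K: "compact K" using f by (auto simp: C1c_def)
 have u2: "GDERIV (pd b u) x :> grad (pd b u) x" "continuous_on U (grad (pd b u))"
   if "b : Basis" "x : U" for b x
 proof -
  show "GDERIV (pd b u) x :> grad (pd b u) x" using u that by (auto intro!: differentiable_GDERIV)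
  show "continuous_on U (grad (pd b u))" unfolding grad_eq_sum_pd[abs_def]
   using u that by (intro continuous_intros) auto
 qed
 have cg: "continuous_on U (pd b u)" if "b : Basis" for b using u that by auto
 have "(LBINT x. g x \<bullet> grad u x) = (LBINT x. (SUM b:Basis. pd b u x * (b \<bullet> g x)))"
  by (intro Bochner_Integration.integral_cong refl) (simp add: grad_eq_sum_pd inner_sum_right inner_commute)
 also have "... = (SUM b:Basis. LBINT x. pd b u x * (b \<bullet> g x))"
  by (rule Bochner_Integration.integral_sum, rule integrable_cont_compact[OF K])
   (use C1c_grad_zero[OF f] in \<open>auto intro!: continuous_intros C1c_cont_grad[OF f] continuous_on_subset[OF cg U(2)]\<close>)
 also have "... = (SUM b:Basis. LBINT x. f x * (- pd b (pd b u) x))"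
 proof (rule sum.cong[OF refl])
  fix b :: 'a assume b: "b : Basis"
  show "(LBINT x. pd b u x * (b \<bullet> g x)) = (LBINT x. f x * (- pd b (pd b u) x))"
  proof (cases "U = {}")
   case True
   hence "K = {}" using U by auto
   hence "f x = 0" "g x = 0" for x using f C1c_grad_zero[OF f] by (auto simp: C1c_def)
   thus ?thesis by simp
  next
   case False
   thus ?thesis using integration_by_parts[OF f U u2(1)[OF b] u2(2)[OF b], of _ b] b
    by (auto simp: inner_grad_pd)
  qed
 qed
 also have "... = (LBINT x. (SUM b:Basis. f x * (- pd b (pd b u) x)))"
 proof (rule Bochner_Integration.integral_sum[symmetric], rule C1c_integrable[OF f])
  fix b :: 'a assume "b : Basis"
  hence "continuous_on U (pd b (pd b u))" using u by auto
  thus "continuous_on K (%x. - pd b (pd b u) x)" by (intro continuous_intros continuous_on_subset[OF _ U(2)])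
 qed
 also have "... = (LBINT x. f x * lap u x)"
  by (intro Bochner_Integration.integral_cong refl) (simp add: lap_def sum_distrib_left sum_negf)
 finally show ?thesis .
qed

section \<open>Mollification\<close>

text \<open>Differentiation turns index \<open>m\<close> into a combination of \<open>m + 1\<close>
  and \<open>m + 2\<close>, so all indices are kept together; the bump itself has
  \<open>m = 0\<close>.\<close>

definition flat_exp :: "nat => real => real" where
 "flat_exp m t = (if t <= 0 then 0 else inverse t ^ m * exp (- inverse t))"

text \<open>With \<open>y = 1 / t\<close> and \<open>k = m + 2\<close>, raising
  \<open>y / k <= exp (y / k)\<close> to the power \<open>k\<close> shows that the exponential beats
  \<open>y ^ (m + 2)\<close>. Vanishing to second order gives derivative 0 at the origin.\<close>

lemma flat_exp_bound: "\<bar>flat_exp m t\<bar> <= real (m + 2) ^ (m + 2) * t^2"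
proof (cases "t <= 0")
 case False
 define y where "y = inverse t"
 have y: "y > 0" "t = inverse y" using False by (auto simp: y_def)
 define k where "k = m + 2"
 have k0: "real k > 0" by (simp add: k_def)
 have "y / k <= exp (y / k)" using exp_ge_add_one_self[of "y / k"] by linarith
 hence "(y / k) ^ k <= exp (y / k) ^ k" using y by (intro power_mono) auto
 also have "... = exp (real k * (y / k))" by (rule exp_of_nat_mult[symmetric])
 also have "... = exp y" using k0 by simp
 finally have "y ^ k <= real k ^ k * exp y" using k0 by (simp add: power_divide field_simps)
 hence "y ^ k * exp (- y) <= real k ^ k" by (simp add: exp_minus field_simps)
 hence "y ^ m * y^2 * exp (- y) <= real k ^ k" by (simp add: k_def power2_eq_square ac_simps)
 hence "y ^ m * exp (- y) <= real k ^ k * (inverse y)^2" using y by (simp add: field_simps)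
 thus ?thesis using False y by (simp add: flat_exp_def k_def)
qed (simp add: flat_exp_def)

lemma flat_exp_deriv:
 "(flat_exp m has_real_derivative (- real m * flat_exp (m + 1) t + 1 * flat_exp (m + 2) t)) (at t)"
proof -
 consider "t < 0" | "t > 0" | "t = 0" by linarith
 thus ?thesis
 proof cases
  case 1
  have "((%t::real. 0::real) has_real_derivative 0) (at t)" by simp
  hence "(flat_exp m has_real_derivative 0) (at t)"
   by (rule has_field_derivative_transform_within_open[of _ _ _ "{..<0}"]) (use 1 in \<open>auto simp: flat_exp_def\<close>)
  thus ?thesis using 1 by (simp add: flat_exp_def)
 next
  case 2
  have "((%t. inverse t ^ m * exp (- inverse t)) has_real_derivative
    (- real m * (inverse t ^ (m + 1) * exp (- inverse t)) + 1 * (inverse t ^ (m + 2) * exp (- inverse t)))) (at t)"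
  proof -
   have p: "((%t. inverse t ^ m) has_real_derivative (- real m * inverse t ^ (m + 1))) (at t)"
    using 2 DERIV_power[OF DERIV_inverse[of t UNIV], of m] by (cases m) (auto simp: algebra_simps)
   have e: "((%t. exp (- inverse t)) has_real_derivative (inverse t ^ 2 * exp (- inverse t))) (at t)"
    using 2 by (auto intro!: derivative_eq_intros simp: power2_eq_square)
   show ?thesis using DERIV_mult[OF p e] by (simp add: algebra_simps power_add power2_eq_square)
  qed
  hence "(flat_exp m has_real_derivative
    (- real m * (inverse t ^ (m + 1) * exp (- inverse t)) + 1 * (inverse t ^ (m + 2) * exp (- inverse t)))) (at t)"
   by (rule has_field_derivative_transform_within_open[of _ _ _ "{0<..}"]) (use 2 in \<open>auto simp: flat_exp_def\<close>)
  thus ?thesis using 2 by (simp add: flat_exp_def)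
 next
  case 3
  define C where "C = real (m + 2) ^ (m + 2)"
  have "((%h. flat_exp m h / h) \<longlongrightarrow> 0) (at 0)"
  proof (rule Lim_null_comparison)
   show "\<forall>\<^sub>F h in at 0. norm (flat_exp m h / h) <= C * \<bar>h\<bar>"
    unfolding eventually_at
   proof (intro exI[of _ 1] conjI ballI impI)
    fix h :: real assume h: "h ~= 0 & dist h 0 < 1"
    have "\<bar>flat_exp m h\<bar> <= C * (\<bar>h\<bar> * \<bar>h\<bar>)"
     using flat_exp_bound[of m h] by (simp add: C_def power2_eq_square)
    hence "\<bar>flat_exp m h\<bar> / \<bar>h\<bar> <= C * \<bar>h\<bar>" using h by (simp add: pos_divide_le_eq)
    thus "norm (flat_exp m h / h) <= C * \<bar>h\<bar>" by simp
   qed simp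
   show "((%h. C * \<bar>h\<bar>) \<longlongrightarrow> 0) (at 0)" by (auto intro!: tendsto_eq_intros)
  qed
  thus ?thesis using 3 by (simp add: DERIV_def flat_exp_def)
 qed
qed

definition bump :: "'a::euclidean_space => real" where
 "bump x = flat_exp 0 (1 - (norm x)^2)"

lemma bump_Ck: "Ck k UNIV (bump :: 'a::euclidean_space => real)"
proof -
 have "Ck k UNIV (%x::'a. (-1) * (norm x)^2 + 1)" for k
  by (intro Ck_add Ck_mult Ck_const Ck_norm2) auto
 hence w: "Ck k UNIV (%x::'a. 1 - (norm x)^2)" for k by simp
 show ?thesis unfolding bump_def[abs_def]
  by (rule Ck_compose_family[OF open_UNIV w, where h=flat_exp and i=0]) (rule flat_exp_deriv)
qed

lemma bump_pos: "norm x < 1 ==> bump x > 0"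
proof -
 assume "norm x < 1"
 hence "(norm x)^2 < 1" using norm_ge_zero[of x] by (simp add: power_less_one_iff)
 thus ?thesis by (simp add: bump_def flat_exp_def)
qed

lemma bump_nonneg: "bump x >= 0" by (simp add: bump_def flat_exp_def)

lemma bump_zero: "x ~: cball 0 1 ==> bump x = 0"
 by (simp add: bump_def flat_exp_def)

lemma Ck1_C1c:
 assumes "Ck (Suc 0) UNIV f" "compact K" "!!x. x ~: K ==> f x = 0"
 shows "C1c f (grad f) K"
proof -
 have "continuous_on UNIV (grad f)" unfolding grad_eq_sum_pd[abs_def]
  using assms(1) by (intro continuous_intros) auto
 thus ?thesis using assms by (auto simp: C1c_def intro!: differentiable_GDERIV)
qed

definition moll :: "real => 'a::euclidean_space => real" where
 "moll d x = bump (x /\<^sub>R d) / (d^DIM('a) * integral\<^sup>L lborel (bump :: 'a => real))"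

lemma bump_cont: "continuous_on S bump" using Ck_continuous[OF bump_Ck[of 0]] continuous_on_subset by blast

text \<open>A nonnegative function with zero integral vanishes almost everywhere, but the open unit
  ball, where \<open>bump\<close> is positive, is not negligible.\<close>

lemma bump_integral_pos: "integral\<^sup>L lborel (bump :: 'a::euclidean_space => real) > 0"
proof -
 have i: "integrable lborel (bump :: 'a => real)"
  by (rule integrable_cont_compact[of "cball 0 1"]) (auto intro: bump_cont bump_zero)
 have "integral\<^sup>L lborel (bump :: 'a => real) >= 0" by (rule integral_nonneg_AE) (auto intro: bump_nonneg)
 moreover have "integral\<^sup>L lborel (bump :: 'a => real) ~= 0"
 proof
  assume "integral\<^sup>L lborel (bump :: 'a => real) = 0"
  hence ae: "AE x in lborel. bump (x::'a) = 0"
   using integral_nonneg_eq_0_iff_AE[OF i] bump_nonneg by auto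
  have s: "{x : space lborel. bump (x::'a) ~= 0} : sets lborel"
   by (auto intro!: borel_open open_Collect_neq bump_cont continuous_intros)
  have "{x : space lborel. bump (x::'a) ~= 0} : null_sets lborel"
   using ae s by (simp add: AE_iff_null)
  hence "negligible {x : space lborel. bump (x::'a) ~= 0}"
   by (simp add: negligible_iff_null_sets null_sets_completionI)
  hence "negligible (ball (0::'a) 1)"
   by (rule negligible_subset) (use bump_pos in force)
  thus False using open_not_negligible[of "ball (0::'a) 1"] by simp
 qed
 ultimately show ?thesis by linarith
qed

lemma moll_Ck: "d > 0 ==> Ck k UNIV (moll d :: 'a::euclidean_space => real)"
proof -
 assume d: "d > 0"
 have gen: "Ck k UNIV (%x::'a. f (x /\<^sub>R d))" if "Ck k UNIV f" for f k
  using that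
 proof (induction k arbitrary: f)
  case 0
  thus ?case by (auto intro!: continuous_on_compose2[of UNIV f] continuous_intros)
 next
  case (Suc k)
  show ?case
  proof (rule Ck_Suc_I[OF open_UNIV])
   show "GDERIV (%x. f (x /\<^sub>R d)) x :> (1/d) *R grad f (x /\<^sub>R d)" for x
    using GDERIV_affine[of f 0 "1/d" x] Ck_GDERIV[OF Suc.prems] by (simp add: inverse_eq_divide)
   show "Ck k UNIV (%x. b \<bullet> ((1/d) *R grad f (x /\<^sub>R d)))" if b: "b : Basis" for b
   proof -
    have "Ck k UNIV (%x. (1/d) * pd b f (x /\<^sub>R d))"
     using Suc.prems b by (intro Ck_mult Ck_const Suc.IH) auto
    thus ?thesis using b by (simp add: inner_grad_pd)
   qed
  qed
 qed
 have "Ck k UNIV (%x::'a. (1 / (d^DIM('a) * integral\<^sup>L lborel (bump :: 'a => real))) * bump (x /\<^sub>R d))"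
  by (intro Ck_mult Ck_const gen[OF bump_Ck]) auto
 thus ?thesis by (simp add: moll_def[abs_def])
qed

lemma moll_nonneg: "d > 0 ==> moll d x >= 0"
 unfolding moll_def using bump_integral_pos[where 'a='a] by (auto intro!: divide_nonneg_nonneg mult_nonneg_nonneg bump_nonneg)

lemma moll_zero: "d > 0 ==> x ~: cball 0 d ==> moll d x = 0"
 unfolding moll_def by (simp add: bump_zero field_simps)

lemma moll_C1c: "d > 0 ==> C1c (moll d :: 'a::euclidean_space => real) (grad (moll d)) (cball 0 d)"
 by (rule Ck1_C1c[OF moll_Ck]) (auto intro: moll_zero)

lemma moll_cont: "d > 0 ==> continuous_on S (moll d)"
 using C1c_cont[OF moll_C1c] .

lemma moll_integral: 
 assumes d: "d > 0" shows "integral\<^sup>L lborel (moll d :: 'a::euclidean_space => real) = 1"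
proof -
 have m: "(moll d :: 'a => real) : borel_measurable borel" by (intro cont_borel_measurable moll_cont d)
 have "integral\<^sup>L lborel (moll d :: 'a => real) = d^DIM('a) * (LBINT x. moll d (d *R (x::'a)))"
  using lborel_integral_affine[OF m, of d 0] d by simp
 also have "... = d^DIM('a) * (integral\<^sup>L lborel (bump :: 'a => real) / (d^DIM('a) * integral\<^sup>L lborel (bump :: 'a => real)))"
  using d by (simp add: moll_def)
 also have "... = 1" using d bump_integral_pos[where 'a='a] by simp
 finally show ?thesis .
qed

section \<open>Convolution with compactly supported kernels\<close>

definition conv :: "('a::euclidean_space => real) => ('a => real) => 'a => real" where
 "conv f k x = (LBINT y. f y * k (x - y))"

lemma integrable_conv:
 fixes k :: "'a::euclidean_space => 'b::euclidean_space"
 assumes f: "integrable lborel f" and k: "continuous_on UNIV k" "compact K" "!!x. x ~: K ==> k x = 0"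
 shows "integrable lborel (%y. f y *R k (x - y))"
proof -
 obtain B where B: "B > 0" "!!x. norm (k x) <= B"
  using cont_compact_bounded[OF k(2) continuous_on_subset[OF k(1)] k(3)] by blast
 have m: "(%y. k (x - y)) : borel_measurable lborel"
  using k(1) by (auto intro!: cont_borel_measurable continuous_on_compose2[OF k(1)] continuous_intros)
 show ?thesis
 proof (rule Bochner_Integration.integrable_bound[of _ "%y. B * norm (f y)"])
  show "integrable lborel (%y. B * norm (f y))" using f by auto
  show "(%y. f y *R k (x - y)) : borel_measurable lborel"
   using m borel_measurable_integrable[OF f] by measurable
  show "AE y in lborel. norm (f y *R k (x - y)) <= norm (B * norm (f y))"
   using B by (auto simp: mult.commute[of B] intro!: mult_left_mono)
 qed
qed

lemma conv_continuous:
 assumes f: "integrable lborel f" and k: "continuous_on UNIV k" "compact K" "!!x. x ~: K ==> k x = 0"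
 shows "continuous_on UNIV (conv f k)"
proof (clarsimp simp: continuous_on_iff)
 fix x and e :: real assume e: "e > 0"
 define I where "I = (LBINT y. \<bar>f y\<bar>) + 1"
 have I: "I > 0" unfolding I_def by (simp add: add_nonneg_pos)
 obtain d where d: "d > 0" "!!x y. norm (x - y) <= d ==> norm (k x - k y) <= e / (2 * I)"
  using cont_compact_uniform[OF k(2,1,3), of "e / (2 * I)"] e I by auto
 have i: "integrable lborel (%y. f y * k (x - y))" for x using integrable_conv[OF f k, of x] by simp
 have "dist (conv f k x') (conv f k x) < e" if "dist x' x < d" for x'
 proof -
  have "conv f k x' - conv f k x = (LBINT y. f y * (k (x' - y) - k (x - y)))"
   unfolding conv_def using i[of x'] i[of x] by (simp add: algebra_simps)
  also have "\<bar>...\<bar> <= (LBINT y. \<bar>f y\<bar> * (e / (2 * I)))"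
  proof (rule order_trans[OF integral_abs_bound], rule integral_mono)
   show "integrable lborel (%y. \<bar>f y * (k (x' - y) - k (x - y))\<bar>)"
    using i[of x'] i[of x] by (simp add: algebra_simps)
   show "\<bar>f y * (k (x' - y) - k (x - y))\<bar> <= \<bar>f y\<bar> * (e / (2 * I))" for y
    using d(2)[of "x' - y" "x - y"] that unfolding abs_mult by (intro mult_left_mono) (auto simp: dist_norm)
  qed (use f in auto)
  also have "... = (I - 1) * (e / (2 * I))" by (simp add: I_def)
  also have "... < e" using I e by (simp add: field_simps add_pos_pos)
  finally show ?thesis by (simp add: dist_norm)
 qed
 thus "EX d>0. ALL x'. dist x' x < d --> dist (conv f k x') (conv f k x) < e" using d(1) by blast
qed

text \<open>The derivative falls on the kernel. Uniform continuity of \<open>g\<close> makes the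
  first-order remainder of \<open>k\<close> at most \<open>e / I\<close> times the increment at
  every point, and integrating against \<open>f\<close> leaves at most \<open>e\<close> times the
  increment.\<close>

lemma conv_GDERIV:
 assumes f: "integrable lborel f" and k: "C1c k g K"
 shows "GDERIV (conv f k) x :> (LBINT y. f y *R g (x - y))"
proof -
 have K: "compact K" "!!x. x ~: K ==> k x = 0" using k by (auto simp: C1c_def)
 let ?D = "LBINT y. f y *R g (x - y)"
 define I where "I = (LBINT y. \<bar>f y\<bar>) + 1"
 have I: "I > 0" unfolding I_def by (simp add: add_nonneg_pos)
 have i: "integrable lborel (%y. f y * k (x - y))" for x
  using integrable_conv[OF f C1c_cont[OF k] K, of x] by simp
 have j: "integrable lborel (%y. f y *R g (x - y))"
  by (rule integrable_conv[OF f C1c_cont_grad[OF k] K(1) C1c_grad_zero[OF k]])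
 have "EX d>0. ALL y. norm (y - x) < d --> norm (conv f k y - conv f k x - (y - x) \<bullet> ?D) <= e * norm (y - x)"
  if e: "e > 0" for e
 proof -
  obtain d where d: "d > 0" "!!x y. norm (x - y) <= d ==> norm (g x - g y) <= e / I"
   using cont_compact_uniform[OF K(1) C1c_cont_grad[OF k] C1c_grad_zero[OF k], of "e / I"] e I by auto
  have "norm (conv f k y - conv f k x - (y - x) \<bullet> ?D) <= e * norm (y - x)" if y: "norm (y - x) < d" for y
  proof -
   let ?h = "y - x"
   have pt: "\<bar>k (y - z) - k (x - z) - ?h \<bullet> g (x - z)\<bar> <= (e / I) * norm ?h" for z
   proof -
    define q where "q w = k w - (w - (x - z)) \<bullet> g (x - z)" for w
    have "\<bar>q (y - z) - q (x - z)\<bar> <= (e / I) * norm ((y - z) - (x - z))"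
    proof (rule GDERIV_lipschitz[of "cball (x - z) d" q "%w. g w - g (x - z)"])
     show "GDERIV q w :> g w - g (x - z)" for w
     proof -
      have "GDERIV (%w. (w - (x - z)) \<bullet> g (x - z)) w :> g (x - z)"
       unfolding gderiv_def by (auto intro!: derivative_eq_intros)
      thus ?thesis unfolding q_def[abs_def] using k by (intro GDERIV_diff) (auto simp: C1c_def)
     qed
     show "norm (g w - g (x - z)) <= e / I" if "w : cball (x - z) d" for w
      using d(2)[of w "x - z"] that by (simp add: dist_norm norm_minus_commute)
    qed (use y d(1) in \<open>auto simp: dist_norm norm_minus_commute\<close>)
    thus ?thesis by (simp add: q_def)
   qed
   have "?h \<bullet> ?D = (LBINT z. f z * (?h \<bullet> g (x - z)))"
    using integral_inner_right[of ?h lborel "%z. f z *R g (x - z)"] j by simp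
   moreover have j2: "integrable lborel (%z. f z * (?h \<bullet> g (x - z)))"
    using integrable_inner_right[of ?h lborel "%z. f z *R g (x - z)"] j by simp
   ultimately have "conv f k y - conv f k x - ?h \<bullet> ?D
     = (LBINT z. f z * (k (y - z) - k (x - z) - ?h \<bullet> g (x - z)))"
    unfolding conv_def using i[of y] i[of x] j2 by (simp add: right_diff_distrib)
   also have "\<bar>...\<bar> <= (LBINT z. \<bar>f z\<bar> * ((e / I) * norm ?h))"
   proof (rule order_trans[OF integral_abs_bound], rule integral_mono)
    show "integrable lborel (%z. \<bar>f z * (k (y - z) - k (x - z) - ?h \<bullet> g (x - z))\<bar>)"
     using i[of y] i[of x] j2 by (simp add: right_diff_distrib)
    show "\<bar>f z * (k (y - z) - k (x - z) - ?h \<bullet> g (x - z))\<bar> <= \<bar>f z\<bar> * ((e / I) * norm ?h)" for z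
     using pt[of z] unfolding abs_mult by (intro mult_left_mono) auto
   qed (use f in auto)
   also have "... = (I - 1) * ((e / I) * norm ?h)" by (simp add: I_def)
   also have "... <= I * ((e / I) * norm ?h)" using I e by (intro mult_right_mono) auto
   also have "... = e * norm ?h" using I by simp
   finally show ?thesis by simp
  qed
  thus ?thesis using d(1) by blast
 qed
 moreover have "bounded_linear (%h. h \<bullet> ?D)" by (rule bounded_linear_inner_left)
 ultimately show ?thesis unfolding gderiv_def has_derivative_at_alt by (simp add: norm_minus_commute)
qed

lemma pd_compact_support:
 assumes "compact K" "!!x. x ~: K ==> f x = 0" "x ~: K"
 shows "pd b f x = 0"
proof -
 have "GDERIV f x :> 0"
  by (rule GDERIV_transform_open[OF GDERIV_const[of 0], of "- K"]) (use assms compact_imp_closed in auto)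
 thus ?thesis using GDERIV_pd by fastforce
qed

lemma conv_pd:
 assumes f: "integrable lborel f" and k: "Ck (Suc 0) UNIV k" "compact K" "!!x. x ~: K ==> k x = 0" and b: "b : Basis"
 shows "pd b (conv f k) x = conv f (pd b k) x"
proof -
 have c: "C1c k (grad k) K" by (rule Ck1_C1c[OF k])
 have j: "integrable lborel (%y. f y *R grad k (x - y))"
  by (rule integrable_conv[OF f C1c_cont_grad[OF c] k(2) C1c_grad_zero[OF c]])
 have "pd b (conv f k) x = b \<bullet> (LBINT y. f y *R grad k (x - y))" by (rule GDERIV_pd[OF conv_GDERIV[OF f c]])
 also have "... = (LBINT y. f y * (b \<bullet> grad k (x - y)))"
  using integral_inner_right[of b lborel "%z. f z *R grad k (x - z)"] j by simp
 finally show ?thesis using b by (simp add: inner_grad_pd conv_def)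
qed

lemma conv_Ck:
 assumes f: "integrable lborel f" and k: "Ck m UNIV k" "compact K" "!!x. x ~: K ==> k x = 0"
 shows "Ck m UNIV (conv f k)"
 using k(1,3)
proof (induction m arbitrary: k)
 case 0
 thus ?case using conv_continuous[OF f _ k(2)] by simp
next
 case (Suc m)
 have c1: "Ck (Suc 0) UNIV k" by (rule Ck_mono[OF Suc.prems(1)]) simp
 have c: "C1c k (grad k) K" by (rule Ck1_C1c[OF c1 k(2) Suc.prems(2)])
 have "Ck m UNIV (pd b (conv f k))" if b: "b : Basis" for b
 proof -
  have "Ck m UNIV (conv f (pd b k))"
   using Suc.prems b by (intro Suc.IH) (auto intro: pd_compact_support[OF k(2)])
  moreover have "conv f (pd b k) = pd b (conv f k)" using conv_pd[OF f c1 k(2) Suc.prems(2) b] by auto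
  ultimately show ?thesis by simp
 qed
 moreover have "continuous_on UNIV (conv f k)" using conv_continuous[OF f _ k(2) Suc.prems(2)] Suc.prems(1) by simp
 moreover have "conv f k differentiable (at x)" for x using GDERIV_differentiable[OF conv_GDERIV[OF f c]] .
 ultimately show ?case by simp
qed

text \<open>Integration by parts in \<open>y\<close> moves the derivative from the kernel to
  \<open>f\<close>. The derivative of a mollification is thus the mollification of the derivative,
  which gives uniform convergence of gradients.\<close>

lemma conv_grad_swap:
 assumes f: "C1c f g S" and k: "C1c k h K" and b: "b : Basis"
 shows "pd b (conv f k) x = conv (%y. b \<bullet> g y) k x"
proof -
 have S: "compact S" "!!x. x ~: S ==> f x = 0" using f by (auto simp: C1c_def)
 have K: "compact K" "!!x. x ~: K ==> k x = 0" using k by (auto simp: C1c_def)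
 have fi: "integrable lborel f" by (rule integrable_cont_compact[OF S(1) C1c_cont[OF f] S(2)])
 have j: "integrable lborel (%y. f y *R h (x - y))"
  by (rule integrable_conv[OF fi C1c_cont_grad[OF k] K(1) C1c_grad_zero[OF k]])
 have d: "GDERIV (%y. k (x - y)) y :> - h (x - y)" for y
  using GDERIV_affine[of k x "-1" y "h (x - y)"] k by (auto simp: C1c_def)
 have "(LBINT y. f y * (b \<bullet> (- h (x - y)))) = - (LBINT y. k (x - y) * (b \<bullet> g y))"
  by (rule integration_by_parts[OF f open_UNIV _ d])
   (auto intro!: continuous_intros continuous_on_compose2[OF C1c_cont_grad[OF k, of UNIV]])
 hence "(LBINT y. f y * (b \<bullet> h (x - y))) = conv (%y. b \<bullet> g y) k x"
  by (simp add: conv_def mult.commute)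
 moreover have "pd b (conv f k) x = b \<bullet> (LBINT y. f y *R h (x - y))" by (rule GDERIV_pd[OF conv_GDERIV[OF fi k]])
 moreover have "b \<bullet> (LBINT y. f y *R h (x - y)) = (LBINT y. f y * (b \<bullet> h (x - y)))"
  using integral_inner_right[of b lborel "%z. f z *R h (x - z)"] j by simp
 ultimately show ?thesis by simp
qed

text \<open>The kernel is a probability density supported in the ball of radius \<open>d\<close>, so
  the left side is an average of values of \<open>f - c\<close> near \<open>x\<close>.\<close>

lemma conv_moll_approx:
 assumes f: "integrable lborel f" and d: "d > 0" and c: "!!y. y : cball x d ==> \<bar>f y - c\<bar> <= e"
 shows "\<bar>conv f (moll d) x - c\<bar> <= e"
proof -
 have m: "moll d : borel_measurable borel" by (intro cont_borel_measurable moll_cont d)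
 have mi: "integrable lborel (%y. moll d (x - y))"
  by (rule integrable_cont_compact[of "cball x d"])
   (auto intro!: moll_zero d continuous_on_compose2[OF moll_cont[OF d, of UNIV]] continuous_intros simp: dist_norm norm_minus_commute)
 have i: "integrable lborel (%y. f y * moll d (x - y))"
  using integrable_conv[OF f moll_cont[OF d] compact_cball[of 0 d] moll_zero[OF d]] by simp
 have one: "(LBINT y. moll d (x - y)) = 1"
  using lborel_integral_reflect[OF m, of x] moll_integral[OF d] by simp
 have "conv f (moll d) x - c = (LBINT y. (f y - c) * moll d (x - y))"
  unfolding conv_def using i mi one by (simp add: left_diff_distrib)
 also have "\<bar>...\<bar> <= (LBINT y. e * moll d (x - y))"
 proof (rule order_trans[OF integral_abs_bound], rule integral_mono)
  show "integrable lborel (%y. \<bar>(f y - c) * moll d (x - y)\<bar>)" using i mi by (simp add: left_diff_distrib)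
  show "\<bar>(f y - c) * moll d (x - y)\<bar> <= e * moll d (x - y)" for y
  proof (cases "y : cball x d")
   case True
   thus ?thesis using c moll_nonneg[OF d, of "x - y"] by (simp add: abs_mult mult_right_mono)
  next
   case False
   hence "moll d (x - y) = 0" by (intro moll_zero[OF d]) (simp add: dist_norm norm_minus_commute)
   thus ?thesis by simp
  qed
 qed (use mi in auto)
 also have "... = e" using one by simp
 finally show ?thesis .
qed

lemma conv_moll_support:
 assumes "d > 0" "!!y. y : cball x d ==> f y = 0"
 shows "conv f (moll d) x = 0"
proof -
 have "f y * moll d (x - y) = 0" for y
  using assms(2)[of y] moll_zero[OF assms(1), of "x - y"]
  by (cases "y : cball x d") (auto simp: dist_norm norm_minus_commute)
 hence "(%y. f y * moll d (x - y)) = (%_. 0)" by blast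
 thus ?thesis by (simp add: conv_def)
qed

text \<open>Obtained by mollification. One compact set \<open>S'\<close> serves for all
  \<open>e\<close>, which is what later turns uniform closeness into closeness of integrals.\<close>

lemma C1c_approx:
 fixes f :: "'a::euclidean_space => real"
 assumes f: "C1c f g S" and U: "open U" "S <= U"
 obtains S' where "compact S'" "S' <= U" "S <= S'"
  "!!e. e > 0 ==> EX ph. smooth_on UNIV ph & (ALL x. x ~: S' --> ph x = 0) &
    (ALL x. \<bar>ph x - f x\<bar> <= e & norm (grad ph x - g x) <= e)"
proof -
 have S: "compact S" "!!x. x ~: S ==> f x = 0" using f by (auto simp: C1c_def)
 have fi: "integrable lborel f" by (rule integrable_cont_compact[OF S(1) C1c_cont[OF f] S(2)])
 obtain r where r: "r > 0" "(UN x:S. cball x r) <= U"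
 proof -
  have "EX r>0. ALL x:S. ALL y:- U. r <= dist x y"
   by (rule separate_compact_closed[OF S(1)]) (use U in auto)
  then obtain r where r: "r > 0" "!!x y. x : S ==> y ~: U ==> r <= dist x y" by auto
  show thesis
  proof (rule that[of "r/2"])
   show "(UN x:S. cball x (r/2)) <= U" using r by force
  qed (use r in auto)
 qed
 define S' where "S' = (%(x, y). x + y) ` (S \<times> cball 0 r)"
 have cS': "compact S'" unfolding S'_def
  by (rule compact_continuous_image) (auto intro!: continuous_intros compact_Times S simp: case_prod_beta)
 have S'I: "y : S'" if "x : S" "dist x y <= r" for x y
  unfolding S'_def using that by (intro image_eqI[of _ _ "(x, y - x)"]) (auto simp: dist_norm norm_minus_commute)
 have S'U: "S' <= U"
 proof
  fix y assume "y : S'"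
  then obtain x z where "x : S" "norm z <= r" "y = x + z" unfolding S'_def by auto
  hence "y : (UN x:S. cball x r)" by (auto intro!: bexI[of _ x] simp: dist_norm)
  thus "y : U" using subsetD[OF r(2)] by blast
 qed
 have "EX ph. smooth_on UNIV ph & (ALL x. x ~: S' --> ph x = 0) &
    (ALL x. \<bar>ph x - f x\<bar> <= e & norm (grad ph x - g x) <= e)" if e: "e > 0" for e
 proof -
  let ?n = "real DIM('a)"
  obtain d1 where d1: "d1 > 0" "!!x y. norm (x - y) <= d1 ==> norm (f x - f y) <= e"
   using cont_compact_uniform[OF S(1) C1c_cont[OF f] S(2) e] by blast
  have e': "e / ?n > 0" using e by simp
  obtain d2 where d2: "d2 > 0" "!!x y. norm (x - y) <= d2 ==> norm (g x - g y) <= e / ?n"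
   using cont_compact_uniform[OF S(1) C1c_cont_grad[OF f] C1c_grad_zero[OF f] e'] by blast
  define d where "d = min r (min d1 d2)"
  have d: "d > 0" "d <= r" "d <= d1" "d <= d2" using r d1 d2 by (auto simp: d_def)
  define ph where "ph = conv f (moll d)"
  have "smooth_on UNIV ph" unfolding smooth_on_def ph_def
   using conv_Ck[OF fi moll_Ck[OF d(1)] compact_cball moll_zero[OF d(1)]] by blast
  moreover have "ph x = 0" if "x ~: S'" for x unfolding ph_def
  proof (rule conv_moll_support[OF d(1)])
   fix y assume "y : cball x d"
   hence "y ~: S" using S'I[of y x] that d(2) by (auto simp: dist_commute)
   thus "f y = 0" using S by auto
  qed
  moreover have "\<bar>ph x - f x\<bar> <= e" for x unfolding ph_def
   by (rule conv_moll_approx[OF fi d(1)]) (use d1(2) d(3) in \<open>auto simp: dist_norm norm_minus_commute\<close>)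
  moreover have "norm (grad ph x - g x) <= e" for x
  proof -
   have "\<bar>b \<bullet> (grad ph x - g x)\<bar> <= e / ?n" if b: "b : Basis" for b
   proof -
    have gi: "integrable lborel (%y. b \<bullet> g y)"
     by (rule integrable_cont_compact[OF S(1)]) (use C1c_grad_zero[OF f] C1c_cont_grad[OF f] in \<open>auto intro!: continuous_intros\<close>)
    have "b \<bullet> grad ph x = conv (%y. b \<bullet> g y) (moll d) x"
     unfolding ph_def inner_grad_pd[OF b] by (rule conv_grad_swap[OF f moll_C1c[OF d(1)] b])
    moreover have "\<bar>conv (%y. b \<bullet> g y) (moll d) x - b \<bullet> g x\<bar> <= e / ?n"
    proof (rule conv_moll_approx[OF gi d(1)])
     fix y assume "y : cball x d"
     hence "norm (g y - g x) <= e / ?n" using d2(2)[of y x] d(4) by (simp add: dist_norm norm_minus_commute)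
     moreover have "\<bar>b \<bullet> g y - b \<bullet> g x\<bar> <= norm (g y - g x)"
      using Basis_le_norm[OF b, of "g y - g x"] by (simp add: inner_diff_right inner_commute[of _ b])
     ultimately show "\<bar>b \<bullet> g y - b \<bullet> g x\<bar> <= e / ?n" by linarith
    qed
    ultimately show ?thesis by (simp add: inner_diff_right)
   qed
   from norm_le_Basis_bound[OF this] show ?thesis by simp
  qed
  ultimately show ?thesis by blast
 qed
 thus thesis using that[OF cS' S'U] S'I r(1) by (metis dist_self less_imp_le subsetI)
qed

section \<open>Truncation and cutoff\<close>

definition psq :: "real => real" where "psq t = (max 0 t)^2"

lemma psq_DERIV: "(psq has_real_derivative 2 * max 0 t) (at t)"
proof -
 consider "t < 0" | "t > 0" | "t = 0" by linarith
 thus ?thesis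
 proof cases
  case 1
  have "((%t::real. 0::real) has_real_derivative 0) (at t)" by simp
  hence "(psq has_real_derivative 0) (at t)"
   by (rule has_field_derivative_transform_within_open[of _ _ _ "{..<0}"]) (use 1 in \<open>auto simp: psq_def\<close>)
  thus ?thesis using 1 by simp
 next
  case 2
  have "((%t::real. t^2) has_real_derivative 2 * t) (at t)" by (auto intro!: derivative_eq_intros)
  hence "(psq has_real_derivative 2 * t) (at t)"
   by (rule has_field_derivative_transform_within_open[of _ _ _ "{0<..}"]) (use 2 in \<open>auto simp: psq_def\<close>)
  thus ?thesis using 2 by simp
 next
  case 3
  have "((%h. psq h / h) \<longlongrightarrow> 0) (at 0)"
  proof (rule Lim_null_comparison)
   have "norm (psq h / h) <= \<bar>h\<bar>" for h
    by (auto simp: psq_def max_def power2_eq_square)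
   thus "\<forall>\<^sub>F h in at 0. norm (psq h / h) <= \<bar>h\<bar>" by (simp add: always_eventually)
   show "((%h. \<bar>h\<bar>) \<longlongrightarrow> (0::real)) (at 0)" by (auto intro!: tendsto_eq_intros)
  qed
  thus ?thesis using 3 by (simp add: DERIV_def psq_def)
 qed
qed

lemma psq_mono: "s <= t ==> psq s <= psq t"
 unfolding psq_def by (intro power_mono) auto

lemma psq_cont: "continuous_on S psq" unfolding psq_def[abs_def] by (intro continuous_intros)

text \<open>For \<open>t > d\<close> this is \<open>(t - d)^2 / t\<close>, with derivative
  \<open>1 - d^2 / t^2\<close> between 0 and 1. It vanishes up to \<open>d\<close>, is C1, and
  increases to \<open>t\<close> as \<open>d\<close> decreases to 0, so truncating a positive
  function never increases its gradient.\<close>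

definition trunc :: "real => real => real" where "trunc d t = psq (t - d) / t"

definition trunc' :: "real => real => real" where
 "trunc' d t = (if t <= d then 0 else 1 - d^2 / t^2)"

lemma trunc_zero: "t <= d ==> trunc d t = 0" by (simp add: trunc_def psq_def)

lemma trunc_DERIV:
 assumes d: "d > 0" shows "(trunc d has_real_derivative trunc' d t) (at t)"
proof (cases "t < d")
 case True
 have "((%t::real. 0::real) has_real_derivative 0) (at t)" by simp
 hence "(trunc d has_real_derivative 0) (at t)"
  by (rule has_field_derivative_transform_within_open[of _ _ _ "{..<d}"]) (use True in \<open>auto simp: trunc_zero\<close>)
 thus ?thesis using True by (simp add: trunc'_def)
next
 case False
 hence t: "t > 0" "t >= d" using d by auto
 have p: "((%t. psq (t - d)) has_real_derivative (2 * max 0 (t - d)) * 1) (at t)"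
  by (rule DERIV_chain2[OF psq_DERIV]) (auto intro!: derivative_eq_intros)
 have "((%t. psq (t - d) / t) has_real_derivative ((2 * max 0 (t - d)) * 1 * t - psq (t - d) * 1) / (t * t)) (at t)"
  by (rule DERIV_divide[OF p DERIV_ident]) (use t in auto)
 moreover have "((2 * max 0 (t - d)) * 1 * t - psq (t - d) * 1) / (t * t) = trunc' d t"
  using t by (auto simp: trunc'_def psq_def power2_eq_square field_simps)
 ultimately show ?thesis by (simp add: trunc_def[abs_def])
qed

lemma trunc'_bounds: "d > 0 ==> 0 <= trunc' d t & trunc' d t <= 1"
proof -
 assume d: "d > 0"
 show ?thesis
 proof (cases "t <= d")
  case False
  hence "d^2 <= t^2" using d by (intro power_mono) auto
  thus ?thesis using False d by (auto simp: trunc'_def field_simps)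
 qed (simp add: trunc'_def)
qed

lemma trunc_bounds: "d > 0 ==> t >= 0 ==> 0 <= trunc d t & trunc d t <= t"
proof -
 assume d: "d > 0" and t: "t >= 0"
 have "psq (t - d) <= psq t" using d by (intro psq_mono) auto
 also have "psq t = t * t" using t by (simp add: psq_def power2_eq_square)
 finally show ?thesis using t by (cases "t = 0") (auto simp: trunc_def psq_def field_simps)
qed

lemma trunc'_cont: "d > 0 ==> continuous_on S (trunc' d)"
proof -
 assume d: "d > 0"
 have "trunc' d t = 1 - d^2 / (max d t)^2" for t using d by (auto simp: trunc'_def max_def)
 hence e: "trunc' d = (%t. 1 - d^2 / (max d t)^2)" by auto
 show ?thesis unfolding e using d by (intro continuous_intros) (auto simp: max_def)
qed

lemma trunc_cont: "d > 0 ==> continuous_on S (trunc d)"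
 by (meson DERIV_isCont continuous_at_imp_continuous_on trunc_DERIV)

lemma inv_Suc_tendsto: "(%k. 1 / real (Suc k)) ----> 0"
 by (rule LIMSEQ_Suc[OF lim_1_over_n])

lemma trunc_tendsto: "t >= 0 ==> (%k. trunc (1 / real (Suc k)) t) ----> t"
proof -
 assume t: "t >= 0"
 have "(%k. t - 1 / real (Suc k)) ----> t - 0" by (intro tendsto_diff tendsto_const inv_Suc_tendsto)
 from tendsto_mult_right[OF isCont_tendsto_compose[OF DERIV_isCont[OF psq_DERIV] this], of "1 / t"]
 have "(%k. psq (t - 1 / real (Suc k)) / t) ----> psq (t - 0) / t" by simp
 moreover have "psq (t - 0) / t = t" using t by (cases "t = 0") (auto simp: psq_def power2_eq_square)
 ultimately show ?thesis by (simp add: trunc_def)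
qed

lemma trunc'_tendsto: "t > 0 ==> (%k. trunc' (1 / real (Suc k)) t) ----> 1"
proof -
 assume t: "t > 0"
 have "(%k. 1 - (1 / real (Suc k))^2 / t^2) ----> 1 - 0^2 / t^2"
  using t by (intro tendsto_intros inv_Suc_tendsto) auto
 hence "(%k. 1 - (1 / real (Suc k))^2 / t^2) ----> 1" by simp
 moreover have "\<forall>\<^sub>F k in sequentially. 1 - (1 / real (Suc k))^2 / t^2 = trunc' (1 / real (Suc k)) t"
  using order_tendstoD(2)[OF inv_Suc_tendsto t] by eventually_elim (auto simp: trunc'_def)
 ultimately show ?thesis by (rule Lim_transform_eventually)
qed

lemma trunc_mono: "d' <= d ==> t >= 0 ==> trunc d t <= trunc d' t"
 unfolding trunc_def by (intro divide_right_mono psq_mono) auto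

text \<open>The inner \<open>psq\<close> makes the cutoff C1 where it leaves the value 1, the outer
  one where it reaches 0.\<close>

definition cutf :: "real => 'a::euclidean_space => real" where
 "cutf R x = psq (1 - psq ((norm x)^2 / R^2 - 1))"

definition cutg :: "real => 'a::euclidean_space => 'a" where
 "cutg R x = (- 8 / R^2 * max 0 (1 - psq ((norm x)^2 / R^2 - 1)) * max 0 ((norm x)^2 / R^2 - 1)) *R x"

lemma cutf_GDERIV: "GDERIV (cutf R) x :> cutg R x"
proof -
 have 0: "GDERIV (%x. (norm (x - 0))^2) x :> 2 *R (x - 0)" by (rule GDERIV_norm2)
 have 1: "((%t. 1 - psq (t / R^2 - 1)) has_real_derivative - (2 * max 0 (t / R^2 - 1) * (1 / R^2))) (at t)" for t
 proof -
  have "((%t. t * (1 / R^2) - 1) has_real_derivative 1 / R^2) (at t)"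
   by (rule derivative_eq_intros refl | simp)+
  hence "((%t. t / R^2 - 1) has_real_derivative 1 / R^2) (at t)" by simp
  from DERIV_diff[OF DERIV_const DERIV_chain2[OF psq_DERIV this], of 1]
  show ?thesis by simp
 qed
 from GDERIV_DERIV_compose[OF 0 DERIV_chain2[OF psq_DERIV 1]] show ?thesis
  unfolding cutf_def[abs_def] cutg_def by (simp add: mult.assoc)
qed

lemma cutg_cont: "continuous_on S (cutg R)" unfolding cutg_def divide_inverse
 by (intro continuous_intros continuous_on_compose2[OF psq_cont[of UNIV]]) auto

lemma cutf_one: "R > 0 ==> norm x <= R ==> cutf R x = 1"
proof -
 assume R: "R > 0" "norm x <= R"
 hence "(norm x)^2 <= R^2" by (intro power_mono) auto
 hence "(norm x)^2 / R^2 - 1 <= 0" using R by simp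
 thus ?thesis by (simp add: cutf_def psq_def)
qed

lemma cutf_zero: "R > 0 ==> norm x >= 2 * R ==> cutf R x = 0"
proof -
 assume R: "R > 0" "norm x >= 2 * R"
 hence "(norm x)^2 >= (2 * R)^2" by (intro power_mono) auto
 hence "(norm x)^2 / R^2 >= 4" using R by (simp add: power_mult_distrib pos_le_divide_eq)
 hence "(norm x)^2 / R^2 - 1 >= 1" by simp
 hence "psq 1 <= psq ((norm x)^2 / R^2 - 1)" by (rule psq_mono)
 thus ?thesis unfolding cutf_def by (simp add: psq_def[of 1] psq_def[of "1 - _"])
qed

lemma cutf_bounds: "0 <= cutf R x & cutf R x <= 1"
proof -
 have "1 - psq ((norm x)^2 / R^2 - 1) <= 1" by (simp add: psq_def)
 from psq_mono[OF this] show ?thesis by (simp add: cutf_def psq_def)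
qed

lemma cutf_C1c: "R > 0 ==> C1c (cutf R) (cutg R) (cball 0 (2 * R))"
 unfolding C1c_def using cutf_GDERIV cutg_cont by (auto intro!: cutf_zero)

lemma cutg_zero: "R > 0 ==> norm x <= R ==> cutg R x = 0"
proof -
 assume R: "R > 0" "norm x <= R"
 hence "(norm x)^2 <= R^2" by (intro power_mono) auto
 hence "(norm x)^2 / R^2 - 1 <= 0" using R by simp
 thus ?thesis by (simp add: cutg_def)
qed

lemma cutg_bound: assumes R: "R > 0" shows "norm (cutg R x) <= 48 / R"
proof (cases "norm x <= 2 * R")
 case True
 let ?a = "max 0 (1 - psq ((norm x)^2 / R^2 - 1))" and ?b = "max 0 ((norm x)^2 / R^2 - 1)"
 have a: "0 <= ?a" "?a <= 1" by (auto simp: psq_def)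
 have "(norm x)^2 <= (2 * R)^2" using True by (intro power_mono) auto
 hence b: "0 <= ?b" "?b <= 3" using R by (auto simp: power2_eq_square field_simps)
 have "norm (cutg R x) = 8 / R^2 * (?a * ?b) * norm x"
  unfolding cutg_def using a b R by (simp add: abs_mult)
 also have "... <= 8 / R^2 * (1 * 3) * (2 * R)" using a b True R
  by (intro mult_mono mult_nonneg_nonneg) auto
 also have "... = 48 / R" using R by (simp add: power2_eq_square)
 finally show ?thesis .
next
 case False
 hence "cutg R x = 0" using C1c_grad_zero[OF cutf_C1c[OF R]] by auto
 thus ?thesis using R by simp
qed

lemma cutf_tendsto: "(%k. cutf (real (Suc k)) x) ----> 1"
proof (rule tendsto_eventually)
 obtain N where "norm x <= real N" using real_arch_simple by blast
 thus "\<forall>\<^sub>F k in sequentially. cutf (real (Suc k)) x = 1"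
  unfolding eventually_sequentially by (auto intro!: exI[of _ N] cutf_one)
qed

section \<open>Approximation by test functions\<close>

lemma C1c_test_approx:
 fixes f :: "'a::euclidean_space => real"
 assumes f: "C1c f g S" and U: "open U" "S <= U" and q: "q > 0" and e: "e > 0"
 obtains ph where "test_fun U ph"
  "integrable lborel (%x. (norm (grad ph x - g x))^2)" "(LBINT x. (norm (grad ph x - g x))^2) <= e"
  "integrable lborel (%x. \<bar>ph x - f x\<bar> powr q)" "(LBINT x. \<bar>ph x - f x\<bar> powr q) <= e"
proof -
 obtain S' where S': "compact S'" "S' <= U" "S <= S'"
  "!!e. e > 0 ==> EX ph. smooth_on UNIV ph & (ALL x. x ~: S' --> ph x = 0) &
    (ALL x. \<bar>ph x - f x\<bar> <= e & norm (grad ph x - g x) <= e)"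
  using C1c_approx[OF f U] by metis
 define m where "m = measure lborel S' + 1"
 have m: "m > 0" unfolding m_def by (simp add: add_nonneg_pos)
 \<comment> \<open>Here \<open>m\<close> exceeds the measure of \<open>S'\<close>, and
   \<open>et\<close> is small enough that both integrands are at most \<open>e / m\<close>.\<close>
 define et where "et = min (sqrt (e / m)) ((e / m) powr (1/q))"
 have et: "et > 0" using e m by (simp add: et_def)
 have et2: "et^2 <= e / m"
 proof -
  have "et^2 <= (sqrt (e / m))^2" using et by (intro power_mono) (auto simp: et_def)
  thus ?thesis using e m by simp
 qed
 have etq: "et powr q <= e / m"
 proof -
  have "et powr q <= ((e / m) powr (1/q)) powr q" using et q by (intro powr_mono2) (auto simp: et_def)
  thus ?thesis using e m q by (simp add: powr_powr)
 qed
 obtain ph where ph: "smooth_on UNIV ph" "!!x. x ~: S' ==> ph x = 0"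
  "!!x. \<bar>ph x - f x\<bar> <= et" "!!x. norm (grad ph x - g x) <= et" using S'(4)[OF et] by blast
 have c1: "Ck (Suc 0) UNIV ph" using ph(1) unfolding smooth_on_def by blast
 have c: "C1c ph (grad ph) S'" by (rule Ck1_C1c[OF c1 S'(1) ph(2)])
 have z: "ph x - f x = 0" "grad ph x - g x = 0" if "x ~: S'" for x
  using that ph(2) C1c_grad_zero[OF c] C1c_grad_zero[OF f] S'(3) f by (auto simp: C1c_def)
 have mS: "S' : sets lborel" "emeasure lborel S' < \<infinity>"
  using S'(1) emeasure_bounded_finite[OF compact_imp_bounded[OF S'(1)]] by (auto simp: borel_compact)
 have gen: "integrable lborel h & integral\<^sup>L lborel h <= e"
  if h: "continuous_on UNIV h" "!!x. h x <= e / m" "!!x. x ~: S' ==> h x = 0" for h :: "'a => real"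
 proof -
  have i: "integrable lborel h" by (rule integrable_cont_compact[OF S'(1) continuous_on_subset[OF h(1)] h(3)]) auto
  have i2: "integrable lborel (%x. indicator S' x * (e / m))" using mS by simp
  have "integral\<^sup>L lborel h <= (LBINT x. indicator S' x * (e / m))"
   by (rule integral_mono[OF i i2]) (use h in \<open>auto simp: indicator_def\<close>)
  also have "... = measure lborel S' * (e / m)" using mS by simp
  also have "... <= m * (e / m)" using e m by (intro mult_right_mono) (auto simp: m_def)
  also have "... = e" using m by simp
  finally show ?thesis using i by simp
 qed
 have 1: "integrable lborel (%x. (norm (grad ph x - g x))^2) & (LBINT x. (norm (grad ph x - g x))^2) <= e"
 proof (rule gen)
  show "continuous_on UNIV (%x. (norm (grad ph x - g x))^2)"
   by (intro continuous_intros C1c_cont_grad[OF c] C1c_cont_grad[OF f])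
  show "(norm (grad ph x - g x))^2 <= e / m" for x
   using power_mono[OF ph(4)[of x] norm_ge_zero, of 2] et2 by linarith
 qed (use z in auto)
 have 2: "integrable lborel (%x. \<bar>ph x - f x\<bar> powr q) & (LBINT x. \<bar>ph x - f x\<bar> powr q) <= e"
 proof (rule gen)
  show "continuous_on UNIV (%x. \<bar>ph x - f x\<bar> powr q)"
   using q by (intro continuous_on_powr' continuous_intros C1c_cont[OF c] C1c_cont[OF f]) auto
  show "\<bar>ph x - f x\<bar> powr q <= e / m" for x
   using powr_mono2[of q "\<bar>ph x - f x\<bar>" et] ph(3)[of x] etq q by simp
 qed (use z q in auto)
 have "test_fun U ph" unfolding test_fun_def using ph S' by blast
 thus thesis using that 1 2 by blast
qed

lemma norm_add_sq: "(norm (a + b))^2 <= 2 * (norm (a::'a::real_inner))^2 + 2 * (norm b)^2"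
proof -
 have "(norm (a + b))^2 <= (norm a + norm b)^2" by (intro power_mono norm_triangle_ineq) auto
 also have "... <= 2 * (norm a)^2 + 2 * (norm b)^2" using sum_squares_bound[of "norm a" "norm b"] by (simp add: power2_sum)
 finally show ?thesis .
qed

lemma powr_add_bound: "q > 0 ==> \<bar>a + b::real\<bar> powr q <= 2 powr q * (\<bar>a\<bar> powr q + \<bar>b\<bar> powr q)"
proof -
 assume q: "q > 0"
 have "\<bar>a + b\<bar> powr q <= (2 * max \<bar>a\<bar> \<bar>b\<bar>) powr q" using q by (intro powr_mono2) auto
 also have "... = 2 powr q * (max \<bar>a\<bar> \<bar>b\<bar>) powr q" by (simp add: powr_mult)
 also have "(max \<bar>a\<bar> \<bar>b\<bar>) powr q <= \<bar>a\<bar> powr q + \<bar>b\<bar> powr q" by (simp add: max_def)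
 finally show ?thesis by simp
qed

text \<open>Each \<open>W k\<close> is replaced by a test function for which both integrals differ
  from those of \<open>W k\<close> by an error governed by \<open>1 / (k + 1)\<close>. Membership in
  \<open>D12\<close> or \<open>H10\<close> is thereby reduced to approximation by C1
  functions.\<close>

lemma C1c_seq_test_approx:
 fixes V :: "'a::euclidean_space => real"
 assumes W: "!!k. C1c (W k) (G k) (S k)" "!!k. S k <= U" and U: "open U" and q: "q > 0"
  and V: "V : borel_measurable borel" "g : borel_measurable borel"
  and i: "!!k. integrable lborel (%x. (norm (G k x - g x))^2)" "!!k. integrable lborel (%x. \<bar>W k x - V x\<bar> powr q)"
  and l: "(%k. LBINT x. (norm (G k x - g x))^2) ----> 0" "(%k. LBINT x. \<bar>W k x - V x\<bar> powr q) ----> 0"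
 obtains ph where "!!k. test_fun U (ph k)"
  "(%k. LBINT x. (norm (grad (ph k) x - g x))^2) ----> 0"
  "(%k. LBINT x. \<bar>ph k x - V x\<bar> powr q) ----> 0"
proof -
 define Q where "Q k ph \<longleftrightarrow> test_fun U ph &
  integrable lborel (%x. (norm (grad ph x - G k x))^2) & (LBINT x. (norm (grad ph x - G k x))^2) <= 1 / real (Suc k) &
  integrable lborel (%x. \<bar>ph x - W k x\<bar> powr q) & (LBINT x. \<bar>ph x - W k x\<bar> powr q) <= 1 / real (Suc k)" for k ph
 have "EX ph. Q k ph" for k
 proof -
  have e: "1 / real (Suc k) > 0" by simp
  show ?thesis by (rule C1c_test_approx[OF W(1)[of k] U W(2)[of k] q e]) (unfold Q_def, blast)
 qed
 then obtain ph where "!!k. Q k (ph k)" by metis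
 hence ph: "!!k. test_fun U (ph k)"
  "!!k. integrable lborel (%x. (norm (grad (ph k) x - G k x))^2)"
  "!!k. (LBINT x. (norm (grad (ph k) x - G k x))^2) <= 1 / real (Suc k)"
  "!!k. integrable lborel (%x. \<bar>ph k x - W k x\<bar> powr q)"
  "!!k. (LBINT x. \<bar>ph k x - W k x\<bar> powr q) <= 1 / real (Suc k)"
  unfolding Q_def by auto
 have "(%k. LBINT x. (norm (grad (ph k) x - g x))^2) ----> 0"
 proof (rule tendsto_sandwich[OF _ _ tendsto_const])
  show "(%k. 2 * (1 / real (Suc k)) + 2 * (LBINT x. (norm (G k x - g x))^2)) ----> 0"
   using tendsto_add[OF tendsto_mult_left[OF inv_Suc_tendsto, of 2] tendsto_mult_left[OF l(1), of 2]] by simp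
  show "\<forall>\<^sub>F k in sequentially. 0 <= (LBINT x. (norm (grad (ph k) x - g x))^2)" by simp
  show "\<forall>\<^sub>F k in sequentially. (LBINT x. (norm (grad (ph k) x - g x))^2)
    <= 2 * (1 / real (Suc k)) + 2 * (LBINT x. (norm (G k x - g x))^2)"
  proof (rule always_eventually, rule allI)
   fix k
   let ?h = "%x. 2 * (norm (grad (ph k) x - G k x))^2 + 2 * (norm (G k x - g x))^2"
   have hi: "integrable lborel ?h" using ph(2)[of k] i(1)[of k] by simp
   have "(LBINT x. (norm (grad (ph k) x - g x))^2) <= integral\<^sup>L lborel ?h"
   proof (rule integral_mono_AE'[OF hi])
    have "(norm (grad (ph k) x - g x))^2 <= ?h x" for x
     using norm_add_sq[of "grad (ph k) x - G k x" "G k x - g x"] by simp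
    thus "AE x in lborel. (norm (grad (ph k) x - g x))^2 <= ?h x" by simp
   qed auto
   also have "... <= 2 * (1 / real (Suc k)) + 2 * (LBINT x. (norm (G k x - g x))^2)"
    using ph(2,3)[of k] i(1)[of k] by simp
   finally show "(LBINT x. (norm (grad (ph k) x - g x))^2)
    <= 2 * (1 / real (Suc k)) + 2 * (LBINT x. (norm (G k x - g x))^2)" .
  qed
 qed
 moreover have "(%k. LBINT x. \<bar>ph k x - V x\<bar> powr q) ----> 0"
 proof (rule tendsto_sandwich[OF _ _ tendsto_const])
  show "(%k. 2 powr q * (1 / real (Suc k) + (LBINT x. \<bar>W k x - V x\<bar> powr q))) ----> 0"
   using tendsto_mult_left[OF tendsto_add[OF inv_Suc_tendsto l(2)], of "2 powr q"] by simp
  show "\<forall>\<^sub>F k in sequentially. 0 <= (LBINT x. \<bar>ph k x - V x\<bar> powr q)" by simp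
  show "\<forall>\<^sub>F k in sequentially. (LBINT x. \<bar>ph k x - V x\<bar> powr q)
    <= 2 powr q * (1 / real (Suc k) + (LBINT x. \<bar>W k x - V x\<bar> powr q))"
  proof (rule always_eventually, rule allI)
   fix k
   let ?h = "%x. 2 powr q * (\<bar>ph k x - W k x\<bar> powr q + \<bar>W k x - V x\<bar> powr q)"
   have hi: "integrable lborel ?h" using ph(4)[of k] i(2)[of k] by simp
   have "(LBINT x. \<bar>ph k x - V x\<bar> powr q) <= integral\<^sup>L lborel ?h"
   proof (rule integral_mono_AE'[OF hi])
    have "\<bar>ph k x - V x\<bar> powr q <= ?h x" for x
     using powr_add_bound[OF q, of "ph k x - W k x" "W k x - V x"] by simp
    thus "AE x in lborel. \<bar>ph k x - V x\<bar> powr q <= ?h x" by simp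
   qed auto
   also have "... = 2 powr q * ((LBINT x. \<bar>ph k x - W k x\<bar> powr q) + (LBINT x. \<bar>W k x - V x\<bar> powr q))"
    using ph(4)[of k] i(2)[of k] by simp
   also have "... <= 2 powr q * (1 / real (Suc k) + (LBINT x. \<bar>W k x - V x\<bar> powr q))"
    using ph(5)[of k] by (intro mult_left_mono) auto
   finally show "(LBINT x. \<bar>ph k x - V x\<bar> powr q)
    <= 2 powr q * (1 / real (Suc k) + (LBINT x. \<bar>W k x - V x\<bar> powr q))" .
  qed
 qed
 ultimately show thesis using that[of ph] ph(1) by blast
qed

section \<open>Continuous functions that are positive and C1 on an open set and zero outside\<close>

locale pos_C1 =
 fixes V :: "'a::euclidean_space => real" and U :: "'a set" and g :: "'a => 'a"
 assumes U: "open U" and cV: "continuous_on UNIV V" and pos: "!!x. x : U ==> V x > 0"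
  and zero: "!!x. x ~: U ==> V x = 0" and der: "!!x. x : U ==> GDERIV V x :> g x" and cg: "continuous_on U g"
begin

definition gz :: "'a => 'a" where "gz x = (if x : U then g x else 0)"

text \<open>Across the frontier of \<open>U\<close> the function \<open>V\<close> is merely
  continuous. Truncating it below the level \<open>1 / (k + 1)\<close> and cutting off near infinity
  gives a C1 function with support in the compact subset \<open>Sk k\<close> of
  \<open>U\<close>.\<close>

definition Wk :: "nat => 'a => real" where
 "Wk k x = trunc (1 / real (Suc k)) (V x) * cutf (real (Suc k)) x"

definition Gk :: "nat => 'a => 'a" where
 "Gk k x = (cutf (real (Suc k)) x * trunc' (1 / real (Suc k)) (V x)) *R gz x
   + trunc (1 / real (Suc k)) (V x) *R cutg (real (Suc k)) x"

definition Sk :: "nat => 'a set" where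
 "Sk k = {x : cball 0 (2 * real (Suc k)). V x >= 1 / real (Suc k)}"

lemma nonneg: "V x >= 0" using pos[of x] zero[of x] by (cases "x : U") auto

lemma gz_measurable: "gz : borel_measurable borel"
proof -
 have "(%x. indicator U x *R g x) : borel_measurable borel"
  using borel_measurable_continuous_on_indicator[OF _ cg] U by auto
 moreover have "(%x. indicator U x *R g x) = gz" by (auto simp: gz_def indicator_def)
 ultimately show ?thesis by simp
qed

lemma V_measurable: "V : borel_measurable borel" by (rule cont_borel_measurable[OF cV])

lemma Sk_U: "Sk k <= U" 
proof
 fix x assume "x : Sk k"
 hence "V x > 0" by (auto simp: Sk_def intro: less_le_trans[of _ "1 / (1 + real k)"])
 thus "x : U" using zero by force
qed

lemma Wk_C1c: "C1c (Wk k) (Gk k) (Sk k)"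
proof -
 let ?d = "1 / real (Suc k)" and ?R = "real (Suc k)"
 have d: "?d > 0" and R: "?R > 0" by auto
 have "closed {x. V x >= ?d}" using cV by (intro closed_Collect_le continuous_intros)
 moreover have "Sk k = cball 0 (2 * ?R) Int {x. V x >= ?d}" by (auto simp: Sk_def)
 ultimately have cS: "compact (Sk k)" by (simp only: compact_Int_closed compact_cball)
 \<comment> \<open>\<open>Wk k\<close> vanishes on the open set \<open>Z\<close>, and
   \<open>Z\<close> contains everything off \<open>U\<close>; the two open sets together cover the
   space.\<close>
 define Z where "Z = {x. V x < ?d}"
 have Z: "open Z" unfolding Z_def using cV by (intro open_Collect_less continuous_intros)
 have ZU: "U Un Z = UNIV" using zero d by (auto simp: Z_def)
 have z: "Wk k x = 0" "Gk k x = 0" if "x : Z" for x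
  using that by (auto simp: Wk_def Gk_def Z_def trunc_zero trunc'_def)
 have gd: "GDERIV (Wk k) x :> Gk k x" for x
 proof (cases "x : U")
  case True
  have "GDERIV (%x. trunc ?d (V x)) x :> trunc' ?d (V x) *R g x"
   by (rule GDERIV_DERIV_compose[OF der[OF True] trunc_DERIV[OF d]])
  from GDERIV_mult[OF this cutf_GDERIV[of ?R]] show ?thesis
   unfolding Wk_def[abs_def] Gk_def gz_def using True by (simp add: add.commute)
 next
  case False
  hence "x : Z" using ZU by auto
  thus ?thesis
   using GDERIV_transform_open[OF GDERIV_const[of 0] Z, of x "Wk k"] z by auto
 qed
 have "continuous_on U (Gk k)"
 proof -
  have "continuous_on U (%x. (cutf ?R x * trunc' ?d (V x)) *R g x + trunc ?d (V x) *R cutg ?R x)"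
   by (intro continuous_intros C1c_cont[OF cutf_C1c[OF R]] cutg_cont cg
     continuous_on_compose2[OF trunc'_cont[OF d, of UNIV]] continuous_on_compose2[OF trunc_cont[OF d, of UNIV]]
     continuous_on_subset[OF cV]) auto
  thus ?thesis by (rule continuous_on_eq) (auto simp: Gk_def gz_def)
 qed
 moreover have "continuous_on Z (Gk k)" by (rule continuous_on_eq[of _ "%x. 0"]) (auto simp: z)
 ultimately have cG: "continuous_on UNIV (Gk k)" using continuous_on_open_Un[OF U Z] ZU by simp
 have "Wk k x = 0" if "x ~: Sk k" for x
  using that cutf_zero[OF R, of x] trunc_zero[of "V x" ?d] by (auto simp: Sk_def Wk_def)
 thus ?thesis unfolding C1c_def using cS cG gd by blast
qed

lemma Wk_bounds: "0 <= Wk k x & Wk k x <= V x"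
proof -
 have t: "0 <= trunc (1 / real (Suc k)) (V x)" "trunc (1 / real (Suc k)) (V x) <= V x"
  using trunc_bounds[of "1 / real (Suc k)" "V x"] nonneg by auto
 have "trunc (1 / real (Suc k)) (V x) * cutf (real (Suc k)) x <= V x * 1"
  using t cutf_bounds[of "real (Suc k)" x] nonneg[of x] by (intro mult_mono) auto
 thus ?thesis unfolding Wk_def using t cutf_bounds[of "real (Suc k)" x] by auto
qed

lemma Wk_tendsto: "(%k. Wk k x) ----> V x"
 using tendsto_mult[OF trunc_tendsto[OF nonneg[of x]] cutf_tendsto[of x]] by (simp add: Wk_def)

lemma Wk_powr_tendsto:
 assumes q: "q > 0" and i: "integrable lborel (%x. V x powr q)"
 shows "integrable lborel (%x. \<bar>Wk k x - V x\<bar> powr q)" "(%k. LBINT x. \<bar>Wk k x - V x\<bar> powr q) ----> 0"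
proof -
 have m: "(%x. \<bar>Wk k x - V x\<bar> powr q) : borel_measurable lborel" for k
  using V_measurable cont_borel_measurable[OF C1c_cont[OF Wk_C1c]] by measurable
 have b: "\<bar>Wk k x - V x\<bar> powr q <= V x powr q" for k x
  using q Wk_bounds[of k x] by (intro powr_mono2) auto
 show "integrable lborel (%x. \<bar>Wk k x - V x\<bar> powr q)"
  by (rule Bochner_Integration.integrable_bound[OF i m]) (use b in auto)
 have "(%k. LBINT x. \<bar>Wk k x - V x\<bar> powr q) ----> integral\<^sup>L lborel (%x::'a. 0::real)"
 proof (rule integral_dominated_convergence[OF _ m i])
  show "AE x in lborel. (%k. \<bar>Wk k x - V x\<bar> powr q) ----> 0"
  proof (rule AE_I2)
   fix x
   have "(%k. \<bar>Wk k x - V x\<bar>) ----> 0" using tendsto_rabs[OF LIM_zero[OF Wk_tendsto[of x]]] by simp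
   from tendsto_powr'[OF this tendsto_const, of q] q show "(%k. \<bar>Wk k x - V x\<bar> powr q) ----> 0" by simp
  qed
 qed (use b in auto)
 thus "(%k. LBINT x. \<bar>Wk k x - V x\<bar> powr q) ----> 0" by simp
qed

end

text \<open>Young's inequality replaces Hoelder's: the cutoff error is controlled by the tail of \<open>V powr 2\<^sup>*\<close>.\<close>
lemma annulus_tendsto:
 fixes V :: "'a::euclidean_space => real"
 assumes n: "DIM('a) >= 3" and V: "V : borel_measurable borel" "!!x. V x >= 0"
  and i: "integrable lborel (%x. V x powr crit DIM('a) 0)"
 shows "integrable lborel (%x. (V x)^2 * (norm (cutg (real (Suc k)) x))^2)"
  "(%k. LBINT x. (V x)^2 * (norm (cutg (real (Suc k)) x))^2) ----> 0"
proof -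
 let ?n = "real DIM('a)"
 let ?q = "crit DIM('a) 0"
 let ?v = "unit_ball_vol ?n"
 have n3: "?n >= 3" using n by simp
 define B where "B k = {x::'a. real (Suc k) < norm x}" for k
 define A where "A k = cball (0::'a) (2 * real (Suc k))" for k
 have Bm: "B k : sets borel" for k unfolding B_def by (intro borel_open open_Collect_less continuous_intros)
 have cm: "(%x::'a. cutg R x) : borel_measurable borel" for R by (rule cont_borel_measurable[OF cutg_cont])
 have iB: "integrable lborel (%x. indicator (B k) x * V x powr ?q)" for k
  using integrable_mult_indicator[of "B k" lborel "%x. V x powr ?q"] Bm i by simp
 have vA: "emeasure lborel (A k) = ennreal (?v * (2 * real (Suc k)) ^ DIM('a))" for k
  unfolding A_def by (subst emeasure_cball) auto
 have iA: "integrable lborel (%x. c * indicator (A k) x)" for k and c :: real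
  using vA[of k] by (intro integrable_mult_right) (auto simp: A_def)
 have mA: "(LBINT x. indicator (A k) x) = ?v * (2 * real (Suc k)) ^ DIM('a)" for k
  using vA[of k] by (simp add: measure_def A_def)
 define F where "F k x = (V x)^2 * (norm (cutg (real (Suc k)) x))^2" for k x
 have Fm: "F k : borel_measurable lborel" for k unfolding F_def[abs_def] using V(1) cm by measurable
 define C where "C = (48::real)^2"
 \<comment> \<open>Young's inequality with the conjugate exponents \<open>n / (n - 2)\<close> and
   \<open>n / 2\<close>. For each \<open>ta\<close> the first term is a tail of the integral of
   \<open>V powr ?q\<close>, while the second integrates to a multiple of
   \<open>ta powr (n / 2)\<close> that does not depend on \<open>k\<close>.\<close>
 have bound: "F k x <= C * (ta powr (- ?q / 2) * (indicator (B k) x * V x powr ?q)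
    + (ta powr (?n/2) / real (Suc k) ^ DIM('a)) * indicator (A k) x)" if ta: "ta > 0" for k x ta
 proof (cases "x : A k & x : B k")
  case False
  hence "cutg (real (Suc k)) x = 0"
   using C1c_grad_zero[OF cutf_C1c, of "real (Suc k)" x] cutg_zero[of "real (Suc k)" x] by (auto simp: A_def B_def)
  hence "F k x = 0" by (simp add: F_def)
  thus ?thesis using ta by (simp add: C_def)
 next
  case True
  let ?R = "real (Suc k)"
  have R: "?R > 0" by simp
  have "F k x <= (V x)^2 * (48 / ?R)^2" unfolding F_def
   by (intro mult_left_mono power_mono cutg_bound) auto
  also have "... = C * (((V x)^2 / ta) * (ta / ?R^2))" using ta by (simp add: C_def power_divide)
  also have "((V x)^2 / ta) * (ta / ?R^2) <= ((V x)^2 / ta) powr (?q/2) + (ta / ?R^2) powr (?n/2)"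
  proof -
   have q2: "?q / 2 = ?n / (?n - 2)" using n3 by (simp add: crit_def field_simps)
   have "((V x)^2 / ta) * (ta / ?R^2) <= ((V x)^2 / ta) powr (?q/2) / (?q/2) + (ta / ?R^2) powr (?n/2) / (?n/2)"
    by (rule Youngs_inequality) (use ta n3 in \<open>auto simp: q2 field_simps\<close>)
   also have "... <= ((V x)^2 / ta) powr (?q/2) + (ta / ?R^2) powr (?n/2)"
   proof (rule add_mono)
    have dle: "x / c <= x" if "c >= 1" "x >= 0" for x c :: real
     using mult_left_mono[of 1 c x] that by (simp add: divide_le_eq)
    have "?q / 2 >= 1" using n3 unfolding q2 by simp
    thus "((V x)^2 / ta) powr (?q/2) / (?q/2) <= ((V x)^2 / ta) powr (?q/2)"
     by (rule dle) simp
    have "?n / 2 >= 1" using n3 by simp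
    thus "(ta / ?R^2) powr (?n/2) / (?n/2) <= (ta / ?R^2) powr (?n/2)"
     by (rule dle) simp
   qed
   finally show ?thesis .
  qed
  also have "((V x)^2 / ta) powr (?q/2) = ta powr (- ?q/2) * V x powr ?q"
  proof -
   have "((V x)^2) powr (?q/2) = V x powr ?q"
    using V(2)[of x] by (cases "V x = 0") (auto simp: powr_powr simp flip: powr_numeral)
   thus ?thesis using ta V(2)[of x] by (simp add: powr_divide powr_minus_divide)
  qed
  also have "(ta / ?R^2) powr (?n/2) = ta powr (?n/2) / ?R ^ DIM('a)"
  proof -
   have "(?R^2) powr (?n/2) = (?R powr 2) powr (?n/2)" using powr_realpow[OF R, of 2] by (simp only: of_nat_numeral)
   also have "... = ?R powr ?n" by (simp only: powr_powr) simp
   also have "... = ?R ^ DIM('a)" using R by (rule powr_realpow)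
   finally show ?thesis using ta by (simp add: powr_divide)
  qed
  finally show ?thesis using True by (simp add: C_def)
 qed
 have Fi: "integrable lborel (F k)" for k
 proof (rule Bochner_Integration.integrable_bound[OF _ Fm])
  show "integrable lborel (%x. C * (1 powr (- ?q / 2) * (indicator (B k) x * V x powr ?q)
    + (1 powr (?n/2) / real (Suc k) ^ DIM('a)) * indicator (A k) x))"
   by (intro integrable_mult_right Bochner_Integration.integrable_add iB iA)
  show "AE x in lborel. norm (F k x) <= norm (C * (1 powr (- ?q / 2) * (indicator (B k) x * V x powr ?q)
    + (1 powr (?n/2) / real (Suc k) ^ DIM('a)) * indicator (A k) x))"
  proof (rule AE_I2)
   fix x :: 'a
   have "F k x >= 0" by (simp add: F_def)
   thus "norm (F k x) <= norm (C * (1 powr (- ?q / 2) * (indicator (B k) x * V x powr ?q)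
    + (1 powr (?n/2) / real (Suc k) ^ DIM('a)) * indicator (A k) x))" using bound[of 1 k x] by simp
  qed
 qed
 thus "integrable lborel (%x. (V x)^2 * (norm (cutg (real (Suc k)) x))^2)" by (simp add: F_def[abs_def])
 have tail: "(%k. LBINT x. indicator (B k) x * V x powr ?q) ----> integral\<^sup>L lborel (%x::'a. 0::real)"
 proof (rule integral_dominated_convergence[OF _ _ i])
  show "AE x in lborel. (%k. indicator (B k) x * V x powr ?q) ----> 0"
  proof (rule AE_I2, rule tendsto_eventually)
   fix x :: 'a
   obtain N where "norm x <= real N" using real_arch_simple by blast
   thus "\<forall>\<^sub>F k in sequentially. indicator (B k) x * V x powr ?q = 0"
    unfolding eventually_sequentially by (intro exI[of _ N]) (auto simp: B_def)
  qed
  show "AE x in lborel. norm (indicator (B k) x * V x powr ?q) <= V x powr ?q" for k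
   by (auto simp: indicator_def)
 qed (use iB borel_measurable_integrable in auto)
 have "(%k. integral\<^sup>L lborel (F k)) ----> 0"
 proof (rule LIMSEQ_I)
  fix e :: real assume e: "e > 0"
  define v2 where "v2 = ?v * 2 ^ DIM('a)"
  have v2: "v2 > 0" by (simp add: v2_def)
  \<comment> \<open>Chosen so that the part coming from the volume of the ball \<open>A k\<close>
    equals \<open>e / 4\<close>; the tail is then made small by taking \<open>k\<close>
    large.\<close>
  define ta where "ta = (e / (4 * C * v2)) powr (2 / ?n)"
  have ta: "ta > 0" using e v2 by (simp add: ta_def C_def)
  have tan: "ta powr (?n/2) = e / (4 * C * v2)" unfolding ta_def using e v2 n3 by (simp add: powr_powr C_def)
  define T where "T = C * ta powr (- ?q/2)"
  have T: "T > 0" using ta by (simp add: T_def C_def)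
  have "\<forall>\<^sub>F k in sequentially. (LBINT x. indicator (B k) x * V x powr ?q) < e / (2 * T)"
   using order_tendstoD(2)[OF tail, of "e / (2 * T)"] e T by simp
  then obtain N where N: "!!k. k >= N ==> (LBINT x. indicator (B k) x * V x powr ?q) < e / (2 * T)"
   unfolding eventually_sequentially by auto
  have "norm (integral\<^sup>L lborel (F k) - 0) < e" if k: "k >= N" for k
  proof -
   let ?R = "real (Suc k)"
   have "integral\<^sup>L lborel (F k) <= (LBINT x. C * (ta powr (- ?q / 2) * (indicator (B k) x * V x powr ?q)
     + (ta powr (?n/2) / ?R ^ DIM('a)) * indicator (A k) x))"
    by (rule integral_mono[OF Fi _ bound[OF ta]])
     (intro integrable_mult_right Bochner_Integration.integrable_add iB iA)
   also have "... = C * ((LBINT x. ta powr (- ?q / 2) * (indicator (B k) x * V x powr ?q))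
     + (LBINT x. (ta powr (?n/2) / ?R ^ DIM('a)) * indicator (A k) x))"
    by (subst integral_mult_right_zero, subst Bochner_Integration.integral_add)
     (auto intro!: integrable_mult_right iB iA)
   also have "... = C * (ta powr (- ?q / 2) * (LBINT x. indicator (B k) x * V x powr ?q)
     + (ta powr (?n/2) / ?R ^ DIM('a)) * (?v * (2 * ?R) ^ DIM('a)))"
    unfolding integral_mult_right_zero mA ..
   also have "... = T * (LBINT x. indicator (B k) x * V x powr ?q) + C * (ta powr (?n/2) * v2)"
   proof -
    have "(ta powr (?n/2) / ?R ^ DIM('a)) * (?v * (2 * ?R) ^ DIM('a)) = ta powr (?n/2) * v2"
     by (simp add: v2_def power_mult_distrib del: of_nat_Suc)
    thus ?thesis by (simp add: T_def algebra_simps)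
   qed
   also have "C * (ta powr (?n/2) * v2) = e / 4" unfolding tan using v2 by (simp add: C_def)
   also have "T * (LBINT x. indicator (B k) x * V x powr ?q) < T * (e / (2 * T))"
    using N[OF k] T by (rule mult_strict_left_mono)
   finally have "integral\<^sup>L lborel (F k) < e / 2 + e / 4" using T by simp
   moreover have "integral\<^sup>L lborel (F k) >= 0" by (rule integral_nonneg_AE) (auto simp: F_def)
   ultimately show ?thesis using e by simp
  qed
  thus "EX no. ALL k>=no. norm (integral\<^sup>L lborel (F k) - 0) < e" by blast
 qed
 thus "(%k. LBINT x. (V x)^2 * (norm (cutg (real (Suc k)) x))^2) ----> 0" by (simp add: F_def[abs_def])
qed

section \<open>Limits of \<open>L^2\<close> pairings\<close>

lemma L2_inner_bound: "\<bar>a \<bullet> b\<bar> <= l * (norm (b::'a::real_inner))^2 + (1 / l) * (norm a)^2" if "l > 0"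
proof -
 have "2 * (norm a / sqrt l) * (sqrt l * norm b) <= (norm a / sqrt l)^2 + (sqrt l * norm b)^2"
  by (rule sum_squares_bound)
 hence "2 * (norm a * norm b) <= (norm a)^2 / l + l * (norm b)^2"
  using that by (simp add: power_divide power_mult_distrib)
 moreover have "\<bar>a \<bullet> b\<bar> <= norm a * norm b" by (rule Cauchy_Schwarz_ineq2)
 moreover have "0 <= norm a * norm b" by simp
 ultimately have "\<bar>a \<bullet> b\<bar> <= (norm a)^2 / l + l * (norm b)^2" by linarith
 thus ?thesis by simp
qed

lemma L2_integrable_inner:
 fixes f g :: "'a::euclidean_space => 'b::euclidean_space"
 assumes "f : borel_measurable M" "g : borel_measurable M"
  "integrable M (%x. (norm (f x))^2)" "integrable M (%x. (norm (g x))^2)"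
 shows "integrable M (%x. f x \<bullet> g x)"
proof (rule Bochner_Integration.integrable_bound)
 show "integrable M (%x. 1 * (norm (g x))^2 + (1 / 1) * (norm (f x))^2)" using assms by simp
 show "(%x. f x \<bullet> g x) : borel_measurable M" using assms by measurable
 show "AE x in M. norm (f x \<bullet> g x) <= norm (1 * (norm (g x))^2 + (1 / 1) * (norm (f x))^2)"
 proof (rule AE_I2)
  fix x
  show "norm (f x \<bullet> g x) <= norm (1 * (norm (g x))^2 + (1 / 1) * (norm (f x))^2)"
   using L2_inner_bound[of 1 "f x" "g x"] by simp
 qed
qed

text \<open>Young's inequality with a weight \<open>t\<close> adapted to the size of
  \<open>g\<close> plays the role of the Cauchy-Schwarz inequality for integrals.\<close>

lemma L2_inner_tendsto_zero:
 fixes f :: "nat => 'a::euclidean_space => 'b::euclidean_space"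
 assumes m: "!!k. f k : borel_measurable lborel" "g : borel_measurable lborel"
  and i: "!!k. integrable lborel (%x. (norm (f k x))^2)" "integrable lborel (%x. (norm (g x))^2)"
  and l: "(%k. LBINT x. (norm (f k x))^2) ----> 0"
 shows "(%k. LBINT x. f k x \<bullet> g x) ----> 0"
proof (rule LIMSEQ_I)
 fix e :: real assume e: "e > 0"
 define I where "I = (LBINT x. (norm (g x))^2) + 1"
 have I: "I > 0" unfolding I_def by (simp add: add_nonneg_pos)
 define t where "t = e / (2 * I)"
 have t: "t > 0" using e I by (simp add: t_def)
 obtain N where N: "!!k. k >= N ==> (LBINT x. (norm (f k x))^2) < t * e / 2"
  using order_tendstoD(2)[OF l, of "t * e / 2"] t e unfolding eventually_sequentially by auto
 have "norm ((LBINT x. f k x \<bullet> g x) - 0) < e" if "k >= N" for k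
 proof -
  have "\<bar>LBINT x. f k x \<bullet> g x\<bar> <= (LBINT x. t * (norm (g x))^2 + (1 / t) * (norm (f k x))^2)"
  proof (rule order_trans[OF integral_abs_bound], rule integral_mono)
   show "integrable lborel (%x. \<bar>f k x \<bullet> g x\<bar>)" by (intro integrable_abs L2_integrable_inner m i)
   show "integrable lborel (%x. t * (norm (g x))^2 + (1 / t) * (norm (f k x))^2)" using i by simp
  qed (rule L2_inner_bound[OF t])
  also have "... = t * (LBINT x. (norm (g x))^2) + (1 / t) * (LBINT x. (norm (f k x))^2)"
   using i by simp
  also have "... < t * I + (1 / t) * (t * e / 2)"
   using N[OF that] t by (intro add_strict_mono mult_strict_left_mono) (auto simp: I_def)
  also have "... = e" using t I by (simp add: t_def)
  finally show ?thesis by simp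
 qed
 thus "EX no. ALL k>=no. norm ((LBINT x. f k x \<bullet> g x) - 0) < e" by blast
qed

section \<open>The spaces \<open>H10\<close> and \<open>D12\<close>\<close>

lemma test_fun_C1c:
 assumes "test_fun U ph"
 obtains K where "C1c ph (grad ph) K" "K <= U"
proof -
 obtain K where K: "compact K" "K <= U" "!!x. x ~: K ==> ph x = 0" using assms unfolding test_fun_def by blast
 have "Ck (Suc 0) UNIV ph" using assms unfolding test_fun_def smooth_on_def by blast
 thus thesis using that[OF Ck1_C1c[OF _ K(1,3)] K(2)] by blast
qed

lemma test_fun_zero:
 assumes "test_fun U ph" "x ~: U" shows "ph x = 0 & grad ph x = 0"
proof -
 obtain K where K: "C1c ph (grad ph) K" "K <= U" using test_fun_C1c[OF assms(1)] by blast
 hence x: "x ~: K" using assms(2) by blast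
 thus ?thesis using K(1) C1c_grad_zero[OF K(1) x] unfolding C1c_def by blast
qed

text \<open>Passes from the restricted completed measure of the definitions to \<open>lborel\<close>
  and zero extensions, where all estimates are made.\<close>

lemma lebesgue_on_integral:
 fixes f :: "'a::euclidean_space => 'b::euclidean_space"
 assumes "open U" "(%x. indicator U x *R f x) : borel_measurable borel"
 shows "integral\<^sup>L (lebesgue_on U) f = (LBINT x. indicator U x *R f x)"
proof -
 have "integral\<^sup>L (lebesgue_on U) f = (\<integral>x. indicator U x *R f x \<partial>lebesgue)"
  by (rule integral_restrict_space) (use assms(1) in auto)
 also have "... = (LBINT x. indicator U x *R f x)" by (rule integral_completion) (use assms in auto)
 finally show ?thesis .
qed

lemma lebesgue_on_integrable:
 fixes f :: "'a::euclidean_space => 'b::euclidean_space"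
 assumes "open U" "(%x. indicator U x *R f x) : borel_measurable borel"
 shows "integrable (lebesgue_on U) f \<longleftrightarrow> integrable lborel (%x. indicator U x *R f x)"
proof -
 have "integrable (lebesgue_on U) f \<longleftrightarrow> integrable lebesgue (%x. indicator U x *R f x)"
  by (rule integrable_restrict_space) (use assms(1) in auto)
 also have "... \<longleftrightarrow> integrable lborel (%x. indicator U x *R f x)" by (rule integrable_completion) (use assms in auto)
 finally show ?thesis .
qed

text \<open>The quotients are nonnegative, so the infimum is a genuine lower bound and is itself
  nonnegative. Borel measurability identifies the \<open>lebesgue\<close> integrals in
  \<open>invK0\<close> with \<open>lborel\<close> ones.\<close>

lemma invK0_le:
 fixes u :: "'a::euclidean_space => real"
 assumes D: "D12 u g" and m: "u : borel_measurable borel" "g : borel_measurable borel"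
  and pos: "(LBINT x. \<bar>u x\<bar> powr crit DIM('a) 0) > 0"
 shows "0 <= invK0 TYPE('a)"
  "invK0 TYPE('a) * (LBINT x. \<bar>u x\<bar> powr crit DIM('a) 0) powr (2 / crit DIM('a) 0) <= (LBINT x. (norm (g x))^2)"
proof -
 let ?q = "crit DIM('a) 0"
 let ?r = "%u (g::'a => 'a). (integral\<^sup>L lebesgue (%x. (norm (g x))^2)) /
    (integral\<^sup>L lebesgue (%x. \<bar>u x\<bar> powr ?q)) powr (2 / ?q)"
 let ?S = "{?r u g | (u :: 'a => real) g. D12 u g & ~ (AE x in lebesgue. u x = 0)}"
 have 1: "integral\<^sup>L lebesgue (%x. \<bar>u x\<bar> powr ?q) = (LBINT x. \<bar>u x\<bar> powr ?q)"
  by (rule integral_completion) (use m in measurable)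
 have 2: "integral\<^sup>L lebesgue (%x. (norm (g x))^2) = (LBINT x. (norm (g x))^2)"
  by (rule integral_completion) (use m in measurable)
 have "~ (AE x in lebesgue. u x = 0)"
 proof
  assume "AE x in lebesgue. u x = 0"
  hence "AE x in lebesgue. \<bar>u x\<bar> powr ?q = 0" by auto
  hence "integral\<^sup>L lebesgue (%x. \<bar>u x\<bar> powr ?q) = 0" by (rule integral_eq_zero_AE)
  thus False using pos 1 by simp
 qed
 hence inS: "?r u g : ?S" using D by blast
 have lb: "0 <= r" if r: "r : ?S" for r
  using r by (elim CollectE exE conjE) simp
 have "bdd_below ?S" by (rule bdd_belowI[OF lb])
 from cInf_lower[OF inS this] have "Inf ?S <= ?r u g" .
 hence "invK0 TYPE('a) <= (LBINT x. (norm (g x))^2) / (LBINT x. \<bar>u x\<bar> powr ?q) powr (2 / ?q)"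
  unfolding invK0_def 1 2 .
 thus "invK0 TYPE('a) * (LBINT x. \<bar>u x\<bar> powr ?q) powr (2 / ?q) <= (LBINT x. (norm (g x))^2)"
  using pos by (simp add: pos_le_divide_eq)
 have "?S ~= {}" using inS by (metis (no_types, lifting) empty_iff)
 from cInf_greatest[OF this lb] have "0 <= Inf ?S" .
 thus "0 <= invK0 TYPE('a)" unfolding invK0_def .
qed

context pos_C1
begin

text \<open>The error splits into \<open>- c k x\<close> times \<open>gz x\<close>, which tends to 0
  by dominated convergence, and the truncated \<open>V\<close> times the gradient of the cutoff,
  which is \<open>annulus_tendsto\<close>.\<close>

lemma Gk_L2:
 assumes n: "DIM('a) >= 3" and i: "integrable lborel (%x. V x powr crit DIM('a) 0)"
  and ig: "integrable lborel (%x. (norm (gz x))^2)"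
 shows "integrable lborel (%x. (norm (Gk k x - gz x))^2)" "(%k. LBINT x. (norm (Gk k x - gz x))^2) ----> 0"
proof -
 note an = annulus_tendsto[OF n V_measurable nonneg i]
 define c where "c k x = 1 - cutf (real (Suc k)) x * trunc' (1 / real (Suc k)) (V x)" for k x
 have tb: "0 <= trunc' (1 / real (Suc k)) (V x)" "trunc' (1 / real (Suc k)) (V x) <= 1" for k x
  using trunc'_bounds[of "1 / real (Suc k)" "V x"] by auto
 have cb: "0 <= c k x" "c k x <= 1" for k x
 proof -
  have "cutf (real (Suc k)) x * trunc' (1 / real (Suc k)) (V x) <= 1 * 1"
   using cutf_bounds[of "real (Suc k)" x] tb[of k x] by (intro mult_mono) auto
  thus "0 <= c k x" by (simp add: c_def)
  have "0 <= cutf (real (Suc k)) x * trunc' (1 / real (Suc k)) (V x)"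
   using cutf_bounds[of "real (Suc k)" x] tb[of k x] by (intro mult_nonneg_nonneg) auto
  thus "c k x <= 1" by (simp add: c_def)
 qed
 define A where "A k x = (c k x)^2 * (norm (gz x))^2" for k x
 define B where "B k x = (V x)^2 * (norm (cutg (real (Suc k)) x))^2" for k x
 have cm: "(%x. c k x) : borel_measurable borel" for k
 proof -
  have "continuous_on UNIV (c k)" unfolding c_def[abs_def]
   by (intro continuous_intros C1c_cont[OF cutf_C1c] continuous_on_compose2[OF trunc'_cont[of _ UNIV]] cV) auto
  thus ?thesis by (rule cont_borel_measurable)
 qed
 have Am: "A k : borel_measurable lborel" for k unfolding A_def[abs_def] using cm[of k] gz_measurable by measurable
 have Ab: "A k x <= (norm (gz x))^2" for k x
  unfolding A_def using cb[of k x] by (intro mult_left_le_one_le) (auto simp: power_le_one)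
 have A0: "A k x >= 0" for k x unfolding A_def by simp
 have Ai: "integrable lborel (A k)" for k
  by (rule Bochner_Integration.integrable_bound[OF ig Am]) (use Ab A0 in auto)
 have Al: "(%k. integral\<^sup>L lborel (A k)) ----> integral\<^sup>L lborel (%x::'a. 0::real)"
 proof (rule integral_dominated_convergence[OF _ Am ig])
  show "AE x in lborel. (%k. A k x) ----> 0"
  proof (rule AE_I2)
   fix x
   show "(%k. A k x) ----> 0"
   proof (cases "x : U")
    case True
    have "(%k. c k x) ----> 1 - 1 * 1" unfolding c_def
     by (intro tendsto_intros cutf_tendsto trunc'_tendsto pos True)
    from tendsto_mult_right[OF tendsto_power[OF this, of 2], of "(norm (gz x))^2"] show ?thesis
     by (simp add: A_def)
   qed (simp add: A_def gz_def)
  qed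
 qed (use Ab A0 in auto)
 have Bi: "integrable lborel (B k)" for k using an(1)[of k] by (simp add: B_def[abs_def])
 have Bl: "(%k. integral\<^sup>L lborel (B k)) ----> 0" using an(2) by (simp add: B_def[abs_def])
 have bd: "(norm (Gk k x - gz x))^2 <= 2 * A k x + 2 * B k x" for k x
 proof -
  have eq: "Gk k x - gz x = (- c k x) *R gz x + trunc (1 / real (Suc k)) (V x) *R cutg (real (Suc k)) x"
   by (simp add: Gk_def c_def algebra_simps)
  have "(norm (Gk k x - gz x))^2 <= 2 * (norm ((- c k x) *R gz x))^2
    + 2 * (norm (trunc (1 / real (Suc k)) (V x) *R cutg (real (Suc k)) x))^2"
   unfolding eq by (rule norm_add_sq)
  also have "(norm ((- c k x) *R gz x))^2 = A k x" by (simp add: A_def power_mult_distrib)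
  also have "(norm (trunc (1 / real (Suc k)) (V x) *R cutg (real (Suc k)) x))^2 <= B k x"
  proof -
   have "\<bar>trunc (1 / real (Suc k)) (V x)\<bar> <= \<bar>V x\<bar>" using trunc_bounds[of "1 / real (Suc k)" "V x"] nonneg[of x] by auto
   hence "(trunc (1 / real (Suc k)) (V x))^2 <= (V x)^2" by (simp add: abs_le_square_iff)
   thus ?thesis unfolding B_def norm_scaleR power_mult_distrib power2_abs by (intro mult_right_mono) auto
  qed
  finally show ?thesis by simp
 qed
 have Gm: "(%x. (norm (Gk k x - gz x))^2) : borel_measurable lborel" for k
  using cont_borel_measurable[OF C1c_cont_grad[OF Wk_C1c[of k]]] gz_measurable by measurable
 have ABi: "integrable lborel (%x. 2 * A k x + 2 * B k x)" for k using Ai Bi by simp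
 show i1: "integrable lborel (%x. (norm (Gk k x - gz x))^2)" for k
 proof (rule Bochner_Integration.integrable_bound[OF ABi Gm])
  show "AE x in lborel. norm ((norm (Gk k x - gz x))^2) <= norm (2 * A k x + 2 * B k x)"
   using bd[of k] A0 by (auto simp: B_def)
 qed
 show "(%k. LBINT x. (norm (Gk k x - gz x))^2) ----> 0"
 proof (rule tendsto_sandwich[OF _ _ tendsto_const])
  show "(%k. 2 * integral\<^sup>L lborel (A k) + 2 * integral\<^sup>L lborel (B k)) ----> 0"
   using tendsto_add[OF tendsto_mult_left[OF Al, of 2] tendsto_mult_left[OF Bl, of 2]] by simp
  have "(LBINT x. (norm (Gk k x - gz x))^2) <= 2 * integral\<^sup>L lborel (A k) + 2 * integral\<^sup>L lborel (B k)" for k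
   using integral_mono[OF i1 ABi bd, of k] Ai[of k] Bi[of k] by simp
  thus "\<forall>\<^sub>F k in sequentially. (LBINT x. (norm (Gk k x - gz x))^2) <= 2 * integral\<^sup>L lborel (A k) + 2 * integral\<^sup>L lborel (B k)"
   by simp
 qed simp
qed

lemma D12_V:
 assumes n: "DIM('a) >= 3" and i: "integrable lborel (%x. V x powr crit DIM('a) 0)"
  and ig: "integrable lborel (%x. (norm (gz x))^2)"
 shows "D12 V gz"
proof -
 let ?q = "crit DIM('a) 0"
 have q: "?q > 0" using n by (simp add: crit_def)
 obtain ph where ph: "!!k. test_fun UNIV (ph k)"
  "(%k. LBINT x. (norm (grad (ph k) x - gz x))^2) ----> 0"
  "(%k. LBINT x. \<bar>ph k x - V x\<bar> powr ?q) ----> 0"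
  by (rule C1c_seq_test_approx[OF Wk_C1c subset_UNIV open_UNIV q V_measurable gz_measurable
     Gk_L2(1)[OF n i ig] Wk_powr_tendsto(1)[OF q i] Gk_L2(2)[OF n i ig] Wk_powr_tendsto(2)[OF q i]]) blast
 have [measurable]: "V : borel_measurable borel" "gz : borel_measurable borel" using V_measurable gz_measurable by auto
 have [measurable]: "ph k : borel_measurable borel" "grad (ph k) : borel_measurable borel" for k
  using test_fun_C1c[OF ph(1)[of k]] C1c_cont C1c_cont_grad cont_borel_measurable by metis+
 have e1: "integral\<^sup>L lebesgue (%x. (norm (grad (ph k) x - gz x))^2) = (LBINT x. (norm (grad (ph k) x - gz x))^2)" for k
  by (rule integral_completion) measurable
 have e2: "integral\<^sup>L lebesgue (%x. \<bar>ph k x - V x\<bar> powr ?q) = (LBINT x. \<bar>ph k x - V x\<bar> powr ?q)" for k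
  by (rule integral_completion) measurable
 show ?thesis unfolding D12_def
 proof (intro conjI exI[of _ ph] allI ph(1))
  show "V : borel_measurable lebesgue" "gz : borel_measurable lebesgue" by (auto intro: measurable_completion)
  have "integrable lebesgue (%x. \<bar>V x\<bar> powr ?q) \<longleftrightarrow> integrable lborel (%x. \<bar>V x\<bar> powr ?q)"
   by (rule integrable_completion) measurable
  thus "integrable lebesgue (%x. \<bar>V x\<bar> powr ?q)" using i nonneg by simp
  have "integrable lebesgue (%x. (norm (gz x))^2) \<longleftrightarrow> integrable lborel (%x. (norm (gz x))^2)"
   by (rule integrable_completion) measurable
  thus "integrable lebesgue (%x. (norm (gz x))^2)" using ig by simp
 qed (use ph e1 e2 in auto)
qed

text \<open>The critical integrability enters through the cutoff error in \<open>Gk_L2\<close>,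
  square integrability through the \<open>L^2\<close> part of \<open>H10\<close>. The pair
  \<open>u\<close>, \<open>h\<close> is compared with \<open>V\<close>, \<open>g\<close> on
  \<open>U\<close> only, since \<open>H10\<close> sees nothing else.\<close>

lemma H10_V:
 assumes n: "DIM('a) >= 3" and i: "integrable lborel (%x. V x powr crit DIM('a) 0)"
  and i2: "integrable lborel (%x. (V x)^2)"
  and ig: "integrable lborel (%x. (norm (gz x))^2)"
  and u: "!!x. x : U ==> u x = V x" "!!x. x : U ==> h x = g x"
 shows "H10 U u h"
proof -
 have p2: "V x powr 2 = (V x)^2" for x using nonneg[of x] by (cases "V x = 0") (auto simp: powr_numeral)
 have ap2: "\<bar>x\<bar> powr 2 = x^2" for x :: real by (cases "x = 0") (auto simp: powr_numeral)
 have i2': "integrable lborel (%x. V x powr 2)" using i2 p2 by simp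
 obtain ph where ph: "!!k. test_fun U (ph k)"
  "(%k. LBINT x. (norm (grad (ph k) x - gz x))^2) ----> 0"
  "(%k. LBINT x. \<bar>ph k x - V x\<bar> powr 2) ----> 0"
  by (rule C1c_seq_test_approx[OF Wk_C1c Sk_U U _ V_measurable gz_measurable
     Gk_L2(1)[OF n i ig] Wk_powr_tendsto(1)[OF _ i2'] Gk_L2(2)[OF n i ig] Wk_powr_tendsto(2)[OF _ i2']]) auto
 have [measurable]: "V : borel_measurable borel" "gz : borel_measurable borel" using V_measurable gz_measurable by auto
 have [measurable]: "ph k : borel_measurable borel" "grad (ph k) : borel_measurable borel" for k
  using test_fun_C1c[OF ph(1)[of k]] C1c_cont C1c_cont_grad cont_borel_measurable by metis+
 have [measurable]: "U : sets borel" using U by auto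
 have r1: "(%x. indicator U x *R (norm (grad (ph k) x - h x))^2) = (%x. (norm (grad (ph k) x - gz x))^2)" for k
  using u test_fun_zero[OF ph(1)[of k]] by (auto simp: indicator_def gz_def)
 have r2: "(%x. indicator U x *R (ph k x - u x)^2) = (%x. (ph k x - V x)^2)" for k
  using u zero test_fun_zero[OF ph(1)[of k]] by (auto simp: indicator_def)
 have r3: "(%x. indicator U x *R (u x)^2) = (%x. (V x)^2)" using u zero by (auto simp: indicator_def)
 have r4: "(%x. indicator U x *R (norm (h x))^2) = (%x. (norm (gz x))^2)" using u by (auto simp: indicator_def gz_def)
 have r5: "(%x. indicator U x *R u x) = V" using u zero by (auto simp: indicator_def)
 have r6: "(%x. indicator U x *R h x) = gz" using u by (auto simp: indicator_def gz_def)
 have s: "U Int space lebesgue : sets lebesgue" using U by auto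
 show ?thesis unfolding H10_def
 proof (intro conjI exI[of _ ph] allI ph(1))
  show "u : borel_measurable (lebesgue_on U)"
   using borel_measurable_restrict_space_iff[OF s, of u] r5 by (simp add: measurable_completion)
  show "h : borel_measurable (lebesgue_on U)"
   using borel_measurable_restrict_space_iff[OF s, of h] r6 by (simp add: measurable_completion)
  show "integrable (lebesgue_on U) (%x. (u x)^2)"
   by (subst lebesgue_on_integrable[OF U]; unfold r3) (use i2 in \<open>auto\<close>)
  show "integrable (lebesgue_on U) (%x. (norm (h x))^2)"
   by (subst lebesgue_on_integrable[OF U]; unfold r4) (use ig in \<open>auto\<close>)
  have "integral\<^sup>L (lebesgue_on U) (%x. (norm (grad (ph k) x - h x))^2) = (LBINT x. (norm (grad (ph k) x - gz x))^2)" for k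
   by (subst lebesgue_on_integral[OF U]; unfold r1) auto
  thus "(%k. integral\<^sup>L (lebesgue_on U) (%x. (norm (grad (ph k) x - h x))^2)) ----> 0" using ph(2) by simp
  have "integral\<^sup>L (lebesgue_on U) (%x. (ph k x - u x)^2) = (LBINT x. \<bar>ph k x - V x\<bar> powr 2)" for k
   by (subst lebesgue_on_integral[OF U]; unfold r2 ap2) auto
  thus "(%k. integral\<^sup>L (lebesgue_on U) (%x. (ph k x - u x)^2)) ----> 0" using ph(3) by simp
 qed
qed

text \<open>The equation is tested with \<open>Wk\<close>, an approximation of \<open>V\<close>
  itself, and the limit is taken on the gradient side alone. The behaviour of \<open>F\<close> at
  the frontier is left to each application, which may use dominated or monotone convergence.\<close>

lemma energy_limit:
 assumes n: "DIM('a) >= 3" and i: "integrable lborel (%x. V x powr crit DIM('a) 0)"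
  and ig: "integrable lborel (%x. (norm (gz x))^2)"
  and weak: "!!f h S. C1c f h S ==> S <= U ==> (LBINT x. h x \<bullet> g x) = (LBINT x. f x * F x)"
 shows "(%k. LBINT x. Wk k x * F x) ----> (LBINT x. (norm (gz x))^2)"
proof -
 have [measurable]: "gz : borel_measurable borel" "Gk k : borel_measurable borel" for k
  using gz_measurable cont_borel_measurable[OF C1c_cont_grad[OF Wk_C1c[of k]]] by auto
 have "(%k. LBINT x. (Gk k x - gz x) \<bullet> gz x) ----> 0"
  by (rule L2_inner_tendsto_zero[OF _ _ Gk_L2(1)[OF n i ig] ig Gk_L2(2)[OF n i ig]]) auto
 moreover have "(LBINT x. (Gk k x - gz x) \<bullet> gz x) = (LBINT x. Wk k x * F x) - (LBINT x. (norm (gz x))^2)" for k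
 proof -
  have eq: "Gk k x \<bullet> g x = Gk k x \<bullet> gz x" for x
   using C1c_grad_zero[OF Wk_C1c, of x k] Sk_U[of k] by (cases "x : Sk k") (auto simp: gz_def)
  have i1: "integrable lborel (%x. (Gk k x - gz x) \<bullet> gz x)"
   by (rule L2_integrable_inner[OF _ _ Gk_L2(1)[OF n i ig] ig]) auto
  have i2: "integrable lborel (%x. gz x \<bullet> gz x)" using ig by (simp add: power2_norm_eq_inner)
  have "(LBINT x. Wk k x * F x) = (LBINT x. Gk k x \<bullet> gz x)"
   using weak[OF Wk_C1c Sk_U, of k] eq by simp
  also have "... = (LBINT x. (Gk k x - gz x) \<bullet> gz x + gz x \<bullet> gz x)" by (simp add: inner_diff_left)
  also have "... = (LBINT x. (Gk k x - gz x) \<bullet> gz x) + (LBINT x. gz x \<bullet> gz x)"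
   by (rule Bochner_Integration.integral_add[OF i1 i2])
  finally show ?thesis by (simp add: power2_norm_eq_inner)
 qed
 ultimately show ?thesis using LIM_zero_cancel by simp
qed

lemma energy_powr:
 assumes n: "DIM('a) >= 3" and i: "integrable lborel (%x. V x powr crit DIM('a) 0)"
  and ig: "integrable lborel (%x. (norm (gz x))^2)"
  and weak: "!!f h S. C1c f h S ==> S <= U ==>
    (LBINT x. h x \<bullet> g x) = (LBINT x. f x * V x powr (crit DIM('a) 0 - 1))"
 shows "(LBINT x. (norm (gz x))^2) = (LBINT x. V x powr crit DIM('a) 0)"
proof -
 let ?q = "crit DIM('a) 0"
 have vq: "V x * V x powr (?q - 1) = V x powr ?q" for x
  using nonneg[of x] by (cases "V x = 0") (auto simp: powr_diff)
 have [measurable]: "V : borel_measurable borel" "Wk k : borel_measurable borel" for k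
  using V_measurable cont_borel_measurable[OF C1c_cont[OF Wk_C1c[of k]]] by auto
 have "(%k. LBINT x. Wk k x * V x powr (?q - 1)) ----> (LBINT x. V x powr ?q)"
 proof (rule integral_dominated_convergence[OF _ _ i])
  show "AE x in lborel. (%k. Wk k x * V x powr (?q - 1)) ----> V x powr ?q"
   using tendsto_mult_right[OF Wk_tendsto] by (auto simp: vq[symmetric])
  show "AE x in lborel. norm (Wk k x * V x powr (?q - 1)) <= V x powr ?q" for k
   using Wk_bounds[of k] by (auto simp: vq[symmetric] abs_mult intro!: mult_right_mono)
 qed measurable
 moreover have "(%k. LBINT x. Wk k x * V x powr (?q - 1)) ----> (LBINT x. (norm (gz x))^2)"
  by (rule energy_limit[OF n i ig]) (rule weak)
 ultimately show ?thesis using LIMSEQ_unique by blast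
qed

text \<open>The extension of \<open>V\<close> by zero has weak gradient \<open>gz\<close> on the
  whole space, with no contribution from the frontier of \<open>U\<close>: each \<open>Wk\<close>
  vanishes near it, and both sides of Green's identity for \<open>Wk\<close> converge.\<close>

lemma weak_lap_test:
 assumes n: "DIM('a) >= 3" and i: "integrable lborel (%x. V x powr crit DIM('a) 0)"
  and ig: "integrable lborel (%x. (norm (gz x))^2)" and ph: "test_fun UNIV ph"
 shows "(LBINT x. V x * lap ph x) = (LBINT x. gz x \<bullet> grad ph x)"
proof -
 obtain K where K: "compact K" "!!x. x ~: K ==> ph x = 0" using ph unfolding test_fun_def by blast
 have c: "Ck m UNIV ph" for m using ph unfolding test_fun_def smooth_on_def by blast
 have C: "C1c ph (grad ph) K" by (rule Ck1_C1c[OF c K])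
 have cl: "continuous_on UNIV (lap ph)" unfolding lap_def[abs_def] using c[of "Suc (Suc 0)"] by (intro continuous_intros) auto
 have zl: "lap ph x = 0" if "x ~: K" for x
  unfolding lap_def using pd_compact_support[OF K(1) pd_compact_support[OF K] that] by simp
 have [measurable]: "V : borel_measurable borel" "Wk k : borel_measurable borel" "lap ph : borel_measurable borel"
  "gz : borel_measurable borel" "Gk k : borel_measurable borel" "grad ph : borel_measurable borel" for k
  using V_measurable cont_borel_measurable[OF C1c_cont[OF Wk_C1c[of k]]] cont_borel_measurable[OF cl]
   gz_measurable cont_borel_measurable[OF C1c_cont_grad[OF Wk_C1c[of k]]] cont_borel_measurable[OF C1c_cont_grad[OF C]] by auto
 have iV: "integrable lborel (%x. V x * \<bar>lap ph x\<bar>)"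
  by (rule integrable_cont_compact[OF K(1)])
   (use zl in \<open>auto intro!: continuous_intros continuous_on_subset[OF cV] continuous_on_subset[OF cl]\<close>)
 have l1: "(%k. LBINT x. Wk k x * lap ph x) ----> (LBINT x. V x * lap ph x)"
 proof (rule integral_dominated_convergence[OF _ _ iV])
  show "AE x in lborel. (%k. Wk k x * lap ph x) ----> V x * lap ph x"
   using tendsto_mult_right[OF Wk_tendsto] by auto
  show "AE x in lborel. norm (Wk k x * lap ph x) <= V x * \<bar>lap ph x\<bar>" for k
   using Wk_bounds[of k] by (auto simp: abs_mult intro!: mult_right_mono)
 qed measurable
 have ip: "integrable lborel (%x. (norm (grad ph x))^2)"
  by (rule integrable_cont_compact[OF K(1)])
   (use C1c_grad_zero[OF C] in \<open>auto intro!: continuous_intros C1c_cont_grad[OF C]\<close>)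
 have "(%k. LBINT x. (Gk k x - gz x) \<bullet> grad ph x) ----> 0"
  by (rule L2_inner_tendsto_zero[OF _ _ Gk_L2(1)[OF n i ig] ip Gk_L2(2)[OF n i ig]]) auto
 moreover have "(LBINT x. (Gk k x - gz x) \<bullet> grad ph x) = (LBINT x. Wk k x * lap ph x) - (LBINT x. gz x \<bullet> grad ph x)" for k
 proof -
  have i1: "integrable lborel (%x. (Gk k x - gz x) \<bullet> grad ph x)"
   by (rule L2_integrable_inner[OF _ _ Gk_L2(1)[OF n i ig] ip]) auto
  have i2: "integrable lborel (%x. gz x \<bullet> grad ph x)" by (rule L2_integrable_inner[OF _ _ ig ip]) auto
  have "(LBINT x. Wk k x * lap ph x) = (LBINT x. Gk k x \<bullet> grad ph x)"
   using green_identity[OF Wk_C1c open_UNIV subset_UNIV c] by simp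
  also have "... = (LBINT x. (Gk k x - gz x) \<bullet> grad ph x + gz x \<bullet> grad ph x)" by (simp add: inner_diff_left)
  also have "... = (LBINT x. (Gk k x - gz x) \<bullet> grad ph x) + (LBINT x. gz x \<bullet> grad ph x)"
   by (rule Bochner_Integration.integral_add[OF i1 i2])
  finally show ?thesis by simp
 qed
 ultimately have "(%k. LBINT x. Wk k x * lap ph x) ----> (LBINT x. gz x \<bullet> grad ph x)" using LIM_zero_cancel by simp
 thus ?thesis using LIMSEQ_unique[OF l1] by blast
qed

lemma D12_add_test:
 assumes n: "DIM('a) >= 3" and D: "D12 V gz" and ph: "test_fun UNIV ph"
 shows "D12 (%x. V x + t * ph x) (%x. gz x + t *R grad ph x)"
proof -
 let ?q = "crit DIM('a) 0"
 have q: "?q > 0" using n by (simp add: crit_def)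
 obtain K where C: "C1c ph (grad ph) K" using test_fun_C1c[OF ph] by blast
 have K: "compact K" "!!x. x ~: K ==> ph x = 0" using C by (auto simp: C1c_def)
 obtain f where f: "!!k. test_fun UNIV (f k)"
  "(%k. integral\<^sup>L lebesgue (%x. (norm (grad (f k) x - gz x))^2)) ----> 0"
  "(%k. integral\<^sup>L lebesgue (%x. \<bar>f k x - V x\<bar> powr ?q)) ----> 0"
  and iV: "integrable lebesgue (%x. \<bar>V x\<bar> powr ?q)" and ig: "integrable lebesgue (%x. (norm (gz x))^2)"
  using D unfolding D12_def by blast
 have mb: "V : borel_measurable borel" "gz : borel_measurable borel" "ph : borel_measurable borel" "grad ph : borel_measurable borel"
  using V_measurable gz_measurable cont_borel_measurable[OF C1c_cont[OF C]] cont_borel_measurable[OF C1c_cont_grad[OF C]] by auto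
 have m[measurable]: "V : borel_measurable lebesgue" "gz : borel_measurable lebesgue" "ph : borel_measurable lebesgue" "grad ph : borel_measurable lebesgue"
  using mb by (auto intro: measurable_completion)
 define h where "h k x = f k x + t * ph x" for k x
 have gh: "grad (h k) x = grad (f k) x + t *R grad ph x" for k x
 proof (rule GDERIV_grad)
  obtain L where "C1c (f k) (grad (f k)) L" using test_fun_C1c[OF f(1)] by blast
  thus "GDERIV (h k) x :> grad (f k) x + t *R grad ph x"
   unfolding h_def[abs_def] using C by (intro GDERIV_add GDERIV_cmult) (auto simp: C1c_def)
 qed
 have th: "test_fun UNIV (h k)" for k
 proof -
  obtain L where L: "compact L" "!!x. x ~: L ==> f k x = 0" using f(1)[of k] unfolding test_fun_def by blast
  have "Ck m UNIV (h k)" for m unfolding h_def[abs_def]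
   using f(1)[of k] ph unfolding test_fun_def smooth_on_def by (intro Ck_add Ck_mult Ck_const) auto
  moreover have "compact (L Un K)" "!!x. x ~: L Un K ==> h k x = 0" using L K by (auto simp: h_def)
  ultimately show ?thesis unfolding test_fun_def smooth_on_def by blast
 qed
 have ip: "integrable lebesgue (%x. \<bar>ph x\<bar> powr ?q)" "integrable lebesgue (%x. (norm (grad ph x))^2)"
 proof -
  have "integrable lborel (%x. \<bar>ph x\<bar> powr ?q)"
  proof (rule integrable_cont_compact[OF K(1)])
   show "continuous_on K (%x. \<bar>ph x\<bar> powr ?q)"
    using q by (intro continuous_on_powr' continuous_intros C1c_cont[OF C]) auto
  qed (use K q in auto)
  thus "integrable lebesgue (%x. \<bar>ph x\<bar> powr ?q)" by (subst integrable_completion) (use mb in measurable)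
  have "integrable lborel (%x. (norm (grad ph x))^2)"
   by (rule integrable_cont_compact[OF K(1)]) (use C1c_grad_zero[OF C] in \<open>auto intro!: continuous_intros C1c_cont_grad[OF C]\<close>)
  thus "integrable lebesgue (%x. (norm (grad ph x))^2)" by (subst integrable_completion) (use mb in measurable)
 qed
 show ?thesis unfolding D12_def
 proof (intro conjI exI[of _ h] allI th)
  show "(%x. V x + t * ph x) : borel_measurable lebesgue" "(%x. gz x + t *R grad ph x) : borel_measurable lebesgue"
   by measurable
  show "integrable lebesgue (%x. \<bar>V x + t * ph x\<bar> powr ?q)"
  proof (rule Bochner_Integration.integrable_bound)
   show "integrable lebesgue (%x. 2 powr ?q * (\<bar>V x\<bar> powr ?q + \<bar>t\<bar> powr ?q * \<bar>ph x\<bar> powr ?q))"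
    using iV ip(1) by simp
   have "\<bar>V x + t * ph x\<bar> powr ?q <= 2 powr ?q * (\<bar>V x\<bar> powr ?q + \<bar>t\<bar> powr ?q * \<bar>ph x\<bar> powr ?q)" for x
    using powr_add_bound[OF q, of "V x" "t * ph x"] by (simp add: abs_mult powr_mult)
   thus "AE x in lebesgue. norm (\<bar>V x + t * ph x\<bar> powr ?q) <= norm (2 powr ?q * (\<bar>V x\<bar> powr ?q + \<bar>t\<bar> powr ?q * \<bar>ph x\<bar> powr ?q))"
    by (intro AE_I2) (auto intro: order_trans)
  qed measurable
  show "integrable lebesgue (%x. (norm (gz x + t *R grad ph x))^2)"
  proof (rule Bochner_Integration.integrable_bound)
   show "integrable lebesgue (%x. 2 * (norm (gz x))^2 + 2 * (t^2 * (norm (grad ph x))^2))" using ig ip(2) by simp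
   have "(norm (gz x + t *R grad ph x))^2 <= 2 * (norm (gz x))^2 + 2 * (t^2 * (norm (grad ph x))^2)" for x
    using norm_add_sq[of "gz x" "t *R grad ph x"] by (simp add: power_mult_distrib)
   thus "AE x in lebesgue. norm ((norm (gz x + t *R grad ph x))^2) <= norm (2 * (norm (gz x))^2 + 2 * (t^2 * (norm (grad ph x))^2))"
    by (intro AE_I2) (auto intro: order_trans)
  qed measurable
  show "(%k. integral\<^sup>L lebesgue (%x. (norm (grad (h k) x - (gz x + t *R grad ph x)))^2)) ----> 0"
   using f(2) by (simp add: gh)
  show "(%k. integral\<^sup>L lebesgue (%x. \<bar>h k x - (V x + t * ph x)\<bar> powr ?q)) ----> 0"
   using f(3) by (simp add: h_def)
 qed
qed

text \<open>A minimizer of the Sobolev quotient is superharmonic: adding a nonnegative perturbation does not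
 decrease the denominator, so it cannot decrease the numerator to first order.\<close>
lemma minimizer_superharmonic:
 assumes n: "DIM('a) >= 3" and i: "integrable lborel (%x. V x powr crit DIM('a) 0)"
  and ig: "integrable lborel (%x. (norm (gz x))^2)"
  and pos: "(LBINT x. V x powr crit DIM('a) 0) > 0"
  and min: "(LBINT x. (norm (gz x))^2) <= invK0 TYPE('a) * (LBINT x. V x powr crit DIM('a) 0) powr (2 / crit DIM('a) 0)"
  and ph: "test_fun UNIV ph" "!!x. ph x >= 0"
 shows "0 <= (LBINT x. gz x \<bullet> grad ph x)"
proof -
 let ?q = "crit DIM('a) 0"
 have q: "?q > 0" using n by (simp add: crit_def)
 note D = D12_V[OF n i ig]
 obtain K where C: "C1c ph (grad ph) K" using test_fun_C1c[OF ph(1)] by blast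
 have K: "compact K" "!!x. x ~: K ==> ph x = 0" using C by (auto simp: C1c_def)
 have [measurable]: "V : borel_measurable borel" "gz : borel_measurable borel" "ph : borel_measurable borel" "grad ph : borel_measurable borel"
  using V_measurable gz_measurable cont_borel_measurable[OF C1c_cont[OF C]] cont_borel_measurable[OF C1c_cont_grad[OF C]] by auto
 have ip: "integrable lborel (%x. (norm (grad ph x))^2)"
  by (rule integrable_cont_compact[OF K(1)]) (use C1c_grad_zero[OF C] in \<open>auto intro!: continuous_intros C1c_cont_grad[OF C]\<close>)
 have ix: "integrable lborel (%x. gz x \<bullet> grad ph x)" by (rule L2_integrable_inner[OF _ _ ig ip]) auto
 define A where "A = (LBINT x. gz x \<bullet> grad ph x)"
 define B where "B = (LBINT x. (norm (grad ph x))^2)"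
 \<comment> \<open>Comparison of \<open>V\<close> with \<open>V + t * ph\<close> gives
   \<open>0 <= 2 * t * A + t^2 * B\<close>. After division by \<open>t\<close>, letting
   \<open>t\<close> decrease to 0 leaves the first variation \<open>A\<close>.\<close>
 have ge: "0 <= 2 * A + t * B" if t: "t > 0" for t
 proof -
  have D': "D12 (%x. V x + t * ph x) (%x. gz x + t *R grad ph x)" by (rule D12_add_test[OF n D ph(1)])
  have "integrable lebesgue (%x. \<bar>V x + t * ph x\<bar> powr ?q)" using D' unfolding D12_def by blast
  hence i': "integrable lborel (%x. \<bar>V x + t * ph x\<bar> powr ?q)" by (subst (asm) integrable_completion) auto
  have le: "(LBINT x. V x powr ?q) <= (LBINT x. \<bar>V x + t * ph x\<bar> powr ?q)"
   by (rule integral_mono[OF i i'], rule powr_mono2) (use q nonneg ph(2) t in auto)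
  have pos': "0 < (LBINT x. \<bar>V x + t * ph x\<bar> powr ?q)" using le pos by linarith
  note K = invK0_le[OF D' _ _ pos']
  have "(LBINT x. (norm (gz x))^2) <= invK0 TYPE('a) * (LBINT x. V x powr ?q) powr (2 / ?q)" by (rule min)
  also have "... <= invK0 TYPE('a) * (LBINT x. \<bar>V x + t * ph x\<bar> powr ?q) powr (2 / ?q)"
   using le pos q K(1) by (intro mult_left_mono powr_mono2) auto
  also have "... <= (LBINT x. (norm (gz x + t *R grad ph x))^2)" by (rule K(2)) auto
  also have "(%x. (norm (gz x + t *R grad ph x))^2) = (%x. (norm (gz x))^2 + (2 * t * (gz x \<bullet> grad ph x) + t^2 * (norm (grad ph x))^2))"
   unfolding power2_norm_eq_inner by (simp add: inner_add_left inner_add_right inner_commute power2_eq_square algebra_simps)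
  also have "integral\<^sup>L lborel ... = (LBINT x. (norm (gz x))^2) + (2 * t * A + t^2 * B)"
   unfolding A_def B_def using ig ix ip by simp
  finally have "0 <= t * (2 * A + t * B)" by (simp add: algebra_simps power2_eq_square)
  thus ?thesis using t by (simp add: zero_le_mult_iff)
 qed
 have "((%t. 2 * A + t * B) \<longlongrightarrow> 2 * A + 0 * B) (at_right 0)" by (intro tendsto_intros)
 moreover have "\<forall>\<^sub>F t in at_right 0. 0 <= 2 * A + t * B"
  using eventually_at_right_less[of "0::real"] by eventually_elim (rule ge)
 ultimately have "0 <= 2 * A + 0 * B" by (intro tendsto_lowerbound) auto
 thus ?thesis by (simp add: A_def)
qed

end

section \<open>Laplacians of mollifications\<close>

lemma open_affine_preimage: "open U ==> open {y. c + a *R y : U}" for c :: "'a::euclidean_space"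
 by (rule open_vimage[of U "%y. c + a *R y", unfolded vimage_def]) (auto intro!: continuous_intros)

lemma Ck_affine_on:
 fixes f :: "'a::euclidean_space => real"
 assumes U: "open U"
 shows "Ck k U f ==> Ck k {x. c + a *R x : U} (%x. f (c + a *R x))"
proof (induction k arbitrary: f)
 case 0
 thus ?case by (auto intro!: continuous_on_compose2[of U f] continuous_intros)
next
 case (Suc k)
 have o: "open {x. c + a *R x : U}" by (rule open_affine_preimage[OF U])
 show ?case
 proof (rule Ck_Suc_I[OF o])
  show "GDERIV (%x. f (c + a *R x)) x :> a *R grad f (c + a *R x)" if "x : {x. c + a *R x : U}" for x
   using GDERIV_affine Ck_GDERIV[OF Suc.prems] that by blast
  show "Ck k {x. c + a *R x : U} (%x. b \<bullet> (a *R grad f (c + a *R x)))" if b: "b : Basis" for b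
  proof -
   have "Ck k {x. c + a *R x : U} (%x. a * pd b f (c + a *R x))"
    using Suc.prems b by (intro Ck_mult Ck_const Suc.IH o) auto
   thus ?thesis using b by (simp add: inner_grad_pd)
  qed
 qed
qed
lemma pd_reflect:
 assumes "Ck (Suc 0) UNIV f" shows "pd b (%y. f (x - y)) y = - pd b f (x - y)"
proof -
 have "GDERIV f (x + (-1) *R y) :> grad f (x + (-1) *R y)" using Ck_GDERIV[OF assms] by blast
 from GDERIV_affine[OF this] have "GDERIV (%y. f (x - y)) y :> - grad f (x - y)" by simp
 moreover have "GDERIV f (x - y) :> grad f (x - y)" using Ck_GDERIV[OF assms] by blast
 ultimately show ?thesis using GDERIV_pd by (metis inner_minus_right)
qed

lemma pd_uminus:
 assumes "Ck (Suc 0) UNIV f" shows "pd b (%y. - f y) y = - pd b f y"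
proof -
 have d: "GDERIV f y :> grad f y" using Ck_GDERIV[OF assms] by blast
 show ?thesis using GDERIV_pd[OF GDERIV_minus[OF d]] GDERIV_pd[OF d] by (metis inner_minus_right)
qed

lemma lap_reflect:
 assumes k: "Ck (Suc (Suc 0)) UNIV k" shows "lap (%y. k (x - y)) y = lap k (x - y)"
proof -
 have "pd b (pd b (%y. k (x - y))) y = pd b (pd b k) (x - y)" if b: "b : Basis" for b
 proof -
  have k1: "Ck (Suc 0) UNIV k" using Ck_SucD[OF k] .
  have kb: "Ck (Suc 0) UNIV (pd b k)" using k b by simp
  have kr: "Ck (Suc 0) UNIV (%y. pd b k (x - y))" using Ck_affine_on[OF open_UNIV kb, of x "-1"] by simp
  have "pd b (%y. k (x - y)) = (%y. - pd b k (x - y))" using pd_reflect[OF k1] by auto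
  thus ?thesis using pd_uminus[OF kr] pd_reflect[OF kb] by simp
 qed
 thus ?thesis by (simp add: lap_def)
qed

lemma test_fun_reflect:
 assumes "!!m. Ck m UNIV k" "!!z. z ~: cball 0 d ==> k z = 0"
 shows "test_fun UNIV (%y. k (x - y))"
proof -
 have "Ck m UNIV (%y. k (x - y))" for m using Ck_affine_on[OF open_UNIV assms(1), of m x "-1"] by simp
 moreover have "k (x - y) = 0" if "y ~: cball x d" for y
  by (rule assms(2)) (use that in \<open>simp add: dist_norm norm_minus_commute\<close>)
 ultimately show ?thesis unfolding test_fun_def smooth_on_def using compact_cball by blast
qed

lemma pd_conv_fun:
 assumes "integrable lborel f" "Ck (Suc 0) UNIV k" "compact K" "!!x. x ~: K ==> k x = 0" "b : Basis"
 shows "pd b (conv f k) = conv f (pd b k)"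
 using conv_pd[OF assms] by auto

lemma lap_conv:
 assumes f: "integrable lborel f" and k: "Ck (Suc (Suc 0)) UNIV k" "compact K" "!!x. x ~: K ==> k x = 0"
 shows "lap (conv f k) x = conv f (lap k) x"
proof -
 have z: "pd b k x = 0" "pd b (pd b k) x = 0" if "x ~: K" for b x
  using pd_compact_support[OF k(2,3) that] pd_compact_support[OF k(2) pd_compact_support[OF k(2,3)] that] by auto
 have "pd b (pd b (conv f k)) x = conv f (pd b (pd b k)) x" if b: "b : Basis" for b
 proof -
  have "pd b (conv f k) = conv f (pd b k)" by (rule pd_conv_fun[OF f Ck_SucD[OF k(1)] k(2,3) b])
  moreover have "pd b (conv f (pd b k)) = conv f (pd b (pd b k))"
   by (rule pd_conv_fun[OF f _ k(2) _ b]) (use k(1) b z in auto)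
  ultimately show ?thesis by simp
 qed
 hence "lap (conv f k) x = - (SUM b:Basis. LBINT y. f y * pd b (pd b k) (x - y))"
  by (simp add: lap_def conv_def)
 also have "... = - (LBINT y. (SUM b:Basis. f y * pd b (pd b k) (x - y)))"
 proof -
  have "integrable lborel (%y. f y * pd b (pd b k) (x - y))" if "b : Basis" for b
  proof -
   have "integrable lborel (%y. f y *R pd b (pd b k) (x - y))"
    by (rule integrable_conv[OF f _ k(2)]) (use k(1) that z in auto)
   thus ?thesis by simp
  qed
  thus ?thesis by (simp add: Bochner_Integration.integral_sum)
 qed
 also have "... = conv f (lap k) x" unfolding conv_def
  by (subst Bochner_Integration.integral_minus[symmetric]) (simp add: lap_def sum_distrib_left)
 finally show ?thesis .
qed

lemma cutf_mult_integrable: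
 assumes "continuous_on UNIV (f::'a::euclidean_space => real)" "R > 0"
 shows "integrable lborel (%y. f y * cutf R y)"
proof (rule integrable_cont_compact[of "cball 0 (2 * R)"])
 show "continuous_on (cball 0 (2 * R)) (%y. f y * cutf R y)"
  by (intro continuous_intros continuous_on_subset[OF assms(1)] C1c_cont[OF cutf_C1c[OF assms(2)]]) auto
 show "f y * cutf R y = 0" if "y ~: cball 0 (2 * R)" for y
  using cutf_zero[OF assms(2), of y] that by auto
qed auto

lemma lap_compact_support:
 assumes "compact K" "!!x. x ~: K ==> f x = 0" "x ~: K"
 shows "lap f x = 0"
proof -
 have "pd b f z = 0" if "z ~: K" for b z by (rule pd_compact_support[OF assms(1) _ that]) (rule assms(2))
 hence "pd b (pd b f) x = 0" for b by (intro pd_compact_support[OF assms(1) _ assms(3)])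
 thus ?thesis by (simp add: lap_def)
qed

text \<open>The cutoff makes \<open>V\<close> integrable, and it equals 1 on the support of
  \<open>y\<close> mapped to \<open>k (x - y)\<close>, so it disappears from the integral.\<close>

lemma lap_conv_local:
 fixes V :: "'a::euclidean_space => real"
 assumes V: "continuous_on UNIV V" and k: "!!m. Ck m UNIV k" "!!z. z ~: cball 0 d ==> k z = 0"
  and R: "R > 0" "norm x + d <= R"
 shows "lap (conv (%y. V y * cutf R y) k) x = (LBINT y. V y * lap (%y. k (x - y)) y)"
proof -
 have "lap (conv (%y. V y * cutf R y) k) x = conv (%y. V y * cutf R y) (lap k) x"
  by (rule lap_conv[OF cutf_mult_integrable[OF V R(1)] k(1) compact_cball k(2)])
 also have "... = (LBINT y. V y * lap (%y. k (x - y)) y)"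
  unfolding conv_def
 proof (intro Bochner_Integration.integral_cong refl)
  fix y
  show "V y * cutf R y * lap k (x - y) = V y * lap (%y. k (x - y)) y"
  proof (cases "x - y : cball 0 d")
   case True
   have "norm y <= norm x + norm (x - y)" using norm_triangle_sub[of y x] by (simp add: norm_minus_commute)
   also have "... <= R" using True R by simp
   finally have "cutf R y = 1" using cutf_one[OF R(1)] by blast
   thus ?thesis by (simp add: lap_reflect[OF k(1)])
  next
   case False
   hence "lap k (x - y) = 0" by (intro lap_compact_support[OF compact_cball k(2)])
   thus ?thesis by (simp add: lap_reflect[OF k(1)])
  qed
 qed
 finally show ?thesis .
qed

lemma conv_moll_ge:
 assumes f: "integrable lborel f" and d: "d > 0" and c: "!!y. y : cball x d ==> f y >= c"
 shows "conv f (moll d) x >= c"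
proof -
 have m: "moll d : borel_measurable borel" by (intro cont_borel_measurable moll_cont d)
 have mi: "integrable lborel (%y. moll d (x - y))"
  by (rule integrable_cont_compact[of "cball x d"])
   (auto intro!: moll_zero d continuous_on_compose2[OF moll_cont[OF d, of UNIV]] continuous_intros simp: dist_norm norm_minus_commute)
 have i: "integrable lborel (%y. f y * moll d (x - y))"
  using integrable_conv[OF f moll_cont[OF d] compact_cball[of 0 d] moll_zero[OF d]] by simp
 have one: "(LBINT y. moll d (x - y)) = 1"
  using lborel_integral_reflect[OF m, of x] moll_integral[OF d] by simp
 have "0 <= (LBINT y. (f y - c) * moll d (x - y))"
 proof (rule integral_nonneg_AE, rule AE_I2)
  fix y show "0 <= (f y - c) * moll d (x - y)"
   using c[of y] moll_nonneg[OF d, of "x - y"] moll_zero[OF d, of "x - y"]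
   by (cases "y : cball x d") (auto simp: dist_norm norm_minus_commute)
 qed
 also have "... = conv f (moll d) x - c" unfolding conv_def using i mi one by (simp add: left_diff_distrib)
 finally show ?thesis by simp
qed

section \<open>Positivity of superharmonic functions\<close>

text \<open>Since \<open>V\<close> is superharmonic only in the weak sense, its mollifications are
  compared with a truncated fundamental solution on an annulus. The mollification radius then tends
  to 0, and after that the outer radius tends to infinity.\<close>

lemma superharmonic_lower_bound:
 fixes V :: "'a::euclidean_space => real"
 assumes n: "DIM('a) >= 3" and cV: "continuous_on UNIV V" and V0: "!!x. V x >= 0"
  and sh: "!!ph. test_fun UNIV ph ==> (!!x. ph x >= 0) ==> 0 <= (LBINT x. V x * lap ph x)"
  and r: "r > 0" "m > 0" "!!y. norm y <= 2 * r ==> V y >= m"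
 shows "EX c>0. ALL y. norm y >= r --> V y >= c * norm y powr (2 - real DIM('a))"
proof -
 let ?n = "real DIM('a)"
 have n3: "?n >= 3" using n by simp
 \<comment> \<open>As a power of the squared norm, \<open>2 * a = 2 - n\<close> is the fundamental
   solution: its Laplacian has the factor \<open>4 * (a - 1) + 2 * n = 0\<close>.\<close>
 define a where "a = (2 - ?n) / 2"
 have a: "a < 0" using n3 by (simp add: a_def)
 \<comment> \<open>Normalizes the fundamental solution to the value \<open>m\<close> on the inner
   sphere.\<close>
 define c where "c = m * r powr (- 2 * a)"
 have c: "c > 0" using r by (simp add: c_def)
 have sq: "(rh^2) powr a = rh powr (2 * a)" if "rh > 0" for rh :: real
 proof -
  have "rh^2 = rh powr 2" using powr_realpow[OF that, of 2] by (simp only: of_nat_numeral)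
  thus ?thesis by (simp only: powr_powr)
 qed
 have step1: "V y >= c * (((norm (y - 0))^2) powr a - (R^2) powr a)" if y: "r < norm y" "norm y < R" for y R
 proof -
  define h where "h y = c * (((norm (y - 0))^2) powr a - (R^2) powr a)" for y :: 'a
  have R: "R > r" "R > 0" using y r by auto
  define D where "D = {y::'a. r < norm y & norm y < R}"
  have oD: "open D" unfolding D_def by (intro open_Collect_conj open_Collect_less continuous_intros)
  have bD: "bounded D" unfolding bounded_iff D_def by (auto intro!: exI[of _ R])
  have cD: "closure D <= {y. r <= norm y & norm y <= R}"
   by (rule closure_minimal) (auto simp: D_def intro!: closed_Collect_conj closed_Collect_le continuous_intros)
  \<comment> \<open>The condition \<open>d <= r\<close> keeps the averaging ball of a point of the
    inner sphere within \<open>norm y <= 2 * r\<close>, where \<open>V >= m\<close>; the cutoff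
    equals 1 up to norm \<open>R + r\<close>.\<close>
  have fin: "h y <= conv (%y. V y * cutf (R + r) y) (moll d) y" if d: "0 < d" "d <= r" for d
  proof -
   let ?f = "%y. V y * cutf (R + r) y"
   let ?u = "conv ?f (moll d)"
   have Rr: "R + r > 0" using R r by simp
   have fi: "integrable lborel ?f" by (rule cutf_mult_integrable[OF cV Rr])
   have uC: "Ck m UNIV ?u" for m by (rule conv_Ck[OF fi moll_Ck[OF d(1)] compact_cball moll_zero[OF d(1)]])
   have "h y - ?u y <= 0"
   proof (rule max_principle[OF oD bD])
    have "continuous_on UNIV ?u" using uC[of 0] by simp
    moreover have "continuous_on (closure D) h" unfolding h_def
     using cD r by (intro continuous_intros) (auto simp: subset_iff)
    ultimately show "continuous_on (closure D) (%y. h y - ?u y)"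
     by (intro continuous_intros) (auto intro: continuous_on_subset)
    show "EX L>=0. has_lap (%y. h y - ?u y) x L" if x: "x : D" for x
    proof -
     define rh where "rh = (norm (x - 0))^2"
     have rh: "rh > 0" using x r by (auto simp: rh_def D_def)
     have "has_lap (%y. c * (((norm (y - 0))^2) powr a - (R^2) powr a)) x
       (4 * (c * (a * ((a - 1) * rh powr (a - 2)))) * (norm (x - 0))^2 + 2 * ?n * (c * (a * ((norm (x - 0))^2) powr (a - 1))))"
     proof (rule has_lap_radial[of "{0<..}" x 0 "%s. c * (s powr a - (R^2) powr a)" "%s. c * (a * s powr (a - 1))"])
      show "((%s. c * (s powr a - (R^2) powr a)) has_real_derivative c * (a * s powr (a - 1))) (at s)" if "s : {0<..}" for s
       using that by (auto intro!: derivative_eq_intros)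
      show "((%s. c * (a * s powr (a - 1))) has_real_derivative c * (a * ((a - 1) * rh powr (a - 2)))) (at ((norm (x - 0))^2))"
       using rh unfolding rh_def by (auto intro!: derivative_eq_intros simp: field_simps)
     qed (use rh in \<open>auto simp: rh_def\<close>)
     moreover have "4 * (c * (a * ((a - 1) * rh powr (a - 2)))) * rh + 2 * ?n * (c * (a * rh powr (a - 1))) = 0"
     proof -
      have e: "rh powr (a - 2) * rh = rh powr (a - 1)"
       using rh powr_add[of rh "a - 2" 1] by simp
      have "4 * (c * (a * ((a - 1) * rh powr (a - 2)))) * rh + 2 * ?n * (c * (a * rh powr (a - 1)))
        = c * a * (4 * (a - 1) * (rh powr (a - 2) * rh) + 2 * ?n * rh powr (a - 1))" by (simp add: algebra_simps)
      also have "... = c * a * rh powr (a - 1) * (4 * (a - 1) + 2 * ?n)" unfolding e by (simp add: algebra_simps)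
      also have "4 * (a - 1) + 2 * ?n = 0" by (simp add: a_def field_simps)
      finally show ?thesis by simp
     qed
     ultimately have hl: "has_lap h x 0" by (simp add: h_def[abs_def] rh_def)
     have "has_lap (%y. h y - ?u y) x (0 - - lap ?u x)"
      by (rule has_lap_diff[OF hl Ck2_has_lap[OF open_UNIV uC]]) simp
     moreover have "0 <= lap ?u x"
     proof -
      have nx: "norm x + d <= R + r" using x d by (auto simp: D_def)
      have "lap ?u x = (LBINT y. V y * lap (%y. moll d (x - y)) y)"
       by (rule lap_conv_local[OF cV moll_Ck[OF d(1)] moll_zero[OF d(1)] Rr nx])
      moreover have "0 <= (LBINT y. V y * lap (%y. moll d (x - y)) y)"
       by (rule sh[OF test_fun_reflect[OF moll_Ck[OF d(1)] moll_zero[OF d(1)]]]) (auto intro: moll_nonneg d)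
      ultimately show ?thesis by simp
     qed
     ultimately show ?thesis by auto
    qed
    show "h x - ?u x <= 0" if x: "x : frontier D" for x
    proof -
     have xc: "r <= norm x" "norm x <= R" using x cD by (auto simp: frontier_def)
     have xD: "x ~: D" using x oD by (simp add: frontier_def interior_open)
     have f0: "?f y >= 0" for y using V0[of y] cutf_bounds[of "R + r" y] by simp
     consider "norm x = r" | "norm x = R" using xc xD by (auto simp: D_def)
     thus ?thesis
     proof cases
      case 1
      have "?u x >= m"
      proof (rule conv_moll_ge[OF fi d(1)])
       fix y assume "y : cball x d"
       hence "norm y <= norm x + d" using norm_triangle_sub[of y x] by (simp add: dist_norm norm_minus_commute)
       hence ny: "norm y <= 2 * r" "norm y <= R + r" using 1 d R by auto
       thus "m <= ?f y" using r(3)[OF ny(1)] cutf_one[OF Rr ny(2)] by simp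
      qed
      moreover have "h x <= m"
      proof -
       have "c * (r^2) powr a = m"
        unfolding c_def sq[OF r(1)] using r(1) by (simp add: powr_minus field_simps)
       moreover have "0 <= c * (R^2) powr a" using c by simp
       ultimately show ?thesis unfolding h_def using 1 by (simp add: right_diff_distrib)
      qed
      ultimately show ?thesis by linarith
     next
      case 2
      have "?u x >= 0" by (rule conv_moll_ge[OF fi d(1)]) (rule f0)
      moreover have "h x = 0" unfolding h_def using 2 by simp
      ultimately show ?thesis by linarith
     qed
    qed
    show "y : D" using y by (simp add: D_def)
   qed
   thus ?thesis by simp
  qed
  show ?thesis
  proof (rule field_le_epsilon)
   fix e :: real assume e: "e > 0"
   obtain d0 where d0: "d0 > 0" "!!z. dist z y < d0 ==> dist (V z) (V y) < e"
    using cV e unfolding continuous_on_iff by (metis UNIV_I)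
   define d where "d = min (d0 / 2) r"
   have d: "0 < d" "d <= r" "d < d0" using d0 r by (auto simp: d_def)
   have Rr: "R + r > 0" using R r by simp
   have "\<bar>conv (%y. V y * cutf (R + r) y) (moll d) y - V y\<bar> <= e"
   proof (rule conv_moll_approx[OF cutf_mult_integrable[OF cV Rr] d(1)])
    fix z assume z: "z : cball y d"
    hence "norm z <= norm y + d" using norm_triangle_sub[of z y] by (simp add: dist_norm norm_minus_commute)
    hence "norm z <= R + r" using y d by simp
    hence "cutf (R + r) z = 1" by (rule cutf_one[OF Rr])
    moreover have "dist z y < d0" using z d by (simp add: dist_commute)
    ultimately show "\<bar>V z * cutf (R + r) z - V y\<bar> <= e" using d0(2)[of z] by (simp add: dist_norm)
   qed
   thus "c * (((norm (y - 0))^2) powr a - (R^2) powr a) <= V y + e"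
    using fin[OF d(1,2)] unfolding h_def by linarith
  qed
 qed
 have F1: "V y >= c * norm y powr (2 - ?n)" if y: "norm y > r" for y
 proof -
  have y0: "norm y > 0" using y r(1) by linarith
  have "((%R::real. c * (((norm (y - 0))^2) powr a - R powr (2 * a))) \<longlongrightarrow> c * (((norm (y - 0))^2) powr a - 0)) at_top"
   using a by (intro tendsto_mult tendsto_diff tendsto_const tendsto_neg_powr filterlim_ident) auto
  moreover have "\<forall>\<^sub>F R in at_top. c * (((norm (y - 0))^2) powr a - R powr (2 * a)) <= V y"
   using eventually_gt_at_top[of "norm y"]
  proof eventually_elim
   case (elim R)
   hence "R > 0" using y0 by linarith
   thus ?case using step1[OF y elim] sq[of R] by simp
  qed
  ultimately have "c * (((norm (y - 0))^2) powr a - 0) <= V y" by (intro tendsto_upperbound) auto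
  moreover have "2 * a = 2 - ?n" by (simp add: a_def)
  ultimately show ?thesis using sq[OF y0] by simp
 qed
 \<comment> \<open>The annulus is open, so its inner sphere is treated separately, by
   \<open>V >= m\<close>.\<close>
 have F2: "V y >= min m c * r powr (?n - 2) * norm y powr (2 - ?n)" if y: "norm y = r" for y
 proof -
  have "r powr (?n - 2) * norm y powr (2 - ?n) = 1" using y r(1) by (simp add: powr_add[symmetric])
  hence "min m c * r powr (?n - 2) * norm y powr (2 - ?n) = min m c" by (simp add: mult.assoc)
  moreover have "min m c <= V y" using r(3)[of y] y r(1) by (auto intro: min.coboundedI1)
  ultimately show ?thesis by (simp only:)
 qed
 have "V y >= min c (min m c * r powr (?n - 2)) * norm y powr (2 - ?n)" if ny: "norm y >= r" for y
 proof -
  have p: "0 <= norm y powr (2 - ?n)" by simp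
  consider "norm y > r" | "norm y = r" using ny by linarith
  thus ?thesis
  proof cases
   case 1
   hence "V y >= c * norm y powr (2 - ?n)" by (rule F1)
   thus ?thesis using mult_right_mono[OF min.cobounded1 p, of c] by (meson order_trans)
  next
   case 2
   hence "V y >= (min m c * r powr (?n - 2)) * norm y powr (2 - ?n)" by (rule F2)
   thus ?thesis using mult_right_mono[OF min.cobounded2 p, of c] by (meson order_trans)
  qed
 qed
 moreover have "min c (min m c * r powr (?n - 2)) > 0" using c r by simp
 ultimately show ?thesis by blast
qed

section \<open>Convergence of gradients and regularity of weak solutions\<close>

lemma grad_Cauchy_limit:
 fixes p :: "nat => 'a::euclidean_space => real"
 assumes S: "open S" "convex S" and der: "!!j x. x : S ==> GDERIV (p j) x :> q j x" and cq: "!!j. continuous_on S (q j)"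
  and lim: "!!x. x : S ==> (%j. p j x) ----> P x"
  and C: "!!e. e > 0 ==> EX N. ALL i>=N. ALL j>=N. ALL x:S. norm (q i x - q j x) < e"
 obtains h where "continuous_on S h" "!!x. x : S ==> GDERIV P x :> h x" "uniform_limit S q h sequentially"
proof -
 have "uniformly_Cauchy_on S q" unfolding uniformly_Cauchy_on_def using C by (simp add: dist_norm) meson
 then obtain h where h: "uniform_limit S q h sequentially"
  using uniformly_convergent_eq_Cauchy unfolding uniformly_convergent_on_def by blast
 have ch: "continuous_on S h" by (rule uniform_limit_theorem[OF _ h]) (use cq in auto)
 have "GDERIV P x :> h x" if x: "x : S" for x
 proof -
  have "EX g. ALL x:S. (%n. p n x) ----> g x & (g has_derivative (%v. v \<bullet> h x)) (at x within S)"
  proof (rule has_derivative_sequence[OF S(2), where f'="%n x v. v \<bullet> q n x"])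
   show "(p n has_derivative (%v. v \<bullet> q n y)) (at y within S)" if "y : S" for n y
    using der[OF that] unfolding gderiv_def by (rule has_derivative_at_withinI)
   show "\<forall>\<^sub>F n in sequentially. ALL x:S. ALL v. norm (v \<bullet> q n x - v \<bullet> h x) <= e * norm v" if e: "e > 0" for e
    using uniform_limitD[OF h e]
   proof eventually_elim
    case (elim n)
    show ?case
    proof (intro ballI allI)
     fix y v assume y: "y : S"
     have "norm (v \<bullet> q n y - v \<bullet> h y) <= norm v * norm (q n y - h y)"
      using Cauchy_Schwarz_ineq2[of v "q n y - h y"] by (simp add: inner_diff_right)
     also have "... <= norm v * e" using elim y by (intro mult_left_mono) (auto simp: dist_norm less_imp_le)
     finally show "norm (v \<bullet> q n y - v \<bullet> h y) <= e * norm v" by (simp add: mult.commute)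
    qed
   qed
  qed (use x lim in auto)
  then obtain g where g: "!!x. x : S ==> (%n. p n x) ----> g x" "!!x. x : S ==> (g has_derivative (%v. v \<bullet> h x)) (at x within S)"
   by blast
  have "g y = P y" if "y : S" for y using LIMSEQ_unique[OF g(1)[OF that] lim[OF that]] .
  moreover have "GDERIV g x :> h x" using g(2)[OF x] at_within_open[OF x S(1)] by (simp add: gderiv_def)
  ultimately show ?thesis using GDERIV_transform_open[OF _ S(1) x] by blast
 qed
 thus thesis using that ch h by blast
qed

lemma conv_moll_uniform:
 assumes S: "compact S" and f: "continuous_on UNIV f" "!!x. x ~: S ==> f x = 0" and e: "e > 0"
 shows "EX N. ALL j>=N. ALL x. \<bar>conv f (moll (1 / real (Suc j))) x - f x\<bar> <= e"
proof -
 have fi: "integrable lborel f" by (rule integrable_cont_compact[OF S continuous_on_subset[OF f(1)] f(2)]) auto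
 obtain d where d: "d > 0" "!!x y. norm (x - y) <= d ==> norm (f x - f y) <= e"
  using cont_compact_uniform[OF S f e] by blast
 obtain N where N: "!!j. j >= N ==> 1 / real (Suc j) < d"
  using order_tendstoD(2)[OF inv_Suc_tendsto d(1)] unfolding eventually_sequentially by auto
 have "\<bar>conv f (moll (1 / real (Suc j))) x - f x\<bar> <= e" if "j >= N" for j x
  by (rule conv_moll_approx[OF fi]) (use d(2) N[OF that] in \<open>auto simp: dist_norm norm_minus_commute simp del: of_nat_Suc\<close>)
 thus ?thesis by blast
qed

text \<open>The derivatives \<open>p j\<close> of mollifications converge uniformly to
  \<open>b \<bullet> g x\<close>, and their Laplacians converge uniformly to the derivative of
  \<open>F\<close>. The interior gradient estimate for differences \<open>p i - p j\<close> makes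
  the gradients a Cauchy sequence, so the limit is C1. The last conclusion serves to identify the
  Laplacian of \<open>V\<close>.\<close>

lemma weak_regularity_local:
 fixes V :: "'a::euclidean_space => real"
 assumes V: "!!x. GDERIV V x :> g x" "continuous_on UNIV g" and F: "!!x. GDERIV F x :> f x" "continuous_on UNIV f"
  and weak: "!!ph. test_fun UNIV ph ==> (LBINT x. V x * lap ph x) = (LBINT x. F x * ph x)"
  and b: "b : Basis" and R0: "R0 > 0"
 defines "u \<equiv> %j. conv (%y. V y * cutf (R0 + 4) y) (moll (1 / real (Suc j)))"
 obtains h where "continuous_on (ball 0 R0) h" "!!x. x : ball 0 R0 ==> GDERIV (%x. b \<bullet> g x) x :> h x"
  "!!x. x : ball 0 R0 ==> (%j. pd b (pd b (u j)) x) ----> b \<bullet> h x"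
proof -
 \<comment> \<open>The equation for \<open>p j\<close> is used up to norm \<open>R0 + 3\<close>,
   which leaves room for unit balls around points of \<open>ball 0 R0\<close>. The mollification
   radii are at most 1, so only the region where the cutoff equals 1 matters.\<close>
 let ?R = "R0 + 4"
 let ?n = "real DIM('a)"
 have R: "?R > 0" using R0 by simp
 define de where "de j = 1 / real (Suc j)" for j
 have de: "0 < de j" "de j <= 1" for j by (auto simp: de_def)
 have cV: "continuous_on UNIV V" using V(1) GDERIV_continuous continuous_at_imp_continuous_on by blast
 have cF: "continuous_on UNIV F" using F(1) GDERIV_continuous continuous_at_imp_continuous_on by blast
 let ?S = "cball (0::'a) (2 * ?R)"
 define gV where "gV x = cutf ?R x *R g x + V x *R cutg ?R x" for x
 define gF where "gF x = cutf ?R x *R f x + F x *R cutg ?R x" for x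
 have CV: "C1c (%y. V y * cutf ?R y) gV ?S"
  using C1c_mult[OF cutf_C1c[OF R] V] by (simp add: gV_def[abs_def] mult.commute)
 have CF: "C1c (%y. F y * cutf ?R y) gF ?S"
  using C1c_mult[OF cutf_C1c[OF R] F] by (simp add: gF_def[abs_def] mult.commute)
 have gVe: "gV x = g x" if "norm x <= ?R" for x
  using cutf_one[OF R that] cutg_zero[OF R that] by (simp add: gV_def)
 have iV: "integrable lborel (%y. V y * cutf ?R y)" by (rule cutf_mult_integrable[OF cV R])
 have iF: "integrable lborel (%y. F y * cutf ?R y)" by (rule cutf_mult_integrable[OF cF R])
 have k: "Ck m UNIV (moll (de j) :: 'a => real)" for m j by (rule moll_Ck[OF de(1)])
 have kb: "Ck m UNIV (pd b (moll (de j)))" for m j using k[of "Suc m" j] b by simp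
 have kz: "moll (de j) z = 0" if "z ~: cball 0 (de j)" for z :: 'a and j by (rule moll_zero[OF de(1) that])
 have kbz: "pd b (moll (de j)) z = 0" if "z ~: cball 0 (de j)" for z and j
  by (rule pd_compact_support[OF compact_cball kz that])
 define p where "p j = pd b (u j)" for j
 have u: "u j = conv (%y. V y * cutf ?R y) (moll (de j))" for j by (simp add: u_def de_def)
 have p1: "p j = conv (%y. V y * cutf ?R y) (pd b (moll (de j)))" for j
  unfolding p_def u by (rule pd_conv_fun[OF iV k compact_cball kz b])
 have p2: "p j x = conv (%y. b \<bullet> gV y) (moll (de j)) x" for j x
  unfolding p_def u by (rule conv_grad_swap[OF CV moll_C1c[OF de(1)] b])
 have pC: "Ck m UNIV (p j)" for m j unfolding p1 by (rule conv_Ck[OF iV kb compact_cball kbz])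
 have pl: "lap (p j) x = conv (%y. b \<bullet> gF y) (moll (de j)) x" if x: "norm x <= R0 + 3" for j x
 proof -
  have nx: "norm x + de j <= ?R" using x de(2)[of j] by simp
  have "lap (p j) x = (LBINT y. V y * lap (%y. pd b (moll (de j)) (x - y)) y)"
   unfolding p1 by (rule lap_conv_local[OF cV kb kbz R nx])
  also have "... = (LBINT y. F y * pd b (moll (de j)) (x - y))"
   by (rule weak[OF test_fun_reflect[OF kb kbz]])
  also have "... = conv (%y. F y * cutf ?R y) (pd b (moll (de j))) x"
   unfolding conv_def
  proof (intro Bochner_Integration.integral_cong refl)
   fix y show "F y * pd b (moll (de j)) (x - y) = F y * cutf ?R y * pd b (moll (de j)) (x - y)"
   proof (cases "x - y : cball 0 (de j)")
    case True
    have "norm y <= norm x + norm (x - y)" using norm_triangle_sub[of y x] by (simp add: norm_minus_commute)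
    hence "norm y <= ?R" using True nx by simp
    hence "cutf ?R y = 1" by (rule cutf_one[OF R])
    thus ?thesis by simp
   qed (simp add: kbz)
  qed
  also have "... = pd b (conv (%y. F y * cutf ?R y) (moll (de j))) x"
   by (rule conv_pd[OF iF k compact_cball kz b, symmetric])
  also have "... = conv (%y. b \<bullet> gF y) (moll (de j)) x" by (rule conv_grad_swap[OF CF moll_C1c[OF de(1)] b])
  finally show ?thesis .
 qed
 have uV: "EX N. ALL j>=N. ALL x. \<bar>p j x - b \<bullet> gV x\<bar> <= e" if "e > 0" for e
  unfolding p2 de_def by (rule conv_moll_uniform[OF compact_cball[of 0 "2 * ?R"]])
   (use that C1c_cont_grad[OF CV] C1c_grad_zero[OF CV] in \<open>auto intro!: continuous_intros\<close>)
 have uF: "EX N. ALL j>=N. ALL x. \<bar>conv (%y. b \<bullet> gF y) (moll (de j)) x - b \<bullet> gF x\<bar> <= e" if "e > 0" for e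
  unfolding de_def by (rule conv_moll_uniform[OF compact_cball[of 0 "2 * ?R"]])
   (use that C1c_cont_grad[OF CF] C1c_grad_zero[OF CF] in \<open>auto intro!: continuous_intros\<close>)
 let ?B = "ball (0::'a) R0"
 obtain h where h: "continuous_on ?B h" "!!x. x : ?B ==> GDERIV (%x. b \<bullet> gV x) x :> h x" "uniform_limit ?B (%j. grad (p j)) h sequentially"
 proof (rule grad_Cauchy_limit[of ?B p "%j. grad (p j)" "%x. b \<bullet> gV x"])
  show "GDERIV (p j) x :> grad (p j) x" for j x by (rule Ck_GDERIV[OF pC[of "Suc 0"]]) simp
  show "continuous_on ?B (grad (p j))" for j unfolding grad_eq_sum_pd[abs_def]
   using pC[of "Suc 0" j] by (intro continuous_intros) (auto intro: continuous_on_subset)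
  show "(%j. p j x) ----> b \<bullet> gV x" for x
  proof (rule LIMSEQ_I)
   fix e :: real assume "e > 0"
   then obtain N where "ALL j>=N. ALL x. \<bar>p j x - b \<bullet> gV x\<bar> <= e/2" using uV[of "e/2"] by auto
   hence "ALL j>=N. norm (p j x - b \<bullet> gV x) < e" using \<open>e > 0\<close> by (metis field_sum_of_halves less_add_same_cancel1 order_le_less_trans half_gt_zero real_norm_def)
   thus "EX no. ALL j>=no. norm (p j x - b \<bullet> gV x) < e" by blast
  qed
  show "EX N. ALL i>=N. ALL j>=N. ALL x:?B. norm (grad (p i) x - grad (p j) x) < e" if e: "e > 0" for e
  proof -
   define m where "m = 2 * ?n + 1"
   have m: "m > 0" by (simp add: m_def add_nonneg_pos)
   define et where "et = e / (2 * ?n * m)"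
   have et: "et > 0" using e m by (simp add: et_def)
   obtain N1 where N1: "!!j x. j >= N1 ==> \<bar>p j x - b \<bullet> gV x\<bar> <= et" using uV[OF et] by blast
   obtain N2 where N2: "!!j x. j >= N2 ==> \<bar>conv (%y. b \<bullet> gF y) (moll (de j)) x - b \<bullet> gF x\<bar> <= et" using uF[OF et] by blast
   have "norm (grad (p i) x - grad (p j) x) < e" if ij: "i >= max N1 N2" "j >= max N1 N2" and x: "x : ?B" for i j x
   proof -
    have "\<bar>a \<bullet> (grad (p i) x - grad (p j) x)\<bar> <= ?n * (2 * et) / 1 + (2 * et) * 1 / 2" if a: "a : Basis" for a
    proof (rule gradient_estimate[OF a, of 1 x "%y. p i y - p j y"])
     have "continuous_on UNIV (p j)" for j using pC[of 0] by simp
     thus "continuous_on (cball x 1) (%y. p i y - p j y)"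
      by (intro continuous_intros) (auto intro: continuous_on_subset)
     show "GDERIV (%y. p i y - p j y) x :> grad (p i) x - grad (p j) x"
      by (intro GDERIV_diff Ck_GDERIV[OF pC[of "Suc 0"]]) auto
     show "\<bar>p i y - p j y\<bar> <= 2 * et" for y using N1[of i y] N1[of j y] ij by linarith
     show "EX L. \<bar>L\<bar> <= 2 * et & has_lap (%y. p i y - p j y) y L" if y: "y : ball x 1" for y
     proof -
      have "norm y <= norm x + dist x y" using norm_triangle_sub[of y x] by (simp add: dist_norm norm_minus_commute)
      hence ny: "norm y <= R0 + 3" using x y by simp
      have "has_lap (%y. p i y - p j y) y (- lap (p i) y - - lap (p j) y)"
       by (intro has_lap_diff Ck2_has_lap[OF open_UNIV pC]) auto
      moreover have "\<bar>- lap (p i) y - - lap (p j) y\<bar> <= 2 * et"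
       unfolding pl[OF ny] using N2[of i y] N2[of j y] ij by linarith
      ultimately show ?thesis by blast
     qed
    qed simp
    from norm_le_Basis_bound[OF this] have "norm (grad (p i) x - grad (p j) x) <= ?n * (m * et)"
     by (simp add: algebra_simps m_def)
    also have "... = e / 2" unfolding et_def using DIM_positive[where 'a='a] m by simp
    finally show ?thesis using e by simp
   qed
   thus ?thesis by blast
  qed
 qed auto
 have "GDERIV (%x. b \<bullet> g x) x :> h x" if x: "x : ?B" for x
  by (rule GDERIV_transform_open[OF h(2)[OF x] open_ball x]) (auto simp: gVe)
 moreover have "(%j. pd b (pd b (u j)) x) ----> b \<bullet> h x" if x: "x : ?B" for x
 proof -
  have "(%j. b \<bullet> grad (p j) x) ----> b \<bullet> h x" by (intro tendsto_intros tendsto_uniform_limitI[OF h(3) x])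
  thus ?thesis using b by (simp add: inner_grad_pd p_def)
 qed
 ultimately show thesis using that h(1) by blast
qed

text \<open>At a fixed point the Laplacians of the mollifications converge to \<open>lap V x\<close>
  by the convergence of second derivatives, and to \<open>F x\<close> by the weak equation tested
  with the reflected kernel.\<close>

lemma weak_regularity:
 fixes V :: "'a::euclidean_space => real"
 assumes V: "!!x. GDERIV V x :> g x" "continuous_on UNIV g" and F: "!!x. GDERIV F x :> f x" "continuous_on UNIV f"
  and weak: "!!ph. test_fun UNIV ph ==> (LBINT x. V x * lap ph x) = (LBINT x. F x * ph x)"
 shows "Ck (Suc (Suc 0)) UNIV V" "lap V x = F x"
proof -
 have cV: "continuous_on UNIV V" using V(1) GDERIV_continuous continuous_at_imp_continuous_on by blast
 have cF: "continuous_on UNIV F" using F(1) GDERIV_continuous continuous_at_imp_continuous_on by blast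
 have ex: "(%x. b \<bullet> g x) differentiable (at x)" "isCont (grad (%x. b \<bullet> g x)) x" if b: "b : Basis" for b x
 proof -
  define R0 where "R0 = norm x + 1"
  have R0: "R0 > 0" by (simp add: R0_def add_nonneg_pos)
  obtain h where h: "continuous_on (ball 0 R0) h" "!!x. x : ball 0 R0 ==> GDERIV (%x. b \<bullet> g x) x :> h x"
   by (rule weak_regularity_local[OF V F _ b R0], erule weak) blast
  have x: "x : ball 0 R0" by (simp add: R0_def)
  show "(%x. b \<bullet> g x) differentiable (at x)" using GDERIV_differentiable[OF h(2)[OF x]] .
  have "continuous_on (ball 0 R0) (grad (%x. b \<bullet> g x))"
   by (rule continuous_on_eq[OF h(1)]) (use GDERIV_grad[OF h(2)] in auto)
  thus "isCont (grad (%x. b \<bullet> g x)) x" using x by (simp add: continuous_on_eq_continuous_at)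
 qed
 show C2: "Ck (Suc (Suc 0)) UNIV V"
 proof (rule Ck_Suc_I[OF open_UNIV V(1)], rule Ck_Suc_I[OF open_UNIV])
  fix b :: 'a assume b: "b : Basis"
  show "GDERIV (%x. b \<bullet> g x) x :> grad (%x. b \<bullet> g x) x" for x using ex(1)[OF b] by (rule differentiable_GDERIV)
  fix a :: 'a
  have "continuous_on UNIV (grad (%x. b \<bullet> g x))" using ex(2)[OF b] by (simp add: continuous_on_eq_continuous_at)
  thus "Ck 0 UNIV (%x. a \<bullet> grad (%x. b \<bullet> g x) x)" by (auto intro!: continuous_intros)
 qed
 define R0 where "R0 = norm x + 1"
 have R0: "R0 > 0" by (simp add: R0_def add_nonneg_pos)
 have xR: "x : ball 0 R0" by (simp add: R0_def)
 define u where "u j = conv (%y. V y * cutf (R0 + 4) y) (moll (1 / real (Suc j)))" for j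
 have "(%j. pd b (pd b (u j)) x) ----> pd b (pd b V) x" if b: "b : Basis" for b
 proof -
  obtain h where h: "!!x. x : ball 0 R0 ==> GDERIV (%x. b \<bullet> g x) x :> h x"
   "!!x. x : ball 0 R0 ==> (%j. pd b (pd b (u j)) x) ----> b \<bullet> h x"
   unfolding u_def by (rule weak_regularity_local[OF V F _ b R0], erule weak) blast
  have "pd b V = (%x. b \<bullet> g x)" using GDERIV_pd[OF V(1)] by auto
  thus ?thesis using h(2)[OF xR] GDERIV_pd[OF h(1)[OF xR]] by simp
 qed
 hence "(%j. lap (u j) x) ----> lap V x" unfolding lap_def by (intro tendsto_intros) auto
 moreover have "(%j. lap (u j) x) ----> F x"
 proof (rule LIMSEQ_I)
  fix e :: real assume e: "e > 0"
  let ?R = "R0 + 4"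
  have R: "?R > 0" using R0 by simp
  have cz: "cutf ?R x = 0" if "x ~: cball 0 (2 * ?R)" for x :: 'a using cutf_zero[OF R, of x] that by auto
  have "EX N. ALL j>=N. ALL x. \<bar>conv (%y. F y * cutf ?R y) (moll (1 / real (Suc j))) x - F x * cutf ?R x\<bar> <= e / 2"
   by (rule conv_moll_uniform[OF compact_cball[of 0 "2 * ?R"]])
    (use e cz in \<open>auto intro!: continuous_intros cF C1c_cont[OF cutf_C1c[OF R]]\<close>)
  then obtain N where N: "!!j x. j >= N ==> \<bar>conv (%y. F y * cutf ?R y) (moll (1 / real (Suc j))) x - F x * cutf ?R x\<bar> <= e / 2" by blast
  have "norm (lap (u j) x - F x) < e" if j: "j >= N" for j
  proof -
   define d where "d = 1 / real (Suc j)"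
   have d: "0 < d" "d <= 1" by (auto simp: d_def)
   have nx: "norm x + d <= ?R" using d by (simp add: R0_def)
   have "lap (u j) x = (LBINT y. V y * lap (%y. moll d (x - y)) y)"
    unfolding u_def d_def[symmetric] by (rule lap_conv_local[OF cV moll_Ck[OF d(1)] moll_zero[OF d(1)] R nx])
   also have "... = (LBINT y. F y * moll d (x - y))"
    by (rule weak[OF test_fun_reflect[OF moll_Ck[OF d(1)] moll_zero[OF d(1)]]])
   also have "... = conv (%y. F y * cutf ?R y) (moll d) x" unfolding conv_def
   proof (intro Bochner_Integration.integral_cong refl)
    fix y show "F y * moll d (x - y) = F y * cutf ?R y * moll d (x - y)"
    proof (cases "x - y : cball 0 d")
     case True
     have "norm y <= norm x + norm (x - y)" using norm_triangle_sub[of y x] by (simp add: norm_minus_commute)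
     hence "norm y <= ?R" using True nx by simp
     hence "cutf ?R y = 1" by (rule cutf_one[OF R])
     thus ?thesis by simp
    qed (simp add: moll_zero[OF d(1)])
   qed
   finally have "lap (u j) x = conv (%y. F y * cutf ?R y) (moll d) x" .
   moreover have "cutf ?R x = 1" by (rule cutf_one[OF R]) (simp add: R0_def)
   ultimately show ?thesis using N[OF j, of x] e unfolding d_def by simp
  qed
  thus "EX no. ALL j>=no. norm (lap (u j) x - F x) < e" by blast
 qed
 ultimately show "lap V x = F x" using LIMSEQ_unique by blast
qed

section \<open>Third derivatives\<close>

text \<open>Keeps a finite order of differentiability, as required while \<open>V\<close> is known
  to be only C2 or C3.\<close>

lemma Ck_powr_same:
 assumes U: "open U" and pos: "!!x. x : U ==> w x > 0"
 shows "Ck k U w ==> Ck k U (%x. w x powr al)"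
proof (induction k arbitrary: al)
 case 0
 thus ?case using pos by (auto intro!: continuous_intros simp: less_imp_neq[symmetric])
next
 case (Suc k)
 show ?case
 proof (rule Ck_Suc_I[OF U])
  fix x assume x: "x : U"
  have "((%t. t powr al) has_real_derivative al * w x powr (al - 1)) (at (w x))"
   using pos[OF x] by (auto intro!: derivative_eq_intros)
  from GDERIV_DERIV_compose[OF Ck_GDERIV[OF Suc.prems x] this]
  show "GDERIV (%x. w x powr al) x :> (al * w x powr (al - 1)) *R grad w x" .
 next
  fix b :: 'a assume b: "b : Basis"
  have "Ck k U (%x. (al * w x powr (al - 1)) * pd b w x)"
   using Suc.prems b by (intro Ck_mult Ck_const Suc.IH Ck_SucD[OF Suc.prems] U) auto
  thus "Ck k U (%x. b \<bullet> ((al * w x powr (al - 1)) *R grad w x))" using b by (simp add: inner_grad_pd)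
 qed
qed

lemma grad_continuous: "Ck (Suc 0) UNIV f ==> continuous_on S (grad f)"
 unfolding grad_eq_sum_pd[abs_def] by (intro continuous_intros) (auto intro: continuous_on_subset)

lemma GDERIV_sum:
 assumes "finite B" "!!b. b : B ==> GDERIV (f b) x :> D b"
 shows "GDERIV (%x. SUM b:B. f b x) x :> (SUM b:B. D b)"
 using assms by (induction B rule: finite_induct) (auto intro!: GDERIV_add GDERIV_const)

text \<open>Two applications of the mean value theorem. The left side is symmetric in
  \<open>a\<close> and \<open>b\<close>, so using it in both orders with small \<open>h\<close>
  gives the symmetry of second derivatives.\<close>

lemma second_difference:
 fixes f :: "'a::euclidean_space => real"
 assumes f: "Ck (Suc (Suc 0)) UNIV f" and ab: "a : Basis" "b : Basis" and h: "h > 0"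
 obtains t r where "0 < t" "t < h" "0 < r" "r < h"
  "f (x + h *R a + h *R b) - f (x + h *R a) - f (x + h *R b) + f x = h * (h * pd b (pd a f) (x + t *R a + r *R b))"
proof -
 have d: "((%t. f (y + t *R a)) has_real_derivative pd a f (y + t *R a)) (at t)" for y t
  using GDERIV_along[OF Ck_GDERIV[OF Ck_SucD[OF f] UNIV_I], where x=y and t=t and b=a] ab by (simp add: inner_grad_pd)
 have f1: "Ck (Suc 0) UNIV (pd a f)" using f ab by simp
 have d2: "((%t. pd a f (y + t *R b)) has_real_derivative pd b (pd a f) (y + t *R b)) (at t)" for y t
  using GDERIV_along[OF Ck_GDERIV[OF f1 UNIV_I], where x=y and t=t and b=b] ab by (simp add: inner_grad_pd)
 have "EX t. 0 < t & t < h & (f (x + h *R b + h *R a) - f (x + h *R a)) - (f (x + h *R b + 0 *R a) - f (x + 0 *R a))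
   = (h - 0) * (pd a f (x + h *R b + t *R a) - pd a f (x + t *R a))"
  by (rule MVT2[OF h]) (intro DERIV_diff d)
 then obtain t where t: "0 < t" "t < h" "f (x + h *R b + h *R a) - f (x + h *R a) - (f (x + h *R b) - f x)
   = h * (pd a f (x + h *R b + t *R a) - pd a f (x + t *R a))" by auto
 have "EX r. 0 < r & r < h & pd a f (x + t *R a + h *R b) - pd a f (x + t *R a + 0 *R b) = (h - 0) * pd b (pd a f) (x + t *R a + r *R b)"
  by (rule MVT2[OF h]) (rule d2)
 then obtain r where "0 < r" "r < h" "pd a f (x + t *R a + h *R b) - pd a f (x + t *R a) = h * pd b (pd a f) (x + t *R a + r *R b)" by auto
 thus thesis using t by (intro that[of t r]) (auto simp: add.assoc add.commute[of "h *R b"])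
qed

lemma pd_commute:
 fixes f :: "'a::euclidean_space => real"
 assumes f: "Ck (Suc (Suc 0)) UNIV f" and ab: "a : Basis" "b : Basis"
 shows "pd a (pd b f) x = pd b (pd a f) x"
proof (rule ccontr)
 define e where "e = dist (pd a (pd b f) x) (pd b (pd a f) x) / 2"
 assume "pd a (pd b f) x ~= pd b (pd a f) x"
 hence e: "e > 0" by (simp add: e_def)
 have c: "continuous_on UNIV (pd a (pd b f))" "continuous_on UNIV (pd b (pd a f))" using f ab by auto
 obtain d1 where d1: "d1 > 0" "!!y. dist y x < d1 ==> dist (pd a (pd b f) y) (pd a (pd b f) x) < e"
  using c(1) e unfolding continuous_on_iff by (metis UNIV_I)
 obtain d2 where d2: "d2 > 0" "!!y. dist y x < d2 ==> dist (pd b (pd a f) y) (pd b (pd a f) x) < e"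
  using c(2) e unfolding continuous_on_iff by (metis UNIV_I)
 define h where "h = min d1 d2 / 2"
 have h: "h > 0" using d1 d2 by (simp add: h_def)
 have near: "dist (x + t *R v + r *R w) x < min d1 d2" if "0 < t" "t < h" "0 < r" "r < h" "v : Basis" "w : Basis" for t r and v w :: 'a
  using norm_triangle_ineq[of "t *R v" "r *R w"] that by (simp add: dist_norm h_def)
 obtain t r where 1: "0 < t" "t < h" "0 < r" "r < h"
  "f (x + h *R a + h *R b) - f (x + h *R a) - f (x + h *R b) + f x = h * (h * pd b (pd a f) (x + t *R a + r *R b))"
  using second_difference[OF f ab h] by blast
 obtain t' r' where 2: "0 < t'" "t' < h" "0 < r'" "r' < h"
  "f (x + h *R b + h *R a) - f (x + h *R b) - f (x + h *R a) + f x = h * (h * pd a (pd b f) (x + t' *R b + r' *R a))"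
  using second_difference[OF f ab(2,1) h] by blast
 have "x + h *R a + h *R b = x + h *R b + h *R a" by simp
 hence "h * (h * pd b (pd a f) (x + t *R a + r *R b)) = h * (h * pd a (pd b f) (x + t' *R b + r' *R a))"
  using 1(5) 2(5) by (simp only:)
 hence "pd b (pd a f) (x + t *R a + r *R b) = pd a (pd b f) (x + t' *R b + r' *R a)" using h by simp
 thus False using d1(2)[of "x + t' *R b + r' *R a"] d2(2)[of "x + t *R a + r *R b"] near[OF 1(1-4) ab] near[OF 2(1-4) ab(2,1)]
   dist_triangle3[of "pd a (pd b f) x" "pd b (pd a f) x" "pd a (pd b f) (x + t' *R b + r' *R a)"]
  by (simp add: e_def)
qed

text \<open>The weak equation may be differentiated, so that \<open>weak_regularity\<close> applies to the derivatives of \<open>V\<close>.\<close>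
lemma weak_regularity_Suc:
 fixes V :: "'a::euclidean_space => real"
 assumes V: "Ck (Suc (Suc 0)) UNIV V" and F: "Ck (Suc (Suc 0)) UNIV F"
  and weak: "!!ph. test_fun UNIV ph ==> (LBINT x. V x * lap ph x) = (LBINT x. F x * ph x)"
 shows "Ck (Suc (Suc (Suc 0))) UNIV V"
proof -
 have g: "GDERIV f x :> grad f x" "continuous_on UNIV (grad f)" if "Ck (Suc 0) UNIV f" for f :: "'a => real" and x
  using Ck_GDERIV[OF that] grad_continuous[OF that] by auto
 have "Ck (Suc (Suc 0)) UNIV (pd b V)" if b: "b : Basis" for b
 proof -
  have V1: "Ck (Suc 0) UNIV (pd b V)" and F1: "Ck (Suc 0) UNIV (pd b F)" using V F b by auto
  have "(LBINT x. pd b V x * lap ph x) = (LBINT x. pd b F x * ph x)" if ph: "test_fun UNIV ph" for ph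
  proof -
   obtain K where K: "compact K" "!!x. x ~: K ==> ph x = 0" using ph by (auto simp: test_fun_def)
   have c: "Ck m UNIV ph" for m using ph by (simp add: test_fun_def smooth_on_def)
   have cp: "Ck m UNIV (pd a ph)" if "a : Basis" for a m using c[of "Suc m"] that by simp
   have t: "test_fun UNIV (pd b ph)" unfolding test_fun_def smooth_on_def 
    by (intro conjI allI exI[of _ K] cp[OF b] K(1) impI pd_compact_support[OF K]) auto
   have pp: "Ck (Suc 0) UNIV (pd a (pd a ph))" if "a : Basis" for a using cp[OF that, of "Suc (Suc 0)"] that by simp
   have G: "GDERIV (lap ph) x :> - (SUM a:Basis. grad (pd a (pd a ph)) x)" for x
    unfolding lap_def[abs_def] by (intro GDERIV_minus GDERIV_sum finite_Basis g(1) pp)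
   \<comment> \<open>By symmetry of second derivatives, testing the equation of \<open>V\<close>
     with \<open>pd b ph\<close> is the same as testing the differentiated equation with
     \<open>ph\<close>.\<close>
   have com: "pd b (lap ph) = lap (pd b ph)"
   proof
    fix x
    have "pd b (lap ph) x = - (SUM a:Basis. pd b (pd a (pd a ph)) x)"
     using GDERIV_pd[OF G[of x], of b] b by (simp add: inner_sum_right inner_grad_pd)
    also have "(SUM a:Basis. pd b (pd a (pd a ph)) x) = (SUM a:Basis. pd a (pd a (pd b ph)) x)"
    proof (rule sum.cong[OF refl])
     fix a :: 'a assume a: "a : Basis"
     have "pd b (pd a ph) = pd a (pd b ph)" using pd_commute[OF c b a] by auto
     thus "pd b (pd a (pd a ph)) x = pd a (pd a (pd b ph)) x" using pd_commute[OF cp[OF a] b a, of x] by simp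
    qed
    finally show "pd b (lap ph) x = lap (pd b ph) x" unfolding lap_def[of "pd b ph"] .
   qed
   have Cl: "C1c (lap ph) (%x. - (SUM a:Basis. grad (pd a (pd a ph)) x)) K" unfolding C1c_def
    using G K lap_compact_support[OF K] by (auto intro!: continuous_intros g(2) pp)
   have "(LBINT x. lap ph x * (b \<bullet> grad V x)) = - (LBINT x. V x * (b \<bullet> (- (SUM a:Basis. grad (pd a (pd a ph)) x))))"
    by (rule integration_by_parts[OF Cl open_UNIV subset_UNIV g[OF Ck_SucD[OF V]]])
   also have "... = - (LBINT x. V x * lap (pd b ph) x)" unfolding com[symmetric] GDERIV_pd[OF G] ..
   also have "... = - (LBINT x. F x * (b \<bullet> grad ph x))" using weak[OF t] b by (simp add: inner_grad_pd)
   also have "... = (LBINT x. ph x * (b \<bullet> grad F x))"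
    by (rule integration_by_parts[OF Ck1_C1c[OF c K] open_UNIV subset_UNIV g[OF Ck_SucD[OF F]], symmetric])
   finally show ?thesis using b by (simp add: inner_grad_pd mult.commute)
  qed
  from weak_regularity(1)[OF g[OF V1] g[OF F1] this] show ?thesis .
 qed
 thus ?thesis using V by simp
qed

section \<open>Classification of entire solutions of finite energy\<close>

lemma GDERIV_zero_const:
 fixes f :: "'a::euclidean_space => real"
 assumes "!!x. GDERIV f x :> 0" shows "f x = f y"
 using GDERIV_lipschitz[of UNIV f "%_. 0" 0 x y] assms by auto

text \<open>\<open>eqw\<close> says that the Euclidean metric divided by \<open>w^2\<close> has
  constant scalar curvature; in dimension at least 3, \<open>E2 = 0\<close> says that it is
  Einstein. The argument is Obata's, with cutoffs in place of compactness.\<close>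

locale conformal_factor =
 fixes w :: "'a::euclidean_space => real" and cc :: real
 assumes w3: "Ck (Suc (Suc (Suc 0))) UNIV w" and wpos: "!!x. w x > 0"
  and eqw: "!!x. w x * (SUM b:Basis. pd b (pd b w) x) = real DIM('a) / 2 * (norm (grad w x))^2 + cc"
begin

definition qq :: "'a => real" where "qq x = (SUM b:Basis. pd b (pd b w) x)"
definition HH :: "'a => 'a" where "HH x = (SUM b:Basis. pd b w x *R grad (pd b w) x)"
text \<open>The gradient of \<open>qq\<close>, found by differentiating \<open>eqw\<close> instead
  of \<open>qq\<close> itself. It involves second derivatives of \<open>w\<close> only, so it can be
  differentiated once more when \<open>w\<close> is C3.\<close>

definition QQ :: "'a => 'a" where "QQ x = (1 / w x) *R (real DIM('a) *R HH x - qq x *R grad w x)"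
definition SS :: "'a => real" where "SS x = (SUM a:Basis. SUM b:Basis. (pd a (pd b w) x)^2)"
definition E2 :: "'a => real" where
 "E2 x = (SUM a:Basis. SUM b:Basis. (pd a (pd b w) x - (if a = b then qq x / real DIM('a) else 0))^2)"

lemma w2: "Ck (Suc (Suc 0)) UNIV w" using Ck_SucD[OF w3] .
lemma wb2: "b : Basis ==> Ck (Suc (Suc 0)) UNIV (pd b w)" using w3 by simp
lemma w1: "Ck (Suc 0) UNIV w" using Ck_SucD[OF w2] .
lemma wb1: "b : Basis ==> Ck (Suc 0) UNIV (pd b w)" using w2 by simp
lemma cont_w: "continuous_on S w" using w1 by (auto intro: continuous_on_subset[OF _ subset_UNIV])
lemma cont_pd: "b : Basis ==> continuous_on S (pd b w)"
 by (rule continuous_on_subset[OF _ subset_UNIV]) (use w1 in simp)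
lemma cont_pd2: "a : Basis ==> b : Basis ==> continuous_on S (pd a (pd b w))"
 by (rule continuous_on_subset[OF _ subset_UNIV]) (use w2 in simp)
lemma cont_grad: "continuous_on S (grad w)" by (rule grad_continuous[OF w1])
lemma cont_qq: "continuous_on S qq" unfolding qq_def by (intro continuous_intros cont_pd2)
lemma cont_HH: "continuous_on S HH" unfolding HH_def by (intro continuous_intros cont_pd grad_continuous wb1)
lemma cont_QQ: "continuous_on S QQ" unfolding QQ_def
 using wpos by (intro continuous_intros cont_w cont_HH cont_qq cont_grad) (auto simp: less_imp_neq[symmetric])
lemma cont_E2: "continuous_on S E2"
proof -
 have "continuous_on S (%x. pd a (pd b w) x - (if a = b then qq x / real DIM('a) else 0))"
  if "a : Basis" "b : Basis" for a b :: 'a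
  using that by (cases "a = b") (auto intro!: continuous_intros cont_pd2 cont_qq)
 thus ?thesis unfolding E2_def by (intro continuous_on_sum continuous_on_power)
qed

lemma norm_grad_sq: "(norm (grad w x))^2 = (SUM b:Basis. (pd b w x)^2)"
proof -
 have "(norm (grad w x))^2 = (SUM b:Basis. (grad w x \<bullet> b) * (grad w x \<bullet> b))"
  unfolding power2_norm_eq_inner by (rule euclidean_inner)
 also have "... = (SUM b:Basis. (pd b w x)^2)"
  by (intro sum.cong refl) (simp add: power2_eq_square inner_commute[of "grad w x"] inner_grad_pd)
 finally show ?thesis .
qed

lemma qq_eq: "qq x = (real DIM('a) / 2 * (SUM b:Basis. (pd b w x)^2) + cc) * inverse (w x)"
 using eqw[of x] wpos[of x] unfolding qq_def norm_grad_sq by (simp add: field_simps)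

lemma qq_GDERIV: "GDERIV qq x :> QQ x"
proof -
 have db: "GDERIV (%x. (pd b w x)^2) x :> 2 *R (pd b w x *R grad (pd b w) x)" if "b : Basis" for b
 proof -
  have g: "GDERIV (pd b w) x :> grad (pd b w) x" using Ck_GDERIV[OF wb1[OF that]] by simp
  show ?thesis using GDERIV_mult[OF g g] unfolding power2_eq_square scaleR_2 .
 qed
 have "GDERIV (%x. real DIM('a) / 2 * (SUM b:Basis. (pd b w x)^2) + cc) x :> (real DIM('a) / 2) *R (2 *R HH x) + 0"
  unfolding HH_def scaleR_sum_right[of 2] by (intro GDERIV_add GDERIV_cmult GDERIV_const GDERIV_sum finite_Basis db)
 from GDERIV_mult[OF this GDERIV_inverse[OF Ck_GDERIV[OF w1 UNIV_I]]] wpos[of x]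
 have "GDERIV (%x. (real DIM('a) / 2 * (SUM b:Basis. (pd b w x)^2) + cc) * inverse (w x)) x :>
   (real DIM('a) / 2 * (SUM b:Basis. (pd b w x)^2) + cc) *R (- (inverse (w x))\<^sup>2 *R grad w x)
   + inverse (w x) *R ((real DIM('a) / 2) *R (2 *R HH x) + 0)" by auto
 moreover have "(real DIM('a) / 2 * (SUM b:Basis. (pd b w x)^2) + cc) *R (- (inverse (w x))\<^sup>2 *R grad w x)
   + inverse (w x) *R ((real DIM('a) / 2) *R (2 *R HH x) + 0) = QQ x"
  unfolding QQ_def qq_eq by (simp add: scaleR_diff_right inverse_eq_divide power2_eq_square)
 moreover have "qq = (%x. (real DIM('a) / 2 * (SUM b:Basis. (pd b w x)^2) + cc) * inverse (w x))" using qq_eq by auto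
 ultimately show ?thesis by simp
qed

lemma wQ_eq: "w x *R QQ x = real DIM('a) *R HH x - qq x *R grad w x"
 using wpos[of x] by (simp add: QQ_def)

lemma wQ_comp: "a : Basis ==> a \<bullet> (w x *R QQ x) = real DIM('a) * (SUM b:Basis. pd b w x * pd a (pd b w) x) - qq x * pd a w x"
 unfolding wQ_eq HH_def by (simp add: inner_diff_right inner_sum_right inner_grad_pd)

lemma E2_eq: "E2 x = SS x - (qq x)\<^sup>2 / real DIM('a)"
proof -
 let ?n = "real DIM('a)"
 have n: "?n > 0" by simp
 have "E2 x = (SUM a:Basis. SUM b:Basis. (pd a (pd b w) x)^2 + (if a = b then (qq x / ?n)^2 - 2 * (qq x / ?n) * pd a (pd a w) x else 0))"
  unfolding E2_def by (intro sum.cong refl) (auto simp: power2_diff)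
 also have "... = SS x + (SUM a:Basis. (SUM b:Basis. if a = b then (qq x / ?n)^2 - 2 * (qq x / ?n) * pd a (pd a w) x else 0))"
  unfolding SS_def by (simp add: sum.distrib)
 also have "(SUM a:Basis. (SUM b:Basis. if a = b then (qq x / ?n)^2 - 2 * (qq x / ?n) * pd a (pd a w) x else 0))
   = (SUM a:Basis. (qq x / ?n)^2 - 2 * (qq x / ?n) * pd a (pd a w) x)"
  by (intro sum.cong refl) simp
 also have "... = ?n * (qq x / ?n)^2 - 2 * (qq x / ?n) * qq x"
  by (simp add: sum_subtractf qq_def sum_distrib_left)
 also have "... = - (qq x)\<^sup>2 / ?n" using n by (simp add: power2_eq_square field_simps)
 finally show ?thesis by simp
qed

lemma E2_nonneg: "E2 x >= 0" unfolding E2_def by (intro sum_nonneg) auto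

text \<open>\<open>w x *R QQ x\<close> is \<open>n\<close> times the trace-free Hessian of
  \<open>w\<close> applied to its gradient, and \<open>E2\<close> is the squared norm of that
  Hessian.\<close>

lemma wQ_bound: "(norm (w x *R QQ x))^2 <= (real DIM('a))^2 * (E2 x * (norm (grad w x))^2)"
proof -
 let ?n = "real DIM('a)"
 let ?E = "%a b. pd a (pd b w) x - (if a = b then qq x / ?n else 0)"
 have comp: "(w x *R QQ x) \<bullet> a = ?n * (SUM b:Basis. ?E a b * pd b w x)" if a: "a : Basis" for a
 proof -
  have "(w x *R QQ x) \<bullet> a = ?n * (SUM b:Basis. pd b w x * pd a (pd b w) x) - qq x * pd a w x"
   using wQ_comp[OF a] by (simp only: inner_commute)
  also have "(SUM b:Basis. ?E a b * pd b w x) = (SUM b:Basis. pd b w x * pd a (pd b w) x - (if a = b then qq x / ?n * pd b w x else 0))"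
   by (intro sum.cong refl) (auto simp: algebra_simps)
  hence "?n * (SUM b:Basis. ?E a b * pd b w x) = ?n * (SUM b:Basis. pd b w x * pd a (pd b w) x) - ?n * (qq x / ?n * pd a w x)"
   using a by (simp add: sum_subtractf right_diff_distrib)
  hence "?n * (SUM b:Basis. pd b w x * pd a (pd b w) x) - qq x * pd a w x = ?n * (SUM b:Basis. ?E a b * pd b w x)"
   by simp
  finally show ?thesis .
 qed
 have "(norm (w x *R QQ x))^2 = (SUM a:Basis. ((w x *R QQ x) \<bullet> a)^2)"
  unfolding power2_norm_eq_inner by (subst euclidean_inner) (simp add: power2_eq_square)
 also have "... = (SUM a:Basis. ?n^2 * (SUM b:Basis. ?E a b * pd b w x)^2)"
  by (intro sum.cong refl) (simp only: comp power_mult_distrib)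
 also have "... <= (SUM a:Basis. ?n^2 * ((SUM b:Basis. (?E a b)^2) * (SUM b:Basis. (pd b w x)^2)))"
  by (intro sum_mono mult_left_mono Cauchy_Schwarz_ineq_sum) auto
 also have "... = ?n^2 * (E2 x * (norm (grad w x))^2)"
  unfolding E2_def norm_grad_sq by (simp add: sum_distrib_left sum_distrib_right mult_ac)
 finally show ?thesis .
qed

text \<open>Symmetry of second derivatives lets \<open>pd b\<close> be taken last, so the Laplacian
  of \<open>pd b w\<close> is a derivative of \<open>qq\<close>. This is how \<open>QQ\<close>
  reappears in its own divergence.\<close>

lemma third_derivatives: assumes b: "b : Basis" shows "(SUM c:Basis. pd c (pd c (pd b w)) x) = b \<bullet> QQ x"
proof -
 have "(SUM c:Basis. pd c (pd c (pd b w)) x) = (SUM c:Basis. pd b (pd c (pd c w)) x)"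
 proof (rule sum.cong[OF refl])
  fix c :: 'a assume c: "c : Basis"
  have "pd c (pd b w) = pd b (pd c w)" using pd_commute[OF w2 c b] by auto
  thus "pd c (pd c (pd b w)) x = pd b (pd c (pd c w)) x" using pd_commute[OF wb2[OF c] c b, of x] by simp
 qed
 also have "... = b \<bullet> (SUM c:Basis. grad (pd c (pd c w)) x)" using b by (simp add: inner_sum_right inner_grad_pd)
 also have "(SUM c:Basis. grad (pd c (pd c w)) x) = QQ x"
 proof (rule GDERIV_unique[OF _ qq_GDERIV])
  show "GDERIV qq x :> (SUM c:Basis. grad (pd c (pd c w)) x)" unfolding qq_def[abs_def]
   by (intro GDERIV_sum finite_Basis Ck_GDERIV[OF _ UNIV_I, of 0]) (use wb2 in auto)
 qed
 finally show ?thesis .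
qed

text \<open>The divergence of \<open>w *R QQ\<close> is
  \<open>n * E2 + (n - 1) * (grad w \<bullet> QQ)\<close>. The weight \<open>w powr (1 - n)\<close>
  is the one whose gradient cancels the second term after integration by parts, so only derivatives
  of \<open>ze\<close> remain.\<close>

lemma integral_identity:
 assumes ze: "C1c ze z K"
 shows "(LBINT x. ze x * w x powr (1 - real DIM('a)) * E2 x)
   = - (1 / real DIM('a)) * (LBINT x. w x powr (1 - real DIM('a)) * ((w x *R QQ x) \<bullet> z x))"
proof -
 let ?n = "real DIM('a)"
 define p where "p x = w x powr (1 - ?n)" for x
 define p' where "p' x = ((1 - ?n) * w x powr (- ?n)) *R grad w x" for x
 have pd': "GDERIV p x :> p' x" for x
 proof -
  have "((%t. t powr (1 - ?n)) has_real_derivative (1 - ?n) * w x powr (- ?n)) (at (w x))"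
   using wpos[of x] by (auto intro!: derivative_eq_intros)
  from GDERIV_DERIV_compose[OF Ck_GDERIV[OF w1 UNIV_I] this] show ?thesis by (simp add: p_def[abs_def] p'_def)
 qed
 have cp': "continuous_on S p'" for S unfolding p'_def using wpos by (intro continuous_intros cont_w cont_grad) (auto simp: less_imp_neq[symmetric])
 define om where "om x = ze x * p x" for x
 define ow where "ow x = ze x *R p' x + p x *R z x" for x
 have om: "C1c om ow K" unfolding om_def[abs_def] ow_def[abs_def] by (rule C1c_mult[OF ze pd' cp'])
 define Y where "Y b x = ?n *R (SUM c:Basis. pd c w x *R grad (pd b (pd c w)) x + pd b (pd c w) x *R grad (pd c w) x)
   - (qq x *R grad (pd b w) x + pd b w x *R QQ x)" for b x
 have Yd: "GDERIV (%x. b \<bullet> (w x *R QQ x)) x :> Y b x" if b: "b : Basis" for b x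
  unfolding wQ_comp[OF b] Y_def
  by (intro GDERIV_diff GDERIV_cmult GDERIV_sum GDERIV_mult qq_GDERIV finite_Basis Ck_GDERIV[OF _ UNIV_I, of 0]) (use b wb2 wb1 in auto)
 have cY: "continuous_on S (Y b)" if b: "b : Basis" for b S
  unfolding Y_def by (intro continuous_intros grad_continuous cont_pd cont_pd2 cont_qq cont_QQ b) (use b wb2 wb1 in auto)
 have Ys: "(SUM b:Basis. b \<bullet> Y b x) = ?n * E2 x + (?n - 1) * (grad w x \<bullet> QQ x)" for x
 proof -
  have g: "grad w x \<bullet> QQ x = (SUM b:Basis. pd b w x * (b \<bullet> QQ x))" by (simp add: grad_eq_sum_pd inner_sum_left)
  have "(SUM b:Basis. b \<bullet> Y b x) = (SUM b:Basis. ?n * (SUM c:Basis. pd c w x * pd b (pd b (pd c w)) x + (pd b (pd c w) x)^2)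
    - (qq x * pd b (pd b w) x + pd b w x * (b \<bullet> QQ x)))"
   by (intro sum.cong refl) (simp add: Y_def inner_diff_right inner_add_right inner_sum_right inner_grad_pd power2_eq_square)
  also have "... = ?n * (SUM b:Basis. SUM c:Basis. pd c w x * pd b (pd b (pd c w)) x) + ?n * SS x - (qq x * qq x + grad w x \<bullet> QQ x)"
   unfolding g SS_def by (simp add: sum_subtractf sum.distrib sum_distrib_left[symmetric] qq_def distrib_left)
  also have "(SUM b:Basis. SUM c:Basis. pd c w x * pd b (pd b (pd c w)) x) = grad w x \<bullet> QQ x"
   unfolding g by (subst sum.swap) (simp add: sum_distrib_left[symmetric] third_derivatives)
  also have "?n * (grad w x \<bullet> QQ x) + ?n * SS x - (qq x * qq x + grad w x \<bullet> QQ x) = ?n * E2 x + (?n - 1) * (grad w x \<bullet> QQ x)"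
   unfolding E2_eq by (simp add: field_simps power2_eq_square)
  finally show ?thesis .
 qed
 have cQ: "continuous_on S (%x. p x *R (w x *R QQ x))" "continuous_on S (%x. w x *R QQ x)" for S
  unfolding p_def using wpos by (intro continuous_intros cont_w cont_QQ; auto simp: less_imp_neq[symmetric])+
 have iE: "integrable lborel (%x. om x * E2 x)" "integrable lborel (%x. om x * (grad w x \<bullet> QQ x))"
  by (intro C1c_integrable[OF om] continuous_intros cont_E2 cont_grad cont_QQ)+
 have i7: "integrable lborel (%x. p x * ((w x *R QQ x) \<bullet> z x))"
  using C1c_integrable_grad[OF ze cQ(1)] by (simp add: inner_commute mult.assoc)
 have "?n * (LBINT x. om x * E2 x) + (?n - 1) * (LBINT x. om x * (grad w x \<bullet> QQ x)) = (LBINT x. (SUM b:Basis. om x * (b \<bullet> Y b x)))"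
 proof -
  have "(SUM b:Basis. om x * (b \<bullet> Y b x)) = ?n * (om x * E2 x) + (?n - 1) * (om x * (grad w x \<bullet> QQ x))" for x
   unfolding sum_distrib_left[symmetric] Ys by (simp add: algebra_simps)
  thus ?thesis using iE by simp
 qed
 also have "... = (SUM b:Basis. LBINT x. om x * (b \<bullet> Y b x))"
  by (intro Bochner_Integration.integral_sum C1c_integrable[OF om] continuous_intros cY)
 also have "... = (SUM b:Basis. - (LBINT x. b \<bullet> (w x *R QQ x) * (b \<bullet> ow x)))"
  by (intro sum.cong refl integration_by_parts[OF om open_UNIV subset_UNIV Yd cY])
 also have "... = - (LBINT x. (SUM b:Basis. b \<bullet> (w x *R QQ x) * (b \<bullet> ow x)))"
 proof -
  have "integrable lborel (%x. b \<bullet> (w x *R QQ x) * (b \<bullet> ow x))" for b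
  proof -
   have "integrable lborel (%x. ow x \<bullet> ((b \<bullet> (w x *R QQ x)) *R b))" by (intro C1c_integrable_grad[OF om] continuous_intros cQ(2))
   thus ?thesis by (simp add: inner_commute)
  qed
  thus ?thesis by (simp add: sum_negf Bochner_Integration.integral_sum)
 qed
 also have "... = - (LBINT x. (1 - ?n) * (om x * (grad w x \<bullet> QQ x)) + p x * ((w x *R QQ x) \<bullet> z x))"
 proof -
  have "(SUM b:Basis. b \<bullet> (w x *R QQ x) * (b \<bullet> ow x)) = (1 - ?n) * (om x * (grad w x \<bullet> QQ x)) + p x * ((w x *R QQ x) \<bullet> z x)" for x
  proof -
   have "w x * w x powr (- ?n) = p x" using wpos[of x] powr_add[of "w x" 1 "- ?n"] by (simp add: p_def)
   hence e: "w x * ((1 - ?n) * w x powr (- ?n)) = (1 - ?n) * p x" by (simp add: algebra_simps)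
   have "(SUM b:Basis. b \<bullet> (w x *R QQ x) * (b \<bullet> ow x)) = (w x *R QQ x) \<bullet> ow x"
    unfolding euclidean_inner[of "w x *R QQ x" "ow x"] by (simp only: inner_commute)
   also have "... = ze x * (w x * ((1 - ?n) * w x powr (- ?n))) * (grad w x \<bullet> QQ x) + p x * ((w x *R QQ x) \<bullet> z x)"
    by (simp add: ow_def p'_def inner_add_right inner_commute[of "QQ x" "grad w x"] algebra_simps)
   finally show ?thesis unfolding e by (simp add: om_def)
  qed
  thus ?thesis by simp
 qed
 also have "... = (?n - 1) * (LBINT x. om x * (grad w x \<bullet> QQ x)) - (LBINT x. p x * ((w x *R QQ x) \<bullet> z x))"
  unfolding Bochner_Integration.integral_add[OF integrable_mult_right[OF iE(2)] i7] integral_mult_right_zero by (simp only: algebra_simps)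
 finally have "?n * (LBINT x. om x * E2 x) = - (LBINT x. p x * ((w x *R QQ x) \<bullet> z x))" by simp
 thus ?thesis unfolding om_def p_def by (simp add: field_simps)
qed

text \<open>A Caccioppoli inequality: with \<open>ze = et^2\<close>, the bound
  \<open>wQ_bound\<close> puts a factor \<open>sqrt E2\<close> on the right side, and Young's
  inequality absorbs half of the left side.\<close>

lemma energy_estimate:
 assumes et: "C1c et et' K"
 shows "(LBINT x. (et x)^2 * w x powr (1 - real DIM('a)) * E2 x)
   <= 4 * (LBINT x. w x powr (1 - real DIM('a)) * ((norm (grad w x))^2 * (norm (et' x))^2))"
proof -
 let ?n = "real DIM('a)"
 have n: "?n > 0" by simp
 define p where "p x = w x powr (1 - ?n)" for x
 have cp: "continuous_on S p" for S unfolding p_def using wpos by (intro continuous_intros cont_w) (auto simp: less_imp_neq[symmetric])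
 have p0: "p x > 0" for x using wpos[of x] by (simp add: p_def)
 have K: "compact K" "!!x. x ~: K ==> et x = 0" using et by (auto simp: C1c_def)
 have d: "!!x. GDERIV et x :> et' x" "continuous_on UNIV et'" using et by (auto simp: C1c_def)
 have C: "C1c (%x. et x * et x) (%x. et x *R et' x + et x *R et' x) K" by (rule C1c_mult[OF et d])
 define L where "L = (LBINT x. et x * et x * p x * E2 x)"
 have iL: "integrable lborel (%x. et x * et x * p x * E2 x)"
  by (rule integrable_cont_compact[OF K(1)]) (use K in \<open>auto intro!: continuous_intros cp cont_E2 C1c_cont[OF et]\<close>)
 have iR: "integrable lborel (%x. p x * ((norm (grad w x))^2 * (norm (et' x))^2))"
  by (rule integrable_cont_compact[OF K(1)])
   (use C1c_grad_zero[OF et] in \<open>auto intro!: continuous_intros cp cont_grad C1c_cont_grad[OF et]\<close>)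
 have iM: "integrable lborel (%x. p x * ((w x *R QQ x) \<bullet> (et x *R et' x + et x *R et' x)))"
  by (rule integrable_cont_compact[OF K(1)])
   (use C1c_grad_zero[OF et] in \<open>auto intro!: continuous_intros cp cont_w cont_QQ C1c_cont[OF et] C1c_cont_grad[OF et]\<close>)
 have "L = - (1 / ?n) * (LBINT x. p x * ((w x *R QQ x) \<bullet> (et x *R et' x + et x *R et' x)))"
  unfolding L_def p_def by (rule integral_identity[OF C])
 also have "... = (LBINT x. - (1 / ?n) * (p x * ((w x *R QQ x) \<bullet> (et x *R et' x + et x *R et' x))))" by simp
 also have "... <= (LBINT x. 1/2 * (et x * et x * p x * E2 x) + 2 * (p x * ((norm (grad w x))^2 * (norm (et' x))^2)))"
 proof (rule integral_mono)
  fix x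
  define X where "X = \<bar>et x\<bar> * sqrt (E2 x)"
  define Y where "Y = norm (grad w x) * norm (et' x)"
  have "norm (w x *R QQ x) <= ?n * (sqrt (E2 x) * norm (grad w x))"
  proof (rule power2_le_imp_le)
   show "(norm (w x *R QQ x))^2 <= (?n * (sqrt (E2 x) * norm (grad w x)))^2"
    using wQ_bound[of x] E2_nonneg[of x] by (simp add: power_mult_distrib)
  qed (use E2_nonneg[of x] in auto)
  hence "\<bar>(w x *R QQ x) \<bullet> et' x\<bar> <= ?n * (sqrt (E2 x) * norm (grad w x)) * norm (et' x)"
   using Cauchy_Schwarz_ineq2[of "w x *R QQ x" "et' x"] by (meson mult_right_mono norm_ge_zero order_trans)
  hence "\<bar>et x\<bar> * \<bar>(w x *R QQ x) \<bullet> et' x\<bar> <= \<bar>et x\<bar> * (?n * (sqrt (E2 x) * norm (grad w x)) * norm (et' x))"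
   by (rule mult_left_mono) simp
  also have "... = ?n * (X * Y)" by (simp add: X_def Y_def)
  finally have 1: "(1 / ?n) * \<bar>et x * ((w x *R QQ x) \<bullet> et' x)\<bar> <= X * Y" using n by (simp add: abs_mult field_simps)
  have 2: "2 * (X * Y) <= 1/2 * X^2 + 2 * Y^2"
   using sum_squares_bound[of "X / sqrt 2" "sqrt 2 * Y"] by (simp add: power_mult_distrib power_divide)
  have "- (1 / ?n) * ((w x *R QQ x) \<bullet> (et x *R et' x + et x *R et' x)) = - 2 * ((1 / ?n) * (et x * ((w x *R QQ x) \<bullet> et' x)))"
   by (simp add: inner_add_right)
  also have "... <= 2 * ((1 / ?n) * \<bar>et x * ((w x *R QQ x) \<bullet> et' x)\<bar>)"
  proof -
   have "- ((1 / ?n) * t) <= (1 / ?n) * \<bar>t\<bar>" for t using n by (simp add: field_simps abs_ge_minus_self)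
   from this[of "et x * ((w x *R QQ x) \<bullet> et' x)"] show ?thesis by linarith
  qed
  also have "... <= 1/2 * X^2 + 2 * Y^2" using 1 2 by linarith
  also have "X^2 = et x * et x * E2 x" 
   by (simp only: X_def power_mult_distrib power2_abs real_sqrt_pow2[OF E2_nonneg]) (simp add: power2_eq_square)
  also have "Y^2 = (norm (grad w x))^2 * (norm (et' x))^2" by (simp add: Y_def power_mult_distrib)
  finally have "p x * (- (1 / ?n) * ((w x *R QQ x) \<bullet> (et x *R et' x + et x *R et' x)))
    <= p x * (1/2 * (et x * et x * E2 x) + 2 * ((norm (grad w x))^2 * (norm (et' x))^2))"
   using p0[of x] by (intro mult_left_mono) auto
  thus "- (1 / ?n) * (p x * ((w x *R QQ x) \<bullet> (et x *R et' x + et x *R et' x)))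
    <= 1/2 * (et x * et x * p x * E2 x) + 2 * (p x * ((norm (grad w x))^2 * (norm (et' x))^2))"
   by (simp add: algebra_simps)
 qed (use iL iR iM in auto)
 also have "... = 1/2 * L + 2 * (LBINT x. p x * ((norm (grad w x))^2 * (norm (et' x))^2))"
  unfolding L_def using iL iR by simp
 finally have "L <= 4 * (LBINT x. p x * ((norm (grad w x))^2 * (norm (et' x))^2))" by simp
 thus ?thesis by (simp add: L_def p_def power2_eq_square)
qed

text \<open>If \<open>E2\<close> were positive at \<open>x0\<close>, continuity would give the left
  side of \<open>energy_estimate\<close> a positive lower bound as soon as the cutoffs equal 1 near
  \<open>x0\<close>.\<close>

lemma E2_zero:
 assumes T: "(%k. LBINT x. w x powr (1 - real DIM('a)) * ((norm (grad w x))^2 * (norm (cutg (real (Suc k)) x))^2)) ----> 0"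
 shows "E2 x0 = 0"
proof (rule ccontr)
 let ?n = "real DIM('a)"
 assume "E2 x0 ~= 0"
 hence e0: "E2 x0 > 0" using E2_nonneg[of x0] by linarith
 define F where "F x = w x powr (1 - ?n) * E2 x" for x
 have cF: "continuous_on UNIV F" unfolding F_def using wpos by (intro continuous_intros cont_w cont_E2) (auto simp: less_imp_neq[symmetric])
 have F0: "F x >= 0" for x using E2_nonneg by (simp add: F_def)
 have Fx: "F x0 > 0" using e0 wpos[of x0] by (simp add: F_def)
 obtain d where d: "d > 0" "!!y. dist y x0 < d ==> dist (F y) (F x0) < F x0 / 2"
  using cF Fx unfolding continuous_on_iff by (metis UNIV_I half_gt_zero)
 define m where "m = measure lborel (ball x0 d)"
 have fm: "emeasure lborel (ball x0 d) < \<infinity>" by (rule emeasure_bounded_finite) auto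
 have m: "m > 0" unfolding m_def using content_ball_pos[OF d(1), of x0] by simp
 obtain N where N: "norm x0 + d <= real N" using real_arch_simple by blast
 have lower: "F x0 / 2 * m <= (LBINT x. (cutf (real (Suc k)) x)^2 * w x powr (1 - ?n) * E2 x)" if k: "k >= N" for k
 proof -
  have R: "real (Suc k) > 0" by simp
  have A: "(LBINT x. indicator (ball x0 d) x * (F x0 / 2)) <= (LBINT x. (cutf (real (Suc k)) x)^2 * w x powr (1 - ?n) * E2 x)"
  proof (rule integral_mono)
   show "integrable lborel (%x. indicator (ball x0 d) x * (F x0 / 2))" using fm by simp
   show "integrable lborel (%x. (cutf (real (Suc k)) x)^2 * w x powr (1 - ?n) * E2 x)"
   proof (rule integrable_cont_compact[of "cball 0 (2 * real (Suc k))"])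
    show "continuous_on (cball 0 (2 * real (Suc k))) (%x. (cutf (real (Suc k)) x)^2 * w x powr (1 - ?n) * E2 x)"
     using wpos by (intro continuous_intros cont_w cont_E2 C1c_cont[OF cutf_C1c[OF R]]) (auto simp: less_imp_neq[symmetric])
    show "(cutf (real (Suc k)) x)^2 * w x powr (1 - ?n) * E2 x = 0" if "x ~: cball 0 (2 * real (Suc k))" for x
     using cutf_zero[OF R, of x] that by (auto simp del: of_nat_Suc)
   qed auto
   fix x
   show "indicator (ball x0 d) x * (F x0 / 2) <= (cutf (real (Suc k)) x)^2 * w x powr (1 - ?n) * E2 x"
   proof (cases "x : ball x0 d")
    case True
    have "norm x <= norm x0 + dist x0 x" using norm_triangle_sub[of x x0] by (simp add: dist_norm norm_minus_commute)
    hence "norm x <= real (Suc k)" using True N k by simp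
    hence "cutf (real (Suc k)) x = 1" by (rule cutf_one[OF R])
    moreover have "F x0 / 2 <= F x"
    proof -
     have "\<bar>F x - F x0\<bar> < F x0 / 2" using d(2)[of x] True by (simp add: dist_commute dist_real_def abs_minus_commute)
     thus ?thesis by linarith
    qed
    ultimately show ?thesis using True by (simp add: F_def)
   next
    case False
    thus ?thesis using F0[of x] by (simp add: F_def mult.assoc del: of_nat_Suc)
   qed
  qed
  have B: "(LBINT x. indicator (ball x0 d) x * (F x0 / 2)) = m * (F x0 / 2)" using fm by (simp add: m_def)
  show ?thesis using A unfolding B mult.commute[of m] .
 qed
 have "F x0 / 2 * m <= 4 * 0"
 proof (rule tendsto_lowerbound[OF tendsto_mult_left[OF T, of 4]])
  show "\<forall>\<^sub>F k in sequentially. F x0 / 2 * m <= 4 * (LBINT x. w x powr (1 - ?n) * ((norm (grad w x))^2 * (norm (cutg (real (Suc k)) x))^2))"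
   using eventually_ge_at_top[of N]
  proof eventually_elim
   case (elim k)
   show ?case using lower[OF elim] energy_estimate[OF cutf_C1c[of "real (Suc k)"]] by (simp del: of_nat_Suc)
  qed
 qed simp
 thus False using Fx m by (simp add: mult_le_0_iff)
qed

text \<open>Vanishing of \<open>E2\<close> forces \<open>QQ = 0\<close>, so \<open>qq\<close> is
  constant and the Hessian is a constant multiple of the identity; two integrations from 0 give the
  polynomial.\<close>

lemma quadratic:
 assumes E: "!!x. E2 x = 0" and w0: "w 0 = 1" and g0: "grad w 0 = 0"
 shows "w x = 1 + cc / (2 * real DIM('a)) * (norm x)^2"
proof -
 let ?n = "real DIM('a)"
 have n: "?n > 0" by simp
 have Q0: "QQ x = 0" for x
 proof -
  have "(norm (w x *R QQ x))^2 <= 0" using wQ_bound[of x] E by simp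
  thus ?thesis using wpos[of x] by simp
 qed
 have "qq x = qq 0" for x using GDERIV_zero_const[of qq x 0] qq_GDERIV Q0 by simp
 moreover have "qq 0 = cc" using eqw[of 0] w0 g0 by (simp add: qq_def)
 ultimately have q: "qq x = cc" for x by simp
 have wab: "pd a (pd b w) x = (if a = b then cc / ?n else 0)" if a: "a : Basis" and b: "b : Basis" for a b x
 proof -
  let ?e = "%a b. (pd a (pd b w) x - (if a = b then qq x / ?n else 0))^2"
  have "(SUM a:Basis. SUM b:Basis. ?e a b) = 0" using E[of x] by (simp add: E2_def)
  hence "ALL a:Basis. (SUM b:Basis. ?e a b) = 0" by (subst (asm) sum_nonneg_eq_0_iff) (auto intro: sum_nonneg)
  hence "(SUM b:Basis. ?e a b) = 0" using a by blast
  hence "ALL b:Basis. ?e a b = 0" by (subst (asm) sum_nonneg_eq_0_iff) auto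
  hence "?e a b = 0" using b by blast
  thus ?thesis by (simp add: q split: if_splits)
 qed
 have wb: "pd b w x = cc / ?n * (x \<bullet> b)" if b: "b : Basis" for b x
 proof -
  let ?f = "%x. pd b w x - cc / ?n * (x \<bullet> b)"
  have "GDERIV ?f x :> 0" for x
  proof -
   have "grad (pd b w) x = (SUM a:Basis. (if a = b then cc / ?n else 0) *R a)"
    unfolding grad_eq_sum_pd by (intro sum.cong refl) (simp add: wab b)
   also have "... = (SUM a:Basis. if a = b then (cc / ?n) *R a else 0)" by (intro sum.cong refl) simp
   also have "... = (cc / ?n) *R b" using b by simp
   finally have "grad (pd b w) x - (cc / ?n) *R b = 0" by simp
   moreover have "GDERIV ?f x :> grad (pd b w) x - (cc / ?n) *R b"
    by (intro GDERIV_diff GDERIV_cmult GDERIV_inner Ck_GDERIV[OF wb1[OF b]]) simp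
   ultimately show ?thesis by simp
  qed
  from GDERIV_zero_const[OF this, of x 0] have "?f x = ?f 0" .
  moreover have "pd b w 0 = 0" using inner_grad_pd[OF b, of w 0] g0 by simp
  ultimately show ?thesis by simp
 qed
 let ?f = "%x. w x - cc / (2 * ?n) * (norm (x - 0))^2"
 have "GDERIV ?f x :> 0" for x
 proof -
  have "grad w x = (SUM b:Basis. (cc / ?n * (x \<bullet> b)) *R b)" unfolding grad_eq_sum_pd by (intro sum.cong refl) (simp add: wb)
  also have "... = (cc / ?n) *R (SUM b:Basis. (x \<bullet> b) *R b)" by (simp add: scaleR_sum_right)
  also have "... = (cc / ?n) *R x" by (simp only: euclidean_representation)
  finally have "grad w x - (cc / (2 * ?n)) *R (2 *R (x - 0)) = 0" by simp
  moreover have "GDERIV ?f x :> grad w x - (cc / (2 * ?n)) *R (2 *R (x - 0))"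
   by (intro GDERIV_diff GDERIV_cmult GDERIV_norm2 Ck_GDERIV[OF w1]) simp
  ultimately show ?thesis by simp
 qed
 from GDERIV_zero_const[OF this, of x 0] show ?thesis using w0 by simp
qed

end

text \<open>The lower bound for \<open>V\<close> bounds \<open>w\<close> by a multiple of
  \<open>(norm y)^2\<close>, which just compensates the squared gradient of the cutoff. The error
  term is then controlled by the tail of the Dirichlet integral of \<open>V\<close>. The conditions
  \<open>V 0 = 1\<close> and \<open>V <= 1\<close> fix scale and centre.\<close>

theorem entire_solution_classification:
 fixes V :: "'a::euclidean_space => real"
 assumes n: "DIM('a) >= 3" and V3: "Ck (Suc (Suc (Suc 0))) UNIV V" and Vpos: "!!x. V x > 0"
  and eq: "!!x. lap V x = V x powr (crit DIM('a) 0 - 1)"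
  and en: "integrable lborel (%x. (norm (grad V x))^2)"
  and lower: "r > 0" "c > 0" "!!y. norm y >= r ==> V y >= c * norm y powr (2 - real DIM('a))"
  and V0: "V 0 = 1" and V1: "!!x. V x <= 1"
 shows "V y = (1 + (norm y)^2 / (real DIM('a) * (real DIM('a) - 2))) powr (- (real DIM('a) - 2) / 2)"
proof -
 let ?n = "real DIM('a)"
 have n3: "?n >= 3" using n by simp
 \<comment> \<open>For this exponent the powers of \<open>V\<close> in the nonlinear term cancel
   (\<open>e2\<close>), and \<open>be * (be - 1) = n / 2 * be^2\<close> (\<open>b1\<close>) produces
   the gradient term of \<open>eqw\<close>.\<close>
 define be where "be = - 2 / (?n - 2)"
 define cc where "cc = 2 / (?n - 2)"
 define w where "w x = V x powr be" for x
 have V2: "Ck (Suc (Suc 0)) UNIV V" using Ck_SucD[OF V3] .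
 have V1': "Ck (Suc 0) UNIV V" using Ck_SucD[OF V2] .
 have Vg: "GDERIV V x :> grad V x" for x using Ck_GDERIV[OF V1'] by simp
 have w3: "Ck (Suc (Suc (Suc 0))) UNIV w" unfolding w_def[abs_def] by (rule Ck_powr_same[OF open_UNIV _ V3]) (rule Vpos)
 have wpos: "w x > 0" for x using Vpos[of x] by (simp add: w_def)
 have powD: "((%t. t powr al) has_real_derivative al * V x powr (al - 1)) (at (V x))" for al x
  using Vpos[of x] by (auto intro!: derivative_eq_intros)
 have wg: "GDERIV w x :> (be * V x powr (be - 1)) *R grad V x" for x
  unfolding w_def[abs_def] by (rule GDERIV_DERIV_compose[OF Vg powD])
 have gw: "grad w x = (be * V x powr (be - 1)) *R grad V x" for x by (rule GDERIV_grad[OF wg])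
 have pw: "pd b w = (%x. be * V x powr (be - 1) * pd b V x)" if b: "b : Basis" for b
  using GDERIV_pd[OF wg] b by (auto simp: inner_grad_pd)
 have pw2: "pd b (pd b w) x = be * (be - 1) * V x powr (be - 2) * (pd b V x)^2 + be * V x powr (be - 1) * pd b (pd b V) x"
  if b: "b : Basis" for b x
 proof -
  have gb: "GDERIV (pd b V) x :> grad (pd b V) x" using V2 b by (auto intro!: differentiable_GDERIV)
  have "GDERIV (%x. be * V x powr (be - 1)) x :> be *R (((be - 1) * V x powr (be - 1 - 1)) *R grad V x)"
   by (rule GDERIV_cmult[OF GDERIV_DERIV_compose[OF Vg powD]])
  from GDERIV_pd[OF GDERIV_mult[OF this gb], of b]
  show ?thesis unfolding pw[OF b] using b
   by (simp add: inner_add_right inner_grad_pd power2_eq_square algebra_simps)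
 qed
 have ng: "(norm (grad V x))^2 = (SUM b:Basis. (pd b V x)^2)" for x
  unfolding power2_norm_eq_inner by (subst euclidean_inner) (simp add: power2_eq_square inner_commute[of "grad V x"] inner_grad_pd)
 have eqw: "w x * (SUM b:Basis. pd b (pd b w) x) = ?n / 2 * (norm (grad w x))^2 + cc" for x
 proof -
  have s: "(SUM b:Basis. pd b (pd b w) x) = be * (be - 1) * V x powr (be - 2) * (norm (grad V x))^2 - be * V x powr (be - 1) * lap V x"
   unfolding lap_def ng by (simp add: pw2 sum.distrib sum_distrib_left)
  have e1: "V x powr be * V x powr (be - 2) = (V x powr (be - 1))^2"
   using Vpos[of x] by (simp add: power2_eq_square flip: powr_add)
  have e2: "V x powr be * (V x powr (be - 1) * V x powr (crit DIM('a) 0 - 1)) = 1"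
  proof -
   have "be + (be - 1 + (crit DIM('a) 0 - 1)) = 0"
   proof -
    define m where "m = ?n - 2"
    have m: "m > 0" "?n = m + 2" using n3 by (auto simp: m_def)
    show ?thesis unfolding be_def crit_def m(2) using m(1) by (simp add: field_simps)
   qed
   thus ?thesis using Vpos[of x] by (simp flip: powr_add)
  qed
  have b1: "be * (be - 1) = ?n / 2 * be^2"
  proof -
   define m where "m = ?n - 2"
   have m: "m > 0" "?n = m + 2" using n3 by (auto simp: m_def)
   show ?thesis unfolding be_def m(2) using m(1) by (simp add: power2_eq_square field_simps)
  qed
  have "w x * (SUM b:Basis. pd b (pd b w) x) = be * (be - 1) * (V x powr be * V x powr (be - 2)) * (norm (grad V x))^2
    - be * (V x powr be * (V x powr (be - 1) * V x powr (crit DIM('a) 0 - 1)))"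
   unfolding s eq w_def by (simp add: algebra_simps)
  also have "... = ?n / 2 * (be^2 * (V x powr (be - 1))^2 * (norm (grad V x))^2) - be"
   unfolding e1 e2 b1 by simp
  also have "be^2 * (V x powr (be - 1))^2 * (norm (grad V x))^2 = (norm (grad w x))^2"
   unfolding gw by (simp add: power_mult_distrib)
  finally show ?thesis by (simp add: cc_def be_def)
 qed
 interpret cf: conformal_factor w cc by unfold_locales (use w3 wpos eqw in auto)
 \<comment> \<open>In terms of \<open>V\<close> the integrand is the energy density times
   \<open>V powr be\<close>, a quantity that grows at most quadratically.\<close>
 have pt: "w x powr (1 - ?n) * (norm (grad w x))^2 = be^2 * (V x powr be * (norm (grad V x))^2)" for x
 proof -
  have ex: "be * (1 - ?n) + ((be - 1) + (be - 1)) = be"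
  proof -
   define m where "m = ?n - 2"
   have m: "m > 0" "?n = m + 2" using n3 by (auto simp: m_def)
   show ?thesis unfolding be_def m(2) using m(1) by (simp add: field_simps)
  qed
  have "w x powr (1 - ?n) * (V x powr (be - 1))^2 = V x powr (be * (1 - ?n) + ((be - 1) + (be - 1)))"
   unfolding w_def power2_eq_square powr_powr powr_add ..
  also have "... = V x powr be" unfolding ex ..
  finally show ?thesis unfolding gw by (simp add: power_mult_distrib algebra_simps)
 qed
 \<comment> \<open>On the annulus \<open>V powr be <= c powr be * (2 * R)^2\<close> and the squared
   cutoff gradient is at most \<open>(48 / R)^2\<close>; the powers of \<open>R\<close>
   cancel.\<close>
 define M where "M = c powr be * (4 * 48^2)"
 define B where "B k = {x::'a. real (Suc k) < norm x}" for k
 have Bm: "B k : sets borel" for k unfolding B_def by (intro borel_open open_Collect_less continuous_intros)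
 have iB: "integrable lborel (%x. indicator (B k) x * (norm (grad V x))^2)" for k
  using integrable_mult_indicator[of "B k" lborel "%x. (norm (grad V x))^2"] Bm en by simp
 define T where "T k = (LBINT x. w x powr (1 - ?n) * ((norm (grad w x))^2 * (norm (cutg (real (Suc k)) x))^2))" for k
 have Tb: "T k <= be^2 * M * (LBINT x. indicator (B k) x * (norm (grad V x))^2)" if k: "real (Suc k) >= r" for k
 proof -
  let ?R = "real (Suc k)"
  have R: "?R > 0" by simp
  have "T k <= (LBINT x. be^2 * M * (indicator (B k) x * (norm (grad V x))^2))"
   unfolding T_def
  proof (rule integral_mono_AE')
   show "integrable lborel (%x. be^2 * M * (indicator (B k) x * (norm (grad V x))^2))" using iB[of k] by (rule integrable_mult_right)
   have "w x powr (1 - ?n) * ((norm (grad w x))^2 * (norm (cutg ?R x))^2) <= be^2 * M * (indicator (B k) x * (norm (grad V x))^2)" for x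
   proof (cases "?R < norm x & norm x <= 2 * ?R")
    case False
    hence "cutg ?R x = 0"
     using C1c_grad_zero[OF cutf_C1c[OF R], of x] cutg_zero[OF R, of x] by (auto simp del: of_nat_Suc)
    thus ?thesis by (simp add: M_def del: of_nat_Suc)
   next
    case True
    have nx: "norm x > 0" using True R by linarith
    have "V x >= c * norm x powr (2 - ?n)" by (rule lower(3)) (use True k in linarith)
    moreover have "c * norm x powr (2 - ?n) > 0" using lower(2) nx by simp
    ultimately have "V x powr be <= (c * norm x powr (2 - ?n)) powr be"
     using n3 by (intro powr_mono2') (auto simp: be_def)
    also have "... = c powr be * norm x powr ((2 - ?n) * be)" using lower(2) by (simp add: powr_mult powr_powr)
    also have "(2 - ?n) * be = 2" using n3 by (simp add: be_def field_simps)
    also have "norm x powr 2 = (norm x)^2" using nx by simp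
    also have "c powr be * (norm x)^2 <= c powr be * (2 * ?R)^2" using True by (intro mult_left_mono power_mono) auto
    finally have 1: "V x powr be <= c powr be * (2 * ?R)^2" .
    have 2: "(norm (cutg ?R x))^2 <= (48 / ?R)^2" by (intro power_mono cutg_bound R) auto
    have "V x powr be * (norm (cutg ?R x))^2 <= (c powr be * (2 * ?R)^2) * (48 / ?R)^2" using 1 2 by (intro mult_mono) auto
    also have "... = M"
    proof -
     have "(2 * ?R)^2 * (48 / ?R)^2 = 4 * 48^2" using R by (simp add: power_mult_distrib power_divide del: of_nat_Suc)
     thus ?thesis by (simp add: M_def mult.assoc)
    qed
    finally have 3: "V x powr be * (norm (cutg ?R x))^2 <= M" .
    have "w x powr (1 - ?n) * ((norm (grad w x))^2 * (norm (cutg ?R x))^2)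
      = (w x powr (1 - ?n) * (norm (grad w x))^2) * (norm (cutg ?R x))^2" by (simp only: mult.assoc)
    also have "... = be^2 * (norm (grad V x))^2 * (V x powr be * (norm (cutg ?R x))^2)"
     unfolding pt by (simp only: mult_ac)
    also have "... <= be^2 * (norm (grad V x))^2 * M" using 3 by (intro mult_left_mono) auto
    finally show ?thesis using True by (simp add: B_def mult_ac del: of_nat_Suc)
   qed
   thus "AE x in lborel. w x powr (1 - ?n) * ((norm (grad w x))^2 * (norm (cutg ?R x))^2) <= be^2 * M * (indicator (B k) x * (norm (grad V x))^2)"
    by (intro AE_I2)
   show "AE x in lborel. 0 <= be^2 * M * (indicator (B k) x * (norm (grad V x))^2)" by (intro AE_I2) (simp add: M_def)
  qed
  thus ?thesis by simp
 qed
 have tail: "(%k. LBINT x. indicator (B k) x * (norm (grad V x))^2) ----> integral\<^sup>L lborel (%x::'a. 0::real)"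
 proof (rule integral_dominated_convergence[OF _ _ en])
  show "AE x in lborel. (%k. indicator (B k) x * (norm (grad V x))^2) ----> 0"
  proof (rule AE_I2, rule tendsto_eventually)
   fix x :: 'a
   obtain N where "norm x <= real N" using real_arch_simple by blast
   thus "\<forall>\<^sub>F k in sequentially. indicator (B k) x * (norm (grad V x))^2 = 0"
    unfolding eventually_sequentially by (intro exI[of _ N]) (auto simp: B_def)
  qed
  show "AE x in lborel. norm (indicator (B k) x * (norm (grad V x))^2) <= (norm (grad V x))^2" for k
   by (auto simp: indicator_def)
 qed (use iB borel_measurable_integrable in auto)
 have Tl: "T ----> 0"
 proof (rule tendsto_sandwich[OF _ _ tendsto_const])
  show "\<forall>\<^sub>F k in sequentially. 0 <= T k"
   unfolding T_def by (intro always_eventually allI integral_nonneg_AE AE_I2) simp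
  obtain N where N: "r <= real N" using real_arch_simple by blast
  show "\<forall>\<^sub>F k in sequentially. T k <= be^2 * M * (LBINT x. indicator (B k) x * (norm (grad V x))^2)"
   using eventually_ge_at_top[of N] by eventually_elim (rule Tb, use N in auto)
  show "(%k. be^2 * M * (LBINT x. indicator (B k) x * (norm (grad V x))^2)) ----> 0"
   using tendsto_mult_left[OF tail, of "be^2 * M"] by simp
 qed
 have E: "cf.E2 x = 0" for x by (rule cf.E2_zero) (use Tl in \<open>simp add: T_def[abs_def]\<close>)
 have g0: "grad V 0 = 0"
 proof -
  have "(V has_derivative (%h. h \<bullet> grad V 0)) (at 0)" using Vg[of 0] by (simp add: gderiv_def)
  hence "(%h. h \<bullet> grad V 0) = (%h. 0)"
   by (rule has_derivative_local_max) (use V0 V1 in simp)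
  hence "grad V 0 \<bullet> grad V 0 = 0" by meson
  thus ?thesis by simp
 qed
 have wy: "w y = 1 + cc / (2 * ?n) * (norm y)^2"
  by (rule cf.quadratic[OF E]) (simp_all add: w_def V0 gw g0)
 have "V y = (V y powr be) powr (- (?n - 2) / 2)"
 proof -
  have "be * (- (?n - 2) / 2) = 1" using n3 by (simp add: be_def field_simps)
  hence "(V y powr be) powr (- (?n - 2) / 2) = V y powr 1" unfolding powr_powr by (simp only:)
  thus ?thesis using Vpos[of y] by simp
 qed
 moreover have "cc / (2 * ?n) * (norm y)^2 = (norm y)^2 / (?n * (?n - 2))" using n3 by (simp add: cc_def field_simps)
 ultimately show ?thesis using wy by (simp add: w_def)
qed

section \<open>Equicontinuity up to the boundary\<close>

text \<open>The ball touches \<open>p\<close> from the side to which the gradient of the defining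
  function points. Inside it the linear part of \<open>ph\<close> at \<open>p\<close> outweighs the
  quadratic Taylor error, so \<open>ph\<close> stays nonnegative there. Lower and Lipschitz bounds
  for the gradient make the radius uniform near \<open>p0\<close>.\<close>

lemma exterior_ball_local:
 fixes Om :: "'a::euclidean_space set"
 assumes Om: "open Om" and r: "r > 0" and ph: "smooth_on (ball p0 r) ph" "grad ph p0 ~= 0"
  and def: "!!x. x : ball p0 r ==> x : Om \<longleftrightarrow> ph x < 0"
 shows "EX d>0. EX R>0. ALL p:frontier Om Int ball p0 d. EX z. dist z p = R & ball z R Int Om = {}"
proof -
 let ?B = "ball p0 r"
 let ?n = "real DIM('a)"
 have C2: "Ck (Suc (Suc 0)) ?B ph" using ph(1) unfolding smooth_on_def by blast
 have C1: "Ck (Suc 0) ?B ph" using Ck_SucD[OF C2] .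
 have cg: "continuous_on ?B (grad ph)" unfolding grad_eq_sum_pd[abs_def] using C1 by (intro continuous_intros) auto
 have gd: "GDERIV ph x :> grad ph x" if "x : ?B" for x using Ck_GDERIV[OF C1 that] .
 define m where "m = norm (grad ph p0) / 2"
 have m: "m > 0" using ph(2) by (simp add: m_def)
 have p0B: "p0 : ?B" using r by simp
 obtain rh0 where rh0: "rh0 > 0" "!!x. x : ?B ==> dist x p0 < rh0 ==> dist (grad ph x) (grad ph p0) < m"
  using cg p0B m unfolding continuous_on_iff by blast
 define rh where "rh = min (rh0 / 2) (r / 2)"
 have rh: "rh > 0" "rh < rh0" "rh < r" using rh0 r by (auto simp: rh_def)
 have gm: "norm (grad ph x) >= m" if "x : cball p0 rh" for x
 proof -
  have "dist (grad ph x) (grad ph p0) < m" using that rh by (intro rh0(2)) (auto simp: dist_commute)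
  moreover have "norm (grad ph p0) <= norm (grad ph x) + dist (grad ph x) (grad ph p0)"
   using norm_triangle_sub[of "grad ph p0" "grad ph x"] by (simp add: dist_norm norm_minus_commute)
  ultimately show ?thesis unfolding m_def by linarith
 qed
 have "EX M>0. ALL x:cball p0 rh. norm (grad (pd b ph) x) <= M" if b: "b : Basis" for b
 proof -
  have "continuous_on ?B (grad (pd b ph))" unfolding grad_eq_sum_pd[abs_def] using C2 b by (intro continuous_intros) auto
  hence "continuous_on (cball p0 rh) (grad (pd b ph))" by (rule continuous_on_subset) (use rh in auto)
  hence "bounded (grad (pd b ph) ` cball p0 rh)" using compact_continuous_image compact_imp_bounded compact_cball by blast
  thus ?thesis unfolding bounded_pos by auto
 qed
 then obtain Mf where Mf: "!!b. b : Basis ==> Mf b > 0 & (ALL x:cball p0 rh. norm (grad (pd b ph) x) <= Mf b)" by metis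
 define M where "M = ?n * (SUM b:Basis. Mf b)"
 have Ms: "Mf b <= (SUM b:Basis. Mf b)" if "b : Basis" for b
  using that Mf by (intro member_le_sum) (auto simp: less_imp_le)
 have M0: "M >= 0" unfolding M_def using Mf by (intro mult_nonneg_nonneg sum_nonneg) (auto simp: less_imp_le)
 have lip: "norm (grad ph x - grad ph y) <= M * norm (x - y)" if x: "x : cball p0 rh" and y: "y : cball p0 rh" for x y
 proof -
  have "\<bar>b \<bullet> (grad ph x - grad ph y)\<bar> <= (SUM b:Basis. Mf b) * norm (x - y)" if b: "b : Basis" for b
  proof -
   have "\<bar>pd b ph x - pd b ph y\<bar> <= Mf b * norm (x - y)"
   proof (rule GDERIV_lipschitz[of "cball p0 rh" "pd b ph" "grad (pd b ph)"])
    fix z assume "z : cball p0 rh"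
    hence "z : ?B" using rh by auto
    thus "GDERIV (pd b ph) z :> grad (pd b ph) z" using C2 b by (auto intro!: differentiable_GDERIV)
   qed (use Mf b x y in auto)
   also have "... <= (SUM b:Basis. Mf b) * norm (x - y)" using Ms[OF b] by (intro mult_right_mono) auto
   finally show ?thesis using b by (simp add: inner_diff_right inner_grad_pd)
  qed
  from norm_le_Basis_bound[OF this] show ?thesis by (simp add: M_def mult.assoc)
 qed
 \<comment> \<open>The first entry keeps the touching ball inside \<open>cball p0 rh\<close>; the
   second makes \<open>m / (2 * R)\<close> exceed the Lipschitz constant \<open>M\<close>.\<close>
 define R where "R = min (rh / 8) (m / (2 * (M + 1)))"
 have R: "R > 0" "R <= rh / 8" "R <= m / (2 * (M + 1))"
  using rh m M0 by (simp_all only: R_def min.cobounded1 min.cobounded2) auto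
 have "EX z. dist z p = R & ball z R Int Om = {}" if p: "p : frontier Om" "p : ball p0 (rh / 2)" for p
 proof -
  have pB: "p : ?B" "p : cball p0 rh" using p rh by auto
  have "p ~: Om" using p(1) Om by (simp add: frontier_def interior_open)
  hence php: "ph p >= 0" using def[OF pB(1)] by simp
  define G where "G = norm (grad ph p)"
  have G: "G >= m" "G > 0" using gm[OF pB(2)] m by (auto simp: G_def)
  define \<nu> where "\<nu> = (1 / G) *R grad ph p"
  have \<nu>: "norm \<nu> = 1" using G by (simp add: \<nu>_def G_def)
  define z where "z = p + R *R \<nu>"
  have "y ~: Om" if y: "y : ball z R" for y
  proof -
   define h where "h = y - p"
   have zp: "dist z p = R" using R \<nu> by (simp add: z_def dist_norm)
   have "dist y p <= dist y z + dist z p" by (rule dist_triangle)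
   hence yp: "dist y p < 2 * R" using y zp by (simp add: dist_commute)
   have yrh: "y : cball p0 rh"
   proof -
    have "dist p0 p < rh / 2" using p(2) by simp
    thus ?thesis using dist_triangle[of p0 y p] yp R(2) rh(1) unfolding mem_cball dist_commute[of p y] by linarith
   qed
   hence yB: "y : ?B" using rh by auto
   have "(norm (h - R *R \<nu>))^2 < R^2"
    using y by (intro power_strict_mono) (auto simp: h_def z_def dist_norm norm_minus_commute algebra_simps)
   \<comment> \<open>Membership in a ball of radius \<open>R\<close> tangent at \<open>p\<close>
     means that the normal component of \<open>h\<close> controls \<open>(norm h)^2\<close>.\<close>
   hence "(norm h)^2 < 2 * R * (h \<bullet> \<nu>)"
    using \<nu> unfolding power2_norm_eq_inner by (simp add: inner_diff_left inner_diff_right inner_commute power2_eq_square norm_eq_1 algebra_simps)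
   hence hn: "(norm h)^2 / (2 * R) <= h \<bullet> \<nu>" using R by (simp add: field_simps)
   define q where "q x = ph x - (x - p) \<bullet> grad ph p" for x
   have "\<bar>q y - q p\<bar> <= (M * norm h) * norm (y - p)"
   proof (rule GDERIV_lipschitz[of "closed_segment p y" q "%x. grad ph x - grad ph p"])
    fix x assume x: "x : closed_segment p y"
    have "closed_segment p y <= cball p0 rh" using pB(2) yrh by (intro closed_segment_subset) auto
    hence xrh: "x : cball p0 rh" using x by blast
    hence "x : ?B" using rh by auto
    moreover have "GDERIV (%x. (x - p) \<bullet> grad ph p) x :> grad ph p" unfolding gderiv_def by (auto intro!: derivative_eq_intros)
    ultimately show "GDERIV q x :> grad ph x - grad ph p" unfolding q_def[abs_def] by (intro GDERIV_diff gd)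
    have "norm (x - p) <= norm h" using segment_bound[OF x] by (simp add: h_def norm_minus_commute)
    thus "norm (grad ph x - grad ph p) <= M * norm h"
     using lip[OF xrh pB(2)] M0 by (meson mult_left_mono order_trans)
   qed auto
   hence "ph y >= ph p + h \<bullet> grad ph p - M * (norm h)^2"
    by (simp add: q_def h_def power2_eq_square abs_le_iff)
   moreover have "h \<bullet> grad ph p = G * (h \<bullet> \<nu>)" using G by (simp add: \<nu>_def)
   moreover have "G * (h \<bullet> \<nu>) >= m * ((norm h)^2 / (2 * R))" using G hn m R by (intro mult_mono) auto
   moreover have "m * ((norm h)^2 / (2 * R)) >= M * (norm h)^2"
   proof -
    have "2 * R * (M + 1) <= m" using R(3) M0 by (simp add: field_simps)
    hence "2 * R * M <= m" using R(1) by (simp add: algebra_simps)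
    hence "M <= m / (2 * R)" using R(1) by (simp add: field_simps)
    hence "M * (norm h)^2 <= m / (2 * R) * (norm h)^2" by (intro mult_right_mono) auto
    thus ?thesis by simp
   qed
   ultimately have "ph y >= 0" using php by linarith
   thus ?thesis using def[OF yB] by simp
  qed
  hence "ball z R Int Om = {}" by blast
  moreover have "dist z p = R" using R \<nu> by (simp add: z_def dist_norm)
  ultimately show ?thesis by blast
 qed
 thus ?thesis using R(1) rh(1) by (intro exI[of _ "rh/2"] conjI exI[of _ R]) auto
qed

lemma exterior_ball_shrink:
 fixes p :: "'a::euclidean_space"
 assumes "dist z p = R" "ball z R Int Om = {}" "0 < R'" "R' <= R"
 shows "EX z'. dist z' p = R' & ball z' R' Int Om = {}"
proof -
 define z' where "z' = p + (R' / R) *R (z - p)"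
 have R: "R > 0" using assms by simp
 have n: "norm (z - p) = R" using assms(1) by (simp add: dist_norm)
 have "dist z' p = R'" using R assms(3) n by (simp add: z'_def dist_norm)
 moreover have "ball z' R' <= ball z R"
 proof
  fix y assume y: "y : ball z' R'"
  have "z - z' = (1 - R' / R) *R (z - p)" by (simp add: z'_def algebra_simps)
  hence "dist z z' = (1 - R' / R) * R" using n assms R by (simp add: dist_norm)
  also have "... = R - R'" using R by (simp add: left_diff_distrib)
  finally have "dist z z' = R - R'" .
  thus "y : ball z R" using y dist_triangle[of z y z'] by simp
 qed
 ultimately show ?thesis using assms(2) by blast
qed

text \<open>Compactness of the frontier reduces to finitely many local radii, and an exterior ball
  may always be shrunk to a smaller one tangent at the same point.\<close>

lemma exterior_ball:
 fixes Om :: "'a::euclidean_space set"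
 assumes "smooth_bounded_domain Om"
 obtains R where "R > 0" "!!p. p : frontier Om ==> EX z. dist z p = R & ball z R Int Om = {}"
proof -
 have Om: "open Om" "bounded Om" using assms unfolding smooth_bounded_domain_def by auto
 have "EX d>0. EX R>0. ALL p:frontier Om Int ball p0 d. EX z. dist z p = R & ball z R Int Om = {}" if p0: "p0 : frontier Om" for p0
 proof -
  obtain r ph where "r > 0" "smooth_on (ball p0 r) ph" "grad ph p0 ~= 0" "!!x. x : ball p0 r ==> x : Om \<longleftrightarrow> ph x < 0"
   using assms p0 unfolding smooth_bounded_domain_def by metis
  thus ?thesis using exterior_ball_local[OF Om(1)] by blast
 qed
 then obtain d Rf where dR: "!!p0. p0 : frontier Om ==> d p0 > 0 & Rf p0 > 0 &
   (ALL p:frontier Om Int ball p0 (d p0). EX z. dist z p = Rf p0 & ball z (Rf p0) Int Om = {})" by metis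
 have "compact (frontier Om)" using Om(2) by (rule compact_frontier_bounded)
 then obtain F where F: "F <= frontier Om" "finite F" "frontier Om <= (UN p:F. ball p (d p))"
  by (rule compactE_image[of _ "frontier Om" "%p. ball p (d p)"]) (use dR in force)+
 define R where "R = Min (insert 1 (Rf ` F))"
 have fin: "finite (insert 1 (Rf ` F))" using F(2) by simp
 have "R > 0" unfolding R_def using fin dR F(1) by (subst Min_gr_iff) auto
 moreover have "EX z. dist z p = R & ball z R Int Om = {}" if p: "p : frontier Om" for p
 proof -
  obtain p0 where p0: "p0 : F" "p : ball p0 (d p0)" using F(3) p by blast
  then obtain z where z: "dist z p = Rf p0" "ball z (Rf p0) Int Om = {}" using dR[of p0] F(1) p by blast
  have "R <= Rf p0" unfolding R_def using fin p0(1) by (intro Min_le) auto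
  thus ?thesis using exterior_ball_shrink[OF z \<open>R > 0\<close>] by blast
 qed
 ultimately show thesis using that by blast
qed

section \<open>Boundary barriers, uniform in the exponent and in the position of the pole\<close>

lemma powr_lipschitz:
 fixes s a b :: real
 assumes s: "0 < s" "s <= 1" and ab: "0 <= a" "a <= 3" "0 <= b" "b <= 3"
 shows "\<bar>a powr (2 - s) - b powr (2 - s)\<bar> <= 6 * \<bar>a - b\<bar>"
proof -
 have gen: "b powr (2 - s) - a powr (2 - s) <= 6 * (b - a) & a powr (2 - s) <= b powr (2 - s)" if ab: "0 <= a" "a < b" "b <= 3" for a b :: real
 proof -
  have "EX l z. a < z & z < b & ((%t. t powr (2 - s)) has_real_derivative l) (at z) & b powr (2 - s) - a powr (2 - s) = (b - a) * l"
  proof (rule MVT[OF ab(2)])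
   show "continuous_on {a..b} (%t. t powr (2 - s))" using ab s by (intro continuous_on_powr' continuous_intros) auto
   show "(%t. t powr (2 - s)) differentiable (at x)" if "a < x" "x < b" for x
   proof -
    have "((%t. t powr (2 - s)) has_real_derivative (2 - s) * x powr (2 - s - 1)) (at x)"
     using that ab by (auto intro!: derivative_eq_intros)
    thus ?thesis using real_differentiable_def by blast
   qed
  qed
  then obtain l z where z: "a < z" "z < b" "((%t. t powr (2 - s)) has_real_derivative l) (at z)" "b powr (2 - s) - a powr (2 - s) = (b - a) * l"
   by blast
  have z0: "z > 0" using z ab by linarith
  have "((%t. t powr (2 - s)) has_real_derivative (2 - s) * z powr (2 - s - 1)) (at z)"
   using z0 by (auto intro!: derivative_eq_intros)
  hence l: "l = (2 - s) * z powr (1 - s)" using DERIV_unique[OF z(3)] by simp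
  have "z powr (1 - s) <= 3 powr (1 - s)" using z ab s z0 by (intro powr_mono2) auto
  also have "... <= 3 powr 1" using s by (intro powr_mono) auto
  finally have "z powr (1 - s) <= 3" by simp
  hence "l <= 2 * 3" unfolding l using s by (intro mult_mono) auto
  moreover have "l >= 0" unfolding l using s by simp
  ultimately have "(b - a) * l <= (b - a) * 6" "0 <= (b - a) * l" using ab mult_left_mono[of l 6 "b - a"] by auto
  thus ?thesis using z(4) by linarith
 qed
 consider "a < b" | "b < a" | "a = b" by linarith
 thus ?thesis
 proof cases
  case 1
  thus ?thesis using gen[of a b] ab by (simp add: abs_if)
 next
  case 2
  thus ?thesis using gen[of b a] ab by (simp add: abs_if)
 qed simp
qed

text \<open>Two barriers are combined. The Laplacian of \<open>norm (y - q) powr (2 - s)\<close> is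
  at least \<open>norm (y - q) powr (- s)\<close> and absorbs the singular part; an exponential
  barrier built from the exterior ball absorbs the bounded part and dominates on the frontier. The
  number \<open>de\<close> is chosen before \<open>W\<close>, \<open>D\<close>, \<open>q\<close> and
  \<open>s\<close>, which is what gives equicontinuity of a whole family.\<close>

lemma boundary_barrier:
 fixes r0 C M et :: real
 assumes n: "DIM('a::euclidean_space) >= 3" and r0: "r0 > 0" and C: "C > 0" and M: "M > 0" and et: "et > 0"
 obtains de where "de > 0" "de < 1" "!!(W::'a => real) D p z q s y. [|open D; p ~: D; dist z p = r0; ball z r0 Int D = {};
   continuous_on UNIV W; !!y. y ~: D ==> W y = 0; !!y. W y <= M; q ~: D; dist q p <= 2; 0 < s; s <= 1;
   !!y. y : D ==> y : ball p 1 ==> EX L. - L <= C * (1 + norm (y - q) powr (- s)) & has_lap W y L; dist y p <= de|]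
   ==> W y <= et"
proof -
 let ?n = "real DIM('a)"
 have n3: "?n >= 3" using n by simp
 \<comment> \<open>The ball of half the radius, tangent at \<open>p\<close> from inside: off the
   large ball the squared distance to its centre \<open>z'\<close> exceeds \<open>r^2\<close> by at
   least \<open>(norm (x - p))^2 / 2\<close>, so \<open>wf\<close> grows quadratically away from
   \<open>p\<close>.\<close>
 define r where "r = r0 / 2"
 have r: "r > 0" using r0 by (simp add: r_def)
 \<comment> \<open>Makes \<open>al\<close> times the squared distance to \<open>z'\<close> at least
   \<open>n\<close>, so the Laplacian of \<open>wf\<close> is at most \<open>- 2 * n * al\<close>
   times the exponential.\<close>
 define al where "al = ?n / r^2"
 have al: "al > 0" using r n3 by (simp add: al_def)
 define ka where "ka = exp (- al * ((1 + r)^2 - r^2))"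
 have ka: "ka > 0" by (simp add: ka_def)
 define c0 where "c0 = 2 * ?n * al * ka"
 have c0: "c0 > 0" using al ka n3 by (simp add: c0_def)
 define c1 where "c1 = al / (2 + al)"
 have c1: "c1 > 0" using al by (simp add: c1_def)
 \<comment> \<open>The entries serve, in order, the inequality for Laplacians, the frontier points
   off \<open>D\<close>, where \<open>6 * C * t\<close> is split into a multiple of
   \<open>t^2\<close> and \<open>et / 2\<close>, and the frontier points in \<open>D\<close> at
   distance 1 from \<open>p\<close>, where \<open>W <= M\<close> is used.\<close>
 define L where "L = Max {C / c0, 18 * C^2 / (et * c1), (M + 6 * C) / c1}"
 have L: "C <= L * c0" "18 * C^2 / et <= L * c1" "M + 6 * C <= L * c1" "L > 0"
 proof -
  have "C / c0 <= L" "18 * C^2 / (et * c1) <= L" "(M + 6 * C) / c1 <= L" unfolding L_def by (intro Max_ge; simp)+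
  thus "C <= L * c0" "18 * C^2 / et <= L * c1" "M + 6 * C <= L * c1" using c0 c1 et by (auto simp: field_simps)
  have "C / c0 > 0" using C c0 by simp
  thus "L > 0" using \<open>C / c0 <= L\<close> by linarith
 qed
 \<comment> \<open>Collects the growth of the combined barrier at \<open>p\<close>:
   \<open>6 * C\<close> from the power of the distance to the pole and
   \<open>L * al * (1 + 2 * r)\<close> from \<open>wf\<close>.\<close>
 define K where "K = 6 * C + L * al * (1 + 2 * r) + 1"
 have K: "K > 0" using C L al r by (simp add: K_def add_pos_pos)
 define de where "de = min (1/2) (et / (2 * K))"
 have de: "de > 0" "de < 1" "de * K <= et / 2"
 proof -
  show "de > 0" "de < 1" using et K by (auto simp: de_def)
  have "de <= et / (2 * K)" by (simp add: de_def)
  thus "de * K <= et / 2" using K by (simp add: field_simps)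
 qed
 show thesis
 proof (rule that[OF de(1,2)])
  fix W :: "'a => real" and D p z q s y
  assume D: "open D" and p: "p ~: D" and z: "dist z p = r0" "ball z r0 Int D = {}" and cW: "continuous_on UNIV W"
   and W0: "!!y. y ~: D ==> W y = 0" and WM: "!!y. W y <= M" and q: "q ~: D" "dist q p <= 2" and s: "0 < s" "s <= 1"
   and lap: "!!y. y : D ==> y : ball p 1 ==> EX L. - L <= C * (1 + norm (y - q) powr (- s)) & has_lap W y L"
   and y: "dist y p <= de"
  define z' where "z' = p + (1/2) *R (z - p)"
  define \<psi> where "\<psi> x = ((norm (x - q))^2) powr ((2 - s) / 2)" for x
  define wf where "wf x = 1 - exp (- al * ((norm (x - z'))^2 - r^2))" for x
  have \<psi>e: "\<psi> x = norm (x - q) powr (2 - s)" for x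
  proof (cases "x = q")
   case True thus ?thesis by (simp add: \<psi>_def)
  next
   case False
   hence nz: "norm (x - q) > 0" by simp
   have "(norm (x - q))^2 = norm (x - q) powr 2" using powr_realpow[OF nz, of 2] by (simp only: of_nat_numeral)
   moreover have "2 * ((2 - s) / 2) = 2 - s" by simp
   ultimately show ?thesis unfolding \<psi>_def by (simp only: powr_powr)
  qed
  have nzp: "norm (z - p) = 2 * r" using z(1) by (simp add: dist_norm r_def)
  have zp': "norm (p - z') = r" using nzp by (simp add: z'_def)
  have outer: "(norm (x - z'))^2 >= r^2 + (norm (x - p))^2 / 2" if x: "x ~: ball z r0" for x
  proof -
   have "norm (x - z) >= 2 * r" using x by (simp add: dist_norm norm_minus_commute r_def)
   hence "(norm (x - z))^2 >= (2 * r)^2" using r by (intro power_mono) auto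
   moreover have "(2 * r)^2 = (norm (z - p))^2" using nzp by simp
   ultimately have 1: "(norm (x - z))^2 >= (norm (z - p))^2" by simp
   define h where "h = x - p"
   define v where "v = z - p"
   have "x - z = h - v" "x - z' = h - (1/2) *R v" by (auto simp: h_def v_def z'_def)
   hence a: "(norm (x - z))^2 = (norm h)^2 - 2 * (h \<bullet> v) + (norm v)^2" "(norm (x - z'))^2 = (norm h)^2 - h \<bullet> v + (norm v)^2 / 4"
    unfolding power2_norm_eq_inner by (auto simp: inner_diff_left inner_diff_right inner_commute)
   have "(norm v)^2 / 4 = r^2" using nzp by (simp add: v_def power2_eq_square)
   thus ?thesis using 1 a by (simp add: h_def[symmetric] v_def[symmetric])
  qed
  define G where "G = D Int ball p 1"
  have oG: "open G" unfolding G_def using D by auto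
  have bG: "bounded G" unfolding G_def by (meson bounded_ball bounded_subset inf_le2)
  have cG: "x ~: ball z r0 & dist x p <= 1" if "x : closure G" for x
  proof -
   have "closure G <= - ball z r0" using z(2) unfolding G_def by (intro closure_minimal) (auto simp: closed_Compl)
   moreover have "closure G <= cball p 1" unfolding G_def by (intro closure_minimal) auto
   ultimately show ?thesis using that by (auto simp: dist_commute)
  qed
  have c\<psi>: "continuous_on S \<psi>" for S unfolding \<psi>_def using s by (intro continuous_on_powr' continuous_intros) auto
  have cwf: "continuous_on S wf" for S unfolding wf_def by (intro continuous_intros)
  have \<psi>lip: "\<bar>\<psi> x - \<psi> p\<bar> <= 6 * norm (x - p)" if "dist x p <= 1" for x
  proof -
   have pq: "norm (p - q) <= 2" using q(2) by (simp add: dist_norm norm_minus_commute)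
   have "norm (x - q) <= norm (x - p) + norm (p - q)" using norm_triangle_ineq[of "x - p" "p - q"] by simp
   hence xq: "norm (x - q) <= 3" using pq that by (simp add: dist_norm)
   have "\<bar>\<psi> x - \<psi> p\<bar> <= 6 * \<bar>norm (x - q) - norm (p - q)\<bar>" unfolding \<psi>e using pq xq by (intro powr_lipschitz s) auto
   also have "\<bar>norm (x - q) - norm (p - q)\<bar> <= norm (x - p)" using norm_triangle_ineq3[of "x - q" "p - q"] by simp
   finally show ?thesis by simp
  qed
  have wlow: "wf x >= c1 * (norm (x - p))^2" if x: "x : closure G" for x
  proof -
   define t where "t = al * ((norm (x - p))^2 / 2)"
   have h1: "(norm (x - p))^2 <= 1" using cG[OF x] by (simp add: dist_norm power_le_one)
   have t: "0 <= t" "t <= al / 2" using al h1 by (auto simp: t_def)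
   have "- al * ((norm (x - z'))^2 - r^2) <= - t" using outer[of x] cG[OF x] al mult_left_mono[of "(norm (x - p))^2 / 2" "(norm (x - z'))^2 - r^2" al]
    by (simp add: t_def)
   hence "exp (- al * ((norm (x - z'))^2 - r^2)) <= exp (- t)" by simp
   also have "... <= 1 / (1 + t)"
    using exp_ge_add_one_self[of t] t(1) by (simp add: exp_minus inverse_eq_divide frac_le)
   finally have "wf x >= 1 - 1 / (1 + t)" by (simp add: wf_def)
   also have "1 - 1 / (1 + t) = t / (1 + t)" using t by (simp add: field_simps)
   finally have "wf x >= t / (1 + t)" .
   moreover have "t / (1 + t) >= t / (1 + al / 2)" using t al by (intro divide_left_mono) auto
   moreover have "t / (1 + al / 2) = c1 * (norm (x - p))^2" using al by (simp add: t_def c1_def field_simps)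
   ultimately show ?thesis by linarith
  qed
  have main: "W x + C * \<psi> x - L * wf x <= C * \<psi> p + et / 2" if x: "x : G" for x
  proof (rule max_principle[OF oG bG _ _ _ x])
   show "continuous_on (closure G) (%x. W x + C * \<psi> x - L * wf x)"
    by (intro continuous_intros c\<psi> cwf continuous_on_subset[OF cW]) auto
   show "EX l>=0. has_lap (%x. W x + C * \<psi> x - L * wf x) u l" if u: "u : G" for u
   proof -
    obtain l where l: "- l <= C * (1 + norm (u - q) powr (- s))" "has_lap W u l" using lap[of u] u by (auto simp: G_def)
    have uq: "u ~= q" using u q by (auto simp: G_def)
    define rh where "rh = (norm (u - q))^2"
    have rh: "rh > 0" using uq by (simp add: rh_def)
    define e where "e = (2 - s) / 2"
    have "has_lap (%y. ((norm (y - q))^2) powr e) u (4 * (e * ((e - 1) * rh powr (e - 2))) * (norm (u - q))^2 + 2 * ?n * (e * ((norm (u - q))^2) powr (e - 1)))"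
    proof (rule has_lap_radial[of "{0<..}" u q "%t. t powr e" "%t. e * t powr (e - 1)"])
     show "((%t. t powr e) has_real_derivative e * t powr (e - 1)) (at t)" if "t : {0<..}" for t
      using that by (auto intro!: derivative_eq_intros)
     show "((%t. e * t powr (e - 1)) has_real_derivative e * ((e - 1) * rh powr (e - 2))) (at ((norm (u - q))^2))"
      using rh unfolding rh_def by (auto intro!: derivative_eq_intros simp: field_simps)
    qed (use rh in \<open>auto simp: rh_def\<close>)
    moreover have "4 * (e * ((e - 1) * rh powr (e - 2))) * rh + 2 * ?n * (e * rh powr (e - 1)) = (2 - s) * (?n - s) * norm (u - q) powr (- s)"
    proof -
     have a: "rh powr (e - 2) * rh = rh powr (e - 1)" using rh powr_add[of rh "e - 2" 1] by simp
     have "4 * (e * ((e - 1) * rh powr (e - 2))) * rh + 2 * ?n * (e * rh powr (e - 1))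
       = 2 * e * (2 * (e - 1) * (rh powr (e - 2) * rh) + ?n * rh powr (e - 1))" by (simp add: algebra_simps)
     also have "... = 2 * e * (2 * (e - 1) + ?n) * rh powr (e - 1)" unfolding a by (simp add: algebra_simps)
     finally have f0: "4 * (e * ((e - 1) * rh powr (e - 2))) * rh + 2 * ?n * (e * rh powr (e - 1))
       = 2 * e * (2 * (e - 1) + ?n) * rh powr (e - 1)" .
     have f1: "2 * e * (2 * (e - 1) + ?n) = (2 - s) * (?n - s)"
     proof -
      have "2 * e = 2 - s" by (simp add: e_def)
      moreover have "2 * (e - 1) + ?n = ?n - s" by (simp add: e_def field_simps)
      ultimately show ?thesis by simp
     qed
     have f2: "rh powr (e - 1) = norm (u - q) powr (- s)"
     proof -
      have nz: "norm (u - q) > 0" using uq by simp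
      have "rh = norm (u - q) powr 2" unfolding rh_def using powr_realpow[OF nz, of 2] by (simp only: of_nat_numeral)
      moreover have "2 * (e - 1) = - s" by (simp add: e_def field_simps)
      ultimately show ?thesis by (simp only: powr_powr)
     qed
     show ?thesis using f0 by (simp only: f1 f2)
    qed
    ultimately have h\<psi>: "has_lap \<psi> u ((2 - s) * (?n - s) * norm (u - q) powr (- s))"
     unfolding \<psi>_def[abs_def] e_def[symmetric] by (simp add: rh_def)
    define ta where "ta = (norm (u - z'))^2"
    define E where "E = exp (- al * (ta - r^2))"
    have hw: "has_lap wf u (4 * (- al * al * E) * ta + 2 * ?n * (al * E))"
     unfolding wf_def[abs_def] ta_def E_def
     by (rule has_lap_radial[of UNIV u z' "%t. 1 - exp (- al * (t - r^2))" "%t. al * exp (- al * (t - r^2))"])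
      (auto intro!: derivative_eq_intros)
    have uc: "u : closure G" using u closure_subset by blast
    have tar: "ta >= r^2" unfolding ta_def using outer[of u] cG[OF uc] by (smt (verit) zero_le_power2 divide_nonneg_pos)
    have ta1: "ta <= (1 + r)^2" unfolding ta_def
    proof (rule power_mono)
     have "norm (u - z') <= norm (u - p) + norm (p - z')" using norm_triangle_ineq[of "u - p" "p - z'"] by simp
     thus "norm (u - z') <= 1 + r" using cG[OF uc] zp' by (simp add: dist_norm)
    qed simp
    have Ek: "E >= ka" unfolding E_def ka_def using ta1 al by simp
    have "4 * (- al * al * E) * ta + 2 * ?n * (al * E) <= - c0"
    proof -
     have "al * ta >= ?n" using tar al r mult_left_mono[OF tar, of al] by (simp add: al_def)
     hence "al * E * (2 * ?n - 4 * (al * ta)) <= al * E * (- 2 * ?n)" using al by (intro mult_left_mono) (auto simp: E_def)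
     also have "... <= al * ka * (- 2 * ?n)" using Ek al n3 by (intro mult_right_mono_neg mult_left_mono) auto
     finally show ?thesis by (simp add: c0_def algebra_simps)
    qed
    hence Lw: "L * (4 * (- al * al * E) * ta + 2 * ?n * (al * E)) <= - (L * c0)"
     using L(4) mult_left_mono[of _ "- c0" L] by simp
    have "1 * 1 <= (2 - s) * (?n - s)" using s n3 by (intro mult_mono) auto
    hence "1 * norm (u - q) powr (- s) <= (2 - s) * (?n - s) * norm (u - q) powr (- s)" by (intro mult_right_mono) auto
    hence C\<psi>: "C * norm (u - q) powr (- s) <= C * ((2 - s) * (?n - s) * norm (u - q) powr (- s))" using C by (intro mult_left_mono) auto
    have "0 <= l + C * ((2 - s) * (?n - s) * norm (u - q) powr (- s)) - L * (4 * (- al * al * E) * ta + 2 * ?n * (al * E))"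
     using l(1) C\<psi> Lw L(1) by (simp add: distrib_left)
    moreover have "has_lap (%x. W x + C * \<psi> x - L * wf x) u (l + C * ((2 - s) * (?n - s) * norm (u - q) powr (- s)) - L * (4 * (- al * al * E) * ta + 2 * ?n * (al * E)))"
     by (intro has_lap_diff has_lap_add has_lap_cmult l(2) h\<psi> hw)
    ultimately show ?thesis by blast
   qed
   show "W u + C * \<psi> u - L * wf u <= C * \<psi> p + et / 2" if u: "u : frontier G" for u
   proof -
    have uc: "u : closure G" using u by (simp add: frontier_def)
    have uG: "u ~: G" using u oG by (simp add: frontier_def interior_open)
    define t where "t = norm (u - p)"
    have t: "0 <= t" "t <= 1" using cG[OF uc] by (auto simp: t_def dist_norm)
    have "\<psi> u - \<psi> p <= 6 * t" using \<psi>lip[of u] cG[OF uc] by (simp add: t_def abs_le_iff)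
    hence 1: "C * \<psi> u <= C * \<psi> p + 6 * C * t" using mult_left_mono[of "\<psi> u - \<psi> p" "6 * t" C] C by (simp add: algebra_simps)
    have "c1 * t^2 <= wf u" using wlow[OF uc] by (simp add: t_def)
    hence 2: "L * c1 * t^2 <= L * wf u" using L(4) mult_left_mono[of "c1 * t^2" "wf u" L] by (simp add: mult.assoc)
    show ?thesis
    proof (cases "u : D")
     case False
     have "2 * (6 * C * t / sqrt et) * (sqrt et) <= (6 * C * t / sqrt et)^2 + (sqrt et)^2" by (rule sum_squares_bound)
     hence "12 * C * t <= 36 * C^2 * t^2 / et + et" using et by (simp add: power_mult_distrib power_divide)
     hence "6 * C * t <= 18 * C^2 / et * t^2 + et / 2" by simp
     also have "18 * C^2 / et * t^2 <= L * c1 * t^2" using L(2) by (intro mult_right_mono) auto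
     finally show ?thesis using 1 2 W0[OF False] by linarith
    next
     case True
     hence "t >= 1" using uG by (simp add: G_def t_def dist_norm norm_minus_commute)
     hence t1: "t = 1" using t by simp
     show ?thesis using 1 2 WM[of u] L(3) et unfolding t1 by simp
    qed
   qed
  qed
  show "W y <= et"
  proof (cases "y : D")
   case False
   thus ?thesis using W0 et by simp
  next
   case True
   define t where "t = norm (y - p)"
   have t: "0 <= t" "t <= de" "t < 1" using y de by (auto simp: t_def dist_norm)
   have yG: "y : G" using True t by (simp add: G_def t_def dist_norm norm_minus_commute)
   have "\<psi> p - \<psi> y <= 6 * t" using \<psi>lip[of y] t by (simp add: t_def abs_le_iff dist_norm)
   hence 1: "C * \<psi> p - C * \<psi> y <= 6 * C * t" using mult_left_mono[of "\<psi> p - \<psi> y" "6 * t" C] C by (simp add: algebra_simps)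
   have "wf y <= al * ((norm (y - z'))^2 - r^2)" unfolding wf_def using exp_ge_add_one_self[of "- al * ((norm (y - z'))^2 - r^2)"] by simp
   also have "... <= al * ((1 + 2 * r) * t)"
   proof (rule mult_left_mono)
    have "norm (y - z') <= t + r" using norm_triangle_ineq[of "y - p" "p - z'"] zp' by (simp add: t_def)
    hence "(norm (y - z'))^2 <= (t + r)^2" by (intro power_mono) auto
    moreover have "t * t <= 1 * t" using t by (intro mult_right_mono) auto
    ultimately show "(norm (y - z'))^2 - r^2 <= (1 + 2 * r) * t" by (simp add: power2_eq_square algebra_simps)
   qed (use al in simp)
   finally have "L * wf y <= L * (al * ((1 + 2 * r) * t))" using L(4) by (intro mult_left_mono) auto
   hence 2: "L * wf y <= L * al * (1 + 2 * r) * t" by (simp add: mult.assoc)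
   have "W y <= 6 * C * t + et / 2 + L * al * (1 + 2 * r) * t" using main[OF yG] 1 2 by linarith
   also have "... <= K * t + et / 2" using t(1) by (simp add: K_def algebra_simps)
   also have "K * t <= K * de" using t K by (intro mult_left_mono) auto
   finally show ?thesis using de(3) by (simp add: mult.commute)
  qed
 qed
qed

section \<open>Equicontinuity and compactness\<close>

lemma frontier_between:
 fixes D :: "'a::euclidean_space set"
 assumes "x : D" "y ~: D"
 obtains p where "p : frontier D" "dist x p <= dist x y"
proof -
 have "closed_segment x y Int frontier D ~= {}"
  by (rule connected_Int_frontier) (use assms in auto)
 then obtain p where p: "p : closed_segment x y" "p : frontier D" by blast
 have "dist x p <= dist x y" using segment_bound(1)[OF p(1)] by (simp add: dist_norm norm_minus_commute)
 thus thesis using p that by blast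
qed

text \<open>If both points are within \<open>de\<close> of the complement of \<open>D j\<close>, the
  barrier makes both values at most \<open>e / 4\<close>. Otherwise one of them is the centre of a
  ball of radius \<open>de\<close> in \<open>D j\<close>, and the interior gradient estimate
  applies.\<close>

lemma equicontinuous_family:
 fixes W :: "'i => 'a::euclidean_space => real"
 assumes n: "DIM('a) >= 3" and r0: "r0 > 0" and C: "C > 0" and M: "M > 0" and R: "R > 0"
  and D: "!!j. open (D j)" and cW: "!!j. continuous_on UNIV (W j)" and W0: "!!j y. y ~: D j ==> W j y = 0"
  and Wb: "!!j y. 0 <= W j y & W j y <= M" and q: "!!j. q j ~: D j" and s: "!!j. 0 < s j & s j <= 1"
  and ext: "!!j p. p : frontier (D j) ==> EX z. dist z p = r0 & ball z r0 Int D j = {}"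
  and lap: "!!j y. y : D j ==> norm y < R + 4 ==> EX L. \<bar>L\<bar> <= C * (1 + norm (y - q j) powr (- s j)) & has_lap (W j) y L"
  and der: "!!j y. y : D j ==> GDERIV (W j) y :> g j y"
  and e: "e > 0"
 shows "EX d>0. ALL j. ALL x:cball 0 R. ALL y:cball 0 R. norm (x - y) < d --> \<bar>W j x - W j y\<bar> < e"
proof -
 let ?n = "real DIM('a)"
 have C2: "2 * C > 0" and e4: "e / 4 > 0" using C e by auto
 obtain de where de: "de > 0" "de < 1" and bar: "!!(W::'a => real) D p z q s y. [|open D; p ~: D; dist z p = r0; ball z r0 Int D = {};
   continuous_on UNIV W; !!y. y ~: D ==> W y = 0; !!y. W y <= M; q ~: D; dist q p <= 2; 0 < s; s <= 1;
   !!y. y : D ==> y : ball p 1 ==> EX L. - L <= 2 * C * (1 + norm (y - q) powr (- s)) & has_lap W y L; dist y p <= de|]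
   ==> W y <= e / 4"
  using boundary_barrier[OF n r0 C2 M e4] by blast
 have near: "W j x <= e / 4" if x: "norm x <= R" and t: "t ~: D j" "dist x t < de" for j x t
 proof (cases "x : D j")
  case False
  thus ?thesis using W0 e by simp
 next
  case True
  obtain p where p: "p : frontier (D j)" "dist x p <= dist x t" using frontier_between[OF True t(1)] by blast
  have pD: "p ~: D j" using p(1) D[of j] by (simp add: frontier_def interior_open)
  obtain z where z: "dist z p = r0" "ball z r0 Int D j = {}" using ext[OF p(1)] by blast
  have np: "norm p <= R + 1"
   using norm_triangle_sub[of p x] x p(2) t(2) de(2) by (simp add: dist_norm norm_minus_commute)
  have ny: "norm y < R + 4" if "y : ball p 1" for y
   using norm_triangle_sub[of y p] np that by (simp add: dist_norm norm_minus_commute)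
  \<comment> \<open>A pole at distance more than 2 from \<open>p\<close> is replaced by
    \<open>p\<close>: on \<open>ball p 1\<close> its weight is at most 1, which the doubled constant
    \<open>2 * C\<close> covers.\<close>
  define q' where "q' = (if dist (q j) p <= 2 then q j else p)"
  show ?thesis
  proof (rule bar[OF D pD z cW W0 _ _ _ _ _ _ , of j q' "s j"])
   show "W j y <= M" for y using Wb by blast
   show "q' ~: D j" using q pD by (simp add: q'_def)
   show "dist q' p <= 2" by (simp add: q'_def)
   show "0 < s j" "s j <= 1" using s by auto
   show "dist x p <= de" using p t by simp
   show "EX L. - L <= 2 * C * (1 + norm (y - q') powr (- s j)) & has_lap (W j) y L" if y: "y : D j" "y : ball p 1" for y
   proof -
    obtain L where L: "\<bar>L\<bar> <= C * (1 + norm (y - q j) powr (- s j))" "has_lap (W j) y L" using lap[OF y(1) ny[OF y(2)]] by blast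
    have "C * (1 + norm (y - q j) powr (- s j)) <= 2 * C * (1 + norm (y - q') powr (- s j))"
    proof (cases "dist (q j) p <= 2")
     case True
     thus ?thesis using C by (simp add: q'_def)
    next
     case False
     have "dist (q j) p <= dist (q j) y + dist y p" by (rule dist_triangle)
     hence "norm (y - q j) >= 1" using False y(2) by (simp add: dist_norm norm_minus_commute)
     hence "norm (y - q j) powr (- s j) <= 1 powr (- s j)" using s[of j] by (intro powr_mono2') auto
     hence "C * (1 + norm (y - q j) powr (- s j)) <= C * (1 + 1)" using C by (intro mult_left_mono) auto
     also have "... <= 2 * C * (1 + norm (y - q') powr (- s j))" using C by simp
     finally show ?thesis .
    qed
    thus ?thesis using L by (intro exI[of _ L]) auto
   qed
  qed
 qed
 \<comment> \<open>On the balls of radius \<open>de / 4\<close> used below the pole is at distance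
   at least \<open>de / 4\<close>, which is less than 1, so the weight is at most
   \<open>4 / de\<close> for every exponent \<open>s j <= 1\<close>.\<close>
 define F where "F = C * (1 + 4 / de)"
 define L0 where "L0 = ?n * (?n * M / (de/4) + F * (de/4) / 2)"
 have F0: "F >= 0" using C de by (simp add: F_def)
 have L0: "L0 >= 0" using F0 M de by (simp add: L0_def)
 define d where "d = min (de/2) (e / (L0 + 1))"
 have d: "d > 0" "d <= de / 2" "d * L0 < e"
 proof -
  show "d > 0" using de e L0 by (auto simp: d_def)
  show "d <= de / 2" by (simp only: d_def min.cobounded1)
  have "d <= e / (L0 + 1)" by (simp add: d_def)
  hence "d * (L0 + 1) <= e" using L0 by (simp add: field_simps)
  thus "d * L0 < e" using \<open>d > 0\<close> by (simp add: algebra_simps)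
 qed
 have inner: "\<bar>W j x - W j y\<bar> < e" if x: "norm x <= R" and sub: "ball x de <= D j" and y: "norm (x - y) < d" for j x y
 proof -
  have grad: "norm (g j u) <= L0" if u: "u : ball x (de/2)" for u
   unfolding L0_def
  proof (rule norm_le_Basis_bound)
   fix b :: 'a assume b: "b : Basis"
   have c: "v : ball x de" if "v : cball u (de/4)" for v
    using dist_triangle[of x v u] u that de(1) by simp
   have uD: "u : D j" using sub c[of u] de(1) by auto
   show "\<bar>b \<bullet> g j u\<bar> <= ?n * M / (de/4) + F * (de/4) / 2"
   proof (rule gradient_estimate[OF b, of "de/4" u "W j" F M])
    show "continuous_on (cball u (de/4)) (W j)" by (rule continuous_on_subset[OF cW]) simp
    show "\<bar>W j v\<bar> <= M" for v using Wb[of j v] by auto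
    show "GDERIV (W j) u :> g j u" by (rule der[OF uD])
    show "EX L. \<bar>L\<bar> <= F & has_lap (W j) v L" if v: "v : ball u (de/4)" for v
    proof -
     have vx: "v : ball x de" using c v by auto
     hence vD: "v : D j" using sub by blast
     have nv: "norm v < R + 4" using norm_triangle_sub[of v x] x vx de(2) by (simp add: dist_norm norm_minus_commute)
     obtain L where L: "\<bar>L\<bar> <= C * (1 + norm (v - q j) powr (- s j))" "has_lap (W j) v L" using lap[OF vD nv] by blast
     have "q j ~: ball x de" using q sub by blast
     hence "dist x (q j) >= de" by simp
     moreover have "dist x (q j) <= dist x u + (dist u v + dist v (q j))"
      using dist_triangle[of x "q j" u] dist_triangle[of u "q j" v] by linarith
     moreover have "dist x u < de / 2" "dist u v < de/4" using u v by auto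
     ultimately have nq: "norm (v - q j) >= de/4" by (simp add: dist_norm)
     have "norm (v - q j) powr (- s j) <= (de/4) powr (- s j)" using nq s[of j] de(1) by (intro powr_mono2') auto
     also have "... <= (de/4) powr (- 1)" using s[of j] de by (intro powr_mono') auto
     also have "... = 4 / de" using de(1) by (simp add: powr_minus_divide)
     finally have "C * (1 + norm (v - q j) powr (- s j)) <= F" unfolding F_def using C by (intro mult_left_mono) auto
     thus ?thesis using L by (intro exI[of _ L]) auto
    qed
   qed (use de in auto)
  qed
  have "\<bar>W j x - W j y\<bar> <= L0 * norm (x - y)"
  proof (rule GDERIV_lipschitz[of "ball x (de/2)" "W j" "g j"])
   show "GDERIV (W j) u :> g j u" if "u : ball x (de/2)" for u
    by (rule der) (use that sub de(1) in \<open>auto simp: subset_iff\<close>)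
  qed (use grad y d de in \<open>auto simp: dist_norm\<close>)
  also have "... <= L0 * d" using y L0 by (intro mult_left_mono) auto
  finally show ?thesis using d(3) by (simp add: mult.commute)
 qed
 have "\<bar>W j x - W j y\<bar> < e" if x: "norm x <= R" and y: "norm y <= R" and xy: "norm (x - y) < d" for j x y
 proof -
  consider "ball x de <= D j" | "ball y de <= D j" | t u where "t ~: D j" "dist x t < de" "u ~: D j" "dist y u < de"
   by (force simp: subset_iff)
  thus ?thesis
  proof cases
   case 1
   thus ?thesis using inner[OF x] xy by blast
  next
   case 2
   thus ?thesis using inner[OF y 2, of x] xy by (simp add: norm_minus_commute abs_minus_commute)
  next
   case (3 t u)
   have "W j x <= e / 4" "W j y <= e / 4" using near[OF x 3(1,2)] near[OF y 3(3,4)] by auto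
   moreover have "0 <= W j x" "0 <= W j y" using Wb by auto
   ultimately show ?thesis using e by linarith
  qed
 qed
 thus ?thesis using d(1) by (intro exI[of _ d]) auto
qed

lemma ascoli_diagonal:
 fixes W :: "nat => 'a::euclidean_space => real"
 assumes bd: "!!j x. \<bar>W j x\<bar> <= M"
  and eq: "!!R e. R > 0 ==> e > 0 ==> EX d>0. ALL j. ALL x:cball 0 R. ALL y:cball 0 R. norm (x - y) < d --> \<bar>W j x - W j y\<bar> < e"
 obtains r V where "strict_mono (r :: nat => nat)" "continuous_on UNIV V" "!!R. uniform_limit (cball 0 R) (%j. W (r j)) V sequentially"
proof -
 define B where "B n = cball (0::'a) (real (Suc n))" for n
 define P where "P n s \<longleftrightarrow> (EX g. uniform_limit (B n) (%j. W (s j)) g sequentially)" for n and s :: "nat => nat"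
 interpret subseqs P
 proof
  fix n and s :: "nat => nat" assume "strict_mono s"
  have eqB: "EX d>0. ALL j y. y : B n & norm (x - y) < d --> norm (W (s j) x - W (s j) y) < e" if "x : B n" "e > 0" for x e
  proof -
   have "real (Suc n) > 0" by simp
   from eq[OF this that(2)] obtain d where "d > 0" "ALL j. ALL x:B n. ALL y:B n. norm (x - y) < d --> \<bar>W j x - W j y\<bar> < e"
    unfolding B_def by blast
   thus ?thesis using that(1) by auto
  qed
  obtain g k where k: "strict_mono (k :: nat => nat)" "!!e. 0 < e ==> EX N. ALL m x. m >= N & x : B n --> norm (W (s (k m)) x - g x) < e"
  proof (rule Arzela_Ascoli[of "B n" "%j. W (s j)" M])
   show "compact (B n)" by (simp add: B_def)
   show "norm (W (s m) x) <= M" for m x using bd by simp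
  qed (use eqB in auto)
  have "uniform_limit (B n) (%j. W (s (k j))) g sequentially"
   unfolding uniform_limit_sequentially_iff dist_norm using k(2) by blast
  hence "P n (s \<circ> k)" unfolding P_def by auto
  thus "EX r'. strict_mono r' & P n (s \<circ> r')" using k(1) by blast
 qed
 have "P n diagseq" for n
 proof -
  \<comment> \<open>The diagonal sequence is a subsequence of the \<open>n\<close>-th choice only
    from some index on; the shift is undone afterwards.\<close>
  have "P n (diagseq \<circ> ((+) (Suc n)))"
  proof (rule diagseq_holds)
   fix m and r s :: "nat => nat" assume r: "strict_mono r" and P: "P m s"
   then obtain g where g: "uniform_limit (B m) (%j. W (s j)) g sequentially" unfolding P_def by blast
   have "uniform_limit (B m) (%j. W (s (r j))) g sequentially"
    using filterlim_compose[OF g filterlim_subseq[OF r]] by simp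
   thus "P m (s \<circ> r)" unfolding P_def by auto
  qed
  then obtain g where g: "uniform_limit (B n) (%j. W (diagseq (Suc n + j))) g sequentially" unfolding P_def by auto
  have "uniform_limit (B n) (%j. W (diagseq j)) g sequentially"
   unfolding uniform_limit_sequentially_iff
  proof (intro allI impI)
   fix e :: real assume "e > 0"
   then obtain N where N: "!!j x. j >= N ==> x : B n ==> dist (W (diagseq (Suc n + j)) x) (g x) < e"
    using g unfolding uniform_limit_sequentially_iff by meson
   have "dist (W (diagseq j) x) (g x) < e" if "j >= Suc n + N" "x : B n" for j x
    using N[of "j - Suc n" x] that by simp
   thus "EX N. ALL j>=N. ALL x:B n. dist (W (diagseq j) x) (g x) < e" by blast
  qed
  thus ?thesis unfolding P_def by blast
 qed
 hence "ALL n. EX g. uniform_limit (B n) (%j. W (diagseq j)) g sequentially" unfolding P_def by blast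
 from choice[OF this] obtain G where G: "!!n. uniform_limit (B n) (%j. W (diagseq j)) (G n) sequentially" by blast
 define V where "V x = lim (%j. W (diagseq j) x)" for x
 have GV: "G n x = V x" if "x : B n" for n x
  using limI[OF tendsto_uniform_limitI[OF G that]] by (simp add: V_def)
 have ulB: "uniform_limit (B n) (%j. W (diagseq j)) V sequentially" for n
  using G[of n] GV[of _ n] unfolding uniform_limit_sequentially_iff by auto
 have cW: "continuous_on (B n) (W j)" for n j
  unfolding continuous_on_iff
 proof (intro ballI allI impI)
  fix x and e :: real assume x: "x : B n" and e: "e > 0"
  obtain d where "d > 0" "ALL j. ALL x:B n. ALL y:B n. norm (x - y) < d --> \<bar>W j x - W j y\<bar> < e"
   using eq[of "real (Suc n)" e] e unfolding B_def by auto
  thus "EX d>0. ALL x':B n. dist x' x < d --> dist (W j x') (W j x) < e" using x by (auto simp: dist_norm)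
 qed
 have cVB: "continuous_on (B n) V" for n by (rule uniform_limit_theorem[OF _ ulB]) (use cW in auto)
 have "continuous_on UNIV V"
 proof (rule continuous_at_imp_continuous_on, rule ballI)
  fix x :: 'a
  obtain N where "norm x <= real N" using real_arch_simple by blast
  hence "x : interior (B N)" by (simp add: B_def)
  thus "isCont V x" using cVB continuous_on_interior by blast
 qed
 moreover have "uniform_limit (cball 0 R) (%j. W (diagseq j)) V sequentially" for R
 proof -
  obtain N where "R <= real N" using real_arch_simple by blast
  hence "cball 0 R <= B N" by (auto simp: B_def)
  thus ?thesis using uniform_limit_on_subset[OF ulB] by blast
 qed
 ultimately show thesis using that[OF subseq_diagseq] by blast
qed

section \<open>Locally uniform convergence of gradients\<close>

lemma C1_limit_ball:
 fixes u :: "nat => 'a::euclidean_space => real"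
 assumes rh: "rh > 0" and der: "!!j x. x : cball y0 (2 * rh) ==> GDERIV (u j) x :> g j x" and cg: "!!j. continuous_on (cball y0 (2 * rh)) (g j)"
  and lap: "!!j x. x : cball y0 (2 * rh) ==> has_lap (u j) x (L j x)"
  and uV: "uniform_limit (cball y0 (2 * rh)) u V sequentially" and LF: "uniform_limit (cball y0 (2 * rh)) L F sequentially"
 obtains h where "continuous_on (ball y0 rh) h" "!!x. x : ball y0 rh ==> GDERIV V x :> h x" "uniform_limit (ball y0 rh) g h sequentially"
proof (rule grad_Cauchy_limit[of "ball y0 rh" u g V])
 let ?n = "real DIM('a)"
 have sub: "ball y0 rh <= cball y0 (2 * rh)" using rh by auto
 show "GDERIV (u j) x :> g j x" if "x : ball y0 rh" for j x using der that sub by blast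
 show "continuous_on (ball y0 rh) (g j)" for j using cg continuous_on_subset[OF _ sub] by blast
 show "(%j. u j x) ----> V x" if "x : ball y0 rh" for x using tendsto_uniform_limitI[OF uV] that sub by blast
 show "EX N. ALL i>=N. ALL j>=N. ALL x:ball y0 rh. norm (g i x - g j x) < e" if e: "e > 0" for e
 proof -
  define Q where "Q = ?n * (?n * 2 / rh + 2 * rh / 2)"
  have Q: "Q > 0" using rh by (simp add: Q_def add_pos_pos)
  define et where "et = e / (2 * Q)"
  have et: "et > 0" using e Q by (simp add: et_def)
  obtain N1 where N1: "!!j x. j >= N1 ==> x : cball y0 (2 * rh) ==> dist (u j x) (V x) < et"
   using uV et unfolding uniform_limit_sequentially_iff by meson
  obtain N2 where N2: "!!j x. j >= N2 ==> x : cball y0 (2 * rh) ==> dist (L j x) (F x) < et"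
   using LF et unfolding uniform_limit_sequentially_iff by meson
  have "norm (g i x - g j x) < e" if ij: "i >= max N1 N2" "j >= max N1 N2" and x: "x : ball y0 rh" for i j x
  proof -
   have c: "y : cball y0 (2 * rh)" if "y : cball x rh" for y using dist_triangle[of y0 y x] x that by simp
   \<comment> \<open>The difference of two members has small values and a small Laplacian on the
     ball of radius \<open>rh\<close> around \<open>x\<close>, so its gradient at \<open>x\<close>
     is small.\<close>
   have "\<bar>b \<bullet> (g i x - g j x)\<bar> <= ?n * (2 * et) / rh + (2 * et) * rh / 2" if b: "b : Basis" for b
   proof (rule gradient_estimate[OF b rh, of x "%y. u i y - u j y"])
    have "continuous_on (cball x rh) (u j)" for j
     by (rule continuous_at_imp_continuous_on) (use der c GDERIV_continuous in blast)
    thus "continuous_on (cball x rh) (%y. u i y - u j y)" by (intro continuous_intros)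
    show "GDERIV (%y. u i y - u j y) x :> g i x - g j x" using x rh by (intro GDERIV_diff der) (auto intro: c)
    show "\<bar>u i y - u j y\<bar> <= 2 * et" if "y : cball x rh" for y
     using N1[of i y] N1[of j y] ij c[OF that] by (simp add: dist_real_def)
    show "EX l. \<bar>l\<bar> <= 2 * et & has_lap (%y. u i y - u j y) y l" if "y : ball x rh" for y
    proof -
     have yc: "y : cball y0 (2 * rh)" using c that by auto
     have "has_lap (%y. u i y - u j y) y (L i y - L j y)" by (intro has_lap_diff lap yc)
     moreover have "\<bar>L i y - L j y\<bar> <= 2 * et" using N2[of i y] N2[of j y] ij yc by (simp add: dist_real_def)
     ultimately show ?thesis by blast
    qed
   qed
   from norm_le_Basis_bound[OF this] have "norm (g i x - g j x) <= Q * et" by (simp add: Q_def algebra_simps)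
   also have "... = e / 2" using Q by (simp add: et_def)
   finally show ?thesis using e by simp
  qed
  thus ?thesis by blast
 qed
qed (use that in auto)

text \<open>The domains \<open>D j\<close> vary with \<open>j\<close>, but all late ones contain a
  given closed ball of \<open>P\<close>. After a shift of indices \<open>C1_limit_ball\<close>
  applies, and finitely many balls cover a compact set.\<close>

lemma C1_limit_open:
 fixes u :: "nat => 'a::euclidean_space => real"
 assumes P: "open P" and D: "!!K. compact K ==> K <= P ==> \<forall>\<^sub>F j in sequentially. K <= D j"
  and der: "!!j x. x : D j ==> GDERIV (u j) x :> g j x" and cg: "!!j. continuous_on (D j) (g j)"
  and lap: "!!j x. x : D j ==> has_lap (u j) x (L j x)"
  and uV: "!!K. compact K ==> K <= P ==> uniform_limit K u V sequentially"
  and LF: "!!K. compact K ==> K <= P ==> uniform_limit K L F sequentially"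
 shows "x : P ==> GDERIV V x :> grad V x" "continuous_on P (grad V)" "compact K ==> K <= P ==> uniform_limit K g (grad V) sequentially"
proof -
 have loc: "EX rh>0. ball x rh <= P & (ALL y:ball x rh. GDERIV V y :> grad V y) & continuous_on (ball x rh) (grad V)
   & uniform_limit (ball x rh) g (grad V) sequentially" if x: "x : P" for x
 proof -
  obtain rh0 where rh0: "rh0 > 0" "cball x rh0 <= P" using P x by (meson open_contains_cball)
  define rh where "rh = rh0 / 2"
  have rh: "rh > 0" "2 * rh = rh0" using rh0 by (auto simp: rh_def)
  obtain J where J: "!!j. j >= J ==> cball x (2 * rh) <= D j"
   using D[of "cball x (2 * rh)"] rh0 rh unfolding eventually_sequentially by auto
  have s: "filterlim (%j. j + J) sequentially sequentially" by (rule filterlim_add_const_nat_at_top)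
  have ul: "uniform_limit (cball x (2 * rh)) (%j. u (j + J)) V sequentially" "uniform_limit (cball x (2 * rh)) (%j. L (j + J)) F sequentially"
   using filterlim_compose[OF uV s] filterlim_compose[OF LF s] rh0 rh by auto
  obtain h where h: "continuous_on (ball x rh) h" "!!y. y : ball x rh ==> GDERIV V y :> h y" "uniform_limit (ball x rh) (%j. g (j + J)) h sequentially"
  proof (rule C1_limit_ball[OF rh(1), of x "%j. u (j + J)" "%j. g (j + J)" "%j. L (j + J)" V F])
   show "GDERIV (u (j + J)) y :> g (j + J) y" if "y : cball x (2 * rh)" for j y using der J that by (metis le_add2 subsetD)
   show "continuous_on (cball x (2 * rh)) (g (j + J))" for j using cg J continuous_on_subset by (metis le_add2)
   show "has_lap (u (j + J)) y (L (j + J) y)" if "y : cball x (2 * rh)" for j y using lap J that by (metis le_add2 subsetD)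
  qed (use ul in auto)
  have hg: "h y = grad V y" if "y : ball x rh" for y using GDERIV_grad[OF h(2)[OF that]] by simp
  have "uniform_limit (ball x rh) g h sequentially"
   unfolding uniform_limit_sequentially_iff
  proof (intro allI impI)
   fix e :: real assume "e > 0"
   then obtain N where N: "!!j y. j >= N ==> y : ball x rh ==> dist (g (j + J) y) (h y) < e"
    using h(3) unfolding uniform_limit_sequentially_iff by meson
   have "dist (g j y) (h y) < e" if "j >= N + J" "y : ball x rh" for j y using N[of "j - J" y] that by simp
   thus "EX N. ALL j>=N. ALL y:ball x rh. dist (g j y) (h y) < e" by blast
  qed
  hence "uniform_limit (ball x rh) g (grad V) sequentially" using hg unfolding uniform_limit_sequentially_iff by auto
  moreover have "continuous_on (ball x rh) (grad V)" using h(1) hg by (metis continuous_on_cong)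
  moreover have "ball x rh <= P" using rh0 rh by auto
  ultimately show ?thesis using h(2) hg rh(1) by (intro exI[of _ rh]) auto
 qed
 show "GDERIV V x :> grad V x" if "x : P" for x using loc[OF that] by (metis centre_in_ball)
 show "continuous_on P (grad V)"
 proof (rule continuous_at_imp_continuous_on, rule ballI)
  fix x assume "x : P"
  then obtain rh where "rh > 0" "continuous_on (ball x rh) (grad V)" using loc by blast
  thus "isCont (grad V) x" using continuous_on_eq_continuous_at[OF open_ball] by (metis centre_in_ball)
 qed
 show "uniform_limit K g (grad V) sequentially" if K: "compact K" "K <= P" for K
 proof -
  obtain rh where rh: "!!x. x : K ==> rh x > 0 & uniform_limit (ball x (rh x)) g (grad V) sequentially" using loc K(2) by (metis subsetD)
  obtain T where T: "T <= K" "finite T" "K <= (UN x:T. ball x (rh x))"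
   by (rule compactE_image[OF K(1), of K "%x. ball x (rh x)"]) (use rh in force)+
  show ?thesis unfolding uniform_limit_iff
  proof (intro allI impI)
   fix e :: real assume e: "e > 0"
   have "\<forall>\<^sub>F j in sequentially. ALL x:T. ALL y:ball x (rh x). dist (g j y) (grad V y) < e"
   proof (rule eventually_ball_finite[OF T(2)], rule ballI)
    fix x assume "x : T"
    thus "\<forall>\<^sub>F j in sequentially. ALL y:ball x (rh x). dist (g j y) (grad V y) < e"
     using rh[of x] T(1) e uniform_limitD by blast
   qed
   thus "\<forall>\<^sub>F j in sequentially. ALL y:K. dist (g j y) (grad V y) < e"
    by eventually_elim (use T(3) in blast)
  qed
 qed
qed

section \<open>Energy identities on a bounded domain\<close>

text \<open>Base and exponent both vary; for large \<open>j\<close> they stay in a compact rectangle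
  with base at least \<open>c > 0\<close>, on which \<open>powr\<close> is uniformly continuous in
  the pair.\<close>

lemma uniform_limit_powr:
 fixes f :: "nat => 'a::metric_space => real"
 assumes K: "compact K" and ul: "uniform_limit K f F sequentially" and cF: "continuous_on K F" and pos: "!!x. x : K ==> F x > 0"
  and e: "e ----> E"
 shows "uniform_limit K (%j x. f j x powr e j) (%x. F x powr E) sequentially"
proof (cases "K = {}")
 case False
 obtain xm where xm: "xm : K" "!!x. x : K ==> F xm <= F x" using continuous_attains_inf[OF K False cF] by blast
 obtain xM where xM: "xM : K" "!!x. x : K ==> F x <= F xM" using continuous_attains_sup[OF K False cF] by blast
 define c where "c = F xm / 2"
 have c: "c > 0" using pos[OF xm(1)] by (simp add: c_def)
 define S where "S = {c..F xM + c} \<times> {E - 1..E + 1}"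
 have "compact S" unfolding S_def by (intro compact_Times) auto
 moreover have "continuous_on S (%(t, q). t powr q)" unfolding case_prod_beta
  using c by (intro continuous_intros) (auto simp: S_def)
 ultimately have uc: "uniformly_continuous_on S (%(t, q). t powr q)" by (metis compact_uniformly_continuous)
 show ?thesis unfolding uniform_limit_iff
 proof (intro allI impI)
  fix ep :: real assume "ep > 0"
  then obtain d where d: "d > 0" "!!p p'. p : S ==> p' : S ==> dist p' p < d ==> dist (case p' of (t, q) => t powr q) (case p of (t, q) => t powr q) < ep"
   using uc unfolding uniformly_continuous_on_def by metis
  define et where "et = min c (d / 2)"
  have et: "et > 0" using c d by (simp add: et_def)
  define th where "th = min 1 (d / 2)"
  have th: "th > 0" using d by (simp add: th_def)
  have "\<forall>\<^sub>F j in sequentially. ALL x:K. dist (f j x) (F x) < et" by (rule uniform_limitD[OF ul et])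
  moreover have "\<forall>\<^sub>F j in sequentially. dist (e j) E < th" using e th by (simp add: tendsto_iff)
  ultimately show "\<forall>\<^sub>F j in sequentially. ALL x:K. dist (f j x powr e j) (F x powr E) < ep"
  proof eventually_elim
   case (elim j)
   show ?case
   proof
    fix x assume x: "x : K"
    have f: "\<bar>f j x - F x\<bar> < c" "\<bar>f j x - F x\<bar> < d / 2" using elim(1) x by (auto simp: et_def dist_real_def)
    have q: "\<bar>e j - E\<bar> < 1" "\<bar>e j - E\<bar> < d / 2" using elim(2) by (auto simp: th_def dist_real_def)
    have Fx: "2 * c <= F x" "F x <= F xM" using xm(2)[OF x] xM(2)[OF x] by (auto simp: c_def)
    have "(F x, E) : S" using Fx c by (auto simp: S_def)
    moreover have "(f j x, e j) : S" using Fx f(1) q(1) c by (auto simp: S_def abs_less_iff)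
    moreover have "dist (f j x, e j) (F x, E) < d"
    proof -
     have "dist (f j x, e j) (F x, E) <= dist (f j x) (F x) + dist (e j) E"
      unfolding dist_Pair_Pair by (rule sqrt_sum_squares_le_sum) auto
     thus ?thesis using f(2) q(2) by (simp add: dist_real_def)
    qed
    ultimately show "dist (f j x powr e j) (F x powr E) < ep" using d(2)[of "(F x, E)" "(f j x, e j)"] by simp
   qed
  qed
 qed
qed simp

lemma H10_test_fun:
 assumes "open U" "test_fun U w" shows "H10 U w (grad w)"
proof -
 obtain K where C: "C1c w (grad w) K" "K <= U" using test_fun_C1c[OF assms(2)] by blast
 have K: "compact K" "!!x. x ~: K ==> w x = 0" using C by (auto simp: C1c_def)
 have cw: "continuous_on UNIV w" and cg: "continuous_on UNIV (grad w)" using C1c_cont[OF C(1)] C1c_cont_grad[OF C(1)] by auto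
 have m: "w : borel_measurable lebesgue" "grad w : borel_measurable lebesgue"
  using cont_borel_measurable[OF cw] cont_borel_measurable[OF cg] by (auto intro: measurable_completion)
 have ind: "(%x. indicator U x *R (w x)^2) = (%x. (w x)^2)" "(%x. indicator U x *R (norm (grad w x))^2) = (%x. (norm (grad w x))^2)"
  using K(2) C1c_grad_zero[OF C(1)] C(2) by (auto simp: indicator_def fun_eq_iff subset_iff)
 have b: "(%x. (w x)^2) : borel_measurable borel" "(%x. (norm (grad w x))^2) : borel_measurable borel"
  using cw cg by (auto intro!: cont_borel_measurable continuous_intros)
 have i1: "integrable lborel (%x. (w x)^2)"
  by (rule integrable_cont_compact[OF K(1)]) (use K in \<open>auto intro!: continuous_intros C1c_cont[OF C(1)]\<close>)
 have i2: "integrable lborel (%x. (norm (grad w x))^2)"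
  by (rule integrable_cont_compact[OF K(1)]) (use C1c_grad_zero[OF C(1)] in \<open>auto intro!: continuous_intros C1c_cont_grad[OF C(1)]\<close>)
 show ?thesis unfolding H10_def
 proof (intro conjI exI[of _ "%_. w"] allI assms(2))
  show "w : borel_measurable (lebesgue_on U)" "grad w : borel_measurable (lebesgue_on U)"
   using m by (auto intro: measurable_restrict_space1)
  show "integrable (lebesgue_on U) (%x. (w x)^2)"
   by (subst lebesgue_on_integrable[OF assms(1)]; unfold ind) (use b i1 in auto)
  show "integrable (lebesgue_on U) (%x. (norm (grad w x))^2)"
   by (subst lebesgue_on_integrable[OF assms(1)]; unfold ind) (use b i2 in auto)
 qed auto
qed

lemma cutf_mono: "0 < R ==> R <= R' ==> cutf R x <= cutf R' x"
proof -
 assume R: "0 < R" "R <= R'"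
 have "R^2 <= R'^2" using R by (intro power_mono) auto
 hence "(norm x)^2 / R'^2 <= (norm x)^2 / R^2" using R by (intro divide_left_mono) auto
 hence "psq ((norm x)^2 / R'^2 - 1) <= psq ((norm x)^2 / R^2 - 1)" by (intro psq_mono) simp
 thus ?thesis unfolding cutf_def by (intro psq_mono) simp
qed

text \<open>Prepares monotone convergence for the weighted integral, whose finiteness at the pole is
  a conclusion of \<open>energy\<close>.\<close>

lemma (in pos_C1) Wk_mono: "k <= l ==> Wk k x <= Wk l x"
proof -
 assume kl: "k <= l"
 have "trunc (1 / real (Suc k)) (V x) <= trunc (1 / real (Suc l)) (V x)"
  using kl nonneg by (intro trunc_mono) (auto simp: field_simps)
 moreover have "cutf (real (Suc k)) x <= cutf (real (Suc l)) x" using kl by (intro cutf_mono) auto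
 moreover have "0 <= trunc (1 / real (Suc l)) (V x)" using trunc_bounds[of "1 / real (Suc l)" "V x"] nonneg by auto
 ultimately show ?thesis unfolding Wk_def using cutf_bounds[of "real (Suc k)" x] by (intro mult_mono) auto
qed

section \<open>A positive solution of the Dirichlet problem with the pole on the boundary\<close>

locale dirichlet_solution =
 fixes Om :: "'a::euclidean_space set" and a :: "'a => real" and s :: real and u :: "'a => real" and A M N :: real
 assumes dim: "DIM('a) >= 3" and oOm: "open Om" and bOm: "bounded Om" and ne: "Om ~= {}" and zero: "0 : frontier Om"
  and s: "0 < s" "s < 2" and N: "N = crit DIM('a) s"
  and ca: "continuous_on Om a" and aA: "!!y. y : Om ==> \<bar>a y\<bar> <= A"
  and cu: "continuous_on (closure Om) u" and u2: "Ck (Suc (Suc 0)) Om u"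
  and gb: "EX G. ALL y:Om. norm (grad u y) <= G"
  and eq: "!!y. y : Om ==> lap u y + a y * u y = u y powr (N - 1) * norm y powr (- s)"
  and upos: "!!y. y : Om ==> u y > 0" and ubd: "!!y. y : frontier Om ==> u y = 0"
  and uM: "!!y. y : Om ==> u y <= M"
begin

definition ub :: "'a => real" where "ub y = (if y : Om then u y else 0)"

lemma zero_notin: "0 ~: Om" using zero oOm by (simp add: frontier_def interior_open)

lemma cub: "continuous_on UNIV ub"
proof -
 have "continuous_on (closure Om Un - Om) (%y. if y : Om then u y else 0)"
 proof (rule continuous_on_cases)
  show "closed (closure Om)" "closed (- Om)" using oOm by (auto simp: closed_Compl)
  show "continuous_on (closure Om) u" by (rule cu)
  show "ALL y. y : closure Om & y ~: Om | y : - Om & y : Om --> u y = 0"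
   using ubd oOm by (auto simp: frontier_def interior_open)
 qed auto
 moreover have "closure Om Un - Om = UNIV" using closure_subset by auto
 ultimately show ?thesis by (simp add: ub_def[abs_def])
qed

lemma u_GDERIV: "y : Om ==> GDERIV u y :> grad u y" by (rule Ck_GDERIV[OF Ck_SucD[OF u2]])

lemma ub_GDERIV: "y : Om ==> GDERIV ub y :> grad u y"
 by (rule GDERIV_transform_open[OF u_GDERIV oOm]) (auto simp: ub_def)

lemma cgrad: "continuous_on Om (grad u)"
 unfolding grad_eq_sum_pd[abs_def] using u2 by (intro continuous_intros) auto

lemma pos_C1_ub: "pos_C1 ub Om (grad u)"
 by unfold_locales (use oOm cub upos ub_GDERIV cgrad in \<open>auto simp: ub_def\<close>)

sublocale pc: pos_C1 ub Om "grad u" by (rule pos_C1_ub)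

lemma ub_has_lap: "y : Om ==> has_lap ub y (- lap u y)"
 by (rule has_lap_transform[OF Ck2_has_lap[OF oOm u2] oOm]) (auto simp: ub_def)

lemma M_pos: "M > 0" using ne upos uM by (meson all_not_in_conv less_le_trans)

lemma ub_le: "ub y <= M" using uM M_pos by (simp add: ub_def)

lemma compact_cl: "compact (closure Om)" using bOm by simp

lemma int_cont: "continuous_on UNIV (p::'a => real) ==> (!!y. y ~: Om ==> p y = 0) ==> integrable lborel p"
proof (rule integrable_cont_compact[OF compact_cl])
 assume p: "continuous_on UNIV p" "!!y. y ~: Om ==> p y = 0"
 show "continuous_on (closure Om) p" by (rule continuous_on_subset[OF p(1)]) simp
 show "p y = 0" if "y ~: closure Om" for y using p(2) that closure_subset by blast
qed

lemma int_bounded: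
 assumes "p : borel_measurable borel" "!!y. \<bar>p y\<bar> <= B" "!!y. y ~: Om ==> p y = 0"
 shows "integrable lborel (p :: 'a => real)"
proof (rule Bochner_Integration.integrable_bound[of _ "%y. indicator Om y * B"])
 have "Om : sets lborel" "emeasure lborel Om < \<infinity>" using oOm emeasure_bounded_finite[OF bOm] by auto
 thus "integrable lborel (%y. indicator Om y * B)" by simp
 have "\<bar>p y\<bar> <= \<bar>indicator Om y * B\<bar>" for y using assms(2,3)[of y] by (cases "y : Om") auto
 thus "AE y in lborel. norm (p y) <= norm (indicator Om y * B)" by simp
qed (use assms in simp)

lemma ig: "integrable lborel (%x. (norm (pc.gz x))^2)"
proof -
 obtain G where G: "!!y. y : Om ==> norm (grad u y) <= G" using gb by blast
 have G0: "\<bar>norm (pc.gz x)\<bar> <= \<bar>G\<bar>" for x using G[of x] by (auto simp: pc.gz_def)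
 show ?thesis
 proof (rule int_bounded[of _ "G^2"])
  show "(%x. (norm (pc.gz x))^2) : borel_measurable borel" using pc.gz_measurable by measurable
  show "\<bar>(norm (pc.gz y))^2\<bar> <= G^2" for y using G0[of y] unfolding abs_le_square_iff by simp
  show "(norm (pc.gz y))^2 = 0" if "y ~: Om" for y using that by (simp add: pc.gz_def)
 qed
qed

lemma iq: "q > 0 ==> integrable lborel (%x. ub x powr q)"
 by (rule int_cont) (use pc.nonneg in \<open>auto intro!: continuous_on_powr' cub continuous_on_const\<close>, simp add: ub_def)

lemma i2: "integrable lborel (%x. (ub x)^2)"
 by (rule int_cont) (intro continuous_intros cub, simp add: ub_def)

lemma icrit: "integrable lborel (%x. ub x powr crit DIM('a) 0)"
 by (rule iq) (use dim in \<open>simp add: crit_def\<close>)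

lemma am: "(%y. indicator Om y * a y) : borel_measurable borel"
 using borel_measurable_continuous_on_indicator[OF _ ca] oOm by auto

lemma N_gt: "N > 2" using s dim by (simp add: N crit_def field_simps)

definition DE :: real where "DE = (LBINT x. (norm (pc.gz x))^2)"
definition AE' :: real where "AE' = (LBINT x. a x * (ub x)^2)"
definition wt :: "'a => real" where "wt y = ub y powr N * norm y powr (- s)"
definition II :: real where "II = integral\<^sup>L lborel wt"

lemma weak: "C1c f h S ==> S <= Om ==> (LBINT x. h x \<bullet> grad u x) = (LBINT x. f x * lap u x)"
 by (rule green_identity[OF _ oOm _ u2])

lemma nm[measurable]: "(%y::'a. norm y powr (- s)) : borel_measurable borel" by measurable

lemma ubm[measurable]: "ub : borel_measurable borel" by (rule pc.V_measurable)

lemma Wkm[measurable]: "pc.Wk k : borel_measurable borel" by (rule cont_borel_measurable[OF C1c_cont[OF pc.Wk_C1c]])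

lemma Wk_off: "y ~: Om ==> pc.Wk k y = 0" using pc.Wk_bounds[of k y] by (simp add: ub_def)

lemma ia: "integrable lborel (%x. a x * (ub x)^2)"
proof (rule int_bounded[of _ "A * M^2"])
 have "(%x. (indicator Om x * a x) * (ub x)^2) : borel_measurable borel" using am by measurable
 moreover have "(%x. (indicator Om x * a x) * (ub x)^2) = (%x. a x * (ub x)^2)" by (auto simp: indicator_def ub_def)
 ultimately show "(%x. a x * (ub x)^2) : borel_measurable borel" by simp
 have A0: "A >= 0" using ne aA abs_ge_zero order_trans by (metis all_not_in_conv)
 show "\<bar>a y * (ub y)^2\<bar> <= A * M^2" for y
 proof (cases "y : Om")
  case True
  have "(ub y)^2 <= M^2" using ub_le[of y] pc.nonneg[of y] by (intro power_mono) auto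
  thus ?thesis unfolding abs_mult using aA[OF True] A0 by (intro mult_mono) auto
 qed (use A0 in \<open>simp add: ub_def\<close>)
qed (simp add: ub_def)

text \<open>The weight is unbounded near 0, so the product of \<open>u\<close> with its equation is
  reached through \<open>Wk\<close>: the gradient and potential terms converge to finite limits, and
  monotone convergence then gives both finiteness and value of the weighted integral.\<close>

lemma energy: "integrable lborel wt" "II = DE + AE'"
proof -
 define f where "f k y = pc.Wk k y * (ub y powr (N - 1) * norm y powr (- s))" for k y
 define h where "h k y = a y * (pc.Wk k y * ub y)" for k y
 have fh: "pc.Wk k y * lap u y = f k y - h k y" for k y
 proof (cases "y : Om")
  case True
  hence "lap u y = ub y powr (N - 1) * norm y powr (- s) - a y * ub y" using eq[OF True] by (simp add: ub_def)
  thus ?thesis unfolding f_def h_def by (simp only:) (simp add: algebra_simps)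
 qed (simp add: f_def h_def Wk_off)
 have hm: "h k : borel_measurable borel" for k
 proof -
  have "(%y. (indicator Om y * a y) * (pc.Wk k y * ub y)) : borel_measurable borel" using am by measurable
  moreover have "(%y. (indicator Om y * a y) * (pc.Wk k y * ub y)) = h k" by (auto simp: indicator_def ub_def h_def)
  ultimately show ?thesis by simp
 qed
 have hb: "\<bar>h k y\<bar> <= \<bar>a y * (ub y)^2\<bar>" for k y
  unfolding h_def power2_eq_square abs_mult using pc.Wk_bounds[of k y] by (intro mult_left_mono mult_right_mono) auto
 have hi: "integrable lborel (h k)" for k
  by (rule Bochner_Integration.integrable_bound[OF ia]) (use hm hb in auto)
 have hl: "(%k. integral\<^sup>L lborel (h k)) ----> AE'" unfolding AE'_def
 proof (rule integral_dominated_convergence[where w="%y. \<bar>a y * (ub y)^2\<bar>"])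
  show "AE y in lborel. (%k. h k y) ----> a y * (ub y)^2"
  proof (rule AE_I2)
   fix y show "(%k. h k y) ----> a y * (ub y)^2" unfolding h_def power2_eq_square by (intro tendsto_intros pc.Wk_tendsto)
  qed
 qed (use ia hm hb borel_measurable_integrable[OF ia] in auto)
 have fi: "integrable lborel (f k)" for k
 proof (rule integrable_cont_compact[of "pc.Sk k"])
  have C: "C1c (pc.Wk k) (pc.Gk k) (pc.Sk k)" by (rule pc.Wk_C1c)
  show "compact (pc.Sk k)" using C by (simp add: C1c_def)
  have "y ~= 0" "ub y ~= 0" if "y : pc.Sk k" for y using that pc.Sk_U[of k] zero_notin pc.pos by (auto simp: less_imp_neq[symmetric])
  thus "continuous_on (pc.Sk k) (f k)" unfolding f_def
   by (intro continuous_intros C1c_cont[OF C] continuous_on_subset[OF cub]) auto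
  show "f k y = 0" if "y ~: pc.Sk k" for y using C that by (simp add: C1c_def f_def)
 qed
 have "(%k. LBINT x. pc.Wk k x * lap u x) ----> DE" unfolding DE_def
  by (rule pc.energy_limit[OF dim icrit ig]) (rule weak)
 hence "(%k. integral\<^sup>L lborel (f k) - integral\<^sup>L lborel (h k)) ----> DE" unfolding fh using fi hi by simp
 from tendsto_add[OF this hl] have fl: "(%k. integral\<^sup>L lborel (f k)) ----> DE + AE'" by simp
 have wte: "wt y = ub y * (ub y powr (N - 1) * norm y powr (- s))" for y
 proof -
  have "ub y powr N = ub y * ub y powr (N - 1)" using pc.nonneg[of y] by (cases "ub y = 0") (auto simp: powr_diff)
  thus ?thesis by (simp add: wt_def)
 qed
 have wtm: "wt : borel_measurable lborel" unfolding wt_def[abs_def] by measurable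
 have mono: "AE x in lborel. mono (%k. f k x)"
  unfolding f_def by (intro AE_I2 monoI mult_right_mono pc.Wk_mono) auto
 have nn: "AE x in lborel. 0 <= f k x" for k unfolding f_def using pc.Wk_bounds by (intro AE_I2) auto
 have lim: "AE x in lborel. (%k. f k x) ----> wt x" unfolding f_def wte by (intro AE_I2 tendsto_intros pc.Wk_tendsto)
 show "integrable lborel wt" by (rule integral_monotone_convergence_nonneg(1)[OF fi mono nn lim fl wtm])
 show "II = DE + AE'" unfolding II_def by (rule integral_monotone_convergence_nonneg(2)[OF fi mono nn lim fl wtm])
qed

lemma stmt_energy: "integral\<^sup>L (lebesgue_on Om) (%y. (norm (grad u y))^2 + a y * (u y)^2) = II"
proof -
 have e: "(%y. indicator Om y *R ((norm (grad u y))^2 + a y * (u y)^2)) = (%y. (norm (pc.gz y))^2 + a y * (ub y)^2)"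
  by (auto simp: indicator_def pc.gz_def ub_def)
 have i: "integrable lborel (%y. (norm (pc.gz y))^2 + a y * (ub y)^2)" using ig ia by simp
 have "integral\<^sup>L (lebesgue_on Om) (%y. (norm (grad u y))^2 + a y * (u y)^2) = (LBINT y. (norm (pc.gz y))^2 + a y * (ub y)^2)"
  by (subst lebesgue_on_integral[OF oOm]; unfold e) (use borel_measurable_integrable[OF i] in auto)
 also have "... = DE + AE'" unfolding DE_def AE'_def using ig ia by simp
 finally show ?thesis using energy(2) by simp
qed

lemma stmt_II: "integral\<^sup>L (lebesgue_on Om) (%y. u y powr N * norm y powr (- s)) = II"
proof -
 have e: "(%y. indicator Om y *R (u y powr N * norm y powr (- s))) = wt" using N_gt by (auto simp: indicator_def wt_def ub_def)
 show ?thesis unfolding II_def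
  by (subst lebesgue_on_integral[OF oOm]; unfold e) (use borel_measurable_integrable[OF energy(1)] in auto)
qed

lemma wt_nonneg: "wt y >= 0" by (simp add: wt_def)

lemma II_pos: "II > 0"
proof -
 have "II ~= 0"
 proof
  assume "II = 0"
  hence ae: "AE y in lborel. wt y = 0" using integral_nonneg_eq_0_iff_AE[OF energy(1)] wt_nonneg unfolding II_def by auto
  have s': "{y : space lborel. wt y ~= 0} : sets lborel" using borel_measurable_integrable[OF energy(1)] by measurable
  have "{y : space lborel. wt y ~= 0} : null_sets lborel" using ae s' by (simp add: AE_iff_null)
  hence "negligible {y : space lborel. wt y ~= 0}" by (simp add: negligible_iff_null_sets null_sets_completionI)
  hence "negligible Om"
  proof (rule negligible_subset)
   show "Om <= {y : space lborel. wt y ~= 0}"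
   proof
    fix y assume y: "y : Om"
    hence "y ~= 0" "u y > 0" using zero_notin upos by auto
    thus "y : {y : space lborel. wt y ~= 0}" using y by (simp add: wt_def ub_def)
   qed
  qed
  thus False using open_not_negligible[OF oOm ne] by simp
 qed
 moreover have "II >= 0" unfolding II_def by (rule integral_nonneg_AE) (use wt_nonneg in auto)
 ultimately show ?thesis by linarith
qed

lemma H10_u: "H10 Om u (grad u)"
 by (rule pc.H10_V[OF dim icrit i2 ig]) (auto simp: ub_def)

lemma stmt_DE: "integral\<^sup>L (lebesgue_on Om) (%y. (norm (grad u y))^2) = DE"
proof -
 have e: "(%y. indicator Om y *R ((norm (grad u y))^2)) = (%y. (norm (pc.gz y))^2)" by (auto simp: indicator_def pc.gz_def)
 show ?thesis unfolding DE_def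
  by (subst lebesgue_on_integral[OF oOm]; unfold e) (use borel_measurable_integrable[OF ig] in auto)
qed

end

section \<open>Sequences of solutions concentrate\<close>

lemma uniform_limit_integral_compact:
 fixes f :: "'i => 'a::euclidean_space => real"
 assumes K: "compact K" and c: "\<forall>\<^sub>F j in G. continuous_on K (f j)" and ul: "uniform_limit K f F G" and G: "G ~= bot"
  and z: "!!j x. x ~: K ==> f j x = 0" "!!x. x ~: K ==> F x = 0"
 shows "((%j. integral\<^sup>L lborel (f j)) \<longlongrightarrow> integral\<^sup>L lborel F) G"
proof (rule tendstoI)
 fix e :: real assume e: "e > 0"
 have cF: "continuous_on K F" using uniform_limit_theorem[OF c ul G] .
 have iF: "integrable lborel F" by (rule integrable_cont_compact[OF K cF z(2)])
 define B where "B = measure lborel K"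
 have iK: "integrable lborel (%x. indicator K x * d)" for d :: real
  using compact_imp_closed[OF K] emeasure_bounded_finite[OF compact_imp_bounded[OF K]] by (auto intro!: integrable_mult_left integrable_real_indicator)
 define d where "d = e / (2 * (B + 1))"
 have B0: "B >= 0" by (simp add: B_def)
 have d: "d > 0" using e B0 by (simp add: d_def)
 have "\<forall>\<^sub>F j in G. ALL x:K. dist (f j x) (F x) < d" by (rule uniform_limitD[OF ul d])
 with c show "\<forall>\<^sub>F j in G. dist (integral\<^sup>L lborel (f j)) (integral\<^sup>L lborel F) < e"
 proof eventually_elim
  case (elim j)
  have i: "integrable lborel (f j)" by (rule integrable_cont_compact[OF K elim(1) z(1)])
  have "\<bar>integral\<^sup>L lborel (%x. f j x - F x)\<bar> <= integral\<^sup>L lborel (%x. \<bar>f j x - F x\<bar>)" by (rule integral_abs_bound)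
  also have "... <= integral\<^sup>L lborel (%x. indicator K x * d)"
  proof (rule integral_mono)
   show "\<bar>f j x - F x\<bar> <= indicator K x * d" for x using elim(2) z by (cases "x : K") (auto simp: dist_real_def less_imp_le)
  qed (use i iF iK in auto)
  also have "... = B * d" using K compact_imp_closed by (simp add: B_def)
  also have "... < e" using e B0 by (simp add: d_def divide_simps)
  finally show ?case using i iF by (simp add: dist_real_def)
 qed
qed

lemma fatou_bound:
 fixes f :: "nat => 'a => real"
 assumes m: "!!j. integrable M (f j)" and nn: "!!j x. f j x >= 0" and lim: "!!x. (%j. f j x) ----> F x"
  and b: "\<forall>\<^sub>F j in sequentially. integral\<^sup>L M (f j) <= b j" "b ----> B"
 shows "integrable M F" "integral\<^sup>L M F <= B"
proof -
 have F0: "F x >= 0" for x by (rule LIMSEQ_le_const[OF lim]) (use nn in auto)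
 have Fm: "F : borel_measurable M" by (rule borel_measurable_LIMSEQ_real[OF lim]) (use m in auto)
 have B0: "B >= 0"
 proof (rule tendsto_lowerbound[OF b(2)])
  show "\<forall>\<^sub>F j in sequentially. 0 <= b j" using b(1)
   by eventually_elim (rule order_trans[OF integral_nonneg_AE]; use nn in auto)
 qed simp
 have "(\<integral>\<^sup>+x. ennreal (F x) \<partial>M) = (\<integral>\<^sup>+x. liminf (%j. ennreal (f j x)) \<partial>M)"
  by (intro nn_integral_cong lim_imp_Liminf[symmetric] tendsto_ennrealI lim) simp
 also have "... <= liminf (%j. \<integral>\<^sup>+x. ennreal (f j x) \<partial>M)" by (rule nn_integral_liminf) (use m in auto)
 also have "... <= liminf (%j. ennreal (b j))"
 proof (rule Liminf_mono)
  show "\<forall>\<^sub>F j in sequentially. (\<integral>\<^sup>+x. ennreal (f j x) \<partial>M) <= ennreal (b j)" using b(1)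
   by eventually_elim (use nn_integral_eq_integral[OF m] nn in \<open>simp add: ennreal_leI\<close>)
 qed
 also have "... = ennreal B" by (intro lim_imp_Liminf tendsto_ennrealI b(2)) simp
 finally have le: "(\<integral>\<^sup>+x. ennreal (F x) \<partial>M) <= ennreal B" .
 thus i: "integrable M F" using F0 Fm by (intro integrableI_nonneg) (auto simp: less_top[symmetric] top_unique)
 show "integral\<^sup>L M F <= B" using le F0 B0 unfolding nn_integral_eq_integral[OF i AE_I2[OF F0]] by simp
qed

lemma lborel_integrable_affine:
 fixes f :: "'a::euclidean_space => real"
 assumes f: "integrable lborel f" and k: "k > 0" shows "integrable lborel (%x. f (c + k *R x))"
proof -
 have m: "f : borel_measurable borel" using borel_measurable_integrable[OF f] by simp
 have "(\<integral>\<^sup>+x. ennreal (norm (f x)) \<partial>lborel) = ennreal (k ^ DIM('a)) * (\<integral>\<^sup>+x. ennreal (norm (f (c + k *R x))) \<partial>lborel)"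
  using m by (intro lborel_nn_integral_affine[OF _ k]) measurable
 moreover have "(\<integral>\<^sup>+x. ennreal (norm (f x)) \<partial>lborel) < \<infinity>" using f by (simp add: integrable_iff_bounded)
 ultimately have "(\<integral>\<^sup>+x. ennreal (norm (f (c + k *R x))) \<partial>lborel) < \<infinity>"
  using k by (auto simp: ennreal_mult_less_top)
 moreover have "(%x. f (c + k *R x)) : borel_measurable lborel" using m by measurable
 ultimately show ?thesis by (simp add: integrable_iff_bounded)
qed

text \<open>Self-similarity replaces polar coordinates: the truncated function is at most a constant
  plus twice its own dilation, and dilation by 2 shrinks integrals by at least 8 in dimension at
  least 3, so the integral can be absorbed.\<close>

lemma inverse_norm_integrable:
 assumes n: "DIM('a::euclidean_space) >= 3" and R: "R > 0"
 shows "integrable lborel (%y::'a. indicator (ball 0 R) y * inverse (norm y))"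
proof -
 let ?B = "ball (0::'a) R"
 define f where "f m y = indicator ?B y * min (real m) (inverse (norm y))" for m and y :: 'a
 define v where "v = measure lborel ?B"
 have iB: "integrable lborel (%y. indicator ?B y * c)" for c :: real
  using emeasure_bounded_finite[OF bounded_ball[of "0::'a" R]] by (intro integrable_mult_left integrable_real_indicator) auto
 have fm: "f m : borel_measurable borel" for m unfolding f_def[abs_def]
  by (intro borel_measurable_times borel_measurable_indicator borel_measurable_min borel_measurable_inverse borel_measurable_const borel_measurable_norm) auto
 have f0: "0 <= f m y" for m y by (simp add: f_def)
 have fi: "integrable lborel (f m)" for m
  by (rule Bochner_Integration.integrable_bound[OF iB[of "real m"]]) (use fm in \<open>auto simp: f_def indicator_def\<close>)
 \<comment> \<open>Points of the half ball are handled by doubling; outside it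
   \<open>inverse (norm y)\<close> is at most \<open>2 / R\<close>.\<close>
 have le: "f m y <= indicator ?B y * (2 / R) + 2 * f m (0 + 2 *R y)" for m y
 proof (cases "y : ball 0 (R / 2)")
  case True
  hence "y : ?B" "2 *R y : ?B" using R by auto
  moreover have "min (real m) (inverse (norm y)) <= 2 * min (real m) (inverse (2 * norm y))" by (simp add: min_def)
  ultimately show ?thesis using R unfolding f_def by (simp add: add_increasing)
 next
  case False
  hence "inverse (norm y) <= 2 / R" using R by (simp add: divide_simps)
  hence "f m y <= indicator ?B y * (2 / R)" by (auto simp: f_def indicator_def)
  thus ?thesis using f0[of m "0 + 2 *R y"] by linarith
 qed
 have "integral\<^sup>L lborel (f m) <= 4 * v / R" for m
 proof -
  define J where "J = integral\<^sup>L lborel (f m)"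
  have i2: "integrable lborel (%y. f m (0 + 2 *R y))" by (rule lborel_integrable_affine[OF fi]) simp
  have J: "J = 2 ^ DIM('a) * (LBINT y. f m (0 + 2 *R y))" unfolding J_def using lborel_integral_affine[OF fm, of 2 m 0] by simp
  have "(8::real) <= 2 ^ DIM('a)" using power_increasing[of 3 "DIM('a)" "2::real"] n by simp
  moreover have "0 <= (LBINT y. f m (0 + 2 *R y))" by (rule integral_nonneg_AE) (use f0 in auto)
  ultimately have "8 * (LBINT y. f m (0 + 2 *R y)) <= J" unfolding J by (rule mult_right_mono)
  moreover have "J <= (LBINT y. indicator ?B y * (2 / R) + 2 * f m (0 + 2 *R y))"
   unfolding J_def by (intro integral_mono[OF fi _ le] Bochner_Integration.integrable_add iB integrable_mult_right i2)
  moreover have "... = 2 * v / R + 2 * (LBINT y. f m (0 + 2 *R y))"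
   using Bochner_Integration.integral_add[OF iB[of "2 / R"] integrable_mult_right[OF i2, of 2]] by (simp add: v_def)
  moreover have "0 <= J" unfolding J_def by (rule integral_nonneg_AE) (use f0 in auto)
  ultimately show ?thesis unfolding J_def by linarith
 qed
 hence b: "\<forall>\<^sub>F m in sequentially. integral\<^sup>L lborel (f m) <= 4 * v / R" by simp
 have "(%m. f m y) ----> indicator ?B y * inverse (norm y)" for y
 proof (rule tendsto_eventually)
  obtain m0 where "inverse (norm y) <= real m0" using real_arch_simple by blast
  thus "\<forall>\<^sub>F m in sequentially. f m y = indicator ?B y * inverse (norm y)"
   unfolding f_def eventually_sequentially by (intro exI[of _ m0]) (auto simp: min_def)
 qed
 from fatou_bound(1)[OF fi f0 this b tendsto_const] show ?thesis .
qed

text \<open>If the maximum \<open>m\<close> were positive, the set where \<open>V >= m / 2\<close>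
  would be compact in \<open>Om\<close>. A close mollification is harmonic there, and the maximum
  principle on the set where \<open>V > m / 2\<close> bounds it by \<open>m / 2 + m / 8\<close>,
  against its value near \<open>m\<close> at the maximum point.\<close>

lemma weakly_harmonic_zero:
 fixes V :: "'a::euclidean_space => real"
 assumes Om: "open Om" "bounded Om" and cV: "continuous_on UNIV V" and V0: "!!x. V x >= 0" and off: "!!x. x ~: Om ==> V x = 0"
  and weak: "!!w. test_fun Om w ==> (LBINT x. V x * lap w x) = 0"
 shows "V z = 0"
proof (rule ccontr)
 assume z: "V z ~= 0"
 let ?S = "closure Om"
 have S: "compact ?S" using Om by simp
 have offS: "x ~: ?S ==> V x = 0" for x using off closure_subset by blast
 have "?S ~= {}" using z offS by fastforce
 then obtain p where p: "p : ?S" "!!x. x : ?S ==> V x <= V p"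
  using continuous_attains_sup[OF S _ continuous_on_subset[OF cV subset_UNIV]] by blast
 define m where "m = V p"
 have "z : ?S" using z offS by blast
 hence m: "m > 0" using p(2) z V0[of z] by (force simp: m_def)
 define D where "D = {x. V x > m / 2}"
 define K where "K = {x. V x >= m / 2}"
 have oD: "open D" unfolding D_def by (rule open_Collect_less) (auto intro: cV)
 have cK: "closed K" unfolding K_def by (rule closed_Collect_le) (auto intro: cV)
 have KOm: "K <= Om" using off m by (fastforce simp: K_def)
 have DK: "closure D <= K" by (rule closure_minimal[OF _ cK]) (auto simp: D_def K_def)
 have K: "compact K" using cK Om KOm bounded_subset compact_eq_bounded_closed by blast
 obtain d where d: "d > 0" "(UN x:K. ball x d) <= Om" using compact_subset_open_imp_ball_epsilon_subset[OF K Om(1) KOm] by blast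
 obtain N1 where N1: "!!j x. j >= N1 ==> \<bar>conv V (moll (1 / real (Suc j))) x - V x\<bar> <= m / 8"
  using conv_moll_uniform[OF S cV offS, of "m / 8"] m by auto
 obtain N2 where N2: "1 / real (Suc N2) < d" using nat_approx_posE[OF d(1)] by blast
 \<comment> \<open>The index makes the mollification uniformly \<open>m / 8\<close>-close to
   \<open>V\<close> and its radius smaller than \<open>d\<close>, so that the kernel centred at any
   point of \<open>K\<close> is a test function of \<open>Om\<close>.\<close>
 define j where "j = max N1 N2"
 define t where "t = 1 / real (Suc j)"
 have t: "t > 0" "t < d" unfolding t_def using N2 frac_le[of 1 1 "real (Suc N2)" "real (Suc j)"] by (auto simp: j_def)
 let ?h = "conv V (moll t)"
 have h: "\<bar>?h x - V x\<bar> <= m / 8" for x using N1[of j x] by (simp add: t_def j_def)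
 have iV: "integrable lborel V" by (rule integrable_cont_compact[OF S continuous_on_subset[OF cV subset_UNIV] offS])
 have mk: "Ck k UNIV (moll t :: 'a => real)" for k by (rule moll_Ck[OF t(1)])
 have mz: "moll t y = 0" if "y ~: cball 0 t" for y :: 'a by (rule moll_zero[OF t(1) that])
 have h2: "Ck (Suc (Suc 0)) UNIV ?h" by (rule conv_Ck[OF iV mk compact_cball mz])
 have lap0: "lap ?h x = 0" if x: "x : K" for x
 proof -
  have "test_fun Om (%y. moll t (x - y))" unfolding test_fun_def
  proof (intro conjI exI[of _ "cball x t"])
   show "smooth_on UNIV (%y. moll t (x - y))" using test_fun_reflect[OF mk mz] by (simp add: test_fun_def)
   show "cball x t <= Om" using d(2) t x by fastforce
  qed (use mz in \<open>auto simp: dist_norm\<close>)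
  from weak[OF this] have "conv V (lap (moll t)) x = 0" unfolding conv_def lap_reflect[OF mk] .
  thus ?thesis using lap_conv[OF iV mk compact_cball[of 0 t] mz] by simp
 qed
 have "?h p <= m / 2 + m / 8"
 proof (rule max_principle[OF oD])
  show "bounded D" using DK K compact_imp_bounded bounded_subset closure_subset by (metis (no_types))
  show "continuous_on (closure D) ?h" by (rule continuous_on_subset[OF Ck_continuous[OF h2] subset_UNIV])
  show "EX L>=0. has_lap ?h x L" if "x : D" for x
  proof -
   have "x : K" using that by (simp add: D_def K_def)
   hence "has_lap ?h x 0" using Ck2_has_lap[OF open_UNIV h2, of x] lap0 by simp
   thus ?thesis by blast
  qed
  show "?h x <= m / 2 + m / 8" if "x : frontier D" for x
  proof -
   have "x ~: D" using that oD by (simp add: frontier_def interior_open)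
   thus ?thesis using h[of x] unfolding D_def mem_Collect_eq by linarith
  qed
  show "p : D" using m by (simp add: D_def m_def)
 qed
 thus False using h[of p] m unfolding m_def by linarith
qed

section \<open>Sequences of solutions and blow-up of their maxima\<close>

locale blowup_sequence =
 fixes Om :: "'a::euclidean_space set" and a :: "'a => real" and s :: "nat => real" and u :: "nat => 'a => real"
  and x :: "nat => 'a" and \<mu> rh :: "nat => real" and A :: real
 assumes ds: "!!j. dirichlet_solution Om a (s j) (u j) A (u j (x j)) (crit DIM('a) (s j))"
  and s1: "!!j. s j <= 1" and sl: "s ----> 0" and dom: "smooth_bounded_domain Om" and coer: "coercive a Om"
  and eb: "!!j. integral\<^sup>L (lebesgue_on Om) (%y. (norm (grad (u j) y))^2 + a y * (u j y)^2)
     / (integral\<^sup>L (lebesgue_on Om) (%y. u j y powr crit DIM('a) (s j) * norm y powr (- s j)))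
       powr (2 / crit DIM('a) (s j)) <= invK0 TYPE('a) + rh j" and rh: "rh ----> 0"
  and weak0: "!!w g. H10 Om w g ==> (%j. integral\<^sup>L (lebesgue_on Om) (%y. grad (u j) y \<bullet> g y)) ----> 0"
  and xin: "!!j. x j : Om" and mu: "!!j. \<mu> j > 0" and xval: "!!j. u j (x j) = \<mu> j powr (- (real DIM('a) - 2) / 2)"

lemma blowup_subseq:
 assumes "blowup_sequence Om a s u x \<mu> rh A" "strict_mono r"
 shows "blowup_sequence Om a (%j. s (r j)) (%j. u (r j)) (%j. x (r j)) (%j. \<mu> (r j)) (%j. rh (r j)) A"
proof -
 interpret b: blowup_sequence Om a s u x \<mu> rh A by (rule assms(1))
 note L = LIMSEQ_subseq_LIMSEQ[OF _ assms(2), unfolded comp_def]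
 show ?thesis
 proof (rule blowup_sequence.intro)
  show "(%j. s (r j)) ----> 0" "(%j. rh (r j)) ----> 0" by (rule L[OF b.sl] L[OF b.rh])+
  show "(%j. integral\<^sup>L (lebesgue_on Om) (%y. grad (u (r j)) y \<bullet> g y)) ----> 0" if "H10 Om w g" for w g
   by (rule L[OF b.weak0[OF that]])
 qed (rule b.ds b.s1 b.dom b.coer b.eb b.xin b.mu b.xval)+
qed

context blowup_sequence
begin

sublocale D: dirichlet_solution Om a "s j" "u j" A "u j (x j)" "crit DIM('a) (s j)" for j by (rule ds)

lemma crit_bounds: "2 < crit DIM('a) (s j)" "crit DIM('a) (s j) <= crit DIM('a) 0"
 using D.N_gt[of j] D.dim D.s(1)[of j] by (auto simp: crit_def intro!: divide_right_mono)

lemma coercive_DE: obtains A0 where "A0 > 0" "!!j. A0 * D.DE j <= D.II j"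
 proof -
 obtain A0 where A0: "A0 > 0" "!!ph g. H10 Om ph g ==> A0 * integral\<^sup>L (lebesgue_on Om) (%x. (norm (g x))^2)
   <= integral\<^sup>L (lebesgue_on Om) (%x. (norm (g x))^2 + a x * (ph x)^2)" using coer unfolding coercive_def by blast
 show thesis using that[OF A0(1)] A0(2)[OF D.H10_u] unfolding D.stmt_energy D.stmt_DE by blast
qed

lemma A_nonneg: "A >= 0" using D.aA[OF xin] abs_ge_zero order_trans by blast

text \<open>For exponents in \<open>{0..1}\<close> the weight is at most
  \<open>1 + inverse (norm y)\<close>, an integrable function in dimension at least 3, so
  \<open>J\<close> does not depend on the exponent.\<close>

lemma II_le_max: obtains J where "J > 0" "!!j. D.II j <= u j (x j) powr crit DIM('a) (s j) * J"
proof -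
 obtain R where R: "R > 0" "!!y. y : Om ==> norm y < R" using D.bOm bounded_pos_less by metis
 define h where "h y = indicator (ball 0 R) y * 1 + indicator (ball 0 R) y * inverse (norm y)" for y :: 'a
 have hi: "integrable lborel h" unfolding h_def using emeasure_bounded_finite[OF bounded_ball[of "0::'a" R]]
  by (intro Bochner_Integration.integrable_add inverse_norm_integrable[OF D.dim R(1)] integrable_mult_left integrable_real_indicator) auto
 have "D.II j <= u j (x j) powr crit DIM('a) (s j) * integral\<^sup>L lborel h" for j
  unfolding D.II_def integral_mult_right_zero[symmetric]
 proof (rule integral_mono[OF D.energy(1)])
  fix y
  show "D.wt j y <= u j (x j) powr crit DIM('a) (s j) * h y"
  proof (cases "y : Om")
   case True
   have y: "norm y > 0" "norm y < R" using True R D.zero_notin by auto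
   have "norm y powr (- s j) <= 1 + inverse (norm y)"
   proof (cases "norm y >= 1")
    case False
    have "norm y powr (- s j) <= norm y powr (- 1)" using False s1[of j] y by (intro powr_mono') auto
    also have "... = inverse (norm y)" using y by (simp add: powr_minus)
    finally show ?thesis by simp
   next
    case True
    have "norm y powr (- s j) <= 1" using True D.s(1)[of j] powr_mono[of "- s j" 0 "norm y"] y(1) by simp
    thus ?thesis using y by (simp add: add_increasing2)
   qed
   thus ?thesis unfolding D.wt_def h_def using y D.pc.nonneg[of j y] D.ub_le[of j y] crit_bounds[of j]
    by (intro mult_mono powr_mono2) auto
  qed (simp add: D.wt_def D.ub_def h_def)
 qed (use hi in simp)
 moreover have "integral\<^sup>L lborel h >= 0" by (rule integral_nonneg_AE) (simp add: h_def)
 ultimately show thesis using that[of "integral\<^sup>L lborel h + 1"] by (smt (verit) mult_left_mono powr_ge_zero)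
qed

text \<open>If the maxima \<open>u j (x j)\<close> were bounded, then the functions \<open>u j / u j (x j)\<close> would subconverge to a
 harmonic function: by \<open>weak0\<close> where the maxima are bounded below, by the energy where they are small.\<close>
lemma not_bounded:
 assumes c: "c > 0" shows "EX j. \<mu> j < c"
proof (rule ccontr)
 assume "~ (EX j. \<mu> j < c)"
 hence mc: "\<mu> j >= c" for j by (simp add: not_less)
 let ?n = "real DIM('a)" and ?p = "crit DIM('a) 0"
 have n: "DIM('a) >= 3" "?n >= 3" using D.dim by auto
 define M where "M = c powr (- (?n - 2) / 2)"
 have M: "M > 0" using c by (simp add: M_def)
 define U where "U j = u j (x j)" for j
 have UM: "U j <= M" for j unfolding U_def xval M_def using mc[of j] c n by (intro powr_mono2') auto
 have U0: "U j > 0" for j unfolding U_def by (rule D.upos[OF xin])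
 define w where "w j y = 1 / U j * D.ub j y" for j y
 have bd: "0 <= w j y & w j y <= 1" for j y using D.pc.nonneg[of j y] D.ub_le[of j y] U0[of j] by (auto simp: w_def U_def)
 obtain R0 where R0: "R0 > 0" "ALL p:frontier Om. EX z. dist z p = R0 & ball z R0 Int Om = {}" using exterior_ball[OF dom] by metis
 \<comment> \<open>\<open>A\<close> bounds the linear term. After division by \<open>U j\<close> the
   nonlinear term carries \<open>U j powr (crit DIM('a) (s j) - 2)\<close>; with base
   \<open>1 + M\<close>, which is at least 1, the exponent may be raised to
   \<open>?p\<close>.\<close>
 define C where "C = A + (1 + M) powr ?p"
 have C: "C > 0" unfolding C_def using A_nonneg M by (intro add_nonneg_pos) auto
 have cw: "continuous_on UNIV (w j)" for j unfolding w_def by (intro continuous_intros D.cub)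
 have "EX d>0. ALL j. ALL y:cball 0 R. ALL z:cball 0 R. norm (y - z) < d --> \<bar>w j y - w j z\<bar> < e" if R: "R > 0" and e: "e > 0" for R e
 proof (rule equicontinuous_family[OF n(1) R0(1) C zero_less_one R, where D="%_. Om" and q="%_. 0" and s=s and g="%j y. (1 / U j) *R grad (u j) y"])
  fix j :: nat and y assume y: "y : Om"
  let ?N = "crit DIM('a) (s j)"
  have e1: "1 / U j * - lap (u j) y = a y * w j y - (D.ub j y powr (?N - 1) / U j) * norm y powr (- s j)"
   using D.eq[OF y, of j] y U0[of j] by (simp add: D.ub_def w_def field_simps)
  have "D.ub j y powr (?N - 1) <= U j powr (?N - 1)" using D.pc.nonneg[of j y] D.ub_le[of j y] crit_bounds[of j] unfolding U_def by (intro powr_mono2) auto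
  hence "D.ub j y powr (?N - 1) / U j <= U j powr (?N - 1) / U j" using U0[of j] by (intro divide_right_mono) auto
  also have "... = U j powr (?N - 2)" using U0[of j] powr_diff[of "U j" "?N - 1" 1] by simp
  also have "... <= (1 + M) powr (?N - 2)" using U0[of j] UM[of j] crit_bounds[of j] by (intro powr_mono2) auto
  also have "... <= (1 + M) powr ?p" using M crit_bounds[of j] by (intro powr_mono) auto
  finally have 1: "D.ub j y powr (?N - 1) / U j * norm y powr (- s j) <= (1 + M) powr ?p * norm y powr (- s j)" by (rule mult_right_mono) simp
  have 2: "\<bar>a y * w j y\<bar> <= A * 1" unfolding abs_mult using D.aA[OF y] bd[of j y] A_nonneg by (intro mult_mono) auto
  have "\<bar>1 / U j * - lap (u j) y\<bar> <= A * 1 + (1 + M) powr ?p * norm y powr (- s j)"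
   unfolding e1 using 1 2 U0[of j] by (intro order_trans[OF abs_triangle_ineq4] add_mono) (auto simp: abs_mult)
  also have "... <= C * (1 + norm y powr (- s j))"
   unfolding C_def using A_nonneg by (simp add: distrib_left distrib_right)
  finally show "EX L. \<bar>L\<bar> <= C * (1 + norm (y - 0) powr (- s j)) & has_lap (w j) y L"
   using has_lap_cmult[OF D.ub_has_lap[OF y, of j], of "1 / U j"] by (intro exI[of _ "1 / U j * - lap (u j) y"]) (simp add: w_def[abs_def])
  show "GDERIV (w j) y :> (1 / U j) *R grad (u j) y" unfolding w_def by (rule GDERIV_cmult[OF D.ub_GDERIV[OF y]])
 qed (use D.oOm cw bd R0 D.zero_notin D.s s1 e D.pc.zero in \<open>auto simp: w_def\<close>)
 then obtain r V where r: "strict_mono (r :: nat => nat)" "continuous_on UNIV V" "!!R. uniform_limit (cball 0 R) (%j. w (r j)) V sequentially"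
  using ascoli_diagonal[of w 1] bd by (metis abs_of_nonneg)
 have ptw: "(%j. w (r j) y) ----> V y" for y
  by (rule tendsto_uniform_limitI[OF r(3)[of "norm y"]]) simp
 have V0: "V y >= 0" for y by (rule LIMSEQ_le_const[OF ptw]) (use bd in auto)
 have off: "V y = 0" if "y ~: Om" for y using ptw[of y] that LIMSEQ_unique[OF _ tendsto_const] by (simp add: w_def D.ub_def)
 obtain A0 where A0: "A0 > 0" "!!j. A0 * D.DE j <= D.II j" using coercive_DE by blast
 obtain J where J: "J > 0" "!!j. D.II j <= U j powr crit DIM('a) (s j) * J" using II_le_max unfolding U_def by blast
 have "V y = 0" for y
 proof (rule weakly_harmonic_zero[OF D.oOm D.bOm r(2) V0 off])
  fix ph assume ph: "test_fun Om ph"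
  then obtain K where K: "compact K" "K <= Om" "!!y. y ~: K ==> ph y = 0" by (auto simp: test_fun_def)
  have phU: "test_fun UNIV ph" using ph by (auto simp: test_fun_def)
  have ph2: "Ck (Suc (Suc 0)) UNIV ph" using ph by (simp add: test_fun_def smooth_on_def)
  have cl: "continuous_on UNIV (lap ph)" unfolding lap_def using ph2 by (intro continuous_intros) auto
  have lz: "lap ph y = 0" if "y ~: K" for y by (rule lap_compact_support[OF K(1,3) that])
  have cg: "continuous_on S (grad ph)" for S by (rule grad_continuous[OF Ck_SucD[OF ph2]])
  obtain R where R: "K <= cball 0 R" using compact_imp_bounded[OF K(1)] by (auto simp: bounded_iff subset_iff)
  define F where "F j = (LBINT y. D.pc.gz j y \<bullet> grad ph y)" for j
  have 1: "(%j. LBINT y. w (r j) y * lap ph y) ----> (LBINT y. V y * lap ph y)"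
  proof (rule uniform_limit_integral_compact[OF K(1)])
   have "bounded (lap ph ` K)" "bounded (V ` K)"
    by (intro compact_imp_bounded compact_continuous_image K(1) continuous_on_subset[OF cl subset_UNIV] continuous_on_subset[OF r(2) subset_UNIV])+
   thus "uniform_limit K (%j y. w (r j) y * lap ph y) (%y. V y * lap ph y) sequentially"
    by (intro uniform_lim_mult uniform_limit_on_subset[OF r(3) R] uniform_limit_const)
   show "\<forall>\<^sub>F j in sequentially. continuous_on K (%y. w (r j) y * lap ph y)"
    by (intro always_eventually allI continuous_intros continuous_on_subset[OF cl subset_UNIV] continuous_on_subset[OF cw subset_UNIV])
  qed (use lz in auto)
  have 2: "(LBINT y. w j y * lap ph y) = F j / U j" for j
   using D.pc.weak_lap_test[OF n(1) D.icrit D.ig phU, of j] by (simp add: w_def F_def)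
  have gm: "(%y. D.pc.gz j y \<bullet> grad ph y) : borel_measurable borel" for j
   by (rule borel_measurable_inner[OF D.pc.gz_measurable cont_borel_measurable[OF cg]])
  have F0: "F ----> 0"
  proof -
   have e: "(%y. indicator Om y *R (grad (u j) y \<bullet> grad ph y)) = (%y. D.pc.gz j y \<bullet> grad ph y)" for j by (auto simp: indicator_def D.pc.gz_def)
   have "F j = integral\<^sup>L (lebesgue_on Om) (%y. grad (u j) y \<bullet> grad ph y)" for j
    using gm[of j] by (subst lebesgue_on_integral[OF D.oOm]; unfold e) (auto simp: F_def)
   hence "F = (%j. integral\<^sup>L (lebesgue_on Om) (%y. grad (u j) y \<bullet> grad ph y))" by auto
   thus ?thesis using weak0[OF H10_test_fun[OF D.oOm ph]] by simp
  qed
  define G where "G = (LBINT y. (norm (grad ph y))^2)"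
  have iG: "integrable lborel (%y. (norm (grad ph y))^2)"
   by (rule integrable_cont_compact[OF K(1)]) (use C1c_grad_zero[OF Ck1_C1c[OF Ck_SucD[OF ph2] K(1,3)]] in \<open>auto intro!: continuous_intros cg\<close>)
  define T where "T = G + J / A0"
  have T: "T > 0" unfolding T_def G_def using A0 J by (intro add_nonneg_pos integral_nonneg_AE) auto
  have FU: "\<bar>F j / U j\<bar> <= U j powr (crit DIM('a) (s j) / 2 - 1) * T" for j
  proof -
   \<comment> \<open>The weight in Young's inequality: coercivity and \<open>II_le_max\<close> bound
     the Dirichlet integral by a multiple of \<open>l * l\<close>, so both resulting terms have size
     \<open>l\<close>.\<close>
   define l where "l = U j powr (crit DIM('a) (s j) / 2)"
   have l: "l > 0" using U0[of j] by (simp add: l_def)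
   have i: "integrable lborel (%y. D.pc.gz j y \<bullet> grad ph y)"
    by (rule L2_integrable_inner[OF _ _ D.ig iG]) (use D.pc.gz_measurable cont_borel_measurable[OF cg] in auto)
   have "\<bar>F j\<bar> <= (LBINT y. \<bar>D.pc.gz j y \<bullet> grad ph y\<bar>)" unfolding F_def by (rule integral_abs_bound)
   also have "... <= (LBINT y. l * (norm (grad ph y))^2 + (1 / l) * (norm (D.pc.gz j y))^2)"
    by (rule integral_mono) (use i iG D.ig[of j] L2_inner_bound[OF l] in auto)
   also have "... = l * G + (1 / l) * D.DE j"
    unfolding Bochner_Integration.integral_add[OF integrable_mult_right[OF iG] integrable_mult_right[OF D.ig]] by (simp add: G_def D.DE_def)
   also have "... <= l * G + (1 / l) * (l * l * (J / A0))"
   proof (intro add_left_mono mult_left_mono)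
    have "l * l = U j powr crit DIM('a) (s j)" by (simp add: l_def flip: powr_add)
    hence "A0 * D.DE j <= l * l * J" using A0(2)[of j] J(2)[of j] by simp
    thus "D.DE j <= l * l * (J / A0)" using A0(1) by (simp add: field_simps)
   qed (use l in simp)
   also have "... = l * T" using l by (simp add: T_def algebra_simps)
   finally have "\<bar>F j / U j\<bar> <= l / U j * T" using U0[of j] by (simp add: divide_right_mono)
   also have "l / U j = U j powr (crit DIM('a) (s j) / 2 - 1)" using U0[of j] by (simp add: l_def powr_diff)
   finally show ?thesis .
  qed
  have "(%j. F j / U j) ----> 0"
  proof (rule tendstoI)
   fix e :: real assume e: "e > 0"
   \<comment> \<open>For \<open>U j <= h\<close> the bound \<open>FU\<close> suffices, its exponent
     being at least \<open>1 / (n - 2)\<close> because \<open>s j <= 1\<close>. For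
     \<open>U j > h\<close> the convergence of \<open>F\<close> to 0 is divided by a number bounded
     away from 0.\<close>
   define h where "h = min 1 ((e / (2 * T)) powr (?n - 2))"
   have h: "h > 0" "h <= 1" using e T by (auto simp: h_def)
   have "\<forall>\<^sub>F j in sequentially. \<bar>F j\<bar> < e * h" using F0 e h by (auto simp: tendsto_iff)
   thus "\<forall>\<^sub>F j in sequentially. dist (F j / U j) 0 < e"
   proof eventually_elim
    case (elim j)
    show ?case
    proof (cases "U j <= h")
     case True
     have ex: "1 / (?n - 2) <= crit DIM('a) (s j) / 2 - 1"
     proof -
      have "1 / (?n - 2) <= (2 - s j) / (?n - 2)" using n s1[of j] by (intro divide_right_mono) auto
      also have "... = crit DIM('a) (s j) / 2 - 1" using n by (simp add: crit_def field_simps)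
      finally show ?thesis .
     qed
     have "U j powr (crit DIM('a) (s j) / 2 - 1) <= U j powr (1 / (?n - 2))" using U0[of j] True h by (intro powr_mono'[OF ex]) auto
     also have "... <= ((e / (2 * T)) powr (?n - 2)) powr (1 / (?n - 2))" using U0[of j] True n by (intro powr_mono2) (auto simp: h_def)
     also have "... = e / (2 * T)" using n e T by (simp add: powr_powr)
     finally have "\<bar>F j / U j\<bar> <= e / (2 * T) * T" using FU[of j] T by (meson mult_right_mono order_trans less_imp_le)
     moreover have "e / (2 * T) * T = e / 2" using T by simp
     ultimately show ?thesis using e unfolding dist_real_def diff_0_right by linarith
    next
     case False
     hence "\<bar>F j\<bar> < e * U j" using elim e by (meson less_trans mult_strict_left_mono not_le)
     thus ?thesis using U0[of j] by (simp add: field_simps)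
    qed
   qed
  qed
  from LIMSEQ_subseq_LIMSEQ[OF this r(1)] show "(LBINT y. V y * lap ph y) = 0"
   using LIMSEQ_unique[OF 1] unfolding 2 comp_def by blast
 qed
 hence V: "V = (%_. 0)" by auto
 \<comment> \<open>The normalized functions have the value 1 at the points \<open>x (r j)\<close> of
   the bounded set \<open>Om\<close>, which contradicts uniform convergence to 0.\<close>
 obtain b where b: "!!y. y : Om ==> norm y <= b" using D.bOm by (auto simp: bounded_iff)
 have "\<forall>\<^sub>F j in sequentially. ALL y:cball 0 b. dist (w (r j) y) (V y) < 1" by (rule uniform_limitD[OF r(3)]) simp
 then obtain j where j: "!!y. y : cball 0 b ==> \<bar>w (r j) y\<bar> < 1" unfolding V eventually_sequentially dist_real_def diff_0_right by blast
 show False using j[of "x (r j)"] b[OF xin] xin[of "r j"] U0[of "r j"] by (simp add: w_def D.ub_def U_def)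
qed

end

text \<open>\<open>not_bounded\<close> applies to subsequences as well, in particular to one along
  which \<open>\<mu>\<close> would stay above a positive number.\<close>

lemma blowup_mu_tendsto:
 assumes "blowup_sequence Om a s u x \<mu> rh A"
 shows "\<mu> ----> 0"
proof (rule ccontr)
 have pos: "\<mu> j > 0" for j using assms by (simp add: blowup_sequence_def)
 assume "~ \<mu> ----> 0"
 then obtain e where e: "e > 0" "\<exists>\<^sub>F j in sequentially. ~ dist (\<mu> j) 0 < e" by (auto simp: tendsto_iff frequently_def)
 hence "infinite {j. \<mu> j >= e}" using pos by (simp add: cofinite_eq_sequentially[symmetric] frequently_cofinite not_less less_imp_le)
 then obtain r :: "nat => nat" where r: "strict_mono r" "!!j. r j : {j. \<mu> j >= e}" using infinite_enumerate by blast
 interpret b: blowup_sequence Om a "%j. s (r j)" "%j. u (r j)" "%j. x (r j)" "%j. \<mu> (r j)" "%j. rh (r j)" A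
  by (rule blowup_subseq[OF assms r(1)])
 show False using b.not_bounded[OF e(1)] r(2) by (auto simp: not_less[symmetric])
qed

section \<open>Rescaling\<close>

lemma has_lap_unique:
 assumes "has_lap f x l" "has_lap f x m" shows "l = m"
proof -
 have "p = q" if p: "has_d2 f b x p" and q: "has_d2 f b x q" for b p q
 proof -
  from p obtain g e where g: "e > 0" "!!t. \<bar>t\<bar> < e ==> ((%ta. f (x + ta *R b)) has_real_derivative g t) (at t)" "(g has_real_derivative p) (at 0)"
   unfolding has_d2_def by blast
  from q obtain h e' where h: "e' > 0" "!!t. \<bar>t\<bar> < e' ==> ((%ta. f (x + ta *R b)) has_real_derivative h t) (at t)" "(h has_real_derivative q) (at 0)"
   unfolding has_d2_def by blast
  have "g t = h t" if "t : ball 0 (min e e')" for t using that g(2)[of t] h(2)[of t] by (auto intro: DERIV_unique)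
  hence "(g has_real_derivative q) (at 0)"
   using has_field_derivative_transform_within_open[OF h(3) open_ball, of 0 "min e e'" g] g(1) h(1) by auto
  thus ?thesis using DERIV_unique[OF g(3)] by blast
 qed
 thus ?thesis using assms unfolding has_lap_def by (metis (no_types, lifting) sum.cong)
qed

definition blow_scale :: "real => real => 'a::euclidean_space => real" where
 "blow_scale s m z = norm z powr (s / 2) * m powr ((2 - s) / 2)"

definition blow_fun :: "'a::euclidean_space set => ('a => real) => 'a => real => 'a => real" where
 "blow_fun Om u z k y = (if z + k *R y : Om then u (z + k *R y) / u z else 0)"

text \<open>Applied with the rescaled pole as \<open>z\<close>. Because
  \<open>norm z <= norm (y - z) + norm y\<close>, the normalized weight is controlled uniformly in
  the position of the pole, whether it is near or escapes to infinity.\<close>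

lemma norm_shift_powr:
 fixes y z :: "'a::real_normed_vector"
 assumes s: "0 < s" "s <= 1" and y: "norm y < R + 4" and R: "R > 0" and yz: "y ~= z"
 shows "norm z powr s * norm (y - z) powr (- s) <= 2 * (R + 5) * (1 + norm (y - z) powr (- s))"
proof -
 let ?d = "norm (y - z)"
 have d: "?d > 0" using yz by simp
 have "norm z <= ?d + norm y" using norm_triangle_ineq4[of y "y - z"] by simp
 hence "norm z <= 2 * max ?d (R + 4)" using y by (simp add: max_def)
 hence "norm z powr s <= (2 * max ?d (R + 4)) powr s" using s by (intro powr_mono2) auto
 also have "... = 2 powr s * max ?d (R + 4) powr s" by (rule powr_mult)
 also have "... <= 2 * (?d powr s + (R + 4))"
 proof (intro mult_mono)
  show "2 powr s <= (2::real)" using powr_mono[of s 1 2] s by simp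
  have "(R + 4) powr s <= R + 4" using powr_mono[of s 1 "R + 4"] s R by simp
  moreover have "max ?d (R + 4) powr s <= ?d powr s + (R + 4) powr s" by (auto simp: max_def)
  ultimately show "max ?d (R + 4) powr s <= ?d powr s + (R + 4)" by simp
 qed auto
 finally have "norm z powr s * ?d powr (- s) <= 2 * (?d powr s + (R + 4)) * ?d powr (- s)" by (rule mult_right_mono) simp
 also have "... = 2 * 1 + 2 * (R + 4) * ?d powr (- s)" using d by (simp add: algebra_simps powr_minus)
 also have "... <= 2 * (R + 5) * (1 + ?d powr (- s))" using R by (simp add: algebra_simps)
 finally show ?thesis .
qed

context blowup_sequence
begin

definition k :: "nat => real" where "k j = blow_scale (s j) (\<mu> j) (x j)"
definition DD :: "nat => 'a set" where "DD j = {y. x j + k j *R y : Om}"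
definition W :: "nat => 'a => real" where "W j = blow_fun Om (u j) (x j) (k j)"
definition gW :: "nat => 'a => 'a" where "gW j y = (k j / u j (x j)) *R grad (u j) (x j + k j *R y)"
text \<open>The weight of the rescaled equation, normalized to be 1 at the origin.\<close>

definition th :: "nat => 'a => real" where "th j y = norm (x j) powr s j * norm (x j + k j *R y) powr (- s j)"
definition LW :: "nat => 'a => real" where
 "LW j y = (k j)^2 * a (x j + k j *R y) * W j y - W j y powr (crit DIM('a) (s j) - 1) * th j y"

lemma n3: "real DIM('a) >= 3" using D.dim by simp

lemma xnz: "norm (x j) > 0" using xin[of j] D.zero_notin by auto

lemma kpos: "k j > 0" using xnz[of j] mu[of j] by (simp add: k_def blow_scale_def)

lemma Upos: "u j (x j) > 0" by (rule D.upos[OF xin])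

lemma W_eq: "W j y = D.ub j (x j + k j *R y) / u j (x j)" by (simp add: W_def blow_fun_def D.ub_def)

lemma W_bounds: "0 <= W j y" "W j y <= 1"
 unfolding W_eq using D.pc.nonneg[of j] D.ub_le[of j] Upos[of j] by auto

lemma W_0: "W j 0 = 1" using Upos[of j] xin[of j] by (simp add: W_def blow_fun_def)

lemma W_off: "y ~: DD j ==> W j y = 0" by (simp add: W_def blow_fun_def DD_def)

lemma oDD: "open (DD j)" unfolding DD_def by (rule open_affine_preimage[OF D.oOm])

lemma cW: "continuous_on UNIV (W j)" unfolding W_eq using Upos[of j]
 by (intro continuous_intros continuous_on_compose2[OF D.cub]) auto

lemma W_GDERIV: "y : DD j ==> GDERIV (W j) y :> gW j y"
 using GDERIV_cmult[OF GDERIV_affine[OF D.ub_GDERIV], where c="1 / u j (x j)"] by (simp add: W_eq[abs_def] DD_def gW_def)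

lemma cgW: "continuous_on (DD j) (gW j)" unfolding gW_def DD_def
 by (intro continuous_intros continuous_on_compose2[OF D.cgrad]) auto

text \<open>The defining property of the scale \<open>k\<close>: the factor in front of the rescaled
  nonlinearity is \<open>norm (x j) powr s j\<close>, which turns the weight into
  \<open>th\<close>.\<close>

lemma k_sq: "(k j)^2 * u j (x j) powr (crit DIM('a) (s j) - 2) = norm (x j) powr s j"
proof -
 have "(k j)^2 = norm (x j) powr s j * \<mu> j powr (2 - s j)"
  unfolding k_def blow_scale_def power2_eq_square by (simp add: mult_ac flip: powr_add)
 moreover have "u j (x j) powr (crit DIM('a) (s j) - 2) = \<mu> j powr (- (2 - s j))"
 proof -
  have "- (real DIM('a) - 2) / 2 * (crit DIM('a) (s j) - 2) = - (2 - s j)" using n3 by (simp add: crit_def field_simps)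
  thus ?thesis unfolding xval powr_powr by (simp only:)
 qed
 ultimately show ?thesis using mu[of j] by (simp flip: powr_add)
qed

lemma W_has_lap: assumes y: "y : DD j" shows "has_lap (W j) y (LW j y)"
proof -
 let ?z = "x j + k j *R y" and ?U = "u j (x j)" and ?N = "crit DIM('a) (s j)"
 have z: "?z : Om" using y by (simp add: DD_def)
 have h: "has_lap (W j) y (1 / ?U * ((k j)^2 * (- lap (u j) ?z)))"
  using has_lap_cmult[OF has_lap_affine[OF D.ub_has_lap[OF z]], where c="1 / ?U"] by (simp add: W_eq[abs_def])
 have w: "u j ?z = ?U * W j y" using z Upos[of j] by (simp add: W_eq D.ub_def)
 have W0: "W j y > 0" using w D.upos[OF z, of j] Upos[of j] by (simp add: zero_less_mult_iff)
 have e: "- lap (u j) ?z = a ?z * (?U * W j y) - ?U powr (?N - 1) * W j y powr (?N - 1) * norm ?z powr (- s j)"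
  using D.eq[OF z, of j] Upos[of j] W0 unfolding w by (simp add: powr_mult algebra_simps)
 have "1 / ?U * ((k j)^2 * (- lap (u j) ?z)) = (k j)^2 * a ?z * W j y - ((k j)^2 * (?U powr (?N - 1) / ?U)) * W j y powr (?N - 1) * norm ?z powr (- s j)"
  unfolding e using Upos[of j] by (simp add: field_simps)
 also have "?U powr (?N - 1) / ?U = ?U powr (?N - 2)" using Upos[of j] powr_diff[of ?U "?N - 1" 1] by simp
 finally have "1 / ?U * ((k j)^2 * (- lap (u j) ?z)) = LW j y" unfolding k_sq LW_def th_def by simp
 thus ?thesis using h by simp
qed

lemma W_Ck2: "Ck (Suc (Suc 0)) (DD j) (W j)"
proof (rule Ck_cong[OF oDD])
 show "Ck (Suc (Suc 0)) (DD j) (%y. 1 / u j (x j) * u j (x j + k j *R y))" unfolding DD_def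
  by (rule Ck_mult[OF open_affine_preimage[OF D.oOm] Ck_const[OF open_affine_preimage[OF D.oOm]] Ck_affine_on[OF D.oOm D.u2]])
qed (simp add: W_def blow_fun_def DD_def)

lemma W_lap: "y : DD j ==> lap (W j) y = - LW j y"
 using has_lap_unique[OF W_has_lap Ck2_has_lap[OF oDD W_Ck2]] by fastforce

lemma W_grad: "y : DD j ==> grad (W j) y = gW j y" by (rule GDERIV_grad[OF W_GDERIV])

lemma k_tendsto: "k ----> 0"
proof -
 obtain b where b: "!!y. y : Om ==> norm y <= b" using D.bOm by (auto simp: bounded_iff)
 have mu0: "\<mu> ----> 0" by (rule blowup_mu_tendsto[OF blowup_sequence_axioms])
 have "\<forall>\<^sub>F j in sequentially. \<mu> j < 1" using mu0 by (rule order_tendstoD) simp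
 hence "\<forall>\<^sub>F j in sequentially. norm (k j) <= (1 + \<bar>b\<bar>) * sqrt (\<mu> j)"
 proof eventually_elim
  case (elim j)
  have "norm (x j) powr (s j / 2) <= (1 + \<bar>b\<bar>) powr (s j / 2)" using b[OF xin, of j] D.s[of j] by (intro powr_mono2) auto
  also have "... <= (1 + \<bar>b\<bar>) powr 1" using s1[of j] by (intro powr_mono) auto
  finally have 1: "norm (x j) powr (s j / 2) <= 1 + \<bar>b\<bar>" by simp
  have "\<mu> j powr ((2 - s j) / 2) <= \<mu> j powr (1 / 2)" using s1[of j] mu[of j] elim by (intro powr_mono') auto
  also have "... = sqrt (\<mu> j)" using mu[of j] by (simp add: powr_half_sqrt)
  finally have "k j <= (1 + \<bar>b\<bar>) * sqrt (\<mu> j)" unfolding k_def blow_scale_def using 1 by (intro mult_mono) auto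
  thus ?case using kpos[of j] by simp
 qed
 moreover have "(%j. (1 + \<bar>b\<bar>) * sqrt (\<mu> j)) ----> 0" using tendsto_mult_left[OF tendsto_real_sqrt[OF mu0]] by simp
 ultimately show ?thesis by (rule Lim_null_comparison)
qed

text \<open>The point that rescaling sends to 0, that is, the pole of the weight in the new
  coordinates.\<close>

definition y0 :: "nat => 'a" where "y0 j = - (1 / k j) *R x j"

lemma y0_norm: "norm (x j) = k j * norm (y0 j)" "norm (x j + k j *R y) = k j * norm (y - y0 j)"
proof -
 have "x j = - k j *R y0 j" using kpos[of j] by (simp add: y0_def)
 moreover from this have "x j + k j *R y = k j *R (y - y0 j)" by (simp add: algebra_simps)
 ultimately show "norm (x j) = k j * norm (y0 j)" "norm (x j + k j *R y) = k j * norm (y - y0 j)" using kpos[of j] by auto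
qed

lemma y0_notin: "y0 j ~: DD j" using kpos[of j] D.zero_notin by (simp add: DD_def y0_def)

lemma th_eq: "th j y = norm (y0 j) powr s j * norm (y - y0 j) powr (- s j)"
proof -
 have "k j powr s j * k j powr (- s j) = 1" using kpos[of j] by (simp flip: powr_add)
 thus ?thesis unfolding th_def y0_norm using kpos[of j] by (simp add: powr_mult)
qed

text \<open>The hypotheses of \<open>equicontinuous_family\<close> hold uniformly after rescaling:
  exterior radii are divided by the bounded scale, the potential is multiplied by
  \<open>(k j)^2\<close>, and \<open>norm_shift_powr\<close> controls the weight.\<close>

lemma subsequence_limit:
 obtains r V where "strict_mono (r :: nat => nat)" "continuous_on UNIV V" "!!R. uniform_limit (cball 0 R) (%j. W (r j)) V sequentially"
proof -
 obtain R0 where R0: "R0 > 0" "ALL p:frontier Om. EX z. dist z p = R0 & ball z R0 Int Om = {}" using exterior_ball[OF dom] by metis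
 obtain b where b: "b > 0" "!!j. k j <= b" using convergent_imp_Bseq[OF convergentI[OF k_tendsto]] by (auto simp: Bseq_def abs_le_iff)
 \<comment> \<open>Exterior balls of radius \<open>R0\<close> become balls of radius
   \<open>R0 / k j\<close>, which is at least \<open>R0 / b\<close>.\<close>
 define r0 where "r0 = R0 / b"
 have r0: "r0 > 0" using R0 b by (simp add: r0_def)
 have ext: "EX z. dist z p = r0 & ball z r0 Int DD j = {}" if p: "p : frontier (DD j)" for j p
 proof -
  let ?f = "%y. x j + k j *R y"
  have "?f p ~: Om" using p oDD[of j] by (auto simp: frontier_def interior_open DD_def)
  moreover have "?f p : closure Om"
  proof -
   have "?f ` closure (DD j) <= closure Om" by (rule image_closure_subset) (auto intro!: continuous_intros closure_subset[THEN subsetD] simp: DD_def)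
   thus ?thesis using p by (auto simp: frontier_def)
  qed
  ultimately have "?f p : frontier Om" using D.oOm by (simp add: frontier_def interior_open)
  then obtain z where z: "dist z (?f p) = R0" "ball z R0 Int Om = {}" using R0 by blast
  define z' where "z' = (1 / k j) *R (z - x j)"
  have fz: "?f z' = z" using kpos[of j] by (simp add: z'_def)
  have sc: "dist (?f v) (?f w) = k j * dist v w" for v w
   using kpos[of j] by (simp add: dist_norm flip: scaleR_diff_right)
  have "dist z' p = R0 / k j" using sc[of z' p] z(1) kpos[of j] by (simp add: fz field_simps)
  moreover have "ball z' (R0 / k j) Int DD j = {}"
  proof -
   have "?f v : ball z R0" if "v : ball z' (R0 / k j)" for v using that sc[of z' v] kpos[of j] by (simp add: fz field_simps)
   thus ?thesis using z(2) unfolding DD_def by blast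
  qed
  moreover have "r0 <= R0 / k j" unfolding r0_def using b kpos[of j] R0 by (intro divide_left_mono) auto
  ultimately show ?thesis using exterior_ball_shrink[of z' p "R0 / k j" "DD j" r0] r0 by blast
 qed
 have "EX d>0. ALL j. ALL y:cball 0 R. ALL z:cball 0 R. norm (y - z) < d --> \<bar>W j y - W j z\<bar> < e" if R: "R > 0" and e: "e > 0" for R e
 proof -
  define C where "C = b^2 * A + 2 * (R + 5)"
  have C: "C > 0" unfolding C_def using A_nonneg R by (intro add_nonneg_pos) auto
  show ?thesis
  proof (rule equicontinuous_family[OF D.dim r0 C zero_less_one R, where D=DD and q=y0 and s=s and g=gW])
   fix j y assume y: "y : DD j" "norm y < R + 4"
   have 1: "\<bar>(k j)^2 * a (x j + k j *R y) * W j y\<bar> <= b^2 * A * 1"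
    unfolding abs_mult using y D.aA[of "x j + k j *R y"] W_bounds[of j y] kpos[of j] b A_nonneg
    by (intro mult_mono) (auto simp: DD_def intro!: power_mono)
   have "W j y powr (crit DIM('a) (s j) - 1) <= 1" using W_bounds[of j y] crit_bounds[of j] by (intro powr_le1) auto
   hence "W j y powr (crit DIM('a) (s j) - 1) * th j y <= 1 * th j y" by (rule mult_right_mono) (simp add: th_def)
   also have "1 * th j y <= 2 * (R + 5) * (1 + norm (y - y0 j) powr (- s j))" unfolding th_eq mult_1
    using y y0_notin[of j] D.s(1)[of j] s1[of j] R by (intro norm_shift_powr) auto
   finally have 2: "\<bar>W j y powr (crit DIM('a) (s j) - 1) * th j y\<bar> <= 2 * (R + 5) * (1 + norm (y - y0 j) powr (- s j))" by (simp add: th_def)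
   have "b^2 * A * 1 <= b^2 * A * (1 + norm (y - y0 j) powr (- s j))" using A_nonneg by (intro mult_left_mono) auto
   hence "\<bar>LW j y\<bar> <= C * (1 + norm (y - y0 j) powr (- s j))"
    unfolding LW_def C_def distrib_right using 1 2 by (intro order_trans[OF abs_triangle_ineq4] add_mono) auto
   thus "EX L. \<bar>L\<bar> <= C * (1 + norm (y - y0 j) powr (- s j)) & has_lap (W j) y L" using W_has_lap[OF y(1)] by blast
  qed (use oDD cW W_off W_bounds y0_notin D.s s1 ext W_GDERIV e in auto)
 qed
 thus thesis using ascoli_diagonal[of W 1] W_bounds that by (metis abs_of_nonneg)
qed

text \<open>The common factor by which rescaling divides the Dirichlet integral and the weighted
  integral; it equals \<open>(k j / \<mu> j) powr (n - 2)\<close>.\<close>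

definition Q :: "nat => real" where "Q j = (norm (x j) / \<mu> j) powr (s j * (real DIM('a) - 2) / 2)"

lemma Qpos: "Q j > 0" using xnz[of j] mu[of j] by (simp add: Q_def)

text \<open>The factors of the two energies coincide because their quotient is the content of
  \<open>k_sq\<close>.\<close>

lemma k_pow: "k j ^ DIM('a) * u j (x j) powr crit DIM('a) (s j) * norm (x j) powr (- s j) = Q j"
 "k j ^ DIM('a) * (u j (x j) / k j)^2 = Q j"
proof -
 let ?n = "real DIM('a)"
 have kp: "k j powr t = norm (x j) powr (s j / 2 * t) * \<mu> j powr ((2 - s j) / 2 * t)" for t
  unfolding k_def blow_scale_def by (simp only: powr_mult powr_powr powr_ge_zero)
 have kn: "k j ^ DIM('a) = k j powr ?n" using kpos[of j] by (simp add: powr_realpow)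
 have Q': "Q j = norm (x j) powr (s j * (?n - 2) / 2) * \<mu> j powr (- (s j * (?n - 2) / 2))"
  unfolding Q_def powr_divide powr_minus_divide by simp
 have "k j ^ DIM('a) * u j (x j) powr crit DIM('a) (s j) * norm (x j) powr (- s j)
  = norm (x j) powr (s j / 2 * ?n + - s j) * \<mu> j powr ((2 - s j) / 2 * ?n + (- (?n - 2) / 2) * crit DIM('a) (s j))"
  unfolding kn kp xval powr_powr powr_add by simp
 also have "s j / 2 * ?n + - s j = s j * (?n - 2) / 2" by (simp add: field_simps)
 also have "(2 - s j) / 2 * ?n + (- (?n - 2) / 2) * crit DIM('a) (s j) = - (s j * (?n - 2) / 2)"
 proof -
  have "(- (?n - 2) / 2) * crit DIM('a) (s j) = - (?n - s j)" using n3 by (simp add: crit_def divide_simps) (simp add: algebra_simps)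
  thus ?thesis by (simp add: field_simps)
 qed
 finally show "k j ^ DIM('a) * u j (x j) powr crit DIM('a) (s j) * norm (x j) powr (- s j) = Q j" unfolding Q' .
 have "(u j (x j))^2 = \<mu> j powr (- (?n - 2))" unfolding xval power2_eq_square by (simp flip: powr_add)
 moreover have "k j ^ DIM('a) / (k j)^2 = k j powr (?n - 2)" unfolding kn powr_diff using kpos[of j] by simp
 ultimately have "k j ^ DIM('a) * (u j (x j) / k j)^2 = k j powr (?n - 2) * \<mu> j powr (- (?n - 2))"
  by (simp only: power_divide times_divide_eq_left[symmetric] times_divide_eq_right mult.commute)
 also have "... = norm (x j) powr (s j / 2 * (?n - 2)) * \<mu> j powr ((2 - s j) / 2 * (?n - 2) + - (?n - 2))"
  unfolding kp powr_add by simp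
 also have "(2 - s j) / 2 * (?n - 2) + - (?n - 2) = - (s j * (?n - 2) / 2)" by (simp add: field_simps)
 finally show "k j ^ DIM('a) * (u j (x j) / k j)^2 = Q j" unfolding Q' by simp
qed

lemma II_scaled: "integrable lborel (%y. W j y powr crit DIM('a) (s j) * th j y)"
 "(LBINT y. W j y powr crit DIM('a) (s j) * th j y) = D.II j / Q j"
proof -
 let ?N = "crit DIM('a) (s j)" and ?z = "%y. x j + k j *R y" and ?U = "u j (x j)"
 have e: "D.wt j (?z y) = (?U powr ?N * norm (x j) powr (- s j)) * (W j y powr ?N * th j y)" for y
 proof -
  have "D.ub j (?z y) = ?U * W j y" using Upos[of j] by (simp add: W_eq)
  moreover have "norm (?z y) powr (- s j) = norm (x j) powr (- s j) * th j y" using xnz[of j] unfolding th_def by (simp add: powr_minus)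
  ultimately show ?thesis unfolding D.wt_def using Upos[of j] W_bounds[of j y] by (simp add: powr_mult)
 qed
 have U0: "?U powr ?N * norm (x j) powr (- s j) > 0" using Upos[of j] xnz[of j] by simp
 have wm: "D.wt j : borel_measurable borel" using borel_measurable_integrable[OF D.energy(1)] by simp
 have "integrable lborel (%y. D.wt j (?z y))" by (rule lborel_integrable_affine[OF D.energy(1) kpos])
 thus "integrable lborel (%y. W j y powr ?N * th j y)" unfolding e using U0 integrable_mult_left_iff by force
 have "D.II j = k j ^ DIM('a) * (LBINT y. D.wt j (?z y))"
  unfolding D.II_def using lborel_integral_affine[OF wm, of "k j" "x j"] kpos[of j] by simp
 also have "... = Q j * (LBINT y. W j y powr ?N * th j y)" unfolding e by (simp flip: k_pow(1))
 finally show "(LBINT y. W j y powr ?N * th j y) = D.II j / Q j" using Qpos[of j] by simp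
qed

lemma DE_scaled: "integrable lborel (%y. indicator (DD j) y * (norm (gW j y))^2)"
 "(LBINT y. indicator (DD j) y * (norm (gW j y))^2) = D.DE j / Q j"
proof -
 let ?z = "%y. x j + k j *R y" and ?U = "u j (x j)"
 let ?w = "%z. (norm (D.pc.gz j z))^2"
 have e: "?w (?z y) = (?U / k j)^2 * (indicator (DD j) y * (norm (gW j y))^2)" for y
  using Upos[of j] kpos[of j] by (auto simp: D.pc.gz_def gW_def indicator_def DD_def power_mult_distrib power_divide)
 have U0: "(?U / k j)^2 > 0" using Upos[of j] kpos[of j] by simp
 have wm: "?w : borel_measurable borel" using borel_measurable_integrable[OF D.ig] by simp
 have "integrable lborel (%y. ?w (?z y))" by (rule lborel_integrable_affine[OF D.ig kpos])
 thus "integrable lborel (%y. indicator (DD j) y * (norm (gW j y))^2)" unfolding e using U0 integrable_mult_left_iff by force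
 have "D.DE j = k j ^ DIM('a) * (LBINT y. ?w (?z y))"
  unfolding D.DE_def using lborel_integral_affine[OF wm, of "k j" "x j"] kpos[of j] by simp
 also have "... = Q j * (LBINT y. indicator (DD j) y * (norm (gW j y))^2)" unfolding e by (simp flip: k_pow(2))
 finally show "(LBINT y. indicator (DD j) y * (norm (gW j y))^2) = D.DE j / Q j" using Qpos[of j] by simp
qed

text \<open>By the energy identity numerator and denominator contain the same number
  \<open>II\<close>, so the quotient is \<open>II\<close> to the power
  \<open>1 - 2 / crit DIM('a) (s j)\<close>, and the energy bound can be solved for
  \<open>II\<close>.\<close>

lemma II_le: "D.II j <= (invK0 TYPE('a) + rh j) powr ((real DIM('a) - s j) / (2 - s j))" "0 < invK0 TYPE('a) + rh j"
proof -
 let ?n = "real DIM('a)"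
 have I: "D.II j > 0" by (rule D.II_pos)
 have ex: "1 - 2 / crit DIM('a) (s j) = (2 - s j) / (?n - s j)" using n3 s1[of j] by (simp add: crit_def field_simps)
 have "D.II j / D.II j powr (2 / crit DIM('a) (s j)) <= invK0 TYPE('a) + rh j" using eb[of j] unfolding D.stmt_energy D.stmt_II .
 hence le: "D.II j powr ((2 - s j) / (?n - s j)) <= invK0 TYPE('a) + rh j" unfolding ex[symmetric] using I by (simp add: powr_diff)
 thus "0 < invK0 TYPE('a) + rh j" using I by (smt (verit) powr_gt_zero)
 have "(D.II j powr ((2 - s j) / (?n - s j))) powr ((?n - s j) / (2 - s j)) <= (invK0 TYPE('a) + rh j) powr ((?n - s j) / (2 - s j))"
  using le n3 s1[of j] by (intro powr_mono2) auto
 moreover have "(2 - s j) / (?n - s j) * ((?n - s j) / (2 - s j)) = 1" using n3 s1[of j] by simp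
 ultimately show "D.II j <= (invK0 TYPE('a) + rh j) powr ((?n - s j) / (2 - s j))" using I by (simp add: powr_powr)
qed

end

section \<open>The blow-up limit\<close>

locale blowup_limit = blowup_sequence +
 fixes V :: "'a => real"
 assumes cV: "continuous_on UNIV V" and ul: "!!R. uniform_limit (cball 0 R) W V sequentially"
begin

abbreviation "P \<equiv> {y. V y > 0}"

lemma ulK: "compact K ==> uniform_limit K W V sequentially"
proof -
 assume "compact K"
 then obtain R where "ALL y:K. norm y <= R" using compact_imp_bounded bounded_iff by metis
 thus ?thesis by (intro uniform_limit_on_subset[OF ul[of R]]) auto
qed

lemma ptw: "(%j. W j y) ----> V y" by (rule tendsto_uniform_limitI[OF ul[of "norm y"]]) simp

lemma V_bounds: "0 <= V y" "V y <= 1"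
 by (rule LIMSEQ_le_const[OF ptw], use W_bounds in auto) (rule LIMSEQ_le_const2[OF ptw], use W_bounds in auto)

lemma V_0: "V 0 = 1" using LIMSEQ_unique[OF ptw[of 0]] by (simp add: W_0)

lemma oP: "open P" by (rule open_Collect_less) (auto intro: cV)

lemma cVK: "continuous_on K V" by (rule continuous_on_subset[OF cV subset_UNIV])

text \<open>The functions \<open>W j\<close> vanish off \<open>DD j\<close>, so uniform convergence
  to a positive limit on \<open>K\<close> forces \<open>K\<close> into the rescaled domain.\<close>

lemma eventually_in_DD: assumes K: "compact K" "K <= P" shows "\<forall>\<^sub>F j in sequentially. K <= DD j"
proof (cases "K = {}")
 case False
 obtain p where p: "p : K" "!!y. y : K ==> V p <= V y" using continuous_attains_inf[OF K(1) False cVK] by blast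
 have "V p > 0" using p K by auto
 from uniform_limitD[OF ulK[OF K(1)] this] show ?thesis
 proof eventually_elim
  case (elim j)
  show ?case
  proof
   fix y assume y: "y : K"
   have "W j y > 0" using elim y p(2)[OF y] by (fastforce simp: dist_real_def)
   thus "y : DD j" using W_off[of y j] by (cases "y : DD j") auto
  qed
 qed
qed simp

lemma ball_subset_P: obtains d where "d > 0" "cball 0 d <= P" "ALL y. norm y <= d --> V y >= 1 / 2"
proof -
 obtain d where d: "d > 0" "!!y. dist y 0 < d ==> dist (V y) (V 0) < 1 / 2"
  using cV unfolding continuous_on_iff by (metis UNIV_I half_gt_zero zero_less_one)
 have "V y >= 1 / 2" if "norm y <= d / 2" for y proof -
  have "\<bar>V y - 1\<bar> < 1 / 2" using d(2)[of y] that d(1) by (simp add: V_0 dist_real_def)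
  thus ?thesis by linarith
 qed
 thus thesis using that[of "d / 2"] d(1) by fastforce
qed

text \<open>Since \<open>V 0 = 1\<close>, a fixed ball around 0 eventually lies in the rescaled
  domains, and the pole never does.\<close>

lemma y0_far: obtains d where "d > 0" "d <= 1" "\<forall>\<^sub>F j in sequentially. d <= norm (y0 j)"
proof -
 obtain d where d: "d > 0" "cball 0 d <= P" "ALL y. norm y <= d --> V y >= 1 / 2" by (rule ball_subset_P)
 have "\<forall>\<^sub>F j in sequentially. min d 1 <= norm (y0 j)" using eventually_in_DD[OF compact_cball d(2)]
 proof eventually_elim
  case (elim j)
  hence "y0 j ~: cball 0 d" using y0_notin by blast
  thus ?case by simp
 qed
 thus thesis using that[of "min d 1"] d(1) by simp
qed

text \<open>By \<open>th_eq\<close> the weight is \<open>norm (y - y0 j) / norm (y0 j)\<close> to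
  the power \<open>- s j\<close>. This ratio stays between two positive constants, because the pole
  keeps away from 0 and from \<open>K\<close>; powers of constants with exponent tending to 0 tend
  to 1.\<close>

lemma th_limit: assumes K: "compact K" "K <= P" shows "uniform_limit K th (%_. 1) sequentially"
proof -
 obtain d where d: "d > 0" "d <= 1" "\<forall>\<^sub>F j in sequentially. d <= norm (y0 j)" using y0_far by blast
 \<comment> \<open>A thickening of \<open>K\<close> inside \<open>P\<close> also ends up in the
   rescaled domains, so the pole stays at distance \<open>de\<close> from \<open>K\<close>.\<close>
 obtain de where de: "de > 0" "{v + w | v w. v : K & w : cball 0 de} <= P"
 proof -
  obtain e where e: "e > 0" "(UN y:K. ball y e) <= P" using compact_subset_open_imp_ball_epsilon_subset[OF K(1) oP K(2)] by blast
  have "v + w : P" if "v : K" "w : cball 0 (e / 2)" for v w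
  proof -
   have "v + w : ball v e" using that e(1) by (auto simp: dist_norm)
   thus ?thesis using e(2) that by blast
  qed
  thus ?thesis using that[of "e / 2"] e(1) by auto
 qed
 have "compact {v + w | v w. v : K & w : cball 0 de}" by (rule compact_sums[OF K(1) compact_cball])
 from eventually_in_DD[OF this de(2)] have far: "\<forall>\<^sub>F j in sequentially. ALL y:K. de <= norm (y - y0 j)"
 proof eventually_elim
  case (elim j)
  show ?case
  proof (rule ballI, rule ccontr)
   fix y assume y: "y : K" "~ de <= norm (y - y0 j)"
   hence "y + (y0 j - y) : {v + w | v w. v : K & w : cball 0 de}" unfolding mem_Collect_eq by (intro exI[of _ y] exI[of _ "y0 j - y"]) (auto simp: norm_minus_commute)
   thus False using elim y0_notin[of j] by auto
  qed
 qed
 obtain R where R: "R > 0" "!!y. y : K ==> norm y <= R" using compact_imp_bounded[OF K(1)] by (auto simp: bounded_pos)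
 \<comment> \<open>The first entry covers poles of norm more than \<open>2 * R\<close>, the second
   the nearer ones.\<close>
 define c where "c = min (1 / 2) (de / (2 * R))"
 have c: "c > 0" using de R by (simp add: c_def)
 define C where "C = 1 + R / d"
 have C: "C >= 1" using R d by (simp add: C_def)
 have bd: "\<forall>\<^sub>F j in sequentially. ALL y:K. C powr (- s j) <= th j y & th j y <= c powr (- s j)" using d(3) far
 proof eventually_elim
  case (elim j)
  show ?case
  proof
   fix y assume y: "y : K"
   let ?t = "norm (y - y0 j) / norm (y0 j)"
   have Y: "norm (y0 j) > 0" using elim(1) d by linarith
   have th: "th j y = ?t powr (- s j)" unfolding th_eq powr_divide by (simp add: powr_minus_divide)
   have "norm (y - y0 j) <= R + norm (y0 j)" using norm_triangle_ineq4[of y "y0 j"] R(2)[OF y] by simp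
   also have "... <= C * norm (y0 j)" using elim(1) R(1) d mult_left_mono[OF elim(1), of "R / d"] by (simp add: C_def algebra_simps)
   finally have 1: "?t <= C" using Y by (simp add: divide_simps)
   have 2: "c <= ?t"
   proof (cases "norm (y0 j) <= 2 * R")
    case True
    have "c <= de / (2 * R)" by (simp only: c_def min.cobounded2)
    also have "... <= norm (y - y0 j) / norm (y0 j)" using elim(2) y True Y de R by (intro frac_le) auto
    finally show ?thesis .
   next
    case False
    have "norm (y0 j) - R <= norm (y - y0 j)" using norm_triangle_ineq2[of "y0 j" y] R(2)[OF y] by (simp add: norm_minus_commute)
    hence "1 / 2 <= ?t" using False Y by (simp add: divide_simps)
    moreover have "c <= 1 / 2" by (simp only: c_def min.cobounded1)
    ultimately show ?thesis by linarith
   qed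
   show "C powr (- s j) <= th j y & th j y <= c powr (- s j)"
    unfolding th using 1 2 c C D.s(1)[of j] by (intro conjI powr_mono2') auto
  qed
 qed
 have lim: "(%j. t powr (- s j)) ----> 1" if "t > 0" for t
  using tendsto_powr[OF tendsto_const[of t] tendsto_minus[OF sl]] that by simp
 show ?thesis unfolding uniform_limit_iff
 proof (intro allI impI)
  fix e :: real assume e: "e > 0"
  have "\<forall>\<^sub>F j in sequentially. 1 - e < C powr (- s j)" "\<forall>\<^sub>F j in sequentially. c powr (- s j) < 1 + e"
   using order_tendstoD[OF lim[of C]] order_tendstoD[OF lim[OF c]] C e by auto
  with bd show "\<forall>\<^sub>F j in sequentially. ALL y:K. dist (th j y) 1 < e"
   by eventually_elim (force simp: dist_real_def abs_less_iff)
 qed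
qed

lemma crit_tendsto: "(%j. crit DIM('a) (s j)) ----> crit DIM('a) 0"
 unfolding crit_def by (intro tendsto_intros sl) (use n3 in auto)

lemma LW_limit: assumes K: "compact K" "K <= P"
 shows "uniform_limit K LW (%y. - (V y powr (crit DIM('a) 0 - 1))) sequentially"
proof -
 let ?p = "crit DIM('a) 0 - 1"
 have pw: "uniform_limit K (%j y. W j y powr (crit DIM('a) (s j) - 1)) (%y. V y powr ?p) sequentially"
  using K by (intro uniform_limit_powr ulK cVK tendsto_intros crit_tendsto) auto
 have cp: "continuous_on K (%y. V y powr ?p)" using K by (intro continuous_intros cVK) auto
 have "uniform_limit K (%j y. W j y powr (crit DIM('a) (s j) - 1) * th j y) (%y. V y powr ?p * 1) sequentially"
  by (rule uniform_lim_mult[OF pw th_limit[OF K]]) (auto intro!: compact_imp_bounded compact_continuous_image cp K(1))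
 moreover have "uniform_limit K (%j y. (k j)^2 * a (x j + k j *R y) * W j y) (%_. 0) sequentially"
  unfolding uniform_limit_iff
 proof (intro allI impI)
  fix e :: real assume e: "e > 0"
  have "(%j. (k j)^2 * A) ----> 0^2 * A" by (intro tendsto_intros k_tendsto)
  hence "\<forall>\<^sub>F j in sequentially. (k j)^2 * A < e" using e by (auto dest: order_tendstoD)
  thus "\<forall>\<^sub>F j in sequentially. ALL y:K. dist ((k j)^2 * a (x j + k j *R y) * W j y) 0 < e" using eventually_in_DD[OF K]
  proof eventually_elim
   case (elim j)
   show ?case
   proof
    fix y assume "y : K"
    hence z: "x j + k j *R y : Om" using elim by (auto simp: DD_def)
    have "\<bar>(k j)^2 * a (x j + k j *R y) * W j y\<bar> <= (k j)^2 * A * 1"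
     unfolding abs_mult using D.aA[OF z] W_bounds[of j y] A_nonneg by (intro mult_mono) auto
    thus "dist ((k j)^2 * a (x j + k j *R y) * W j y) 0 < e" using elim by simp
   qed
  qed
 qed
 ultimately have "uniform_limit K (%j y. (k j)^2 * a (x j + k j *R y) * W j y - W j y powr (crit DIM('a) (s j) - 1) * th j y) (%y. 0 - V y powr ?p * 1) sequentially"
  by (intro uniform_limit_minus)
 thus ?thesis unfolding LW_def[abs_def] by simp
qed

lemma C1lim: "y : P ==> GDERIV V y :> grad V y" "continuous_on P (grad V)"
 "compact K ==> K <= P ==> uniform_limit K gW (grad V) sequentially"
 by (rule C1_limit_open[OF oP eventually_in_DD W_GDERIV cgW W_has_lap ulK LW_limit]; assumption)+

sublocale V: pos_C1 V P "grad V"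
 by unfold_locales (use oP cV C1lim(1) C1lim(2) V_bounds(1) in \<open>auto simp: not_less intro: antisym\<close>)

lemma weak: assumes f: "C1c f h S" and S: "S <= P"
 shows "(LBINT y. h y \<bullet> grad V y) = (LBINT y. f y * V y powr (crit DIM('a) 0 - 1))"
proof -
 have cS: "compact S" "!!y. y ~: S ==> f y = 0" using f by (auto simp: C1c_def)
 note DS = eventually_in_DD[OF cS(1) S]
 have bd: "bounded (F ` S)" if "continuous_on S F" for F :: "'a => 'b::real_normed_vector"
  by (intro compact_imp_bounded compact_continuous_image that cS(1))
 have cf: "continuous_on S f" "continuous_on S h" using C1c_cont[OF f] C1c_cont_grad[OF f] by auto
 have cp: "continuous_on S (%y. - (V y powr (crit DIM('a) 0 - 1)))" using S by (intro continuous_intros cVK) auto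
 have 1: "(%j. LBINT y. h y \<bullet> gW j y) ----> (LBINT y. h y \<bullet> grad V y)"
 proof (rule uniform_limit_integral_compact[OF cS(1)])
  show "\<forall>\<^sub>F j in sequentially. continuous_on S (%y. h y \<bullet> gW j y)" using DS
   by eventually_elim (intro continuous_intros cf continuous_on_subset[OF cgW])
  show "uniform_limit S (%j y. h y \<bullet> gW j y) (%y. h y \<bullet> grad V y) sequentially"
   by (intro bounded_bilinear.bounded_uniform_limit[OF bounded_bilinear_inner] uniform_limit_const C1lim(3) cS S bd cf continuous_on_subset[OF C1lim(2)])
 qed (use C1c_grad_zero[OF f] in auto)
 have 2: "(%j. LBINT y. f y * LW j y) ----> (LBINT y. f y * - (V y powr (crit DIM('a) 0 - 1)))"
 proof (rule uniform_limit_integral_compact[OF cS(1)])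
  show "\<forall>\<^sub>F j in sequentially. continuous_on S (%y. f y * LW j y)" using DS
  proof eventually_elim
   case (elim j)
   have "continuous_on S (%y. - lap (W j) y)" unfolding lap_def using W_Ck2[of j] by (intro continuous_intros continuous_on_subset[OF _ elim]) auto
   hence "continuous_on S (LW j)" by (rule continuous_on_cong[THEN iffD1, rotated 2]) (use W_lap elim in auto)
   thus ?case by (intro continuous_intros cf)
  qed
  show "uniform_limit S (%j y. f y * LW j y) (%y. f y * - (V y powr (crit DIM('a) 0 - 1))) sequentially"
   by (intro uniform_lim_mult uniform_limit_const LW_limit cS S bd cf cp)
 qed (use cS in auto)
 have "\<forall>\<^sub>F j in sequentially. (LBINT y. h y \<bullet> gW j y) = - (LBINT y. f y * LW j y)" using DS
 proof eventually_elim
  case (elim j)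
  have "(LBINT y. h y \<bullet> gW j y) = (LBINT y. h y \<bullet> grad (W j) y)"
   by (intro Bochner_Integration.integral_cong refl) (metis W_grad elim subsetD C1c_grad_zero[OF f] inner_zero_left)
  also have "... = (LBINT y. f y * lap (W j) y)" by (rule green_identity[OF f oDD elim W_Ck2])
  also have "... = (LBINT y. - (f y * LW j y))"
  proof (intro Bochner_Integration.integral_cong refl)
   show "f y * lap (W j) y = - (f y * LW j y)" for y using W_lap[of y j] elim cS(2)[of y] by (cases "y : S") auto
  qed
  finally show ?case by simp
 qed
 hence "(%j. LBINT y. h y \<bullet> gW j y) ----> - (LBINT y. f y * - (V y powr (crit DIM('a) 0 - 1)))"
  using tendsto_cong tendsto_minus[OF 2] by fast
 thus ?thesis using LIMSEQ_unique[OF 1] by simp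
qed

section \<open>The energy of the limit\<close>

definition bb :: "nat => real" where "bb j = (invK0 TYPE('a) + rh j) powr ((real DIM('a) - s j) / (2 - s j))"

lemma II_bb: "D.II j <= bb j" unfolding bb_def by (rule II_le)

lemma invK0_nonneg: "invK0 TYPE('a) >= 0"
proof (rule tendsto_lowerbound)
 show "(%j. invK0 TYPE('a) + rh j) ----> invK0 TYPE('a)" using tendsto_add[OF tendsto_const rh] by simp
qed (use less_imp_le[OF II_le(2)] in \<open>auto intro!: always_eventually\<close>)

lemma bb_tendsto: "bb ----> invK0 TYPE('a) powr (real DIM('a) / 2)"
proof -
 have 1: "(%j. invK0 TYPE('a) + rh j) ----> invK0 TYPE('a)" using tendsto_add[OF tendsto_const rh] by simp
 have 2: "(%j. (real DIM('a) - s j) / (2 - s j)) ----> (real DIM('a) - 0) / (2 - 0)" by (intro tendsto_intros sl) auto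
 show ?thesis unfolding bb_def[abs_def] by (rule tendsto_powr'[OF 1 2[simplified]]) (use n3 less_imp_le[OF II_le(2)] in \<open>auto intro!: always_eventually simp del: less_eq_real_def\<close>)
qed

text \<open>The rescaled pole has norm \<open>(norm (x j) / \<mu> j) powr (1 - s j / 2)\<close>,
  which is at least \<open>d\<close>; with \<open>s j <= 1\<close> this gives
  \<open>norm (x j) / \<mu> j >= d^2\<close>. The exponent in \<open>Q\<close> tends to 0, so the
  resulting lower bound tends to 1.\<close>

lemma Q_lower: obtains q where "q ----> 1" "\<forall>\<^sub>F j in sequentially. 0 < q j & q j <= Q j"
proof -
 obtain d where d: "d > 0" "d <= 1" "\<forall>\<^sub>F j in sequentially. d <= norm (y0 j)" using y0_far by blast
 define q where "q j = (d^2) powr (s j * (real DIM('a) - 2) / 2)" for j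
 have "(%j. s j * (real DIM('a) - 2) / 2) ----> 0 * (real DIM('a) - 2) / 2" by (intro tendsto_intros sl) auto
 from tendsto_powr[OF tendsto_const[of "d^2"] this] have "q ----> 1" using d(1) by (simp add: q_def[abs_def])
 moreover have "\<forall>\<^sub>F j in sequentially. 0 < q j & q j <= Q j" using d(3)
 proof eventually_elim
  case (elim j)
  let ?t = "norm (x j) / \<mu> j"
  have t: "?t > 0" using xnz[of j] mu[of j] by simp
  have "norm (y0 j) = norm (x j) / k j" using y0_norm(1)[of j] kpos[of j] by simp
  also have "... = ?t powr (1 - s j / 2)"
  proof -
   have "k j = norm (x j) powr (s j / 2) * \<mu> j powr (1 - s j / 2)" by (simp add: k_def blow_scale_def diff_divide_distrib)
   moreover have "norm (x j) = norm (x j) powr (s j / 2) * norm (x j) powr (1 - s j / 2)" using xnz[of j] by (simp flip: powr_add)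
   ultimately show ?thesis unfolding powr_divide using xnz[of j] by (metis nonzero_mult_divide_mult_cancel_left powr_gt_zero less_irrefl)
  qed
  finally have "d <= ?t powr (1 - s j / 2)" using elim by simp
  moreover have "?t powr (1 - s j / 2) <= ?t powr (1 / 2)" if "?t < 1" using that t s1[of j] by (intro powr_mono') auto
  ultimately have "d <= ?t powr (1 / 2)" if "?t < 1" using that by linarith
  hence "d^2 <= (sqrt ?t)^2" if "?t < 1" using that d(1) t by (intro power_mono) (auto simp: powr_half_sqrt)
  moreover have "d^2 <= 1" using d by (simp add: power_le_one)
  ultimately have "d^2 <= ?t" using t by (cases "?t < 1") auto
  thus ?case unfolding q_def Q_def using d D.s(1)[of j] n3 by (intro conjI powr_mono2) auto
 qed
 ultimately show thesis by (rule that)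
qed

lemma crit0: "crit DIM('a) 0 > 2" "2 / crit DIM('a) 0 = 1 - 2 / real DIM('a)" "crit DIM('a) 0 / (crit DIM('a) 0 - 2) = real DIM('a) / 2"
 using n3 by (auto simp: crit_def field_simps)

text \<open>The gradients and weights are known to converge on \<open>P\<close> only. The indicator
  discards the rest, which can only lower the integrals entering Fatou's lemma.\<close>

lemma pointwise_energy:
 "(%j. indicator P y * (W j y powr crit DIM('a) (s j) * th j y)) ----> V y powr crit DIM('a) 0"
 "(%j. indicator P y * (indicator (DD j) y * (norm (gW j y))^2)) ----> (norm (V.gz y))^2"
proof -
 have "(%j. W j y powr crit DIM('a) (s j) * th j y) ----> V y powr crit DIM('a) 0 * 1" if y: "y : P"
  using y tendsto_uniform_limitI[OF th_limit[of "{y}"]] by (intro tendsto_intros ptw crit_tendsto) auto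
 thus "(%j. indicator P y * (W j y powr crit DIM('a) (s j) * th j y)) ----> V y powr crit DIM('a) 0"
  using V_bounds(1)[of y] by (cases "y : P") auto
 have "(%j. indicator (DD j) y * (norm (gW j y))^2) ----> (norm (V.gz y))^2" if y: "y : P"
 proof -
  have "(%j. gW j y) ----> grad V y" using tendsto_uniform_limitI[OF C1lim(3)[of "{y}"]] y by simp
  hence "(%j. (norm (gW j y))^2) ----> (norm (V.gz y))^2" using y by (auto intro!: tendsto_intros simp: V.gz_def)
  moreover have "\<forall>\<^sub>F j in sequentially. (norm (gW j y))^2 = indicator (DD j) y * (norm (gW j y))^2"
   using eventually_in_DD[of "{y}"] y by (auto elim!: eventually_mono)
  ultimately show ?thesis using tendsto_cong by fast
 qed
 thus "(%j. indicator P y * (indicator (DD j) y * (norm (gW j y))^2)) ----> (norm (V.gz y))^2"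
  by (cases "y : P") (auto simp: V.gz_def)
qed

lemma integrable_P: "integrable lborel f ==> integrable lborel (%y. indicator P y * f y)" for f :: "'a => real"
 using integrable_mult_indicator[of P lborel f] oP by simp

lemma integral_P:
 fixes f :: "'a => real"
 assumes "integrable lborel f" "!!y. f y >= 0" shows "(LBINT y. indicator P y * f y) <= integral\<^sup>L lborel f"
 by (rule integral_mono[OF integrable_P]) (use assms in \<open>auto simp: indicator_def\<close>)

text \<open>Subsequence and bound are left free for two uses: the identity gives the energy bound of
  \<open>V\<close>, and in \<open>Q_tendsto\<close> a subsequence with large \<open>Q\<close> gives
  a contradiction.\<close>

lemma fatou_energy:
 assumes "strict_mono r" "b ----> B" "\<forall>\<^sub>F j in sequentially. D.II (r j) / Q (r j) <= b j"
 shows "integrable lborel (%y. V y powr crit DIM('a) 0)" "(LBINT y. V y powr crit DIM('a) 0) <= B"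
proof -
 let ?f = "%j y. indicator P y * (W (r j) y powr crit DIM('a) (s (r j)) * th (r j) y)"
 have 1: "integrable lborel (?f j)" for j by (rule integrable_P[OF II_scaled(1)])
 have 2: "?f j y >= 0" for j y by (simp add: th_def)
 have 3: "(%j. ?f j y) ----> V y powr crit DIM('a) 0" for y
  using LIMSEQ_subseq_LIMSEQ[OF pointwise_energy(1)[of y] assms(1)] by (simp add: comp_def)
 have 4: "\<forall>\<^sub>F j in sequentially. integral\<^sup>L lborel (?f j) <= b j" using assms(3)
  by eventually_elim (rule order_trans[OF integral_P[OF II_scaled(1)]], auto simp: th_def II_scaled(2)[unfolded th_def])
 show "integrable lborel (%y. V y powr crit DIM('a) 0)" "(LBINT y. V y powr crit DIM('a) 0) <= B"
  by (rule fatou_bound[OF 1 2 3 4 assms(2)])+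
qed

lemma energy_V: "integrable lborel (%y. V y powr crit DIM('a) 0)"
 "(LBINT y. V y powr crit DIM('a) 0) <= invK0 TYPE('a) powr (real DIM('a) / 2)" "integrable lborel (%y. (norm (V.gz y))^2)"
proof -
 obtain q where q: "q ----> 1" "\<forall>\<^sub>F j in sequentially. 0 < q j & q j <= Q j" using Q_lower by blast
 have bq: "(%j. bb j / q j) ----> invK0 TYPE('a) powr (real DIM('a) / 2)" using tendsto_divide[OF bb_tendsto q(1)] by simp
 have le: "\<forall>\<^sub>F j in sequentially. D.II j / Q j <= bb j / q j" using q(2)
  by eventually_elim (use II_bb D.II_pos less_imp_le in \<open>auto intro!: frac_le intro: order_trans[OF less_imp_le[OF D.II_pos]]\<close>)
 show "integrable lborel (%y. V y powr crit DIM('a) 0)" "(LBINT y. V y powr crit DIM('a) 0) <= invK0 TYPE('a) powr (real DIM('a) / 2)"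
  using fatou_energy[OF strict_mono_id bq] le by (auto simp: id_def)
 obtain A0 where A0: "A0 > 0" "!!j. A0 * D.DE j <= D.II j" using coercive_DE by blast
 show "integrable lborel (%y. (norm (V.gz y))^2)"
 proof (rule fatou_bound(1)[where f="%j y. indicator P y * (indicator (DD j) y * (norm (gW j y))^2)", OF integrable_P[OF DE_scaled(1)] _ pointwise_energy(2)])
  show "(%j. (bb j / q j) / A0) ----> invK0 TYPE('a) powr (real DIM('a) / 2) / A0" using A0 by (intro tendsto_intros bq) auto
  show "\<forall>\<^sub>F j in sequentially. (LBINT y. indicator P y * (indicator (DD j) y * (norm (gW j y))^2)) <= (bb j / q j) / A0" using le
  proof eventually_elim
   case (elim j)
   have "(LBINT y. indicator P y * (indicator (DD j) y * (norm (gW j y))^2)) <= D.DE j / Q j"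
    unfolding DE_scaled(2)[symmetric] by (rule integral_P[OF DE_scaled(1)]) simp
   also have "... <= (D.II j / A0) / Q j" using A0 Qpos[of j] by (intro divide_right_mono) (auto simp: field_simps less_imp_le)
   also have "... = (D.II j / Q j) / A0" by simp
   also have "... <= (bb j / q j) / A0" using elim A0 by (intro divide_right_mono) auto
   finally show ?case .
  qed
 qed auto
qed

lemma energy_identity: "(LBINT y. (norm (V.gz y))^2) = (LBINT y. V y powr crit DIM('a) 0)"
 by (rule V.energy_powr[OF D.dim energy_V(1,3)]) (rule weak)

lemma energy_pos: "(LBINT y. V y powr crit DIM('a) 0) > 0"
proof -
 obtain d where d: "d > 0" "cball 0 d <= P" "ALL y. norm y <= d --> V y >= 1 / 2" by (rule ball_subset_P)
 define c where "c = (1 / 2 :: real) powr crit DIM('a) 0"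
 have c: "c > 0" by (simp add: c_def)
 have "0 < c * measure lborel (ball (0::'a) d)" using c d(1) content_ball_pos[of d "0::'a"] by simp
 also have "... = (\<integral>y. indicator (ball 0 d) y * c \<partial>(lborel :: 'a measure))" by simp
 also have "... <= (LBINT y. V y powr crit DIM('a) 0)"
 proof (rule integral_mono[OF _ energy_V(1)])
  show "integrable lborel (%y::'a. indicator (ball 0 d) y * c)" using emeasure_bounded_finite[OF bounded_ball[of "0::'a" d]] by (intro integrable_mult_left integrable_real_indicator) auto
  show "indicator (ball 0 d) y * c <= V y powr crit DIM('a) 0" for y
   using d(3)[rule_format, of y] crit0(1) by (cases "y : ball 0 d") (auto simp: c_def intro!: powr_mono2)
 qed
 finally show ?thesis .
qed

text \<open>Write \<open>X\<close> for the integral and \<open>K\<close> for \<open>invK0\<close>.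
  The upper bound is \<open>X <= K powr (n / 2)\<close>; since \<open>X\<close> is also the
  Dirichlet integral, the Sobolev inequality gives \<open>K * X powr (1 - 2 / n) <= X\<close>, that
  is, the reverse bound. Equality makes \<open>V\<close> a minimizer.\<close>

lemma energy_value: "(LBINT y. V y powr crit DIM('a) 0) = invK0 TYPE('a) powr (real DIM('a) / 2)"
 "(LBINT y. V y powr crit DIM('a) 0) <= invK0 TYPE('a) * (LBINT y. V y powr crit DIM('a) 0) powr (2 / crit DIM('a) 0)"
proof -
 let ?K = "invK0 TYPE('a)" and ?n = "real DIM('a)"
 define X where "X = (LBINT y. V y powr crit DIM('a) 0)"
 have X: "X > 0" using energy_pos by (simp add: X_def)
 have aV: "\<bar>V y\<bar> = V y" for y using V_bounds(1)[of y] by simp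
 have "?K * X powr (2 / crit DIM('a) 0) <= X"
  using invK0_le(2)[OF V.D12_V[OF D.dim energy_V(1,3)] V.V_measurable V.gz_measurable] X unfolding aV energy_identity X_def by blast
 hence "?K <= X / X powr (1 - 2 / ?n)" unfolding crit0(2) using X by (simp add: pos_le_divide_eq)
 also have "... = X powr (2 / ?n)" using X powr_diff[of X 1 "1 - 2 / ?n"] by simp
 finally have 1: "?K <= X powr (2 / ?n)" .
 have up: "X <= ?K powr (?n / 2)" using energy_V(2) by (simp add: X_def)
 have "?K powr (?n / 2) <= (X powr (2 / ?n)) powr (?n / 2)" using 1 invK0_nonneg n3 by (intro powr_mono2) auto
 also have "... = X" using X n3 by (simp add: powr_powr)
 finally have eq: "X = ?K powr (?n / 2)" using up by simp
 thus "(LBINT y. V y powr crit DIM('a) 0) = ?K powr (?n / 2)" by (simp add: X_def)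
 have K0: "?K > 0" using eq X invK0_nonneg by (cases "?K = 0") auto
 have "?K * X powr (2 / crit DIM('a) 0) = ?K powr 1 * ?K powr (?n / 2 * (1 - 2 / ?n))" unfolding crit0(2) eq powr_powr using K0 by simp
 also have "... = ?K powr (1 + ?n / 2 * (1 - 2 / ?n))" by (simp only: powr_add)
 also have "1 + ?n / 2 * (1 - 2 / ?n) = ?n / 2" using n3 by (simp add: field_simps)
 finally show "(LBINT y. V y powr crit DIM('a) 0) <= ?K * (LBINT y. V y powr crit DIM('a) 0) powr (2 / crit DIM('a) 0)"
  using eq unfolding X_def by simp
qed

lemma lower_bound: obtains r c where "r > 0" "c > 0" "ALL y. norm y >= r --> V y >= c * norm y powr (2 - real DIM('a))" "ALL y. norm y <= r --> V y > 0"
proof -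
 obtain d where d: "d > 0" "cball 0 d <= P" "ALL y. norm y <= d --> V y >= 1 / 2" by (rule ball_subset_P)
 have "0 <= (LBINT y. V y * lap ph y)" if "test_fun UNIV ph" "!!y. ph y >= 0" for ph
  unfolding V.weak_lap_test[OF D.dim energy_V(1,3) that(1)]
  by (rule V.minimizer_superharmonic[OF D.dim energy_V(1,3) energy_pos _ that]) (use energy_identity energy_value(2) in simp)
 hence "EX c>0. ALL y. norm y >= d / 2 --> V y >= c * norm y powr (2 - real DIM('a))"
  by (rule superharmonic_lower_bound[OF D.dim cV V_bounds(1), where m="1/2"]) (use d in auto)
 moreover have "V y > 0" if "norm y <= d / 2" for y using d(3)[rule_format, of y] d(1) that by force
 ultimately show thesis using that[of "d / 2"] d(1) by auto
qed

lemma Vpos: "V y > 0"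
proof -
 obtain r c where r: "r > 0" "c > 0" "ALL y. norm y >= r --> V y >= c * norm y powr (2 - real DIM('a))" "ALL y. norm y <= r --> V y > 0" by (rule lower_bound)
 show ?thesis
 proof (cases "norm y <= r")
  case False
  hence "c * norm y powr (2 - real DIM('a)) > 0" using r by (intro mult_pos_pos) auto
  thus ?thesis using r(3)[rule_format, of y] False by linarith
 qed (use r in simp)
qed

lemma P_UNIV: "P = UNIV" using Vpos by auto

lemma V_bubble: "V y = (1 + (norm y)^2 / (real DIM('a) * (real DIM('a) - 2))) powr (- (real DIM('a) - 2) / 2)"
proof -
 let ?p = "crit DIM('a) 0 - 1"
 have gz: "V.gz = grad V" unfolding V.gz_def[abs_def] using Vpos by simp
 have gV: "GDERIV V y :> grad V y" for y using V.der Vpos by simp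
 have cg: "continuous_on UNIV (grad V)" using V.cg unfolding P_UNIV .
 have F: "GDERIV (%y. V y powr ?p) y :> (?p * V y powr (?p - 1)) *R grad V y" for y
  by (rule GDERIV_DERIV_compose[OF gV has_real_derivative_powr[OF Vpos]])
 have nz: "ALL y:UNIV. V y ~= 0" using Vpos by (metis less_irrefl)
 have cF: "continuous_on UNIV (%y. (?p * V y powr (?p - 1)) *R grad V y)"
  by (intro continuous_intros cV cg nz)
 have we: "(LBINT y. V y * lap ph y) = (LBINT y. V y powr ?p * ph y)" if ph: "test_fun UNIV ph" for ph
 proof -
  obtain K where K: "C1c ph (grad ph) K" using test_fun_C1c[OF ph] by blast
  have "K <= P" using Vpos by auto
  from weak[OF K this] show ?thesis using V.weak_lap_test[OF D.dim energy_V(1,3) ph] unfolding gz by (simp add: inner_commute mult.commute)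
 qed
 \<comment> \<open>Regularity is gained in two steps: the right side is C1, so \<open>V\<close> is
   C2; then the right side is C2, so \<open>V\<close> is C3, as the classification requires.\<close>
 note reg = weak_regularity[OF gV cg F cF we]
 have V3: "Ck (Suc (Suc (Suc 0))) UNIV V" by (rule weak_regularity_Suc[OF reg(1) Ck_powr_same[OF open_UNIV Vpos reg(1)] we])
 obtain r c where r: "r > 0" "c > 0" "ALL y. norm y >= r --> V y >= c * norm y powr (2 - real DIM('a))" by (rule lower_bound) blast
 show ?thesis
  by (rule entire_solution_classification[OF D.dim V3 Vpos reg(2) energy_V(3)[unfolded gz] r(1,2) r(3)[rule_format] V_0 V_bounds(2)])
qed

text \<open>If \<open>Q >= 1 + e\<close> along a subsequence, Fatou's lemma would bound the energy
  of \<open>V\<close> by its own value divided by \<open>1 + e\<close>.\<close>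

lemma Q_tendsto: "Q ----> 1"
proof -
 let ?X = "invK0 TYPE('a) powr (real DIM('a) / 2)"
 have X: "?X > 0" using energy_pos energy_value(1) by simp
 obtain q where q: "q ----> 1" "\<forall>\<^sub>F j in sequentially. 0 < q j & q j <= Q j" using Q_lower by blast
 have up: "\<forall>\<^sub>F j in sequentially. Q j < 1 + e" if e: "e > 0" for e
 proof (rule ccontr)
  assume "~ (\<forall>\<^sub>F j in sequentially. Q j < 1 + e)"
  hence "infinite {j. Q j >= 1 + e}" by (simp add: cofinite_eq_sequentially[symmetric] eventually_cofinite not_less)
  then obtain r :: "nat => nat" where r: "strict_mono r" "!!j. r j : {j. Q j >= 1 + e}" using infinite_enumerate by blast
  have "(%j. bb (r j) / (1 + e)) ----> ?X / (1 + e)"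
   using LIMSEQ_subseq_LIMSEQ[OF bb_tendsto r(1)] e by (intro tendsto_divide) (auto simp: comp_def)
  moreover have "D.II (r j) / Q (r j) <= bb (r j) / (1 + e)" for j
   using r(2)[of j] e II_bb[of "r j"] D.II_pos[of "r j"] by (intro frac_le) auto
  ultimately have "?X <= ?X / (1 + e)" using fatou_energy(2)[OF r(1)] energy_value(1) by (simp add: always_eventually)
  thus False using mult_pos_pos[OF X e] e by (simp add: pos_le_divide_eq algebra_simps)
 qed
 show ?thesis
 proof (rule order_tendstoI)
  fix t :: real assume "t < 1"
  hence "\<forall>\<^sub>F j in sequentially. t < q j" using order_tendstoD(1)[OF q(1)] by blast
  with q(2) show "\<forall>\<^sub>F j in sequentially. t < Q j" by eventually_elim linarith
 qed (use up[of "t - 1" for t] in force)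
qed

lemma ratio_tendsto: "(%j. (\<mu> j / norm (x j)) powr s j) ----> 1" "(%j. k j / \<mu> j) ----> 1"
proof -
 have n: "real DIM('a) - 2 > 0" using n3 by simp
 have 1: "(\<mu> j / norm (x j)) powr s j = Q j powr (- 2 / (real DIM('a) - 2))" for j
 proof -
  have "s j * (real DIM('a) - 2) / 2 * (- 2 / (real DIM('a) - 2)) = - s j" using n by simp
  hence "Q j powr (- 2 / (real DIM('a) - 2)) = (norm (x j) / \<mu> j) powr (- s j)" unfolding Q_def powr_powr by (simp only:)
  thus ?thesis by (simp only: powr_divide powr_minus_divide) simp
 qed
 have 2: "k j / \<mu> j = Q j powr (1 / (real DIM('a) - 2))" for j
 proof -
  have "s j * (real DIM('a) - 2) / 2 * (1 / (real DIM('a) - 2)) = s j / 2" using n by (simp add: field_simps)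
  hence "Q j powr (1 / (real DIM('a) - 2)) = (norm (x j) / \<mu> j) powr (s j / 2)" unfolding Q_def powr_powr by (simp only:)
  also have "... = norm (x j) powr (s j / 2) * \<mu> j powr ((2 - s j) / 2 - 1)"
  proof -
   have "(2 - s j) / 2 - 1 = - (s j / 2)" by (simp add: field_simps)
   thus ?thesis by (simp only: powr_divide powr_minus_divide) simp
  qed
  also have "... = k j / \<mu> j" unfolding powr_diff k_def blow_scale_def using mu[of j] by simp
  finally show ?thesis by simp
 qed
 show "(%j. (\<mu> j / norm (x j)) powr s j) ----> 1" "(%j. k j / \<mu> j) ----> 1"
  unfolding 1 2 using tendsto_powr[OF Q_tendsto tendsto_const] by simp_all
qed

end

section \<open>Convergence along the whole family\<close>

text \<open>If the property failed, there would be a sequence of exceptions tending to 0, and none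
  of its terms could be a good one.\<close>

lemma eventually_at_right_subseq:
 assumes "!!e::nat => real. (!!j. 0 < e j) ==> e ----> 0 ==> EX r. \<forall>\<^sub>F j in sequentially. Pr (e (r j))"
 shows "\<forall>\<^sub>F ep in at_right 0. Pr ep"
proof (rule ccontr)
 assume "~ ?thesis"
 hence "ALL j. EX ep>0. ep < 1 / real (Suc j) & ~ Pr ep" unfolding eventually_at_right_field by simp
 then obtain e where e: "!!j. 0 < e j" "!!j. e j < 1 / real (Suc j)" "!!j. ~ Pr (e j)" by metis
 have "e ----> 0" by (rule tendsto_sandwich[OF _ _ tendsto_const lim_inverse_n'[THEN LIMSEQ_Suc]])
   (use e(1,2)[THEN less_imp_le] in auto)
 thus False using assms[OF e(1)] e(3) by (auto simp: eventually_sequentially)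
qed

lemma filterlim_at_right_subseq:
 assumes "!!e::nat => real. (!!j. 0 < e j) ==> e ----> 0 ==> EX r. filterlim (%j. f (e (r j))) F sequentially"
 shows "filterlim f F (at_right 0)"
 unfolding filterlim_iff
proof (intro allI impI)
 fix S assume S: "eventually S F"
 show "\<forall>\<^sub>F ep in at_right 0. S (f ep)"
 proof (rule eventually_at_right_subseq)
  fix e :: "nat => real" assume "!!j. 0 < e j" "e ----> 0"
  then obtain r where "filterlim (%j. f (e (r j))) F sequentially" using assms by blast
  thus "EX r. \<forall>\<^sub>F j in sequentially. S (f (e (r j)))" using S by (auto simp: filterlim_iff)
 qed
qed

text \<open>The fields vanish off \<open>K\<close>, which eventually lies in \<open>D j\<close>, so
  the domain of integration does not matter. On \<open>K\<close> the function
  \<open>norm (g y)\<close> is integrable, being at most \<open>1 + (norm (g y))^2\<close>.\<close>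

lemma uniform_limit_weak:
 fixes h :: "'i => 'a::euclidean_space => 'a"
 assumes K: "compact K" and ul: "uniform_limit K h H G" and z: "!!j y. y ~: K ==> h j y = 0" "!!y. y ~: K ==> H y = 0"
  and c: "\<forall>\<^sub>F j in G. continuous_on K (h j) & K <= D j" "continuous_on K H" and D: "!!j. open (D j)"
  and g: "g : borel_measurable lebesgue" "integrable lebesgue (%y. (norm (g y))^2)"
 shows "((%j. integral\<^sup>L (lebesgue_on (D j)) (%y. h j y \<bullet> g y)) \<longlongrightarrow> integral\<^sup>L lebesgue (%y. H y \<bullet> g y)) G"
proof (rule tendstoI)
 fix e :: real assume e: "e > 0"
 have sK: "K : sets lebesgue" using compact_imp_closed[OF K] by (simp add: borel_closed sets_completionI_sets)
 have fK: "integrable lebesgue (indicator K :: 'a => real)"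
  using sK emeasure_bounded_finite[OF compact_imp_bounded[OF K]] compact_imp_closed[OF K] by (intro integrable_real_indicator) auto
 have iB: "integrable lebesgue (%y. indicator K y * norm (g y))"
 proof (rule Bochner_Integration.integrable_bound[of _ "%y. indicator K y + (norm (g y))^2"])
  have "indicator K y * norm (g y) <= indicator K y + (norm (g y))^2" for y
   using sum_squares_bound[of "norm (g y)" 1] by (auto simp: indicator_def) (smt (verit) norm_ge_zero)
  thus "AE y in lebesgue. norm (indicator K y * norm (g y)) <= norm (indicator K y + (norm (g y))^2)" by (intro AE_I2) auto
 qed (use fK g sK in auto)
 define B where "B = integral\<^sup>L lebesgue (%y. indicator K y * norm (g y))"
 have B: "B >= 0" unfolding B_def by (rule integral_nonneg_AE) auto
 have i: "integrable lebesgue (%y. f y \<bullet> g y)" if f: "continuous_on K f" "!!y. y ~: K ==> f y = 0" for f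
 proof -
  obtain C where C: "C > 0" "!!y. norm (f y) <= C" using cont_compact_bounded[OF K f] by blast
  have fm: "f : borel_measurable lebesgue" using integrable_cont_compact[OF K f] by (auto intro: measurable_completion)
  show ?thesis
  proof (rule Bochner_Integration.integrable_bound[of _ "%y. C * (indicator K y * norm (g y))"])
   show "AE y in lebesgue. norm (f y \<bullet> g y) <= norm (C * (indicator K y * norm (g y)))"
   proof (rule AE_I2)
    fix y
    have "\<bar>f y \<bullet> g y\<bar> <= norm (f y) * norm (g y)" by (rule Cauchy_Schwarz_ineq2)
    also have "... <= C * (indicator K y * norm (g y))" using C f(2)[of y] by (cases "y : K") (auto intro: mult_right_mono)
    finally show "norm (f y \<bullet> g y) <= norm (C * (indicator K y * norm (g y)))" by simp
   qed
  qed (use iB fm g in auto)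
 qed
 define d where "d = e / (B + 1)"
 have d: "d > 0" using e B by (simp add: d_def)
 from c(1) uniform_limitD[OF ul d] show "\<forall>\<^sub>F j in G. dist (integral\<^sup>L (lebesgue_on (D j)) (%y. h j y \<bullet> g y)) (integral\<^sup>L lebesgue (%y. H y \<bullet> g y)) < e"
 proof eventually_elim
  case (elim j)
  have hj: "integrable lebesgue (%y. h j y \<bullet> g y)" "integrable lebesgue (%y. H y \<bullet> g y)" using i elim(1) c(2) z by auto
  have "integral\<^sup>L (lebesgue_on (D j)) (%y. h j y \<bullet> g y) = integral\<^sup>L lebesgue (%y. indicator (D j) y *R (h j y \<bullet> g y))"
   using D[of j] by (intro integral_restrict_space) auto
  also have "(%y. indicator (D j) y *R (h j y \<bullet> g y)) = (%y. h j y \<bullet> g y)" using elim(1) z(1)[of _ j] by (force simp: indicator_def)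
  finally have "integral\<^sup>L (lebesgue_on (D j)) (%y. h j y \<bullet> g y) - integral\<^sup>L lebesgue (%y. H y \<bullet> g y) = integral\<^sup>L lebesgue (%y. (h j y - H y) \<bullet> g y)"
   using hj by (simp add: inner_diff_left)
  also have "\<bar>...\<bar> <= integral\<^sup>L lebesgue (%y. d * (indicator K y * norm (g y)))"
  proof (rule order_trans[OF integral_abs_bound integral_mono])
   show "integrable lebesgue (%y. \<bar>(h j y - H y) \<bullet> g y\<bar>)" using hj by (simp add: inner_diff_left)
   fix y
   have "\<bar>(h j y - H y) \<bullet> g y\<bar> <= norm (h j y - H y) * norm (g y)" by (rule Cauchy_Schwarz_ineq2)
   also have "... <= d * (indicator K y * norm (g y))"
   proof (cases "y : K")
    case True
    hence "norm (h j y - H y) <= d" using elim(2) by (auto simp: dist_norm less_imp_le)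
    thus ?thesis using True by (simp add: mult_right_mono)
   qed (use z in simp)
   finally show "\<bar>(h j y - H y) \<bullet> g y\<bar> <= d * (indicator K y * norm (g y))" .
  qed (use iB in auto)
  also have "... = d * B" by (simp add: B_def)
  also have "... < e" using e B by (simp add: d_def divide_simps)
  finally show ?case by (simp add: dist_real_def)
 qed
qed

section \<open>Consequences along a convergent sequence, once the limit domain is the whole
  space\<close>

context blowup_limit
begin

lemma DD_eventually: "compact K ==> \<forall>\<^sub>F j in sequentially. K <= DD j" by (rule eventually_in_DD) (auto simp: Vpos)

lemma gradW_limit: assumes K: "compact K" shows "uniform_limit K (%j. grad (W j)) (grad V) sequentially"
proof -
 have ul: "uniform_limit K gW (grad V) sequentially" using C1lim(3)[OF K] Vpos by auto
 have ev: "\<forall>\<^sub>F j in sequentially. ALL y:K. gW j y = grad (W j) y" using DD_eventually[OF K]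
  by eventually_elim (auto simp: W_grad)
 show ?thesis by (rule uniform_limit_cong[OF ev, THEN iffD1, OF _ ul]) simp
qed

lemma gradV_cont: "continuous_on S (grad V)" using continuous_on_subset[OF C1lim(2)] Vpos by auto

text \<open>If the rescaled domain contains the ball of radius \<open>R\<close>, every frontier
  point has distance at least \<open>R * k j\<close> from \<open>x j\<close>. The statement for
  \<open>\<mu>\<close> follows since \<open>k j / \<mu> j\<close> tends to 1.\<close>

lemma dist_boundary: "filterlim (%j. infdist (x j) (frontier Om) / k j) at_top sequentially"
 "filterlim (%j. infdist (x j) (frontier Om) / \<mu> j) at_top sequentially"
proof -
 show 1: "filterlim (%j. infdist (x j) (frontier Om) / k j) at_top sequentially" unfolding filterlim_at_top
 proof
  fix R
  show "\<forall>\<^sub>F j in sequentially. R <= infdist (x j) (frontier Om) / k j" using DD_eventually[OF compact_cball[of 0 R]]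
  proof eventually_elim
   case (elim j)
   have ne: "frontier Om ~= {}" using D.zero by auto
   have "R * k j <= infdist (x j) (frontier Om)" unfolding infdist_notempty[OF ne]
   proof (rule cINF_greatest[OF ne])
    fix p assume "p : frontier Om"
    hence p: "p ~: Om" using D.oOm by (simp add: frontier_def interior_open)
    define y where "y = (1 / k j) *R (p - x j)"
    have py: "p = x j + k j *R y" using kpos[of j] by (simp add: y_def)
    hence "y ~: DD j" using p by (simp add: DD_def)
    hence "norm y > R" using elim by (auto simp: not_le[symmetric])
    hence "R * k j <= norm y * k j" using kpos[of j] by (intro mult_right_mono) auto
    also have "... = dist (x j) p" unfolding py using kpos[of j] by (simp add: dist_norm)
    finally show "R * k j <= dist (x j) p" .
   qed
   thus ?case using kpos[of j] by (simp add: pos_le_divide_eq)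
  qed
 qed
 have "infdist (x j) (frontier Om) / \<mu> j = k j / \<mu> j * (infdist (x j) (frontier Om) / k j)" for j using kpos[of j] by simp
 thus "filterlim (%j. infdist (x j) (frontier Om) / \<mu> j) at_top sequentially"
  using filterlim_tendsto_pos_mult_at_top[OF ratio_tendsto(2) _ 1] by simp
qed

lemma gradV_energy: "integral\<^sup>L lebesgue (%y. (norm (grad V y))^2) = invK0 TYPE('a) powr (crit DIM('a) 0 / (crit DIM('a) 0 - 2))"
proof -
 have "V.gz = grad V" unfolding V.gz_def[abs_def] using Vpos by simp
 hence "(LBINT y. (norm (grad V y))^2) = invK0 TYPE('a) powr (real DIM('a) / 2)" using energy_identity energy_value(1) by simp
 moreover have "(%y. (norm (grad V y))^2) : borel_measurable borel" by (intro cont_borel_measurable continuous_intros gradV_cont)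
 ultimately show ?thesis unfolding crit0(3) by (simp add: integral_completion)
qed

lemma weak_limit:
 assumes et: "test_fun UNIV et" and g: "D12 w g"
 shows "(%j. integral\<^sup>L (lebesgue_on (DD j)) (%y. grad (%z. et z * W j z) y \<bullet> g y)) ----> integral\<^sup>L lebesgue (%y. grad (%z. et z * V z) y \<bullet> g y)"
proof -
 obtain K where K: "C1c et (grad et) K" using test_fun_C1c[OF et] by blast
 have cK: "compact K" "!!y. y ~: K ==> et y = 0" using K by (auto simp: C1c_def)
 have c: "continuous_on S et" "continuous_on S (grad et)" for S using C1c_cont[OF K] C1c_cont_grad[OF K] by auto
 have etd: "GDERIV et y :> grad et y" for y using K by (simp add: C1c_def)
 \<comment> \<open>Off \<open>K\<close> the product vanishes on an open set, so its gradient is 0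
   even at points where the other factor is not differentiable.\<close>
 have off: "grad (%z. et z * f z) y = 0" if "y ~: K" for f :: "'a => real" and y
 proof -
  have "GDERIV (%z. 0 :: real) y :> (0::'a)" by (rule GDERIV_const)
  hence "GDERIV (%z. et z * f z) y :> 0"
   by (rule GDERIV_transform_open[of _ _ _ "- K"]) (use compact_imp_closed[OF cK(1)] cK(2) that in auto)
  thus ?thesis by (rule GDERIV_grad)
 qed
 have gV: "GDERIV V y :> grad V y" for y using V.der Vpos by simp
 have eV: "grad (%z. et z * V z) y = et y *R grad V y + V y *R grad et y" for y
  by (rule GDERIV_grad[OF GDERIV_mult[OF etd gV]])
 have eW: "grad (%z. et z * W j z) y = et y *R grad (W j) y + W j y *R grad et y" if "y : DD j" for j y
  unfolding W_grad[OF that] by (rule GDERIV_grad[OF GDERIV_mult[OF etd W_GDERIV[OF that]]])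
 have bd: "bounded (F ` K)" if "continuous_on K F" for F :: "'a => 'b::real_normed_vector"
  by (intro compact_imp_bounded compact_continuous_image that cK(1))
 have ul0: "uniform_limit K (%j y. et y *R grad (W j) y + W j y *R grad et y) (%y. et y *R grad V y + V y *R grad et y) sequentially"
  by (intro uniform_limit_add bounded_bilinear.bounded_uniform_limit[OF bounded_bilinear_scaleR] uniform_limit_const ulK gradW_limit cK bd c cVK gradV_cont)
 have ev: "\<forall>\<^sub>F j in sequentially. ALL y:K. et y *R grad (W j) y + W j y *R grad et y = grad (%z. et z * W j z) y"
  using DD_eventually[OF cK(1)] by eventually_elim (auto simp: eW)
 have ul: "uniform_limit K (%j. grad (%z. et z * W j z)) (grad (%z. et z * V z)) sequentially"
  by (rule uniform_limit_cong[OF ev, THEN iffD1, OF _ ul0]) (simp add: eV)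
 show ?thesis
 proof (rule uniform_limit_weak[OF cK(1) ul off off])
  show "\<forall>\<^sub>F j in sequentially. continuous_on K (grad (%z. et z * W j z)) & K <= DD j" using DD_eventually[OF cK(1)]
  proof eventually_elim
   case (elim j)
   have c1: "continuous_on K (%y. et y *R gW j y + W j y *R grad et y)"
    by (intro continuous_intros c continuous_on_subset[OF cgW elim] continuous_on_subset[OF cW subset_UNIV])
   have c2: "et y *R gW j y + W j y *R grad et y = grad (%z. et z * W j z) y" if "y : K" for y
    using eW[of y j] W_grad[of y j] that elim by auto
   show ?case using continuous_on_cong[OF refl c2, THEN iffD1, OF _ c1] elim by blast
  qed
  show "continuous_on K (grad (%z. et z * V z))" unfolding eV[abs_def] by (intro continuous_intros c cVK gradV_cont)
 qed (use oDD g in \<open>auto simp: D12_def\<close>)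
qed

end

lemma bubble_smooth:
 fixes c :: real
 assumes "c > 0" shows "smooth_on UNIV (%y::'a::euclidean_space. (1 + (norm y)^2 / c) powr t)"
 unfolding smooth_on_def
proof
 fix k
 have "Ck k UNIV (%y::'a. 1 + (1 / c) * (norm y)^2)" for k by (intro Ck_add Ck_mult Ck_const Ck_norm2 open_UNIV)
 hence "Ck k UNIV (%y::'a. (1 + (1 / c) * (norm y)^2) powr t)"
  by (rule Ck_powr[OF open_UNIV]) (use assms in \<open>simp add: add_pos_nonneg\<close>)
 thus "Ck k UNIV (%y::'a. (1 + (norm y)^2 / c) powr t)" by simp
qed

text \<open>The partial derivatives extend continuously to the compact closure, hence are bounded
  inside.\<close>

lemma CkBar_bounds:
 assumes "open Om" "bounded Om" "CkBar 1 (closure Om) f"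
 shows "continuous_on (closure Om) f" "EX G. ALL y:Om. norm (grad f y) <= G"
proof -
 show "continuous_on (closure Om) f" using assms by simp
 have I: "Om <= interior (closure Om)" using assms(1) by (simp add: closure_subset interior_maximal)
 have "ALL b:Basis. EX B. ALL y:Om. \<bar>pd b f y\<bar> <= B"
 proof
  fix b :: 'a assume "b : Basis"
  then obtain g where g: "continuous_on (closure Om) g" "!!y. y : interior (closure Om) ==> g y = pd b f y" using assms(3) by auto
  have "bounded (g ` closure Om)" using assms(2) by (intro compact_imp_bounded compact_continuous_image g(1)) simp
  then obtain B where "!!y. y : closure Om ==> \<bar>g y\<bar> <= B" by (auto simp: bounded_iff)
  thus "EX B. ALL y:Om. \<bar>pd b f y\<bar> <= B" using g(2) I closure_subset by (metis subsetD)
 qed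
 then obtain B where B: "!!b y. b : Basis ==> y : Om ==> \<bar>pd b f y\<bar> <= B b" by metis
 have "norm (grad f y) <= (SUM b:Basis. B b)" if "y : Om" for y
  unfolding grad_eq_sum_pd by (rule order_trans[OF norm_sum sum_mono]) (use B that in auto)
 thus "EX G. ALL y:Om. norm (grad f y) <= G" by blast
qed

theorem theorem3p2:
  fixes \<Omega> :: "'a::euclidean_space set"
    and a :: "'a \<Rightarrow> real"
    and s :: "real \<Rightarrow> real"
    and u :: "real \<Rightarrow> 'a \<Rightarrow> real"
    and x :: "real \<Rightarrow> 'a"
    and \<mu> :: "real \<Rightarrow> real"
  assumes dim: "DIM('a) \<ge> 3"
    and dom: "smooth_bounded_domain \<Omega>"
    and zero_bd: "0 \<in> frontier \<Omega>"
    and a_C1: "CkBar 1 (closure \<Omega>) a"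
    and coer: "coercive a \<Omega>"
    and s_range: "\<And>\<epsilon>. \<epsilon> > 0 \<Longrightarrow> 0 < s \<epsilon> \<and> s \<epsilon> < 2"
    and s_lim: "(s \<longlongrightarrow> 0) (at_right 0)"
    and u_reg: "\<And>\<epsilon>. \<epsilon> > 0 \<Longrightarrow> CkBar 2 (closure \<Omega> - {0}) (u \<epsilon>) \<and> CkBar 1 (closure \<Omega>) (u \<epsilon>)"
    and u_eq: "\<And>\<epsilon> y. \<epsilon> > 0 \<Longrightarrow> y \<in> \<Omega> \<Longrightarrow>
        lap (u \<epsilon>) y + a y * u \<epsilon> y = u \<epsilon> y powr (crit DIM('a) (s \<epsilon>) - 1) * norm y powr (- s \<epsilon>)"
    and u_pos: "\<And>\<epsilon> y. \<epsilon> > 0 \<Longrightarrow> y \<in> \<Omega> \<Longrightarrow> u \<epsilon> y > 0"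
    and u_bd: "\<And>\<epsilon> y. \<epsilon> > 0 \<Longrightarrow> y \<in> frontier \<Omega> \<Longrightarrow> u \<epsilon> y = 0"
    and energy_min: "((\<lambda>\<epsilon>. integral\<^sup>L (lebesgue_on \<Omega>) (\<lambda>y. (norm (grad (u \<epsilon>) y))\<^sup>2 + a y * (u \<epsilon> y)\<^sup>2)
          / (integral\<^sup>L (lebesgue_on \<Omega>) (\<lambda>y. u \<epsilon> y powr crit DIM('a) (s \<epsilon>) * norm y powr (- s \<epsilon>)))
              powr (2 / crit DIM('a) (s \<epsilon>)) - mu_sa (s \<epsilon>) a \<Omega>) \<longlongrightarrow> 0) (at_right 0)"
    and energy_bound: "\<exists>\<rho>. (\<rho> \<longlongrightarrow> 0) (at_right 0) \<and> (\<forall>\<^sub>F \<epsilon> in at_right 0.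
          integral\<^sup>L (lebesgue_on \<Omega>) (\<lambda>y. (norm (grad (u \<epsilon>) y))\<^sup>2 + a y * (u \<epsilon> y)\<^sup>2)
          / (integral\<^sup>L (lebesgue_on \<Omega>) (\<lambda>y. u \<epsilon> y powr crit DIM('a) (s \<epsilon>) * norm y powr (- s \<epsilon>)))
              powr (2 / crit DIM('a) (s \<epsilon>)) \<le> invK0 TYPE('a) + \<rho> \<epsilon>)"
    and weak0: "\<And>w g. H10 \<Omega> w g \<Longrightarrow>
        ((\<lambda>\<epsilon>. integral\<^sup>L (lebesgue_on \<Omega>) (\<lambda>y. grad (u \<epsilon>) y \<bullet> g y)) \<longlongrightarrow> 0) (at_right 0)"
    and x_in: "\<And>\<epsilon>. \<epsilon> > 0 \<Longrightarrow> x \<epsilon> \<in> \<Omega>"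
    and mu_pos: "\<And>\<epsilon>. \<epsilon> > 0 \<Longrightarrow> \<mu> \<epsilon> > 0"
    and x_max: "\<And>\<epsilon> y. \<epsilon> > 0 \<Longrightarrow> y \<in> closure \<Omega> \<Longrightarrow> u \<epsilon> y \<le> u \<epsilon> (x \<epsilon>)"
    and x_val: "\<And>\<epsilon>. \<epsilon> > 0 \<Longrightarrow> u \<epsilon> (x \<epsilon>) = \<mu> \<epsilon> powr (- (real DIM('a) - 2) / 2)"
  shows "let k = (\<lambda>\<epsilon>. norm (x \<epsilon>) powr (s \<epsilon> / 2) * \<mu> \<epsilon> powr ((2 - s \<epsilon>) / 2));
             D = (\<lambda>\<epsilon>. {y. x \<epsilon> + k \<epsilon> *\<^sub>R y \<in> \<Omega>});
             ve = (\<lambda>\<epsilon> y. if y \<in> D \<epsilon> then u \<epsilon> (x \<epsilon> + k \<epsilon> *\<^sub>R y) / u \<epsilon> (x \<epsilon>) else 0)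
         in (\<mu> \<longlongrightarrow> 0) (at_right 0) \<and> (k \<longlongrightarrow> 0) (at_right 0) \<and>
            filterlim (\<lambda>\<epsilon>. infdist (x \<epsilon>) (frontier \<Omega>) / \<mu> \<epsilon>) at_top (at_right 0) \<and>
            filterlim (\<lambda>\<epsilon>. infdist (x \<epsilon>) (frontier \<Omega>) / k \<epsilon>) at_top (at_right 0) \<and>
            (\<exists>v :: 'a \<Rightarrow> real.
               v = (\<lambda>y. (1 + (norm y)\<^sup>2 / (real DIM('a) * (real DIM('a) - 2))) powr (- (real DIM('a) - 2) / 2)) \<and>
               smooth_on UNIV v \<and> v \<noteq> (\<lambda>_. 0) \<and>
               (\<forall>\<eta> w g. test_fun UNIV \<eta> \<longrightarrow> D12 w g \<longrightarrow>
                  ((\<lambda>\<epsilon>. integral\<^sup>L (lebesgue_on (D \<epsilon>)) (\<lambda>y. grad (\<lambda>z. \<eta> z * ve \<epsilon> z) y \<bullet> g y))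
                    \<longlongrightarrow> integral\<^sup>L lebesgue (\<lambda>y. grad (\<lambda>z. \<eta> z * v z) y \<bullet> g y)) (at_right 0)) \<and>
               (\<forall>K. compact K \<longrightarrow> (\<forall>\<^sub>F \<epsilon> in at_right 0. K \<subseteq> D \<epsilon>) \<and>
                  (\<forall>\<delta>>0. \<forall>\<^sub>F \<epsilon> in at_right 0. \<forall>y\<in>K.
                     \<bar>ve \<epsilon> y - v y\<bar> < \<delta> \<and> norm (grad (ve \<epsilon>) y - grad v y) < \<delta>)) \<and>
               integral\<^sup>L lebesgue (\<lambda>y. (norm (grad v y))\<^sup>2)
                 = invK0 TYPE('a) powr (crit DIM('a) 0 / (crit DIM('a) 0 - 2))) \<and>
            (\<exists>e :: nat \<Rightarrow> real. (\<forall>j. e j > 0) \<and> e \<longlonglongrightarrow> 0 \<and>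
               (\<lambda>j. (\<mu> (e j) / norm (x (e j))) powr s (e j)) \<longlonglongrightarrow> 1 \<and>
               (\<lambda>j. k (e j) / \<mu> (e j)) \<longlonglongrightarrow> 1)"
proof -
 let ?n = "real DIM('a)"
 define v :: "'a => real" where "v = (%y. (1 + (norm y)^2 / (?n * (?n - 2))) powr (- (?n - 2) / 2))"
 define k where "k \<epsilon> = norm (x \<epsilon>) powr (s \<epsilon> / 2) * \<mu> \<epsilon> powr ((2 - s \<epsilon>) / 2)" for \<epsilon>
 define E where "E \<epsilon> = {y. x \<epsilon> + k \<epsilon> *R y : \<Omega>}" for \<epsilon>
 define ve where "ve \<epsilon> y = (if y : E \<epsilon> then u \<epsilon> (x \<epsilon> + k \<epsilon> *R y) / u \<epsilon> (x \<epsilon>) else 0)" for \<epsilon> y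
 have \<Omega>: "open \<Omega>" "bounded \<Omega>" "\<Omega> ~= {}" using dom by (auto simp: smooth_bounded_domain_def)
 have z: "0 ~: \<Omega>" using zero_bd \<Omega>(1) by (simp add: frontier_def interior_open)
 have ca: "continuous_on (closure \<Omega>) a" using a_C1 by simp
 have "bounded (a ` closure \<Omega>)" using \<Omega>(2) by (intro compact_imp_bounded compact_continuous_image ca) simp
 then obtain A where A: "!!y. y : closure \<Omega> ==> \<bar>a y\<bar> <= A" by (auto simp: bounded_iff)
 have ds: "dirichlet_solution \<Omega> a (s \<epsilon>) (u \<epsilon>) A (u \<epsilon> (x \<epsilon>)) (crit DIM('a) (s \<epsilon>))" if e: "\<epsilon> > 0" for \<epsilon>
 proof
  show "Ck (Suc (Suc 0)) \<Omega> (u \<epsilon>)"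
   by (rule CkBar_imp_Ck[OF \<Omega>(1), of "closure \<Omega> - {0}"]) (use u_reg[OF e] z closure_subset in \<open>auto simp: numeral_2_eq_2\<close>)
  show "continuous_on \<Omega> a" by (rule continuous_on_subset[OF ca closure_subset])
  show "\<bar>a y\<bar> <= A" "u \<epsilon> y <= u \<epsilon> (x \<epsilon>)" if "y : \<Omega>" for y using A x_max[OF e] that closure_subset by auto
 qed (use dim \<Omega> zero_bd s_range[OF e] CkBar_bounds[OF \<Omega>(1,2)] u_reg[OF e] u_eq[OF e] u_pos[OF e] u_bd[OF e] in auto)
 obtain \<rho> where \<rho>: "(\<rho> \<longlongrightarrow> 0) (at_right 0)" and eb: "\<forall>\<^sub>F \<epsilon> in at_right 0.
     integral\<^sup>L (lebesgue_on \<Omega>) (%y. (norm (grad (u \<epsilon>) y))^2 + a y * (u \<epsilon> y)^2)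
     / (integral\<^sup>L (lebesgue_on \<Omega>) (%y. u \<epsilon> y powr crit DIM('a) (s \<epsilon>) * norm y powr (- s \<epsilon>)))
       powr (2 / crit DIM('a) (s \<epsilon>)) <= invK0 TYPE('a) + \<rho> \<epsilon>" using energy_bound by blast
 have s1: "\<forall>\<^sub>F \<epsilon> in at_right 0. s \<epsilon> < 1" using order_tendstoD(2)[OF s_lim, of 1] by simp
 \<comment> \<open>Along \<open>e\<close> the rescaled solutions converge to the explicit
   \<open>v\<close>. Every sequence tending to 0 has a subsequence with this property, and limits
   along such sequences determine limits of the family.\<close>
 define BL where "BL e = blowup_limit \<Omega> a (%j. s (e j)) (%j. u (e j)) (%j. x (e j)) (%j. \<mu> (e j)) (%j. \<rho> (e j)) A v" for e :: "nat => real"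
 have seq: "EX r. strict_mono r & BL (%j. e (r j))"
  if e: "!!j. 0 < e j" "e ----> 0" for e :: "nat => real"
 proof -
  have fe: "filterlim e (at_right 0) sequentially" using e by (simp add: filterlim_at less_imp_neq[symmetric])
  \<comment> \<open>The conditions \<open>s < 1\<close> and the energy bound hold only for small
    parameters, so an initial segment of the sequence is dropped.\<close>
  obtain N where N: "!!j. j >= N ==> s (e j) < 1 & integral\<^sup>L (lebesgue_on \<Omega>) (%y. (norm (grad (u (e j)) y))^2 + a y * (u (e j) y)^2)
     / (integral\<^sup>L (lebesgue_on \<Omega>) (%y. u (e j) y powr crit DIM('a) (s (e j)) * norm y powr (- s (e j))))
       powr (2 / crit DIM('a) (s (e j))) <= invK0 TYPE('a) + \<rho> (e j)"
   using eventually_compose_filterlim[OF eventually_conj[OF s1 eb] fe] unfolding eventually_sequentially by blast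
  define r0 where "r0 j = j + N" for j :: nat
  have fr: "filterlim (%j. e (r0 j)) (at_right 0) sequentially"
   unfolding r0_def by (rule filterlim_compose[OF fe filterlim_add_const_nat_at_top])
  note L = filterlim_compose[OF _ fr]
  have b: "blowup_sequence \<Omega> a (%j. s (e (r0 j))) (%j. u (e (r0 j))) (%j. x (e (r0 j))) (%j. \<mu> (e (r0 j))) (%j. \<rho> (e (r0 j))) A"
  proof (rule blowup_sequence.intro)
   show "(%j. integral\<^sup>L (lebesgue_on \<Omega>) (%y. grad (u (e (r0 j))) y \<bullet> g y)) ----> 0" if "H10 \<Omega> w g" for w g
    by (rule L[OF weak0[OF that]])
   show "s (e (r0 j)) <= 1" for j using N[of "r0 j"] by (simp add: r0_def)
   show "integral\<^sup>L (lebesgue_on \<Omega>) (%y. (norm (grad (u (e (r0 j))) y))^2 + a y * (u (e (r0 j)) y)^2)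
     / (integral\<^sup>L (lebesgue_on \<Omega>) (%y. u (e (r0 j)) y powr crit DIM('a) (s (e (r0 j))) * norm y powr (- s (e (r0 j)))))
       powr (2 / crit DIM('a) (s (e (r0 j)))) <= invK0 TYPE('a) + \<rho> (e (r0 j))" for j using N[of "r0 j"] by (simp add: r0_def)
  qed (rule ds[OF e(1)] L[OF s_lim] L[OF \<rho>] dom coer x_in[OF e(1)] mu_pos[OF e(1)] x_val[OF e(1)])+
  interpret b: blowup_sequence \<Omega> a "%j. s (e (r0 j))" "%j. u (e (r0 j))" "%j. x (e (r0 j))" "%j. \<mu> (e (r0 j))" "%j. \<rho> (e (r0 j))" A by (rule b)
  obtain r V where r: "strict_mono (r :: nat => nat)" "continuous_on UNIV V" "!!R. uniform_limit (cball 0 R) (%j. b.W (r j)) V sequentially"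
   using b.subsequence_limit by blast
  interpret c: blowup_sequence \<Omega> a "%j. s (e (r0 (r j)))" "%j. u (e (r0 (r j)))" "%j. x (e (r0 (r j)))" "%j. \<mu> (e (r0 (r j)))" "%j. \<rho> (e (r0 (r j)))" A
   by (rule blowup_subseq[OF b r(1)])
  have cW: "c.W = (%j. b.W (r j))" by (intro ext) (simp add: c.W_def b.W_def c.k_def b.k_def)
  have l: "blowup_limit \<Omega> a (%j. s (e (r0 (r j)))) (%j. u (e (r0 (r j)))) (%j. x (e (r0 (r j)))) (%j. \<mu> (e (r0 (r j)))) (%j. \<rho> (e (r0 (r j)))) A V"
   by (intro blowup_limit.intro c.blowup_sequence_axioms blowup_limit_axioms.intro) (use r cW in auto)
  interpret l: blowup_limit \<Omega> a "%j. s (e (r0 (r j)))" "%j. u (e (r0 (r j)))" "%j. x (e (r0 (r j)))" "%j. \<mu> (e (r0 (r j)))" "%j. \<rho> (e (r0 (r j)))" A V by (rule l)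
  \<comment> \<open>The classification makes the limit independent of the subsequence.\<close>
  have "V = v" unfolding v_def by (intro ext l.V_bubble)
  moreover have "strict_mono (%j. r0 (r j))" using r(1) by (simp add: strict_mono_def r0_def)
  ultimately show ?thesis using l unfolding BL_def by blast
 qed
 have trans: "filterlim f F (at_right 0)"
  if f: "!!e. BL e ==> filterlim (%j. f (e j)) F sequentially"
  for f :: "real => 'b" and F
 proof (rule filterlim_at_right_subseq)
  fix e :: "nat => real" assume "!!j. 0 < e j" "e ----> 0"
  from seq[OF this] show "EX r. filterlim (%j. f (e (r j))) F sequentially" using f[of "%j. e (r j)" for r] by meson
 qed
 have ev: "\<forall>\<^sub>F \<epsilon> in at_right 0. Pr \<epsilon>"
  if f: "!!e. BL e ==> \<forall>\<^sub>F j in sequentially. Pr (e j)"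
  for Pr :: "real => bool"
 proof (rule eventually_at_right_subseq)
  fix e :: "nat => real" assume "!!j. 0 < e j" "e ----> 0"
  from seq[OF this] show "EX r. \<forall>\<^sub>F j in sequentially. Pr (e (r j))" using f[of "%j. e (r j)" for r] by meson
 qed
 have concl: "(%j. \<mu> (e j)) ----> 0" "(%j. k (e j)) ----> 0" (is ?c2)
  "filterlim (%j. infdist (x (e j)) (frontier \<Omega>) / \<mu> (e j)) at_top sequentially" (is ?c3)
  "filterlim (%j. infdist (x (e j)) (frontier \<Omega>) / k (e j)) at_top sequentially" (is ?c4)
  "!!\<eta> w g. test_fun UNIV \<eta> ==> D12 w g ==> (%j. integral\<^sup>L (lebesgue_on (E (e j))) (%y. grad (%z. \<eta> z * ve (e j) z) y \<bullet> g y))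
    ----> integral\<^sup>L lebesgue (%y. grad (%z. \<eta> z * v z) y \<bullet> g y)" (is "PROP ?c5")
  "!!K. compact K ==> \<forall>\<^sub>F j in sequentially. K <= E (e j)" (is "PROP ?c6")
  "!!K. compact K ==> uniform_limit K (%j. ve (e j)) v sequentially" (is "PROP ?c7")
  "!!K. compact K ==> uniform_limit K (%j. grad (ve (e j))) (grad v) sequentially" (is "PROP ?c8")
  "integral\<^sup>L lebesgue (%y. (norm (grad v y))^2) = invK0 TYPE('a) powr (crit DIM('a) 0 / (crit DIM('a) 0 - 2))"
  "(%j. (\<mu> (e j) / norm (x (e j))) powr s (e j)) ----> 1" (is ?c10) "(%j. k (e j) / \<mu> (e j)) ----> 1" (is ?c11)
  if "BL e" for e
 proof -
  interpret L: blowup_limit \<Omega> a "%j. s (e j)" "%j. u (e j)" "%j. x (e j)" "%j. \<mu> (e j)" "%j. \<rho> (e j)" A v by (rule that[unfolded BL_def])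
  have k: "L.k j = k (e j)" for j by (simp add: L.k_def blow_scale_def k_def)
  have E: "L.DD j = E (e j)" for j by (simp add: L.DD_def k E_def)
  have W: "L.W j = ve (e j)" for j by (intro ext) (simp add: L.W_def blow_fun_def k E_def ve_def)
  note L = L.k_tendsto L.dist_boundary L.weak_limit L.DD_eventually L.ulK L.gradW_limit L.ratio_tendsto
  note L' = L[unfolded k[abs_def] E[abs_def] W[abs_def]]
  show "(%j. \<mu> (e j)) ----> 0" by (rule blowup_mu_tendsto[OF L.blowup_sequence_axioms])
  show "integral\<^sup>L lebesgue (%y. (norm (grad v y))^2) = invK0 TYPE('a) powr (crit DIM('a) 0 / (crit DIM('a) 0 - 2))" by (rule L.gradV_energy)
  show ?c2 ?c3 ?c4 "PROP ?c5" "PROP ?c6" "PROP ?c7" "PROP ?c8" ?c10 ?c11 by (fact L')+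
 qed
 have C1: "\<forall>\<^sub>F \<epsilon> in at_right 0. ALL y:K. \<bar>ve \<epsilon> y - v y\<bar> < \<delta> & norm (grad (ve \<epsilon>) y - grad v y) < \<delta>" if K: "compact K" and d: "\<delta> > 0" for K \<delta>
 proof -
  have u1: "uniform_limit K ve v (at_right 0)" by (rule trans) (rule concl(7)[OF _ K])
  have u2: "uniform_limit K (%\<epsilon>. grad (ve \<epsilon>)) (grad v) (at_right 0)" by (rule trans) (rule concl(8)[OF _ K])
  show ?thesis using uniform_limitD[OF u1 d] uniform_limitD[OF u2 d] by eventually_elim (auto simp: dist_norm)
 qed
 have lims: "(\<mu> \<longlongrightarrow> 0) (at_right 0)" "(k \<longlongrightarrow> 0) (at_right 0)"
  "filterlim (%\<epsilon>. infdist (x \<epsilon>) (frontier \<Omega>) / \<mu> \<epsilon>) at_top (at_right 0)"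
  "filterlim (%\<epsilon>. infdist (x \<epsilon>) (frontier \<Omega>) / k \<epsilon>) at_top (at_right 0)"
  by (rule trans, erule concl(1-4))+
 have wl: "((%\<epsilon>. integral\<^sup>L (lebesgue_on (E \<epsilon>)) (%y. grad (%z. \<eta> z * ve \<epsilon> z) y \<bullet> g y))
   \<longlongrightarrow> integral\<^sup>L lebesgue (%y. grad (%z. \<eta> z * v z) y \<bullet> g y)) (at_right 0)" if "test_fun UNIV \<eta>" "D12 w g" for \<eta> w g
  by (rule trans) (rule concl(5)[OF _ that])
 have sub: "\<forall>\<^sub>F \<epsilon> in at_right 0. K <= E \<epsilon>" if "compact K" for K by (rule ev) (rule concl(6)[OF _ that])
 define e0 where "e0 j = 1 / real (Suc j)" for j
 have e0: "!!j. 0 < e0 j" "e0 ----> 0" using LIMSEQ_Suc[OF lim_inverse_n'] by (auto simp: e0_def[abs_def])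
 obtain r where r: "strict_mono r" "BL (%j. e0 (r j))"
  using seq[OF e0] by blast
 have sm: "smooth_on UNIV v" unfolding v_def using dim by (intro bubble_smooth) simp
 have "v 0 = 1" by (simp add: v_def)
 hence nz: "v ~= (%_. 0)" by (metis zero_neq_one)
 have ex: "EX e :: nat => real. (ALL j. e j > 0) & e ----> 0 & (%j. (\<mu> (e j) / norm (x (e j))) powr s (e j)) ----> 1 & (%j. k (e j) / \<mu> (e j)) ----> 1"
  by (intro exI[of _ "%j. e0 (r j)"] conjI allI e0(1) concl(10,11)[OF r(2)] LIMSEQ_subseq_LIMSEQ[OF e0(2) r(1), unfolded comp_def])
 have "EX v'. v' = v & smooth_on UNIV v' & v' ~= (%_. 0) &
   (ALL \<eta> w g. test_fun UNIV \<eta> --> D12 w g --> ((%\<epsilon>. integral\<^sup>L (lebesgue_on (E \<epsilon>)) (%y. grad (%z. \<eta> z * ve \<epsilon> z) y \<bullet> g y))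
     \<longlongrightarrow> integral\<^sup>L lebesgue (%y. grad (%z. \<eta> z * v' z) y \<bullet> g y)) (at_right 0)) &
   (ALL K. compact K --> (\<forall>\<^sub>F \<epsilon> in at_right 0. K <= E \<epsilon>) &
     (ALL \<delta>>0. \<forall>\<^sub>F \<epsilon> in at_right 0. ALL y:K. \<bar>ve \<epsilon> y - v' y\<bar> < \<delta> & norm (grad (ve \<epsilon>) y - grad v' y) < \<delta>)) &
   integral\<^sup>L lebesgue (%y. (norm (grad v' y))^2) = invK0 TYPE('a) powr (crit DIM('a) 0 / (crit DIM('a) 0 - 2))"
  using wl sub C1 concl(9)[OF r(2)] sm nz by blast
 with lims ex show ?thesis unfolding Let_def k_def[abs_def] E_def[abs_def] ve_def[abs_def] v_def[abs_def] by (intro conjI)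
qed

end
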